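(* Let $g\ge1$. Identify $B_g(\mathbf{C})$ with an open submanifold of $\operatorname{Sp}_{2g}(\mathbf{Z})\backslash\operatorname{Sp}_{2g}(\mathbf{C})$ by $[(X,E,b)]\mapsto\operatorname{Sp}_{2g}(\mathbf{Z})\,\Pi(X,E,b,\beta)$, where $\beta$ is any integral symplectic basis of $(X,E)$. Under this identification: (1) for every $1\le k\le l\le g$, the higher Ramanujan vector field $v_{kl}$ on $B_g(\mathbf{C})$ is induced by the left invariant holomorphic vector field on $\operatorname{Sp}_{2g}(\mathbf{C})$ associated to $$\frac1{2\pi i}\begin{pmatrix}0&\mathbf{E}^{kl}\\0&0\end{pmatrix}\in\operatorname{Lie}\operatorname{Sp}_{2g}(\mathbf{C});$$ (2) the map $\varphi_g:\mathbf{H}_g\to B_g(\mathbf{C})$ is given by $$\tau\mapsto\left[\begin{pmatrix}\mathbf{1}_g&\tau\\0&\mathbf{1}_g\end{pmatrix}\right]\in\operatorname{Sp}_{2g}(\mathbf{Z})\backslash\operatorname{Sp}_{2g}(\mathbf{C}).$$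
   Context: $\mathbf{H}_g=\{\tau\in M_{g\times g}(\mathbf{C}):\tau^{\mathsf T}=\tau,\operatorname{Im}\tau>0\}$. $\mathbf{E}^{kl}$ is the symmetric $g\times g$ matrix with entries 1 in positions $(k,l)$ and $(l,k)$ and 0 elsewhere. $\operatorname{Sp}_{2g}$ is the group of $M$ with $MJM^{\mathsf T}=J$, $J=\begin{pmatrix}0&\mathbf{1}_g\\-\mathbf{1}_g&0\end{pmatrix}$. A principally polarized complex torus $(X,E)$ of dimension $g$: $X$ a complex torus and $E=\operatorname{Im}H$ for a positive definite Hermitian form $H$ on $\operatorname{Lie}X$ (antilinear in the first variable), $E$ integral and unimodular on $H_1(X,\mathbf{Z})$ (and similarly in families over a complex manifold). Identify $\mathcal{H}^1_{\mathrm{dR}}(X)$ with $\operatorname{Hom}(H_1(X,\mathbf{Z}),\mathbf{C})$ by integration (values in $\mathcal{O}$ in families), with Hodge subspace $\mathcal{F}^1(X)=(\operatorname{Lie}X)^\vee$, and put $\langle E(\gamma,\cdot),E(\delta,\cdot)\rangle_E=\frac1{2\pi i}E(\gamma,\delta)$ for $\gamma,\delta\in H_1(X,\mathbf{Z})$. A symplectic-Hodge basis is a basis $b=(\omega_1,\ldots,\omega_g,\eta_1,\ldots,\eta_g)$ of $\mathcal{H}^1_{\mathrm{dR}}(X)$ with $\omega_i\in\mathcal{F}^1(X)$, $\langle\omega_i,\omega_j\rangle_E=\langle\eta_i,\eta_j\rangle_E=0$, $\langle\omega_i,\eta_j\rangle_E=\delta_{ij}$. An integral symplectic basis is a basis $\beta=(\gamma_1,\ldots,\gamma_g,\delta_1,\ldots,\delta_g)$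 of $H_1(X,\mathbf{Z})$ with $E(\gamma_i,\gamma_j)=E(\delta_i,\delta_j)=0$, $E(\gamma_i,\delta_j)=\delta_{ij}$. With $(\Omega_1)_{ij}=\int_{\gamma_i}\omega_j$, $(N_1)_{ij}=\int_{\gamma_i}\eta_j$, $(\Omega_2)_{ij}=\int_{\delta_i}\omega_j$, $(N_2)_{ij}=\int_{\delta_i}\eta_j$, set $$\Pi(X,E,b,\beta)=\begin{pmatrix}N_2&\frac1{2\pi i}\Omega_2\\N_1&\frac1{2\pi i}\Omega_1\end{pmatrix}\in\operatorname{Sp}_{2g}(\mathbf{C}).$$ $B_g(\mathbf{C})$ is the complex manifold (fine moduli space) of isomorphism classes of triples $(X,E,b)$ with $b$ a symplectic-Hodge basis; it is the set of complex points of the scheme representing over $\mathbf{Z}[1/2]$ the moduli problem of principally polarized abelian schemes of relative dimension $g$ with a symplectic-Hodge basis. The identification in the claim is a biholomorphism onto the open submanifold of classes of $\begin{pmatrix}A&B\\C&D\end{pmatrix}$ with $D\in\operatorname{GL}_g(\mathbf{C})$ and $BD^{-1}\in\mathbf{H}_g$. Higher Ramanujan vector fields: with $(\omega_1,\ldots,\omega_g,\eta_1,\ldots,\eta_g)$ the universal symplectic-Hodge basis over $B_g(\mathbf{C})$ and $\nabla$ the Gauss–Manin connection, $v_{kl}$ ($k\le l$) is the unique vector field with $\nabla_{v_{kl}}\omega_k=\eta_l$, $\nabla_{v_{kl}}\omega_l=\eta_k$, $\nabla_{v_{kl}}\omega_m=0$ for $m\notin\{k,l\}$, and $\nabla_{v_{kl}}\eta_m=0$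 for all $m$. The map $\varphi_g$: let $\mathbf{X}_g\to\mathbf{H}_g$ be the relative torus with fibers $\mathbf{C}^g/(\mathbf{Z}^g+\tau\mathbf{Z}^g)$, $E_g(v,w)=\operatorname{Im}(\overline v^{\mathsf T}(\operatorname{Im}\tau)^{-1}w)$, $\boldsymbol\omega_k=2\pi i\,dz_k$, $\boldsymbol\eta_k=\nabla_{\frac1{2\pi i}\partial/\partial\tau_{kk}}\boldsymbol\omega_k$. Then $\boldsymbol b_g=(\boldsymbol\omega_1,\ldots,\boldsymbol\omega_g,\boldsymbol\eta_1,\ldots,\boldsymbol\eta_g)$ is a symplectic-Hodge basis and $\varphi_g(\tau)=[(\mathbf{X}_{g,\tau},E_{g,\tau},\boldsymbol b_{g,\tau})]$. *)

theory Defs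
  imports "HOL-Analysis.Analysis"
begin

section \<open>Complex manifolds as spaces with a sheaf of holomorphic functions\<close>

text \<open>
  A complex manifold is given by its topology and its sheaf of holomorphic functions:
  \<open>Hol X W\<close> consists of the functions whose restriction to the open set \<open>W\<close> is
  holomorphic (their values outside \<open>W\<close> are irrelevant).
\<close>

record 'a cspace =
  Top :: "'a topology"
  Hol :: "'a set \<Rightarrow> ('a \<Rightarrow> complex) set"

abbreviation points :: "'a cspace \<Rightarrow> 'a set" where
  "points X \<equiv> topspace (Top X)"

definition holomorphic_map :: "'a cspace \<Rightarrow> 'b cspace \<Rightarrow> ('a \<Rightarrow> 'b) \<Rightarrow> bool" where
  "holomorphic_map X Y f \<longleftrightarrow>
     continuous_map (Top X) (Top Y) f \<and>
     (\<forall>W h. openin (Top Y) W \<and> h \<in> Hol Y W \<longrightarrow> h \<circ> f \<in> Hol X {x \<in> points X. f x \<in> W})"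

definition biholomorphic_map :: "'a cspace \<Rightarrow> 'b cspace \<Rightarrow> ('a \<Rightarrow> 'b) \<Rightarrow> bool" where
  "biholomorphic_map X Y f \<longleftrightarrow>
     holomorphic_map X Y f \<and>
     (\<exists>g. holomorphic_map Y X g \<and> (\<forall>x\<in>points X. g (f x) = x) \<and> (\<forall>y\<in>points Y. f (g y) = y))"

definition open_subspace :: "'a cspace \<Rightarrow> 'a set \<Rightarrow> 'a cspace" where
  "open_subspace X W = \<lparr>Top = subtopology (Top X) W, Hol = Hol X\<rparr>"

definition plane_domain :: "complex set \<Rightarrow> complex cspace" where
  "plane_domain U = \<lparr>Top = top_of_set U, Hol = (\<lambda>W. {h. h holomorphic_on W})\<rparr>"

definition mscale :: "complex \<Rightarrow> complex^'n^'m \<Rightarrow> complex^'n^'m" where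
  "mscale c A = (\<chi> i j. c * A $ i $ j)"

definition matrix_holomorphic_on :: "(complex^'n^'m \<Rightarrow> complex) \<Rightarrow> (complex^'n^'m) set \<Rightarrow> bool" where
  "matrix_holomorphic_on h U \<longleftrightarrow>
     (\<forall>A\<in>U. \<exists>D. (h has_derivative D) (at A) \<and> (\<forall>c X. D (mscale c X) = c * D X))"

text \<open>
  A complex submanifold of a space of matrices: the holomorphic functions are those that
  extend locally to holomorphic functions of the matrix entries.  An open set of matrices
  is a special case.
\<close>

definition matrix_submanifold :: "(complex^'n^'m) set \<Rightarrow> (complex^'n^'m) cspace" where
  "matrix_submanifold S =
     \<lparr>Top = top_of_set S,
      Hol = (\<lambda>W. {h. \<forall>A\<in>W. \<exists>N H. open N \<and> A \<in> N \<and> matrix_holomorphic_on H N \<and>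
                                 (\<forall>X\<in>N \<inter> W. H X = h X)})\<rparr>"

text \<open>
  Tangent vectors at \<open>x\<close> act as derivations on germs of holomorphic functions at \<open>x\<close>; on a
  function that is not holomorphic near \<open>x\<close> they take the value 0, so that equality of
  tangent vectors is equality of functions.  Every tangent vector of a complex manifold is
  the velocity of a holomorphic curve.
\<close>

definition holomorphic_near :: "'a cspace \<Rightarrow> 'a \<Rightarrow> ('a \<Rightarrow> complex) \<Rightarrow> bool" where
  "holomorphic_near X x h \<longleftrightarrow> (\<exists>W. openin (Top X) W \<and> x \<in> W \<and> h \<in> Hol X W)"

type_synonym 'a tvec = "('a \<Rightarrow> complex) \<Rightarrow> complex"

definition velocity :: "'a cspace \<Rightarrow> (complex \<Rightarrow> 'a) \<Rightarrow> 'a tvec" where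
  "velocity X c = (\<lambda>h. if holomorphic_near X (c 0) h then deriv (h \<circ> c) 0 else 0)"

definition tangent_space :: "'a cspace \<Rightarrow> 'a \<Rightarrow> 'a tvec set" where
  "tangent_space X x =
     {velocity X c | c. c 0 = x \<and> (\<exists>U. open U \<and> 0 \<in> U \<and> holomorphic_map (plane_domain U) X c)}"

definition pushforward :: "'b cspace \<Rightarrow> ('a \<Rightarrow> 'b) \<Rightarrow> 'a \<Rightarrow> 'a tvec \<Rightarrow> 'b tvec" where
  "pushforward Y f x \<xi> = (\<lambda>h. if holomorphic_near Y (f x) h then \<xi> (h \<circ> f) else 0)"

definition holomorphic_vector_field :: "'a cspace \<Rightarrow> ('a \<Rightarrow> 'a tvec) \<Rightarrow> bool" where
  "holomorphic_vector_field X v \<longleftrightarrow>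
     v \<in> extensional (points X) \<and>
     (\<forall>x\<in>points X. v x \<in> tangent_space X x) \<and>
     (\<forall>W h. openin (Top X) W \<and> h \<in> Hol X W \<longrightarrow> (\<lambda>x. v x h) \<in> Hol X W)"


section \<open>Symplectic groups and the Siegel upper half space\<close>

abbreviation two_pi_i :: complex where
  "two_pi_i \<equiv> 2 * complex_of_real pi * \<i>"

definition block_matrix ::
  "'a^'g^'g \<Rightarrow> 'a^'g^'g \<Rightarrow> 'a^'g^'g \<Rightarrow> 'a^'g^'g \<Rightarrow> 'a^('g + 'g)^('g + 'g)" where
  "block_matrix A B C D =
     (\<chi> i j. case i of
        Inl i' \<Rightarrow> (case j of Inl j' \<Rightarrow> A $ i' $ j' | Inr j' \<Rightarrow> B $ i' $ j')
      | Inr i' \<Rightarrow> (case j of Inl j' \<Rightarrow> C $ i' $ j' | Inr j' \<Rightarrow> D $ i' $ j'))"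

definition J_matrix :: "complex^('g::finite + 'g)^('g + 'g)" where
  "J_matrix = block_matrix 0 (mat 1) (- mat 1) 0"

definition Sp_C :: "(complex^('g::finite + 'g)^('g + 'g)) set" where
  "Sp_C = {M. M ** J_matrix ** transpose M = J_matrix}"

definition Sp_Z :: "(complex^('g::finite + 'g)^('g + 'g)) set" where
  "Sp_Z = {M \<in> Sp_C. \<forall>i j. M $ i $ j \<in> \<int>}"

definition Sp_Z_class ::
  "complex^('g::finite + 'g)^('g + 'g) \<Rightarrow> (complex^('g + 'g)^('g + 'g)) set" where
  "Sp_Z_class M = {S ** M | S. S \<in> Sp_Z}"

abbreviation Sp_manifold :: "(complex^('g::finite + 'g)^('g + 'g)) cspace" where
  "Sp_manifold \<equiv> matrix_submanifold Sp_C"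

definition Sp_quotient :: "(complex^('g::finite + 'g)^('g + 'g)) set cspace" where
  "Sp_quotient =
     \<lparr>Top = topology (\<lambda>W. W \<subseteq> Sp_Z_class ` Sp_C \<and>
                         openin (Top Sp_manifold) {M \<in> Sp_C. Sp_Z_class M \<in> W}),
      Hol = (\<lambda>W. {h. h \<circ> Sp_Z_class \<in> Hol Sp_manifold {M \<in> Sp_C. Sp_Z_class M \<in> W}})\<rparr>"

text \<open>
  \<open>A\<close> is an element of the Lie algebra, i.e. a tangent vector at the identity given by its
  effect on the matrix entries.
\<close>

definition left_invariant_field ::
  "complex^('g::finite + 'g)^('g + 'g) \<Rightarrow>
   complex^('g + 'g)^('g + 'g) \<Rightarrow> (complex^('g + 'g)^('g + 'g)) tvec" where
  "left_invariant_field A =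
     (THE V. holomorphic_vector_field Sp_manifold V \<and>
        (\<forall>S\<in>Sp_C. \<forall>M\<in>Sp_C. V (S ** M) = pushforward Sp_manifold (\<lambda>N. S ** N) M (V M)) \<and>
        (\<forall>i j. V (mat 1) (\<lambda>M. M $ i $ j) = A $ i $ j))"

definition E_matrix :: "'g \<Rightarrow> 'g \<Rightarrow> complex^'g^'g" where
  "E_matrix k l = (\<chi> i j. if (i = k \<and> j = l) \<or> (i = l \<and> j = k) then 1 else 0)"

definition Im_matrix :: "complex^'g^'g \<Rightarrow> real^'g^'g" where
  "Im_matrix \<tau> = (\<chi> i j. Im (\<tau> $ i $ j))"

definition siegel_space :: "(complex^'g^'g) set" where
  "siegel_space = {\<tau>. transpose \<tau> = \<tau> \<and> (\<forall>x. x \<noteq> 0 \<longrightarrow> 0 < x \<bullet> (Im_matrix \<tau> *v x))}"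


section \<open>Principally polarized complex tori with symplectic-Hodge bases\<close>

text \<open>
  Up to isomorphism a complex torus of dimension \<open>g\<close> is \<open>\<complex>\<^sup>g/L\<close> for a lattice \<open>L\<close>, with Lie
  algebra \<open>\<complex>\<^sup>g\<close> and first homology group \<open>L\<close>.
\<close>

definition is_lattice :: "(complex^'g) set \<Rightarrow> bool" where
  "is_lattice L \<longleftrightarrow>
     (\<exists>b :: 'g + 'g \<Rightarrow> complex^'g. inj b \<and> independent (range b) \<and>
        L = {\<Sum>i\<in>UNIV. of_int (n i) *\<^sub>R b i | n. True})"

definition lattice_basis :: "(complex^'g) set \<Rightarrow> ('g + 'g \<Rightarrow> complex^'g) \<Rightarrow> bool" where
  "lattice_basis L b \<longleftrightarrow>
     range b \<subseteq> L \<and> (\<forall>x\<in>L. \<exists>!n. x = (\<Sum>i\<in>UNIV. of_int (n i) *\<^sub>R b i))"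

definition pos_def_hermitian :: "(complex^'g \<Rightarrow> complex^'g \<Rightarrow> complex) \<Rightarrow> bool" where
  "pos_def_hermitian H \<longleftrightarrow>
     (\<forall>v. Vector_Spaces.linear (*s) (*) (H v)) \<and>
     (\<forall>v w. H w v = cnj (H v w)) \<and>
     (\<forall>v. v \<noteq> 0 \<longrightarrow> 0 < Re (H v v))"

definition principal_polarization ::
  "(complex^'g) set \<Rightarrow> (complex^'g \<Rightarrow> complex^'g \<Rightarrow> real) \<Rightarrow> bool" where
  "principal_polarization L E \<longleftrightarrow>
     (\<exists>H. pos_def_hermitian H \<and> (\<forall>v w. E v w = Im (H v w))) \<and>
     (\<forall>\<gamma>\<in>L. \<forall>\<delta>\<in>L. E \<gamma> \<delta> \<in> \<int>) \<and>
     (\<forall>f :: complex^'g \<Rightarrow> int. (\<forall>x\<in>L. \<forall>y\<in>L. f (x + y) = f x + f y) \<longrightarrow>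
        (\<exists>!\<gamma>. \<gamma> \<in> L \<and> (\<forall>x\<in>L. E \<gamma> x = of_int (f x))))"

definition restrict0 :: "'a set \<Rightarrow> ('a \<Rightarrow> complex) \<Rightarrow> 'a \<Rightarrow> complex" where
  "restrict0 L f = (\<lambda>x. if x \<in> L then f x else 0)"

text \<open>De Rham cohomology as \<open>Hom(L, \<complex>)\<close>; homomorphisms are extended by 0 outside \<open>L\<close>.\<close>

definition H1dR :: "(complex^'g) set \<Rightarrow> (complex^'g \<Rightarrow> complex) set" where
  "H1dR L = {f. (\<forall>x\<in>L. \<forall>y\<in>L. f (x + y) = f x + f y) \<and> (\<forall>x. x \<notin> L \<longrightarrow> f x = 0)}"

definition hodge_F1 :: "(complex^'g) set \<Rightarrow> (complex^'g \<Rightarrow> complex) set" where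
  "hodge_F1 L = {restrict0 L a | a. Vector_Spaces.linear (*s) (*) a}"

definition is_pairing ::
  "(complex^'g) set \<Rightarrow> (complex^'g \<Rightarrow> complex^'g \<Rightarrow> real) \<Rightarrow>
   ((complex^'g \<Rightarrow> complex) \<Rightarrow> (complex^'g \<Rightarrow> complex) \<Rightarrow> complex) \<Rightarrow> bool" where
  "is_pairing L E P \<longleftrightarrow>
     (\<forall>f\<in>H1dR L. \<forall>g\<in>H1dR L. \<forall>h\<in>H1dR L. \<forall>a.
        P (\<lambda>x. a * f x + g x) h = a * P f h + P g h \<and>
        P h (\<lambda>x. a * f x + g x) = a * P h f + P h g) \<and>
     (\<forall>\<gamma>\<in>L. \<forall>\<delta>\<in>L.
        P (restrict0 L (\<lambda>x. of_real (E \<gamma> x))) (restrict0 L (\<lambda>x. of_real (E \<delta> x)))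
        = of_real (E \<gamma> \<delta>) / two_pi_i)"

text \<open>The value on \<open>(f, g)\<close> of the unique bilinear form on \<open>H1dR L\<close> satisfying \<open>is_pairing\<close>.\<close>

definition pairing ::
  "(complex^'g) set \<Rightarrow> (complex^'g \<Rightarrow> complex^'g \<Rightarrow> real) \<Rightarrow>
   (complex^'g \<Rightarrow> complex) \<Rightarrow> (complex^'g \<Rightarrow> complex) \<Rightarrow> complex" where
  "pairing L E f g = (THE z. \<forall>P. is_pairing L E P \<longrightarrow> P f g = z)"

record 'g triple =
  lat :: "(complex^'g) set"
  pol :: "complex^'g \<Rightarrow> complex^'g \<Rightarrow> real"
  om :: "'g \<Rightarrow> complex^'g \<Rightarrow> complex"
  et :: "'g \<Rightarrow> complex^'g \<Rightarrow> complex"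

definition symplectic_hodge_basis ::
  "(complex^'g) set \<Rightarrow> (complex^'g \<Rightarrow> complex^'g \<Rightarrow> real) \<Rightarrow>
   ('g \<Rightarrow> complex^'g \<Rightarrow> complex) \<Rightarrow> ('g \<Rightarrow> complex^'g \<Rightarrow> complex) \<Rightarrow> bool" where
  "symplectic_hodge_basis L E \<omega> \<eta> \<longleftrightarrow>
     range \<omega> \<subseteq> H1dR L \<and> range \<eta> \<subseteq> H1dR L \<and>
     (\<forall>f\<in>H1dR L. \<exists>!ac. f = (\<lambda>x. \<Sum>i\<in>UNIV. fst ac i * \<omega> i x + snd ac i * \<eta> i x)) \<and>
     (\<forall>i. \<omega> i \<in> hodge_F1 L) \<and>
     (\<forall>i j. pairing L E (\<omega> i) (\<omega> j) = 0 \<and> pairing L E (\<eta> i) (\<eta> j) = 0 \<and>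
            pairing L E (\<omega> i) (\<eta> j) = (if i = j then 1 else 0))"

definition is_triple :: "'g::finite triple \<Rightarrow> bool" where
  "is_triple t \<longleftrightarrow> is_lattice (lat t) \<and> principal_polarization (lat t) (pol t) \<and>
     symplectic_hodge_basis (lat t) (pol t) (om t) (et t)"

definition triple_iso :: "('g::finite triple \<times> 'g triple) set" where
  "triple_iso = {(t, t'). is_triple t \<and> is_triple t' \<and>
     (\<exists>f. Vector_Spaces.linear (*s) (*s) f \<and> bij f \<and> f ` lat t = lat t' \<and>
        (\<forall>v w. pol t' (f v) (f w) = pol t v w) \<and>
        (\<forall>i. \<forall>x\<in>lat t. om t' i (f x) = om t i x \<and> et t' i (f x) = et t i x))}"

definition triple_class :: "'g::finite triple \<Rightarrow> 'g triple set" where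
  "triple_class t = triple_iso `` {t}"

definition B_set :: "'g::finite triple set set" where
  "B_set = {t. is_triple t} // triple_iso"


section \<open>Holomorphic families and the moduli space\<close>

text \<open>
  A family over \<open>X\<close> locally has a frame \<open>b\<close> of the local system of lattices which varies
  holomorphically, on which the polarization is constant and on which the forms \<open>\<omega>\<close>, \<open>\<eta>\<close>
  have holomorphic periods.  The bundle of Lie algebras is taken to be trivialized; this is
  no restriction, as it is trivialized by the dual basis of \<open>\<omega>\<close>.
\<close>

definition holomorphic_family :: "'a cspace \<Rightarrow> ('a \<Rightarrow> 'g::finite triple) \<Rightarrow> bool" where
  "holomorphic_family X F \<longleftrightarrow>
     (\<forall>u\<in>points X. is_triple (F u)) \<and>
     (\<forall>x\<in>points X. \<exists>N b. openin (Top X) N \<and> x \<in> N \<and>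
        (\<forall>u\<in>N. lattice_basis (lat (F u)) (\<lambda>i. b i u)) \<and>
        (\<forall>i j. (\<lambda>u. b i u $ j) \<in> Hol X N) \<and>
        (\<forall>u\<in>N. \<forall>i j. pol (F u) (b i u) (b j u) = pol (F x) (b i x) (b j x)) \<and>
        (\<forall>i j. (\<lambda>u. om (F u) j (b i u)) \<in> Hol X N \<and> (\<lambda>u. et (F u) j (b i u)) \<in> Hol X N))"

text \<open>
  The topology and the sheaf of the fine moduli space: a set is open, and a function is
  holomorphic, if and only if its pull-back along the classifying map of every family has
  this property.  It suffices to test families over open subsets of a complex affine space
  whose dimension is at least \<open>dim B = g(2g + 1)\<close>, since these include the universal
  family over charts of \<open>B\<close>; here this is the space of \<open>2g \<times> 2g\<close> matrices.
\<close>

definition test_family ::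
  "(complex^('g::finite + 'g)^('g + 'g)) set \<Rightarrow>
   (complex^('g + 'g)^('g + 'g) \<Rightarrow> 'g triple) \<Rightarrow> bool" where
  "test_family U F \<longleftrightarrow> open U \<and> holomorphic_family (matrix_submanifold U) F"

definition B_space :: "'g::finite triple set cspace" where
  "B_space =
     \<lparr>Top = topology (\<lambda>W. W \<subseteq> B_set \<and>
              (\<forall>U F. test_family U F \<longrightarrow> open {u \<in> U. triple_class (F u) \<in> W})),
      Hol = (\<lambda>W. {h. \<forall>U F. test_family U F \<longrightarrow>
              (\<lambda>u. h (triple_class (F u)))
                \<in> Hol (matrix_submanifold U) {u \<in> U. triple_class (F u) \<in> W}})\<rparr>"

definition universal_family :: "('g::finite triple set \<Rightarrow> 'g triple) \<Rightarrow> bool" where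
  "universal_family F \<longleftrightarrow> holomorphic_family B_space F \<and> (\<forall>p\<in>points B_space. F p \<in> p)"


section \<open>Gauss--Manin connection and higher Ramanujan vector fields\<close>

text \<open>
  \<open>L u\<close> is the lattice over \<open>u\<close>.  Holomorphic local sections with values in the
  lattices are exactly the local sections of the local system of homology groups.
\<close>

definition homology_section ::
  "'a cspace \<Rightarrow> ('a \<Rightarrow> (complex^'g) set) \<Rightarrow> 'a \<Rightarrow> complex^'g \<Rightarrow> ('a \<Rightarrow> complex^'g) \<Rightarrow> bool" where
  "homology_section X L x \<gamma> \<sigma> \<longleftrightarrow> \<sigma> x = \<gamma> \<and>
     (\<exists>N. openin (Top X) N \<and> x \<in> N \<and> (\<forall>u\<in>N. \<sigma> u \<in> L u) \<and> (\<forall>j. (\<lambda>u. \<sigma> u $ j) \<in> Hol X N))"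

text \<open>
  The value at \<open>x\<close> of the covariant derivative along \<open>\<xi>\<close> of a section \<open>s\<close> of the de Rham
  bundle, for which the pairing with sections of the homology local system is differentiated.
\<close>

definition gauss_manin ::
  "'a cspace \<Rightarrow> ('a \<Rightarrow> (complex^'g) set) \<Rightarrow> 'a \<Rightarrow> 'a tvec \<Rightarrow>
   ('a \<Rightarrow> complex^'g \<Rightarrow> complex) \<Rightarrow> complex^'g \<Rightarrow> complex" where
  "gauss_manin X L x \<xi> s =
     restrict0 (L x) (\<lambda>\<gamma>. \<xi> (\<lambda>u. s u ((SOME \<sigma>. homology_section X L x \<gamma> \<sigma>) u)))"

definition ramanujan_field :: "'g::finite \<Rightarrow> 'g \<Rightarrow> 'g triple set \<Rightarrow> 'g triple set tvec" where
  "ramanujan_field k l =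
     (THE v. holomorphic_vector_field B_space v \<and>
        (\<forall>F. universal_family F \<longrightarrow>
          (\<forall>p\<in>points B_space.
            (let GM = gauss_manin B_space (\<lambda>q. lat (F q)) p (v p);
                 \<omega> = (\<lambda>m q. om (F q) m);
                 \<eta> = (\<lambda>m q. et (F q) m)
             in GM (\<omega> k) = \<eta> l p \<and> GM (\<omega> l) = \<eta> k p \<and>
                (\<forall>m. m \<notin> {k, l} \<longrightarrow> GM (\<omega> m) = (\<lambda>_. 0)) \<and>
                (\<forall>m. GM (\<eta> m) = (\<lambda>_. 0))))))"


section \<open>Period matrices\<close>

definition integral_symplectic_basis ::
  "(complex^'g) set \<Rightarrow> (complex^'g \<Rightarrow> complex^'g \<Rightarrow> real) \<Rightarrow>
   ('g \<Rightarrow> complex^'g) \<Rightarrow> ('g \<Rightarrow> complex^'g) \<Rightarrow> bool" where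
  "integral_symplectic_basis L E \<gamma> \<delta> \<longleftrightarrow>
     lattice_basis L (case_sum \<gamma> \<delta>) \<and>
     (\<forall>i j. E (\<gamma> i) (\<gamma> j) = 0 \<and> E (\<delta> i) (\<delta> j) = 0 \<and>
            E (\<gamma> i) (\<delta> j) = (if i = j then 1 else 0))"

definition period_matrix ::
  "'g::finite triple \<Rightarrow> ('g \<Rightarrow> complex^'g) \<Rightarrow> ('g \<Rightarrow> complex^'g) \<Rightarrow>
   complex^('g + 'g)^('g + 'g)" where
  "period_matrix t \<gamma> \<delta> =
     (let \<Omega>\<^sub>1 = (\<chi> i j. om t j (\<gamma> i)); N\<^sub>1 = (\<chi> i j. et t j (\<gamma> i));
          \<Omega>\<^sub>2 = (\<chi> i j. om t j (\<delta> i)); N\<^sub>2 = (\<chi> i j. et t j (\<delta> i))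
      in block_matrix N\<^sub>2 (mscale (1 / two_pi_i) \<Omega>\<^sub>2) N\<^sub>1 (mscale (1 / two_pi_i) \<Omega>\<^sub>1))"

definition period_map ::
  "'g::finite triple set \<Rightarrow> (complex^('g + 'g)^('g + 'g)) set" where
  "period_map p =
     (THE q. \<exists>t\<in>p. \<exists>\<gamma> \<delta>. integral_symplectic_basis (lat t) (pol t) \<gamma> \<delta> \<and>
                        q = Sp_Z_class (period_matrix t \<gamma> \<delta>))"

definition period_domain :: "(complex^('g::finite + 'g)^('g + 'g)) set set" where
  "period_domain =
     {Sp_Z_class (block_matrix A B C D) | A B C D.
        block_matrix A B C D \<in> Sp_C \<and> invertible D \<and> B ** matrix_inv D \<in> siegel_space}"


section \<open>The family over the Siegel upper half space\<close>

definition siegel_lattice :: "complex^'g^'g \<Rightarrow> (complex^'g) set" where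
  "siegel_lattice \<tau> = {m + \<tau> *v n | m n. (\<forall>i. m $ i \<in> \<int>) \<and> (\<forall>i. n $ i \<in> \<int>)}"

definition siegel_form :: "complex^'g^'g \<Rightarrow> complex^'g \<Rightarrow> complex^'g \<Rightarrow> real" where
  "siegel_form \<tau> v w =
     Im (\<Sum>i\<in>UNIV. \<Sum>j\<in>UNIV. cnj (v $ i) * of_real (matrix_inv (Im_matrix \<tau>) $ i $ j) * w $ j)"

definition siegel_omega :: "'g \<Rightarrow> complex^'g^'g \<Rightarrow> complex^'g \<Rightarrow> complex" where
  "siegel_omega k \<tau> = restrict0 (siegel_lattice \<tau>) (\<lambda>z. two_pi_i * z $ k)"

definition diag_partial :: "'g \<Rightarrow> complex^'g^'g \<Rightarrow> (complex^'g^'g) tvec" where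
  "diag_partial k \<tau> =
     velocity (matrix_submanifold siegel_space) (\<lambda>t. \<tau> + mscale t (E_matrix k k))"

definition siegel_eta :: "'g \<Rightarrow> complex^'g^'g \<Rightarrow> complex^'g \<Rightarrow> complex" where
  "siegel_eta k \<tau> =
     gauss_manin (matrix_submanifold siegel_space) siegel_lattice \<tau>
       (\<lambda>h. 1 / two_pi_i * diag_partial k \<tau> h) (siegel_omega k)"

definition phi_map :: "complex^'g^'g \<Rightarrow> 'g::finite triple set" where
  "phi_map \<tau> = triple_class
     \<lparr>lat = siegel_lattice \<tau>, pol = siegel_form \<tau>,
      om = (\<lambda>k. siegel_omega k \<tau>), et = (\<lambda>k. siegel_eta k \<tau>)\<rparr>"

end

theory Submission
  imports Defs "HOL-Complex_Analysis.Cauchy_Integral_Formula"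
begin

text \<open>
  Riemann's relations characterize the matrices \<open>M = (A B; C D)\<close> that occur as period matrices: they
  are the \<open>M \<in> Sp\<^sub>2\<^sub>g(\<complex>)\<close> with \<open>D\<close> invertible and \<open>B D\<^sup>-\<^sup>1 \<in> \<H>\<^sub>g\<close>, equivalently those for which
  a Hermitian form built from \<open>B\<close> and \<open>D\<close> is positive definite. The latter condition is open and
  visibly invariant under \<open>Sp\<^sub>2\<^sub>g(\<int>)\<close>, and two such matrices belong to isomorphic triples iff
  they lie in the same orbit. A holomorphic family lifts locally to this set by transporting an integral
  symplectic basis, and the quotient map by the discrete group \<open>Sp\<^sub>2\<^sub>g(\<int>)\<close> is locally
  injective; hence the sheaf of \<open>B\<^sub>g\<close> and the quotient sheaf pull back to the
  same sheaf on matrices. For a period matrix \<open>P\<close> of a family, integral periods are flat, so the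
  equations of the field \<open>v\<^sub>k\<^sub>l\<close> read \<open>dP = P N\<close> with
  \<open>N\<close> the given nilpotent matrix, and \<open>P (1 + t N)\<close> is the flow of the left invariant field.
  For \<open>\<phi>\<^sub>g\<close>, differentiating the periods \<open>2\<pi>i \<tau>\<close> along \<open>\<tau>\<^sub>k\<^sub>k\<close> gives \<open>N\<^sub>2 = 1\<close> and \<open>N\<^sub>1 = 0\<close>.
\<close>

section \<open>Holomorphic functions of matrices\<close>

text \<open>Three obstacles shape the proof. The symplectic group is a proper submanifold of the
  space of matrices, while test families live over open sets of matrices; a holomorphic retraction
  onto the group spreads the tautological family over an open set, and this one family already
  determines the topology and the sheaf of the moduli space. A vector field is holomorphic only if
  it maps holomorphic functions to holomorphic functions, and these are given merely as complex
  Frechet differentiable functions of many variables; so derivatives must be shown to be holomorphic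
  again, by Cauchy's formula and differentiation under the integral. Finally, the pairing, the
  period map, both kinds of vector fields and the section inside the Gauss-Manin connection are
  introduced by definite or indefinite descriptions, each of which needs existence together with
  uniqueness or independence of the choice. Uniqueness of the Ramanujan fields requires that a
  universal family exist at all; this is why every class receives a canonical representative, with
  the omega as coordinates.\<close>

lemma mscale_nth [simp]: "mscale c A $ i $ j = c * A $ i $ j"
  by (simp add: mscale_def)

lemma bounded_linear_mscale_left: "bounded_linear (\<lambda>c. mscale c A)"
  by (rule linear_conv_bounded_linear[THEN iffD1], rule linearI)
    (auto simp: vec_eq_iff algebra_simps)

lemma continuous_on_mscale [continuous_intros]:
  fixes A :: "'a::topological_space \<Rightarrow> complex^'n^'m"
  assumes "continuous_on S c" "continuous_on S A"
  shows "continuous_on S (\<lambda>x. mscale (c x) (A x))"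
  unfolding mscale_def by (intro continuous_intros assms)

definition matrix_unit :: "'m \<Rightarrow> 'n \<Rightarrow> complex^'n^'m" where
  "matrix_unit i j = (\<chi> a b. if a = i \<and> b = j then 1 else 0)"

lemma matrix_unit_expansion: "A = (\<Sum>i\<in>UNIV. \<Sum>j\<in>UNIV. mscale (A $ i $ j) (matrix_unit i j))"
proof -
  have "(\<Sum>i\<in>UNIV. \<Sum>j\<in>UNIV. mscale (A $ i $ j) (matrix_unit i j)) $ a $ b = A $ a $ b" for a b
  proof -
    have "(\<Sum>i\<in>UNIV. \<Sum>j\<in>UNIV. mscale (A $ i $ j) (matrix_unit i j)) $ a $ b
      = (\<Sum>i\<in>UNIV. \<Sum>j\<in>UNIV. if j = b then (if i = a then A $ i $ j else 0) else 0)"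
      unfolding sum_component by (intro sum.cong refl) (auto simp: matrix_unit_def)
    also have "\<dots> = A $ a $ b"
      by (simp add: sum.delta)
    finally show ?thesis .
  qed
  then show ?thesis
    by (simp add: vec_eq_iff)
qed

text \<open>The expansion in matrix units is a finite sum of scalar functions times constant
  matrices, so the sum rule reduces differentiability to the entries.\<close>

lemma has_derivative_matrix:
  fixes r :: "'a::real_normed_vector \<Rightarrow> complex^'n^'m"
  assumes "\<And>i j. ((\<lambda>x. r x $ i $ j) has_derivative D i j) F"
  shows "(r has_derivative (\<lambda>v. \<chi> i j. D i j v)) F"
proof -
  have "((\<lambda>x. \<Sum>i\<in>UNIV. \<Sum>j\<in>UNIV. mscale (r x $ i $ j) (matrix_unit i j)) has_derivative
     (\<lambda>v. \<Sum>i\<in>UNIV. \<Sum>j\<in>UNIV. mscale (D i j v) (matrix_unit i j))) F"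
    by (intro has_derivative_sum bounded_linear.has_derivative[OF bounded_linear_mscale_left] assms)
  then show ?thesis
    using matrix_unit_expansion[of "\<chi> i j. D i j v" for v]
    by (simp add: matrix_unit_expansion[symmetric])
qed

text \<open>Only complex homogeneity is recorded; additivity is part of
  \<open>has_derivative\<close>.\<close>

abbreviation complex_linear :: "(complex^'n^'m \<Rightarrow> complex) \<Rightarrow> bool" where
  "complex_linear D \<equiv> \<forall>c X. D (mscale c X) = c * D X"

lemma matrix_holomorphic_on_subset:
  "matrix_holomorphic_on h U \<Longrightarrow> V \<subseteq> U \<Longrightarrow> matrix_holomorphic_on h V"
  unfolding matrix_holomorphic_on_def by blast

lemma matrix_holomorphic_on_cong:
  assumes "open U" "\<And>X. X \<in> U \<Longrightarrow> h X = h' X" "matrix_holomorphic_on h U"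
  shows "matrix_holomorphic_on h' U"
  unfolding matrix_holomorphic_on_def
proof
  fix A assume A: "A \<in> U"
  then obtain D where D: "(h has_derivative D) (at A)" "complex_linear D"
    using assms(3) unfolding matrix_holomorphic_on_def by blast
  have "(h' has_derivative D) (at A)"
    by (rule has_derivative_transform_within_open[OF D(1) assms(1) A]) (use assms(2) in auto)
  with D(2) show "\<exists>D. (h' has_derivative D) (at A) \<and> complex_linear D" by blast
qed

lemma matrix_holomorphic_on_const: "matrix_holomorphic_on (\<lambda>_. c) U"
  unfolding matrix_holomorphic_on_def
  by (intro ballI exI[of _ "\<lambda>_. 0"] conjI has_derivative_const) auto

lemma matrix_holomorphic_on_entry: "matrix_holomorphic_on (\<lambda>X. X $ i $ j) U"
  unfolding matrix_holomorphic_on_def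
  by (intro ballI exI[of _ "\<lambda>X. X $ i $ j"] conjI)
    (auto intro!: bounded_linear.has_derivative[OF bounded_linear_vec_nth])

lemma matrix_holomorphic_on_add:
  assumes "matrix_holomorphic_on f U" "matrix_holomorphic_on g U"
  shows "matrix_holomorphic_on (\<lambda>X. f X + g X) U"
  unfolding matrix_holomorphic_on_def
proof
  fix A assume A: "A \<in> U"
  then obtain D D' where "(f has_derivative D) (at A)" "complex_linear D"
    "(g has_derivative D') (at A)" "complex_linear D'"
    using assms unfolding matrix_holomorphic_on_def by meson
  then show "\<exists>D. ((\<lambda>X. f X + g X) has_derivative D) (at A) \<and> complex_linear D"
    by (intro exI[of _ "\<lambda>X. D X + D' X"] conjI has_derivative_add) (auto simp: algebra_simps)
qed

lemma matrix_holomorphic_on_mult: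
  assumes "matrix_holomorphic_on f U" "matrix_holomorphic_on g U"
  shows "matrix_holomorphic_on (\<lambda>X. f X * g X) U"
  unfolding matrix_holomorphic_on_def
proof
  fix A assume A: "A \<in> U"
  then obtain D D' where "(f has_derivative D) (at A)" "complex_linear D"
    "(g has_derivative D') (at A)" "complex_linear D'"
    using assms unfolding matrix_holomorphic_on_def by meson
  then show "\<exists>D. ((\<lambda>X. f X * g X) has_derivative D) (at A) \<and> complex_linear D"
    by (intro exI[of _ "\<lambda>X. f A * D' X + D X * g A"] conjI has_derivative_mult) (auto simp: algebra_simps)
qed

lemma matrix_holomorphic_on_inverse:
  assumes "matrix_holomorphic_on f U" "\<And>X. X \<in> U \<Longrightarrow> f X \<noteq> 0"
  shows "matrix_holomorphic_on (\<lambda>X. inverse (f X)) U"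
  unfolding matrix_holomorphic_on_def
proof
  fix A assume A: "A \<in> U"
  then obtain D where "(f has_derivative D) (at A)" "complex_linear D"
    using assms unfolding matrix_holomorphic_on_def by meson
  then show "\<exists>D. ((\<lambda>X. inverse (f X)) has_derivative D) (at A) \<and> complex_linear D"
    using assms(2)[OF A]
    by (intro exI[of _ "\<lambda>X. - (inverse (f A) * D X * inverse (f A))"] conjI Deriv.has_derivative_inverse)
      (auto simp: algebra_simps)
qed

lemma matrix_holomorphic_on_minus:
  assumes "matrix_holomorphic_on f U"
  shows "matrix_holomorphic_on (\<lambda>X. - f X) U"
  using matrix_holomorphic_on_mult[OF matrix_holomorphic_on_const[of "-1"] assms] by simp

lemma matrix_holomorphic_on_divide:
  assumes "matrix_holomorphic_on f U" "matrix_holomorphic_on g U" "\<And>X. X \<in> U \<Longrightarrow> g X \<noteq> 0"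
  shows "matrix_holomorphic_on (\<lambda>X. f X / g X) U"
  using matrix_holomorphic_on_mult[OF assms(1) matrix_holomorphic_on_inverse[OF assms(2,3)]]
  by (simp add: divide_inverse)

lemma matrix_holomorphic_on_sum:
  assumes "\<And>i. i \<in> I \<Longrightarrow> matrix_holomorphic_on (f i) U"
  shows "matrix_holomorphic_on (\<lambda>X. \<Sum>i\<in>I. f i X) U"
  using assms
  by (induction I rule: infinite_finite_induct)
    (auto intro: matrix_holomorphic_on_const matrix_holomorphic_on_add)

lemma matrix_holomorphic_on_prod:
  assumes "\<And>i. i \<in> I \<Longrightarrow> matrix_holomorphic_on (f i) U"
  shows "matrix_holomorphic_on (\<lambda>X. \<Prod>i\<in>I. f i X) U"
  using assms
  by (induction I rule: infinite_finite_induct)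
    (auto intro: matrix_holomorphic_on_const matrix_holomorphic_on_mult)

lemmas matrix_holomorphic_intros =
  matrix_holomorphic_on_const matrix_holomorphic_on_entry matrix_holomorphic_on_add
  matrix_holomorphic_on_mult matrix_holomorphic_on_minus matrix_holomorphic_on_divide
  matrix_holomorphic_on_sum matrix_holomorphic_on_prod

lemma matrix_holomorphic_on_compose:
  fixes r :: "complex^'n^'m \<Rightarrow> complex^'p^'q"
  assumes "matrix_holomorphic_on H N" "\<And>i j. matrix_holomorphic_on (\<lambda>X. r X $ i $ j) U"
    "r ` U \<subseteq> N"
  shows "matrix_holomorphic_on (\<lambda>X. H (r X)) U"
  unfolding matrix_holomorphic_on_def
proof
  fix A assume A: "A \<in> U"
  then obtain D where D: "(H has_derivative D) (at (r A))" "complex_linear D"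
    using assms unfolding matrix_holomorphic_on_def by blast
  have "\<forall>i j. \<exists>D. ((\<lambda>X. r X $ i $ j) has_derivative D) (at A) \<and> complex_linear D"
    using assms(2) A unfolding matrix_holomorphic_on_def by blast
  then obtain D' where D': "\<And>i j. ((\<lambda>X. r X $ i $ j) has_derivative D' i j) (at A)"
    "\<And>i j. complex_linear (D' i j)" by metis
  have "(r has_derivative (\<lambda>v. \<chi> i j. D' i j v)) (at A)"
    by (rule has_derivative_matrix) (rule D')
  from diff_chain_at[OF this D(1)]
  have "((\<lambda>X. H (r X)) has_derivative (\<lambda>v. D (\<chi> i j. D' i j v))) (at A)"
    by (simp add: o_def)
  moreover have "D (\<chi> i j. D' i j (mscale c X)) = c * D (\<chi> i j. D' i j X)" for c X
  proof -
    have "(\<chi> i j. D' i j (mscale c X)) = mscale c (\<chi> i j. D' i j X)"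
      by (simp add: vec_eq_iff D'(2))
    then show ?thesis using D(2) by simp
  qed
  ultimately show "\<exists>D. ((\<lambda>X. H (r X)) has_derivative D) (at A) \<and> complex_linear D"
    by blast
qed

lemma matrix_holomorphic_on_imp_continuous_on:
  "matrix_holomorphic_on h U \<Longrightarrow> continuous_on U h"
  unfolding matrix_holomorphic_on_def
  by (meson continuous_at_imp_continuous_on has_derivative_continuous)

text \<open>Complex homogeneity of \<open>D\<close> turns its value at \<open>v\<close> times
  \<open>C\<close> into \<open>v\<close> times \<open>D C\<close>, so the real Frechet derivative
  along a holomorphic curve becomes a complex derivative.\<close>

lemma matrix_holomorphic_curve:
  fixes c :: "complex \<Rightarrow> complex^'n^'m"
  assumes "(H has_derivative D) (at (c z))" "complex_linear D"
    "\<And>i j. ((\<lambda>z. c z $ i $ j) has_field_derivative C $ i $ j) (at z)"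
  shows "((\<lambda>z. H (c z)) has_field_derivative D C) (at z)"
proof -
  have "(c has_derivative (\<lambda>v. \<chi> i j. C $ i $ j * v)) (at z)"
    by (rule has_derivative_matrix) (use assms(3) in \<open>simp add: has_field_derivative_def\<close>)
  from diff_chain_at[OF this assms(1)]
  have "((\<lambda>z. H (c z)) has_derivative (\<lambda>v. D (\<chi> i j. C $ i $ j * v))) (at z)"
    by (simp add: o_def)
  moreover have "(\<lambda>v. D (\<chi> i j. C $ i $ j * v)) = (*) (D C)"
  proof
    fix v
    have "(\<chi> i j. C $ i $ j * v) = mscale v C" by (simp add: vec_eq_iff)
    then show "D (\<chi> i j. C $ i $ j * v) = D C * v" using assms(2) by simp
  qed
  ultimately show ?thesis by (simp add: has_field_derivative_def)
qed

section \<open>Cauchy's formula along complex lines and derivatives of holomorphic functions\<close>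

lemma matrix_holomorphic_line:
  assumes "(H has_derivative D) (at (X + mscale z V))" "complex_linear D"
  shows "((\<lambda>z. H (X + mscale z V)) has_field_derivative D V) (at z)"
  by (rule matrix_holomorphic_curve[where c = "\<lambda>z. X + mscale z V", OF assms]) (auto intro!: derivative_eq_intros)

lemma matrix_holomorphic_line_holomorphic:
  assumes "matrix_holomorphic_on H N" "\<And>z. z \<in> S \<Longrightarrow> X + mscale z V \<in> N"
  shows "(\<lambda>z. H (X + mscale z V)) holomorphic_on S"
  unfolding holomorphic_on_def
proof
  fix z assume "z \<in> S"
  then obtain D where D: "(H has_derivative D) (at (X + mscale z V))" "complex_linear D"
    using assms unfolding matrix_holomorphic_on_def by blast
  from matrix_holomorphic_line[OF D] show "(\<lambda>z. H (X + mscale z V)) field_differentiable at z within S"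
    using field_differentiable_at_within field_differentiable_def by blast
qed

text \<open>Cauchy's formula for the first derivative, with the circle parametrized by
  \<open>{0..1}\<close>: after cancelling \<open>2 pi i\<close> and one factor
  \<open>r exp(2 pi i t)\<close> the weight \<open>exp(-2 pi i t) / r\<close> remains. The domain of
  integration does not depend on the function, as is wanted for integrals with a parameter.\<close>

lemma deriv_circle_mean:
  assumes "f holomorphic_on U" "open U" "cball 0 r \<subseteq> U" "0 < r"
  shows "deriv f 0 = integral {0..1} (\<lambda>t. f (of_real r * exp (2 * of_real pi * \<i> * of_real t)) *
     (exp (- (2 * of_real pi * \<i> * of_real t)) / of_real r))"
proof -
  have c: "contour_integral (circlepath 0 r) (\<lambda>u. f u / (u - 0)^2) = 2 * pi * \<i> * deriv f 0"
  proof (rule Cauchy_contour_integral_circlepath_2)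
    show "continuous_on (cball 0 r) f"
      using assms holomorphic_on_imp_continuous_on continuous_on_subset by blast
    show "f holomorphic_on ball 0 r"
      using assms(1,3) by (meson ball_subset_cball holomorphic_on_subset)
  qed (use assms in auto)
  have "contour_integral (circlepath 0 r) (\<lambda>u. f u / (u - 0)^2)
     = integral {0..1} (\<lambda>t. (2 * of_real pi * \<i>) * (f (of_real r * exp (2 * of_real pi * \<i> * of_real t)) *
     (exp (- (2 * of_real pi * \<i> * of_real t)) / of_real r)))"
    unfolding contour_integral_integral vector_derivative_circlepath
    by (rule integral_cong) (use assms(4) in \<open>auto simp: circlepath power2_eq_square exp_minus field_simps\<close>)
  also have "\<dots> = (2 * of_real pi * \<i>) * integral {0..1} (\<lambda>t. f (of_real r * exp (2 * of_real pi * \<i> * of_real t)) *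
     (exp (- (2 * of_real pi * \<i> * of_real t)) / of_real r))"
    by simp
  finally show ?thesis
    unfolding c by (simp only: mult_cancel_left of_real_mult of_real_numeral) auto
qed

text \<open>
  Cauchy's formula along the complex line in direction \<open>V\<close> expresses the derivative by values of
  \<open>H\<close>; first continuity of the derivative, then its differentiability follow.
\<close>

lemma directional_derivative_integral:
  fixes H :: "complex^'n^'m \<Rightarrow> complex"
  assumes H: "matrix_holomorphic_on H N" and N: "open N" and X0: "X0 \<in> N"
  obtains r e where "0 < r" "0 < e"
    "\<And>X z. X \<in> ball X0 e \<Longrightarrow> norm z \<le> r \<Longrightarrow> X + mscale z V \<in> N"
    "\<And>X. X \<in> ball X0 e \<Longrightarrow> frechet_derivative H (at X) V = integral {0..1} (\<lambda>t. H (X + mscale (of_real r * exp (2 * of_real pi * \<i> * of_real t)) V) *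
     (exp (- (2 * of_real pi * \<i> * of_real t)) / of_real r))"
proof -
  obtain e0 where e0: "0 < e0" "ball X0 e0 \<subseteq> N"
    using N X0 open_contains_ball by blast
  obtain B where B: "0 < B" "\<And>z. norm (mscale z V) \<le> norm z * B"
    using bounded_linear.pos_bounded[OF bounded_linear_mscale_left[of V]] by blast
  \<comment> \<open>Half of the radius \<open>e0\<close> is spent on moving the base point and half
    on the disc: for \<open>norm z < 2 * r\<close> the shift has norm below \<open>e0 / 2\<close>.
    The room between \<open>r\<close> and \<open>2 * r\<close> provides the open disc around the
    closed one in Cauchy's formula.\<close>
  define e where "e = e0 / 2"
  define r where "r = e0 / (4 * B)"
  have er: "0 < e" "0 < r" using e0 B by (auto simp: e_def r_def)
  have sub: "X + mscale z V \<in> N" if "X \<in> ball X0 e" "norm z < 2 * r" for X z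
  proof -
    have "norm (mscale z V) \<le> norm z * B" by (rule B)
    also have "\<dots> < 2 * r * B" using that B by simp
    also have "\<dots> = e0 / 2" using B by (simp add: r_def)
    finally have "norm (mscale z V) < e0 / 2" .
    moreover have "norm (X0 - X) < e0 / 2" using that by (simp add: e_def dist_norm)
    ultimately have "norm ((X0 - X) - mscale z V) < e0"
      using norm_triangle_ineq4[of "X0 - X" "mscale z V"] by linarith
    then have "X + mscale z V \<in> ball X0 e0" by (simp add: dist_norm algebra_simps)
    then show ?thesis using e0 by blast
  qed
  show ?thesis
  proof (rule that[OF er(2,1)])
    show "X + mscale z V \<in> N" if "X \<in> ball X0 e" "norm z \<le> r" for X z
      using sub that er by force
    fix X assume X: "X \<in> ball X0 e"
    have XN: "X \<in> N" using sub[OF X, of 0] er by (simp add: mscale_def vec_eq_iff zero_vec_def[symmetric])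
    then obtain D where D: "(H has_derivative D) (at X)" "complex_linear D"
      using H unfolding matrix_holomorphic_on_def by blast
    have fD: "frechet_derivative H (at X) = D" using D(1) frechet_derivative_at by metis
    have X0: "X + mscale 0 V = X" by (simp add: vec_eq_iff)
    have "((\<lambda>z. H (X + mscale z V)) has_field_derivative D V) (at 0)"
      by (rule matrix_holomorphic_line) (use D X0 in auto)
    then have "D V = deriv (\<lambda>z. H (X + mscale z V)) 0" by (simp add: DERIV_imp_deriv)
    also have "\<dots> = integral {0..1} (\<lambda>t. H (X + mscale (of_real r * exp (2 * of_real pi * \<i> * of_real t)) V) *
     (exp (- (2 * of_real pi * \<i> * of_real t)) / of_real r))"
      by (rule deriv_circle_mean[where U = "ball 0 (2 * r)"])
        (use er sub X in \<open>auto intro!: matrix_holomorphic_line_holomorphic[OF H] simp: mem_ball_0\<close>)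
    finally show "frechet_derivative H (at X) V = integral {0..1} (\<lambda>t. H (X + mscale (of_real r * exp (2 * of_real pi * \<i> * of_real t)) V) *
     (exp (- (2 * of_real pi * \<i> * of_real t)) / of_real r))"
      by (simp add: fD)
  qed
qed

text \<open>Locally the derivative is an integral whose integrand is jointly continuous in base
  point and angle. The Leibniz rule, which yields differentiability afterwards, asks for this
  continuity.\<close>

lemma continuous_on_frechet_derivative_matrix:
  fixes H :: "complex^'n^'m \<Rightarrow> complex"
  assumes H: "matrix_holomorphic_on H N" and N: "open N"
  shows "continuous_on N (\<lambda>X. frechet_derivative H (at X) V)"
proof (rule continuous_at_imp_continuous_on, rule ballI)
  fix X0 assume X0: "X0 \<in> N"
  obtain r e where re: "0 < r" "0 < e"
    "\<And>X z. X \<in> ball X0 e \<Longrightarrow> norm z \<le> r \<Longrightarrow> X + mscale z V \<in> N"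
    "\<And>X. X \<in> ball X0 e \<Longrightarrow> frechet_derivative H (at X) V = integral {0..1} (\<lambda>t. H (X + mscale (of_real r * exp (2 * of_real pi * \<i> * of_real t)) V) *
     (exp (- (2 * of_real pi * \<i> * of_real t)) / of_real r))"
    by (rule directional_derivative_integral[OF H N X0, of V]) (rule that; blast)
  have "continuous_on (ball X0 e) (\<lambda>X. integral (cbox 0 1) (\<lambda>t. H (X + mscale (of_real r * exp (2 * of_real pi * \<i> * of_real t)) V) *
     (exp (- (2 * of_real pi * \<i> * of_real t)) / of_real r)))"
  proof (rule integral_continuous_on_param)
    have "continuous_on (ball X0 e \<times> cbox (0::real) 1)
        (\<lambda>p. H (fst p + mscale (of_real r * exp (2 * of_real pi * \<i> * of_real (snd p))) V))"
    proof (rule continuous_on_compose2[OF matrix_holomorphic_on_imp_continuous_on[OF H]])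
      show "continuous_on (ball X0 e \<times> cbox (0::real) 1)
        (\<lambda>p. fst p + mscale (of_real r * exp (2 * of_real pi * \<i> * of_real (snd p))) V)"
        by (intro continuous_intros)
    qed (use re in \<open>auto simp: norm_mult\<close>)
    then have "continuous_on (ball X0 e \<times> cbox (0::real) 1)
        (\<lambda>p. H (fst p + mscale (of_real r * exp (2 * of_real pi * \<i> * of_real (snd p))) V) *
       (exp (- (2 * of_real pi * \<i> * of_real (snd p))) / of_real r))"
      by (intro continuous_intros) (use re in auto)
    then show "continuous_on (ball X0 e \<times> cbox (0::real) 1)
        (\<lambda>(X, t). H (X + mscale (of_real r * exp (2 * of_real pi * \<i> * of_real t)) V) *
       (exp (- (2 * of_real pi * \<i> * of_real t)) / of_real r))"
      by (simp add: case_prod_unfold)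
  qed
  then have "continuous_on (ball X0 e) (\<lambda>X. frechet_derivative H (at X) V)"
    by (rule continuous_on_eq) (simp add: re(4))
  then show "isCont (\<lambda>X. frechet_derivative H (at X) V) X0"
    using re(2) by (simp add: continuous_on_eq_continuous_at)
qed

lemma matrix_holomorphic_frechet_derivative:
  fixes H :: "complex^'n^'m \<Rightarrow> complex"
  assumes H: "matrix_holomorphic_on H N" "X \<in> N"
  shows "(H has_derivative frechet_derivative H (at X)) (at X)"
    "complex_linear (frechet_derivative H (at X))"
proof -
  obtain D where D: "(H has_derivative D) (at X)" "complex_linear D"
    using H unfolding matrix_holomorphic_on_def by blast
  have "frechet_derivative H (at X) = D" using D(1) frechet_derivative_at by metis
  with D show "(H has_derivative frechet_derivative H (at X)) (at X)"
    "complex_linear (frechet_derivative H (at X))" by auto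
qed

text \<open>Cauchy's integral is differentiated under the integral sign. The resulting derivative is
  complex linear because the derivative of the integrand is so for every angle.\<close>

lemma matrix_holomorphic_on_directional_derivative:
  fixes H :: "complex^'n^'m \<Rightarrow> complex"
  assumes H: "matrix_holomorphic_on H N" and N: "open N"
  shows "matrix_holomorphic_on (\<lambda>X. frechet_derivative H (at X) V) N"
  unfolding matrix_holomorphic_on_def
proof
  fix X0 assume X0: "X0 \<in> N"
  obtain r e where re: "0 < r" "0 < e"
    "\<And>X z. X \<in> ball X0 e \<Longrightarrow> norm z \<le> r \<Longrightarrow> X + mscale z V \<in> N"
    "\<And>X. X \<in> ball X0 e \<Longrightarrow> frechet_derivative H (at X) V = integral {0..1} (\<lambda>t. H (X + mscale (of_real r * exp (2 * of_real pi * \<i> * of_real t)) V) *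
     (exp (- (2 * of_real pi * \<i> * of_real t)) / of_real r))"
    by (rule directional_derivative_integral[OF H N X0, of V]) (rule that; blast)
  define P where "P X t = X + mscale (of_real r * exp (2 * of_real pi * \<i> * of_real t)) V" for X and t :: real
  define w where "w t = exp (- (2 * of_real pi * \<i> * of_real t)) / of_real r" for t :: real
  have PN: "P X t \<in> N" if "X \<in> ball X0 e" for X t
    unfolding P_def by (rule re(3)[OF that]) (use re in \<open>auto simp: norm_mult\<close>)
  define DH where "DH X = Blinfun (frechet_derivative H (at X))" for X
  have bl: "bounded_linear (frechet_derivative H (at X))" if "X \<in> N" for X
    using matrix_holomorphic_frechet_derivative(1)[OF H that] has_derivative_bounded_linear by blast
  have DH: "blinfun_apply (DH X) = frechet_derivative H (at X)" if "X \<in> N" for X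
    using bl[OF that] by (simp add: DH_def bounded_linear_Blinfun_apply)
  \<comment> \<open>The Leibniz rule takes the derivative as a continuous map into bounded linear
    operators; in finite dimension continuity on each vector suffices.\<close>
  have contDH: "continuous_on N DH"
  proof (rule continuous_on_blinfun_componentwise)
    fix i :: "complex^'n^'m"
    show "continuous_on N (\<lambda>x. blinfun_apply (DH x) i)"
      by (rule continuous_on_eq[OF continuous_on_frechet_derivative_matrix[OF H N]]) (simp add: DH)
  qed
  define fx where "fx X t = blinfun_mult_right (w t) o\<^sub>L DH (P X t)" for X t
  have contw: "continuous_on S w" for S
    unfolding w_def by (intro continuous_intros) (use re in auto)
  have contP: "continuous_on (ball X0 e \<times> cbox 0 1) (\<lambda>p. P (fst p) (snd p))"
    unfolding P_def by (intro continuous_intros)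
  have "((\<lambda>X. integral (cbox 0 1) (\<lambda>t. H (P X t) * w t)) has_derivative
      blinfun_apply (integral (cbox 0 1) (fx X0))) (at X0 within ball X0 e)"
  proof (rule leibniz_rule)
    fix X t assume X: "X \<in> ball X0 e"
    have "((\<lambda>X. P X t) has_derivative (\<lambda>v. v)) (at X)"
      unfolding P_def by (auto intro!: derivative_eq_intros)
    from diff_chain_at[OF this, of H "frechet_derivative H (at (P X t))"]
    have "((\<lambda>X. H (P X t)) has_derivative frechet_derivative H (at (P X t))) (at X)"
      using matrix_holomorphic_frechet_derivative(1)[OF H PN[OF X]] by (simp add: o_def)
    then have "((\<lambda>X. H (P X t) * w t) has_derivative (\<lambda>v. frechet_derivative H (at (P X t)) v * w t)) (at X)"
      by (rule has_derivative_mult_left)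
    moreover have "blinfun_apply (fx X t) = (\<lambda>v. frechet_derivative H (at (P X t)) v * w t)"
      by (auto simp: fx_def DH[OF PN[OF X]])
    ultimately show "((\<lambda>X. H (P X t) * w t) has_derivative blinfun_apply (fx X t)) (at X within ball X0 e)"
      using has_derivative_at_withinI by metis
  next
    fix X assume X: "X \<in> ball X0 e"
    show "(\<lambda>t. H (P X t) * w t) integrable_on cbox 0 1"
    proof (rule integrable_continuous, intro continuous_intros contw)
      show "continuous_on (cbox 0 1) (\<lambda>t. H (P X t))"
      proof (rule continuous_on_compose2[OF matrix_holomorphic_on_imp_continuous_on[OF H]])
        show "continuous_on (cbox 0 1) (P X)" unfolding P_def by (intro continuous_intros)
      qed (use PN X in auto)
    qed
  next
    have "continuous_on (ball X0 e \<times> cbox 0 1) (\<lambda>p. fx (fst p) (snd p))"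
      unfolding fx_def
    proof (intro continuous_intros)
      show "continuous_on (ball X0 e \<times> cbox 0 1) (\<lambda>p. w (snd p))"
        using contw by (intro continuous_on_compose2[OF contw continuous_on_snd]) (auto intro: continuous_intros)
      show "continuous_on (ball X0 e \<times> cbox 0 1) (\<lambda>p. DH (P (fst p) (snd p)))"
        by (rule continuous_on_compose2[OF contDH contP]) (use PN in auto)
    qed
    then show "continuous_on (ball X0 e \<times> cbox 0 1) (\<lambda>(x, t). fx x t)"
      by (simp add: case_prod_unfold)
  qed (use re in auto)
  then have D: "((\<lambda>X. integral (cbox 0 1) (\<lambda>t. H (P X t) * w t)) has_derivative
      blinfun_apply (integral (cbox 0 1) (fx X0))) (at X0)"
    using re at_within_open[of X0 "ball X0 e"] by simp
  have D': "((\<lambda>X. frechet_derivative H (at X) V) has_derivative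
      blinfun_apply (integral (cbox 0 1) (fx X0))) (at X0)"
    by (rule has_derivative_transform_within_open[OF D, of "ball X0 e"])
      (use re in \<open>auto simp: P_def w_def\<close>)
  have int: "fx X0 integrable_on cbox 0 1"
  proof (rule integrable_continuous)
    show "continuous_on (cbox 0 1) (fx X0)"
      unfolding fx_def
    proof (intro continuous_intros contw)
      show "continuous_on (cbox 0 1) (\<lambda>t. DH (P X0 t))"
        by (rule continuous_on_compose2[OF contDH]) (use PN re in \<open>auto simp: P_def intro!: continuous_intros\<close>)
    qed
  qed
  have "complex_linear (blinfun_apply (integral (cbox 0 1) (fx X0)))"
  proof (intro allI)
    fix c Y
    have "blinfun_apply (integral (cbox 0 1) (fx X0)) (mscale c Y)
       = integral (cbox 0 1) (\<lambda>t. blinfun_apply (fx X0 t) (mscale c Y))"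
      by (rule blinfun_apply_integral[OF int])
    also have "\<dots> = integral (cbox 0 1) (\<lambda>t. c * blinfun_apply (fx X0 t) Y)"
    proof (rule integral_cong)
      fix t
      have X: "X0 \<in> ball X0 e" using re by simp
      show "blinfun_apply (fx X0 t) (mscale c Y) = c * blinfun_apply (fx X0 t) Y"
        using matrix_holomorphic_frechet_derivative(2)[OF H PN[OF X, of t]]
        by (simp add: fx_def DH[OF PN[OF X]])
    qed
    also have "\<dots> = c * integral (cbox 0 1) (\<lambda>t. blinfun_apply (fx X0 t) Y)"
      by simp
    also have "\<dots> = c * blinfun_apply (integral (cbox 0 1) (fx X0)) Y"
      by (simp only: blinfun_apply_integral[OF int])
    finally show "blinfun_apply (integral (cbox 0 1) (fx X0)) (mscale c Y)
      = c * blinfun_apply (integral (cbox 0 1) (fx X0)) Y" .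
  qed
  with D' show "\<exists>D. ((\<lambda>X. frechet_derivative H (at X) V) has_derivative D) (at X0) \<and> complex_linear D"
    by blast
qed

text \<open>For a direction that varies with the point, expansion in matrix units reduces to fixed
  directions. Left invariant fields need the direction \<open>X ** N\<close>.\<close>

lemma matrix_holomorphic_on_derivative_along:
  fixes H :: "complex^'n^'m \<Rightarrow> complex" and V :: "complex^'n^'m \<Rightarrow> complex^'n^'m"
  assumes H: "matrix_holomorphic_on H N" and N: "open N"
    and V: "\<And>i j. matrix_holomorphic_on (\<lambda>X. V X $ i $ j) N"
  shows "matrix_holomorphic_on (\<lambda>X. frechet_derivative H (at X) (V X)) N"
proof (rule matrix_holomorphic_on_cong[OF N])
  show "matrix_holomorphic_on (\<lambda>X. \<Sum>i\<in>UNIV. \<Sum>j\<in>UNIV. V X $ i $ j * frechet_derivative H (at X) (matrix_unit i j)) N"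
    by (intro matrix_holomorphic_intros V matrix_holomorphic_on_directional_derivative assms)
  fix X assume X: "X \<in> N"
  have lin: "linear (frechet_derivative H (at X))"
    using matrix_holomorphic_frechet_derivative(1)[OF H X] has_derivative_linear by blast
  show "(\<Sum>i\<in>UNIV. \<Sum>j\<in>UNIV. V X $ i $ j * frechet_derivative H (at X) (matrix_unit i j))
    = frechet_derivative H (at X) (V X)"
    by (subst (2) matrix_unit_expansion)
      (simp add: linear_sum[OF lin] matrix_holomorphic_frechet_derivative(2)[OF H X])
qed

section \<open>Sheaves of holomorphic functions\<close>

lemma Top_matrix_submanifold [simp]: "Top (matrix_submanifold S) = top_of_set S"
  by (simp add: matrix_submanifold_def)

lemma mem_Hol_matrix_submanifold:
  "h \<in> Hol (matrix_submanifold S) W \<longleftrightarrow>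
    (\<forall>A\<in>W. \<exists>N H. open N \<and> A \<in> N \<and> matrix_holomorphic_on H N \<and> (\<forall>X\<in>N \<inter> W. H X = h X))"
  by (simp add: matrix_submanifold_def)

lemma Hol_matrix_submanifoldI:
  assumes "\<And>A. A \<in> W \<Longrightarrow> \<exists>N H. open N \<and> A \<in> N \<and> matrix_holomorphic_on H N \<and> (\<forall>X\<in>N \<inter> W. H X = h X)"
  shows "h \<in> Hol (matrix_submanifold S) W"
  using assms by (simp add: mem_Hol_matrix_submanifold)

lemma Hol_matrix_submanifoldD:
  assumes "h \<in> Hol (matrix_submanifold S) W" "A \<in> W"
  obtains N H where "open N" "A \<in> N" "matrix_holomorphic_on H N" "\<And>X. X \<in> N \<Longrightarrow> X \<in> W \<Longrightarrow> H X = h X"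
proof -
  obtain N H where "open N" "A \<in> N" "matrix_holomorphic_on H N" "\<forall>X\<in>N \<inter> W. H X = h X"
    using assms unfolding mem_Hol_matrix_submanifold by blast
  then show ?thesis by (intro that[of N H]) auto
qed

lemma matrix_holomorphic_on_imp_Hol:
  assumes "matrix_holomorphic_on h U" "open U" "W \<subseteq> U"
  shows "h \<in> Hol (matrix_submanifold S) W"
  by (rule Hol_matrix_submanifoldI) (use assms in blast)

lemma norm_vec_le_sum: "norm (v :: complex^'n) \<le> (\<Sum>j\<in>UNIV. norm (v $ j))"
  unfolding norm_vec_def by (rule L2_set_le_sum) auto

lemma norm_matrix_le_sum: "norm (A :: complex^'n^'m) \<le> (\<Sum>i\<in>UNIV. \<Sum>j\<in>UNIV. norm (A $ i $ j))"
proof -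
  have "norm A \<le> (\<Sum>i\<in>UNIV. norm (A $ i))"
    unfolding norm_vec_def[of A] by (rule L2_set_le_sum) auto
  also have "\<dots> \<le> (\<Sum>i\<in>UNIV. \<Sum>j\<in>UNIV. norm (A $ i $ j))"
    by (intro sum_mono norm_vec_le_sum)
  finally show ?thesis .
qed

text \<open>
  The properties of a structure sheaf that are needed to compute in holomorphic frames; they hold
  for submanifolds of matrices and for the moduli space.
\<close>

locale hol_space =
  fixes X :: "'a cspace"
  assumes Hol_cong: "h \<in> Hol X W \<Longrightarrow> (\<And>x. x \<in> W \<Longrightarrow> h x = h' x) \<Longrightarrow> h' \<in> Hol X W"
    and Hol_subset: "h \<in> Hol X W \<Longrightarrow> W' \<subseteq> W \<Longrightarrow> h \<in> Hol X W'"
    and Hol_const: "(\<lambda>_. a) \<in> Hol X W"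
    and Hol_add: "f \<in> Hol X W \<Longrightarrow> g \<in> Hol X W \<Longrightarrow> (\<lambda>x. f x + g x) \<in> Hol X W"
    and Hol_mult: "f \<in> Hol X W \<Longrightarrow> g \<in> Hol X W \<Longrightarrow> (\<lambda>x. f x * g x) \<in> Hol X W"
    and Hol_open: "openin (Top X) W \<Longrightarrow> h \<in> Hol X W \<Longrightarrow> open V \<Longrightarrow>
      openin (Top X) {x \<in> W. h x \<in> V}"
begin

lemma Hol_sum:
  assumes "\<And>i. i \<in> I \<Longrightarrow> f i \<in> Hol X W"
  shows "(\<lambda>x. \<Sum>i\<in>I. f i x) \<in> Hol X W"
  using assms
  by (induction I rule: infinite_finite_induct) (auto intro: Hol_const Hol_add)

lemma Hol_diff: "f \<in> Hol X W \<Longrightarrow> g \<in> Hol X W \<Longrightarrow> (\<lambda>x. f x - g x) \<in> Hol X W"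
  using Hol_add[OF _ Hol_mult[OF Hol_const[of "-1"], of g]] by simp

lemma Hol_scaleR: "f \<in> Hol X W \<Longrightarrow> (\<lambda>x. r *\<^sub>R f x) \<in> Hol X W"
  using Hol_mult[OF Hol_const[of "of_real r"]] by (simp add: scaleR_conv_of_real)

lemma Hol_near_finite:
  assumes N: "openin (Top X) N" "x \<in> N" and I: "finite I"
    and f: "\<And>i. i \<in> I \<Longrightarrow> f i \<in> Hol X N" and e: "0 < e"
  obtains N' where "openin (Top X) N'" "x \<in> N'" "N' \<subseteq> N"
    "\<And>u i. u \<in> N' \<Longrightarrow> i \<in> I \<Longrightarrow> norm (f i u - f i x) < e"
proof -
  \<comment> \<open>Intersecting with \<open>N\<close> also covers the empty index set.\<close>
  have "openin (Top X) (N \<inter> \<Inter>((\<lambda>i. {u \<in> N. f i u \<in> ball (f i x) e}) ` I))"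
  proof (cases "I = {}")
    case False
    then show ?thesis
      by (intro openin_Int N openin_Inter finite_imageI I) (auto intro!: Hol_open f N simp del: mem_ball)
  qed (use N in auto)
  then show ?thesis
    by (rule that) (use N e in \<open>auto simp: dist_norm norm_minus_commute\<close>)
qed

text \<open>The sheaf controls scalar functions only. The norm of a vector is at most the sum of the
  norms of its coordinates, so each coordinate gets the share \<open>e / CARD('n)\<close>.\<close>

lemma Hol_near_vec:
  fixes \<sigma> :: "'a \<Rightarrow> complex^'n"
  assumes N: "openin (Top X) N" "x \<in> N" and \<sigma>: "\<And>j. (\<lambda>u. \<sigma> u $ j) \<in> Hol X N" and e: "0 < e"
  obtains N' where "openin (Top X) N'" "x \<in> N'" "N' \<subseteq> N" "\<And>u. u \<in> N' \<Longrightarrow> norm (\<sigma> u - \<sigma> x) < e"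
proof -
  obtain N' where N': "openin (Top X) N'" "x \<in> N'" "N' \<subseteq> N"
    and *: "\<And>u j. u \<in> N' \<Longrightarrow> j \<in> UNIV \<Longrightarrow> norm (\<sigma> u $ j - \<sigma> x $ j) < e / CARD('n)"
    by (rule Hol_near_finite[OF N, of UNIV "\<lambda>j u. \<sigma> u $ j" "e / CARD('n)"]) (use \<sigma> e in auto)
  have "norm (\<sigma> u - \<sigma> x) < e" if "u \<in> N'" for u
  proof -
    have "norm (\<sigma> u - \<sigma> x) \<le> (\<Sum>j\<in>UNIV. norm ((\<sigma> u - \<sigma> x) $ j))" by (rule norm_vec_le_sum)
    also have "\<dots> < (\<Sum>j\<in>(UNIV::'n set). e / CARD('n))"
      by (rule sum_strict_mono) (use *[OF that] in auto)
    finally show ?thesis by simp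
  qed
  with N' that show ?thesis by blast
qed

lemma Hol_matrix_open:
  fixes P :: "'a \<Rightarrow> complex^'n^'m"
  assumes N: "openin (Top X) N" and P: "\<And>i j. (\<lambda>u. P u $ i $ j) \<in> Hol X N" and V: "open V"
  shows "openin (Top X) {u \<in> N. P u \<in> V}"
proof (subst openin_subopen, intro ballI)
  fix x assume x: "x \<in> {u \<in> N. P u \<in> V}"
  then obtain e where e: "0 < e" "ball (P x) e \<subseteq> V" using V open_contains_ball by blast
  define k where "k = e / (CARD('m) * CARD('n))"
  have k: "0 < k" using e by (simp add: k_def)
  obtain N' where N': "openin (Top X) N'" "x \<in> N'" "N' \<subseteq> N"
    and *: "\<And>u p. u \<in> N' \<Longrightarrow> p \<in> UNIV \<Longrightarrow> norm (P u $ fst p $ snd p - P x $ fst p $ snd p) < k"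
    by (rule Hol_near_finite[OF N, of x UNIV "\<lambda>p u. P u $ fst p $ snd p" k]) (use P x k in auto)
  have "P u \<in> ball (P x) e" if "u \<in> N'" for u
  proof -
    have "norm (P u - P x) \<le> (\<Sum>i\<in>UNIV. \<Sum>j\<in>UNIV. norm ((P u - P x) $ i $ j))"
      by (rule norm_matrix_le_sum)
    also have "\<dots> < (\<Sum>i\<in>(UNIV::'m set). \<Sum>j\<in>(UNIV::'n set). k)"
      by (intro sum_strict_mono) (use *[OF that, of "(_, _)"] in auto)
    also have "\<dots> = e" by (simp add: k_def)
    finally show ?thesis by (simp add: dist_norm norm_minus_commute)
  qed
  with N' e x show "\<exists>T. openin (Top X) T \<and> x \<in> T \<and> T \<subseteq> {u \<in> N. P u \<in> V}"
    by blast
qed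

text \<open>
  Integral coordinates of a continuous section are continuous, hence locally constant.
\<close>

lemma homology_section_locally_constant:
  fixes b :: "'i::finite \<Rightarrow> 'a \<Rightarrow> complex^'n"
  assumes N: "openin (Top X) N" "x \<in> N"
    and L: "\<And>u y. u \<in> N \<Longrightarrow> y \<in> L u \<Longrightarrow> \<exists>n. y = (\<Sum>i\<in>UNIV. of_int (n i) *\<^sub>R b i u)"
    and b: "\<And>i j. (\<lambda>u. b i u $ j) \<in> Hol X N"
    and indep: "\<And>c. (\<Sum>i\<in>UNIV. c i *\<^sub>R b i x) = 0 \<Longrightarrow> \<forall>i. c i = 0"
    and \<sigma>: "homology_section X L x \<gamma> \<sigma>" and n: "\<gamma> = (\<Sum>i\<in>UNIV. of_int (n i) *\<^sub>R b i x)"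
  obtains N' where "openin (Top X) N'" "x \<in> N'" "N' \<subseteq> N"
    "\<And>u. u \<in> N' \<Longrightarrow> \<sigma> u = (\<Sum>i\<in>UNIV. of_int (n i) *\<^sub>R b i u)"
proof -
  obtain N1 where N1: "openin (Top X) N1" "x \<in> N1" "\<And>u. u \<in> N1 \<Longrightarrow> \<sigma> u \<in> L u"
    "\<And>j. (\<lambda>u. \<sigma> u $ j) \<in> Hol X N1" and \<sigma>x: "\<sigma> x = \<gamma>"
    using \<sigma> unfolding homology_section_def by blast
  \<comment> \<open>The frame at \<open>x\<close> is independent, so real combinations satisfy
    \<open>B * norm c \<le> norm (f c)\<close>. The constant \<open>k\<close> makes moving the frame
    from \<open>x\<close> to \<open>u\<close> cost at most \<open>B / 2 * norm c\<close>, and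
    \<open>\<delta>\<close> stays below \<open>B / 2\<close>; hence the integral difference
    \<open>c\<close> of the coordinates has norm below 1 and vanishes.\<close>
  define f where "f c = (\<Sum>i\<in>UNIV. (c $ i) *\<^sub>R b i x)" for c :: "real^'i"
  have f: "linear f"
    unfolding f_def by (rule linearI) (auto simp: sum.distrib algebra_simps scaleR_sum_right)
  moreover have "inj f"
    unfolding linear_injective_0[OF f] f_def using indep by (auto simp: vec_eq_iff)
  ultimately obtain B where B: "B > 0" "\<And>c. B * norm c \<le> norm (f c)"
    using linear_inj_bounded_below_pos by blast
  define k where "k = B / (2 * CARD('i))"
  have k: "k > 0" using B by (simp add: k_def)
  obtain N2 where N2: "openin (Top X) N2" "x \<in> N2" "N2 \<subseteq> N"
    and close: "\<And>i u. u \<in> N2 \<Longrightarrow> norm (b i u - b i x) \<le> k"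
  proof -
    have "\<forall>i. \<exists>N'. openin (Top X) N' \<and> x \<in> N' \<and> N' \<subseteq> N \<and> (\<forall>u\<in>N'. norm (b i u - b i x) < k)"
    proof
      fix i
      show "\<exists>N'. openin (Top X) N' \<and> x \<in> N' \<and> N' \<subseteq> N \<and> (\<forall>u\<in>N'. norm (b i u - b i x) < k)"
        by (rule Hol_near_vec[where \<sigma> = "b i", OF N b k]) blast
    qed
    from choice[OF this] obtain N' where N': "\<forall>i. openin (Top X) (N' i) \<and> x \<in> N' i \<and> N' i \<subseteq> N \<and>
      (\<forall>u\<in>N' i. norm (b i u - b i x) < k)" by blast
    show ?thesis
    proof (rule that[of "\<Inter>(range N')"])
      show "openin (Top X) (\<Inter>(range N'))" using N' by (intro openin_Inter) auto
      show "norm (b i u - b i x) \<le> k" if "u \<in> \<Inter>(range N')" for i u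
        using N' that by (meson INT_D UNIV_I less_imp_le)
      show "\<Inter>(range N') \<subseteq> N" using N' by blast
    qed (use N' in auto)
  qed
  define \<delta> where "\<delta> u = \<sigma> u - (\<Sum>i\<in>UNIV. of_int (n i) *\<^sub>R b i u)" for u
  have N12: "openin (Top X) (N1 \<inter> N2)" "x \<in> N1 \<inter> N2"
    using N1(1,2) N2(1,2) by auto
  have \<delta>_Hol: "(\<lambda>u. \<delta> u $ j) \<in> Hol X (N1 \<inter> N2)" for j
    unfolding \<delta>_def vector_minus_component sum_component vector_scaleR_component
    by (rule Hol_diff, rule Hol_subset[OF N1(4)], simp, rule Hol_sum, rule Hol_scaleR,
        rule Hol_subset[OF b]) (use N2(3) in blast)
  have "\<exists>N3. openin (Top X) N3 \<and> x \<in> N3 \<and> N3 \<subseteq> N1 \<inter> N2 \<and> (\<forall>u\<in>N3. norm (\<delta> u - \<delta> x) < B / 2)"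
    by (rule Hol_near_vec[where \<sigma> = \<delta> and e = "B / 2" and N = "N1 \<inter> N2" and x = x])
      (use N12 \<delta>_Hol B(1) in auto)
  then obtain N3 where N3: "openin (Top X) N3" "x \<in> N3" "N3 \<subseteq> N1 \<inter> N2"
    and N3_less: "\<forall>u\<in>N3. norm (\<delta> u - \<delta> x) < B / 2" by blast
  have \<delta>x: "\<delta> x = 0" by (simp add: \<delta>_def \<sigma>x n)
  have N3N: "N3 \<subseteq> N" by (rule order_trans[OF N3(3)]) (use N2(3) in blast)
  have \<sigma>_eq: "\<sigma> u = (\<Sum>i\<in>UNIV. of_int (n i) *\<^sub>R b i u)" if u: "u \<in> N3" for u
  proof -
    have uN: "u \<in> N" by (rule subsetD[OF N3N u])
    have "u \<in> N1" using subsetD[OF N3(3) u] by (rule IntD1)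
    then have "\<sigma> u \<in> L u" by (rule N1(3))
    then obtain m where m: "\<sigma> u = (\<Sum>i\<in>UNIV. of_int (m i) *\<^sub>R b i u)"
      using L[OF uN] by blast
    define c :: "real^'i" where "c = (\<chi> i. of_int (m i - n i))"
    have \<delta>u: "\<delta> u = (\<Sum>i\<in>UNIV. (c $ i) *\<^sub>R b i u)"
      by (simp add: \<delta>_def m c_def algebra_simps sum_subtractf)
    have "norm (f c - \<delta> u) = norm (\<Sum>i\<in>UNIV. (c $ i) *\<^sub>R (b i x - b i u))"
      by (simp add: f_def \<delta>u algebra_simps sum_subtractf)
    also have "\<dots> \<le> (\<Sum>i\<in>(UNIV::'i set). norm c * k)"
    proof (rule sum_norm_le)
      fix i
      have "norm (b i x - b i u) \<le> k" using close[of u i] u N3 by (auto simp: norm_minus_commute)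
      then show "norm ((c $ i) *\<^sub>R (b i x - b i u)) \<le> norm c * k"
        using component_le_norm_cart[of c i] by (auto intro!: mult_mono)
    qed
    also have "\<dots> = B / 2 * norm c" by (simp add: k_def)
    finally have "norm (f c - \<delta> u) \<le> B / 2 * norm c" .
    moreover have "B * norm c \<le> norm (f c)" by (rule B)
    moreover have "norm (f c) \<le> norm (f c - \<delta> u) + norm (\<delta> u)"
      using norm_triangle_ineq[of "f c - \<delta> u" "\<delta> u"] by simp
    moreover have "norm (\<delta> u) < B / 2" using N3_less u \<delta>x by simp
    ultimately have "B / 2 * norm c < B / 2 * 1" by simp
    then have c1: "norm c < 1" using B(1) by (simp only: mult_less_cancel_left_pos half_gt_zero)
    have "m i = n i" for i
    proof -
      have "\<bar>c $ i\<bar> < 1" using component_le_norm_cart[of c i] c1 by linarith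
      then show ?thesis unfolding c_def by (simp flip: of_int_diff)
    qed
    then show ?thesis using m by simp
  qed
  show ?thesis by (rule that[of N3]) (simp_all add: N3(1,2) N3N \<sigma>_eq)
qed

end

lemma hol_space_matrix_submanifold: "hol_space (matrix_submanifold (S :: (complex^'n^'m) set))"
proof
  fix h h' :: "complex^'n^'m \<Rightarrow> complex" and W
  assume h: "h \<in> Hol (matrix_submanifold S) W"
  show "h' \<in> Hol (matrix_submanifold S) W" if "\<And>x. x \<in> W \<Longrightarrow> h x = h' x"
    unfolding mem_Hol_matrix_submanifold
  proof
    fix A assume "A \<in> W"
    then obtain N H where "open N" "A \<in> N" "matrix_holomorphic_on H N" "\<forall>X\<in>N \<inter> W. H X = h X"
      using h unfolding mem_Hol_matrix_submanifold by blast
    then show "\<exists>N H. open N \<and> A \<in> N \<and> matrix_holomorphic_on H N \<and> (\<forall>X\<in>N \<inter> W. H X = h' X)"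
      using that by (intro exI[of _ N] exI[of _ H]) auto
  qed
  show "h \<in> Hol (matrix_submanifold S) W'" if W': "W' \<subseteq> W" for W'
  proof (rule Hol_matrix_submanifoldI)
    fix A assume "A \<in> W'"
    then have "A \<in> W" using W' by blast
    then obtain N H where "open N" "A \<in> N" "matrix_holomorphic_on H N" "\<forall>X\<in>N \<inter> W. H X = h X"
      using h unfolding mem_Hol_matrix_submanifold by blast
    then show "\<exists>N H. open N \<and> A \<in> N \<and> matrix_holomorphic_on H N \<and> (\<forall>X\<in>N \<inter> W'. H X = h X)"
      using W' by (intro exI[of _ N] exI[of _ H]) auto
  qed
next
  fix a and W :: "(complex^'n^'m) set"
  show "(\<lambda>_. a) \<in> Hol (matrix_submanifold S) W"
    by (rule matrix_holomorphic_on_imp_Hol[of _ UNIV]) (auto intro: matrix_holomorphic_intros)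
next
  fix f g :: "complex^'n^'m \<Rightarrow> complex" and W
  assume f: "f \<in> Hol (matrix_submanifold S) W" and g: "g \<in> Hol (matrix_submanifold S) W"
  have ex: "\<exists>N F G. open N \<and> A \<in> N \<and> matrix_holomorphic_on F N \<and> matrix_holomorphic_on G N \<and>
      (\<forall>X\<in>N \<inter> W. F X = f X \<and> G X = g X)" if "A \<in> W" for A
  proof -
    obtain N F where F: "open N" "A \<in> N" "matrix_holomorphic_on F N" "\<And>X. X \<in> N \<Longrightarrow> X \<in> W \<Longrightarrow> F X = f X"
      using Hol_matrix_submanifoldD[OF f \<open>A \<in> W\<close>] by metis
    obtain N' G where G: "open N'" "A \<in> N'" "matrix_holomorphic_on G N'" "\<And>X. X \<in> N' \<Longrightarrow> X \<in> W \<Longrightarrow> G X = g X"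
      using Hol_matrix_submanifoldD[OF g \<open>A \<in> W\<close>] by metis
    show ?thesis
      by (rule exI[of _ "N \<inter> N'"], rule exI[of _ F], rule exI[of _ G])
        (use F G in \<open>auto intro: matrix_holomorphic_on_subset\<close>)
  qed
  show "(\<lambda>x. f x + g x) \<in> Hol (matrix_submanifold S) W"
  proof (rule Hol_matrix_submanifoldI)
    fix A assume "A \<in> W"
    from ex[OF this] obtain N F G where "open N" "A \<in> N" "matrix_holomorphic_on F N"
      "matrix_holomorphic_on G N" "\<forall>X\<in>N \<inter> W. F X = f X \<and> G X = g X" by blast
    then show "\<exists>N H. open N \<and> A \<in> N \<and> matrix_holomorphic_on H N \<and> (\<forall>X\<in>N \<inter> W. H X = f X + g X)"
      by (intro exI[of _ N] exI[of _ "\<lambda>X. F X + G X"]) (auto intro: matrix_holomorphic_on_add)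
  qed
  show "(\<lambda>x. f x * g x) \<in> Hol (matrix_submanifold S) W"
  proof (rule Hol_matrix_submanifoldI)
    fix A assume "A \<in> W"
    from ex[OF this] obtain N F G where "open N" "A \<in> N" "matrix_holomorphic_on F N"
      "matrix_holomorphic_on G N" "\<forall>X\<in>N \<inter> W. F X = f X \<and> G X = g X" by blast
    then show "\<exists>N H. open N \<and> A \<in> N \<and> matrix_holomorphic_on H N \<and> (\<forall>X\<in>N \<inter> W. H X = f X * g X)"
      by (intro exI[of _ N] exI[of _ "\<lambda>X. F X * G X"]) (auto intro: matrix_holomorphic_on_mult)
  qed
next
  fix W h and V :: "complex set"
  assume W: "openin (Top (matrix_submanifold S)) W" and h: "h \<in> Hol (matrix_submanifold S) W" and V: "open V"
  show "openin (Top (matrix_submanifold S)) {x \<in> W. h x \<in> V}"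
  proof (subst openin_subopen, intro ballI)
    fix A assume A: "A \<in> {x \<in> W. h x \<in> V}"
    then obtain N H where H: "open N" "A \<in> N" "matrix_holomorphic_on H N" "\<And>X. X \<in> N \<Longrightarrow> X \<in> W \<Longrightarrow> H X = h X"
      using Hol_matrix_submanifoldD[OF h] by (metis (no_types, lifting) mem_Collect_eq)
    have "open (N \<inter> H -` V)"
      using matrix_holomorphic_on_imp_continuous_on[OF H(3)] H(1) V
      by (simp add: Int_commute continuous_on_open_vimage)
    then have "openin (Top (matrix_submanifold S)) (W \<inter> (N \<inter> H -` V))"
      using W by (auto intro: openin_Int_open)
    moreover have "A \<in> W \<inter> (N \<inter> H -` V)" using A H by auto
    moreover have "W \<inter> (N \<inter> H -` V) \<subseteq> {x \<in> W. h x \<in> V}" using H by auto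
    ultimately show "\<exists>T. openin (Top (matrix_submanifold S)) T \<and> A \<in> T \<and> T \<subseteq> {x \<in> W. h x \<in> V}"
      by blast
  qed
qed

text \<open>Each entry extends on a neighbourhood of its own; the finite intersection of these
  carries an extension of the whole matrix.\<close>

lemma Hol_matrix_submanifold_lift:
  fixes P :: "complex^'n^'m \<Rightarrow> complex^'p^'q"
  assumes P: "\<And>i j. (\<lambda>u. P u $ i $ j) \<in> Hol (matrix_submanifold S) W" and A: "A \<in> W"
  obtains N Q where "open N" "A \<in> N" "\<And>i j. matrix_holomorphic_on (\<lambda>u. Q u $ i $ j) N"
    "\<And>u. u \<in> N \<Longrightarrow> u \<in> W \<Longrightarrow> Q u = P u"
proof -
  have "\<forall>i j. \<exists>N H. open N \<and> A \<in> N \<and> matrix_holomorphic_on H N \<and> (\<forall>X\<in>N \<inter> W. H X = P X $ i $ j)"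
    using P A unfolding mem_Hol_matrix_submanifold by blast
  then obtain N H where NH: "\<And>i j. open (N i j)" "\<And>i j. A \<in> N i j" "\<And>i j. matrix_holomorphic_on (H i j) (N i j)"
    "\<And>i j X. X \<in> N i j \<Longrightarrow> X \<in> W \<Longrightarrow> H i j X = P X $ i $ j"
    by (metis IntI)
  let ?N = "\<Inter>i. \<Inter>j. N i j"
  show ?thesis
  proof (rule that[of ?N "\<lambda>u. \<chi> i j. H i j u"])
    show "open ?N" using NH by (intro open_INT ballI) auto
    show "matrix_holomorphic_on (\<lambda>u. (\<chi> i j. H i j u) $ i $ j) ?N" for i j
      using matrix_holomorphic_on_subset[OF NH(3)[of i j], of ?N] by auto
  qed (use NH in \<open>auto simp: vec_eq_iff\<close>)
qed

text \<open>Substituting an extension of \<open>P\<close> into an extension of \<open>h\<close>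
  extends the composition; it has the right values on \<open>W\<close> because \<open>P\<close> maps
  \<open>W\<close> into \<open>W'\<close>, where the extension of \<open>h\<close> can be
  trusted.\<close>

lemma Hol_matrix_submanifold_compose:
  fixes P :: "complex^'n^'m \<Rightarrow> complex^'p^'q"
  assumes P: "\<And>i j. (\<lambda>u. P u $ i $ j) \<in> Hol (matrix_submanifold S) W"
    and h: "h \<in> Hol (matrix_submanifold S') W'" and W: "P ` W \<subseteq> W'"
  shows "(\<lambda>u. h (P u)) \<in> Hol (matrix_submanifold S) W"
proof (rule Hol_matrix_submanifoldI)
  fix A assume A: "A \<in> W"
  obtain N Q where Q: "open N" "A \<in> N" "\<And>i j. matrix_holomorphic_on (\<lambda>u. Q u $ i $ j) N"
    "\<And>u. u \<in> N \<Longrightarrow> u \<in> W \<Longrightarrow> Q u = P u"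
    using Hol_matrix_submanifold_lift[of P S W A] P A by metis
  obtain N' H where H: "open N'" "P A \<in> N'" "matrix_holomorphic_on H N'"
    "\<And>X. X \<in> N' \<Longrightarrow> X \<in> W' \<Longrightarrow> H X = h X"
    by (rule Hol_matrix_submanifoldD[OF h, of "P A"]) (use A W that in auto)
  interpret M: hol_space "matrix_submanifold UNIV" by (rule hol_space_matrix_submanifold)
  have op: "open {u \<in> N. Q u \<in> N'}"
    using M.Hol_matrix_open[of N Q N'] Q H by (auto intro: matrix_holomorphic_on_imp_Hol)
  show "\<exists>N H. open N \<and> A \<in> N \<and> matrix_holomorphic_on H N \<and> (\<forall>X\<in>N \<inter> W. H X = h (P X))"
  proof (intro exI conjI ballI)
    show "matrix_holomorphic_on (\<lambda>X. H (Q X)) {u \<in> N. Q u \<in> N'}"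
      by (rule matrix_holomorphic_on_compose[OF H(3)]) (use Q in \<open>auto intro: matrix_holomorphic_on_subset\<close>)
  qed (use op Q H A W in auto)
qed

section \<open>Symplectic matrices\<close>

lemma sum_UNIV_sum: "(\<Sum>a\<in>(UNIV :: ('a::finite + 'b::finite) set). f a) = (\<Sum>i\<in>UNIV. f (Inl i)) + (\<Sum>i\<in>UNIV. f (Inr i))"
  using sum.Plus[of "UNIV :: 'a set" "UNIV :: 'b set" f] by simp

lemma all_sum: "(\<forall>a :: 'a + 'b. P a) \<longleftrightarrow> (\<forall>i. P (Inl i)) \<and> (\<forall>i. P (Inr i))"
  by (metis sum.exhaust)

lemma block_matrix_nth [simp]:
  "block_matrix A B C D $ Inl i $ Inl j = A $ i $ j"
  "block_matrix A B C D $ Inl i $ Inr j = B $ i $ j"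
  "block_matrix A B C D $ Inr i $ Inl j = C $ i $ j"
  "block_matrix A B C D $ Inr i $ Inr j = D $ i $ j"
  by (simp_all add: block_matrix_def)

definition block_11 :: "'a^('g + 'g)^('g + 'g) \<Rightarrow> 'a^'g^'g" where
  "block_11 M = (\<chi> i j. M $ Inl i $ Inl j)"
definition block_12 :: "'a^('g + 'g)^('g + 'g) \<Rightarrow> 'a^'g^'g" where
  "block_12 M = (\<chi> i j. M $ Inl i $ Inr j)"
definition block_21 :: "'a^('g + 'g)^('g + 'g) \<Rightarrow> 'a^'g^'g" where
  "block_21 M = (\<chi> i j. M $ Inr i $ Inl j)"
definition block_22 :: "'a^('g + 'g)^('g + 'g) \<Rightarrow> 'a^'g^'g" where
  "block_22 M = (\<chi> i j. M $ Inr i $ Inr j)"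

lemmas blocks_def = block_11_def block_12_def block_21_def block_22_def

lemma blocks_nth [simp]:
  "block_11 M $ i $ j = M $ Inl i $ Inl j" "block_12 M $ i $ j = M $ Inl i $ Inr j"
  "block_21 M $ i $ j = M $ Inr i $ Inl j" "block_22 M $ i $ j = M $ Inr i $ Inr j"
  by (simp_all add: blocks_def)

lemma block_matrix_blocks: "block_matrix (block_11 M) (block_12 M) (block_21 M) (block_22 M) = M"
  by (simp add: vec_eq_iff all_sum)

lemma blocks_block_matrix [simp]:
  "block_11 (block_matrix A B C D) = A" "block_12 (block_matrix A B C D) = B"
  "block_21 (block_matrix A B C D) = C" "block_22 (block_matrix A B C D) = D"
  by (simp_all add: vec_eq_iff)

lemma block_matrix_eq_iff:
  "block_matrix A B C D = block_matrix A' B' C' D' \<longleftrightarrow> A = A' \<and> B = B' \<and> C = C' \<and> D = D'"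
  by (metis blocks_block_matrix)

lemma block_matrix_mult:
  fixes A :: "'a::comm_semiring_1^'g^'g::finite"
  shows "block_matrix A B C D ** block_matrix A' B' C' D' =
    block_matrix (A ** A' + B ** C') (A ** B' + B ** D') (C ** A' + D ** C') (C ** B' + D ** D')"
  by (simp add: vec_eq_iff all_sum matrix_matrix_mult_def sum_UNIV_sum)

lemma transpose_block_matrix:
  "transpose (block_matrix A B C D) = block_matrix (transpose A) (transpose C) (transpose B) (transpose D)"
  by (simp add: vec_eq_iff all_sum transpose_def)

lemma block_matrix_1: "block_matrix (mat 1) 0 0 (mat 1) = mat 1"
  by (simp add: vec_eq_iff all_sum mat_def)

lemma matrix_mult_minus [simp]:
  fixes A :: "complex^'n^'m" and B :: "complex^'p^'n"
  shows "(- A) ** B = - (A ** B)" "A ** (- B) = - (A ** B)"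
  by (simp_all add: vec_eq_iff matrix_matrix_mult_def sum_negf)

lemma transpose_add [simp]: "transpose (A + B) = transpose A + transpose (B :: complex^'n^'m)"
  by (simp add: vec_eq_iff transpose_def)

lemma transpose_0 [simp]: "transpose (0 :: complex^'n^'m) = 0"
  by (simp add: vec_eq_iff transpose_def)

lemma matrix_mult_0 [simp]:
  "(0 :: complex^'n^'m) ** (B :: complex^'p^'n) = 0" "(A :: complex^'n^'m) ** (0 :: complex^'p^'n) = 0"
  by (simp_all add: vec_eq_iff matrix_matrix_mult_def)

lemma block_matrix_in_Sp_C_iff:
  "block_matrix A B C D \<in> Sp_C \<longleftrightarrow>
     A ** transpose B = B ** transpose A \<and> A ** transpose D - B ** transpose C = mat 1 \<and>
     C ** transpose B - D ** transpose A = - mat 1 \<and> C ** transpose D = D ** transpose C"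
proof -
  have "block_matrix A B C D ** J_matrix ** transpose (block_matrix A B C D) =
    block_matrix (A ** transpose B - B ** transpose A) (A ** transpose D - B ** transpose C)
     (C ** transpose B - D ** transpose A) (C ** transpose D - D ** transpose C)"
    by (simp add: J_matrix_def transpose_block_matrix block_matrix_mult block_matrix_eq_iff)
  then show ?thesis
    by (auto simp: Sp_C_def J_matrix_def block_matrix_eq_iff)
qed

lemma J_transpose: "transpose J_matrix = - J_matrix"
  by (simp add: J_matrix_def vec_eq_iff all_sum transpose_def mat_def)

lemma J_mult_J: "J_matrix ** J_matrix = - mat 1"
  unfolding J_matrix_def block_matrix_mult block_matrix_1[symmetric]
  by (simp add: vec_eq_iff all_sum)

lemma J_nth [simp]:
  "J_matrix $ Inl i $ Inl j = 0" "J_matrix $ Inr i $ Inr j = 0"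
  "J_matrix $ Inl i $ Inr j = (if i = j then 1 else 0)"
  "J_matrix $ Inr i $ Inl j = - (if i = j then 1 else 0)"
  by (simp_all add: J_matrix_def mat_def)

text \<open>The bilinear form with matrix \<open>J_matrix\<close>; no conjugation is
  involved.\<close>

definition sform :: "complex^('g::finite + 'g) \<Rightarrow> complex^('g + 'g) \<Rightarrow> complex" where
  "sform F G = (\<Sum>i\<in>UNIV. F $ Inl i * G $ Inr i - F $ Inr i * G $ Inl i)"

lemma sform_rows: "(M ** J_matrix ** transpose M) $ a $ b = sform (row a M) (row b M)"
proof -
  have "(M ** J_matrix) $ a $ c = (case c of Inl i \<Rightarrow> - M $ a $ Inr i | Inr i \<Rightarrow> M $ a $ Inl i)" for c
    by (cases c) (simp_all add: matrix_matrix_mult_def sum_UNIV_sum if_distrib[of "\<lambda>x. _ * x"] cong: if_cong,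
       simp add: sum_negf if_distrib[of uminus] if_distrib[of "\<lambda>x. _ * x"] cong: if_cong)
  then show ?thesis
    by (simp add: matrix_matrix_mult_def[of "M ** J_matrix"] sum_UNIV_sum transpose_def sform_def row_def
        sum_subtractf sum_negf)
qed

lemma Sp_C_iff_rows: "M \<in> Sp_C \<longleftrightarrow> (\<forall>a b. sform (row a M) (row b M) = J_matrix $ a $ b)"
  by (simp add: Sp_C_def vec_eq_iff sform_rows)

text \<open>The inverse of a symplectic matrix, from \<open>M J M^T = J\<close> and
  \<open>J^2 = -1\<close>. Unlike \<open>matrix_inv\<close>, this expression is visibly continuous
  and keeps entries integral.\<close>

definition sinv :: "complex^('g::finite + 'g)^('g + 'g) \<Rightarrow> complex^('g + 'g)^('g + 'g)" where
  "sinv M = - (J_matrix ** transpose M ** J_matrix)"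

lemma sinv_right: "M \<in> Sp_C \<Longrightarrow> M ** sinv M = mat 1"
  by (simp add: sinv_def Sp_C_def matrix_mul_assoc J_mult_J)

lemma sinv_left: "M \<in> Sp_C \<Longrightarrow> sinv M ** M = mat 1"
  using sinv_right matrix_left_right_inverse by blast

text \<open>\<open>sinv M\<close> is a left inverse as well; multiplying
  \<open>sinv M ** M = mat 1\<close> by \<open>J_matrix\<close> from the left gives
  \<open>M^T J M = J\<close>.\<close>

lemma transpose_in_Sp_C:
  assumes "M \<in> Sp_C" shows "transpose M \<in> Sp_C"
proof -
  have "J_matrix ** (sinv M ** M) = J_matrix" by (simp add: sinv_left assms)
  then have "transpose M ** J_matrix ** M = J_matrix"
    by (simp add: sinv_def matrix_mul_assoc J_mult_J)
  then show ?thesis by (simp add: Sp_C_def transpose_transpose)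
qed

text \<open>The definition of \<open>Sp_C\<close> is a condition on rows. Riemann's bilinear
  relations concern the columns, which are the period vectors of the forms; closure under
  transposition links the two.\<close>

lemma Sp_C_iff_columns: "M \<in> Sp_C \<longleftrightarrow> (\<forall>a b. sform (column a M) (column b M) = J_matrix $ a $ b)"
proof -
  have "row a (transpose M) = column a M" for a by (simp add: row_transpose)
  then show ?thesis
    using transpose_in_Sp_C[of M] transpose_in_Sp_C[of "transpose M"] Sp_C_iff_rows[of "transpose M"]
    by (auto simp: transpose_transpose)
qed

lemma mult_in_Sp_C:
  assumes "M \<in> Sp_C" "N \<in> Sp_C" shows "M ** N \<in> Sp_C"
proof -
  have "M ** N ** J_matrix ** transpose (M ** N) = M ** (N ** J_matrix ** transpose N) ** transpose M"
    by (simp add: matrix_transpose_mul matrix_mul_assoc)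
  then show ?thesis using assms by (simp add: Sp_C_def)
qed

lemma one_in_Sp_C: "mat 1 \<in> Sp_C"
  by (simp add: Sp_C_def)

lemma sinv_in_Sp_C:
  assumes "M \<in> Sp_C" shows "sinv M \<in> Sp_C"
proof -
  have J: "J_matrix \<in> Sp_C" by (simp add: Sp_C_def J_transpose J_mult_J flip: matrix_mul_assoc)
  have "sinv M = (- J_matrix) ** transpose M ** J_matrix" by (simp add: sinv_def)
  moreover have "- J_matrix \<in> Sp_C" using transpose_in_Sp_C[OF J] by (simp add: J_transpose)
  ultimately show ?thesis using J transpose_in_Sp_C[OF assms] mult_in_Sp_C by metis
qed

lemma Ints_matrix_mult:
  fixes M N :: "complex^'n^'n"
  assumes "\<And>i j. M $ i $ j \<in> \<int>" "\<And>i j. N $ i $ j \<in> \<int>"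
  shows "(M ** N) $ i $ j \<in> \<int>"
  using assms by (auto simp: matrix_matrix_mult_def intro!: Ints_sum)

lemma J_Ints: "J_matrix $ i $ j \<in> \<int>"
  by (cases i; cases j) auto

lemma mult_in_Sp_Z: "S \<in> Sp_Z \<Longrightarrow> T \<in> Sp_Z \<Longrightarrow> S ** T \<in> Sp_Z"
  by (auto simp: Sp_Z_def mult_in_Sp_C intro: Ints_matrix_mult)

lemma one_in_Sp_Z: "mat 1 \<in> Sp_Z"
proof -
  have "(mat 1 :: complex^('a + 'a)^('a + 'a)) $ i $ j \<in> \<int>" for i j by (simp add: mat_def)
  then show ?thesis using one_in_Sp_C by (simp add: Sp_Z_def)
qed

lemma sinv_in_Sp_Z: "S \<in> Sp_Z \<Longrightarrow> sinv S \<in> Sp_Z"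
  by (auto simp: Sp_Z_def sinv_in_Sp_C) (auto simp: sinv_def transpose_def intro!: Ints_matrix_mult J_Ints)

lemma Sp_Z_subset: "S \<in> Sp_Z \<Longrightarrow> S \<in> Sp_C"
  by (simp add: Sp_Z_def)

lemma mem_Sp_Z_class_self: "M \<in> Sp_Z_class M"
  unfolding Sp_Z_class_def using one_in_Sp_Z by (auto intro!: exI[of _ "mat 1"])

lemma Sp_Z_class_mult: "S \<in> Sp_Z \<Longrightarrow> Sp_Z_class (S ** M) = Sp_Z_class M"
proof -
  assume S: "S \<in> Sp_Z"
  have "T ** M = (T ** sinv S) ** (S ** M)" for T
    by (metis S Sp_Z_subset matrix_mul_assoc matrix_mul_rid sinv_left)
  moreover have "T ** (S ** M) = (T ** S) ** M" for T by (simp add: matrix_mul_assoc)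
  ultimately show ?thesis
    unfolding Sp_Z_class_def using mult_in_Sp_Z[OF _ S] mult_in_Sp_Z[OF _ sinv_in_Sp_Z[OF S]] by blast
qed

lemma Sp_Z_class_eq_iff: "Sp_Z_class M = Sp_Z_class N \<longleftrightarrow> (\<exists>S\<in>Sp_Z. N = S ** M)"
proof
  assume "Sp_Z_class M = Sp_Z_class N"
  then have "N \<in> Sp_Z_class M" using mem_Sp_Z_class_self by blast
  then show "\<exists>S\<in>Sp_Z. N = S ** M" by (auto simp: Sp_Z_class_def)
qed (use Sp_Z_class_mult in blast)

section \<open>Discreteness of the integral symplectic group\<close>

lemma continuous_on_matrix_mult [continuous_intros]:
  fixes A :: "'a::topological_space \<Rightarrow> complex^'n^'m" and B :: "'a \<Rightarrow> complex^'p^'n"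
  assumes "continuous_on S A" "continuous_on S B"
  shows "continuous_on S (\<lambda>x. A x ** B x)"
  unfolding matrix_matrix_mult_def by (intro continuous_intros assms)

lemma continuous_on_sinv [continuous_intros]:
  assumes "continuous_on S A" shows "continuous_on S (\<lambda>x. sinv (A x))"
  unfolding sinv_def transpose_def by (intro continuous_intros assms)

text \<open>\<open>S\<close> is recovered from the pair \<open>(M, S ** M)\<close> by a continuous
  expression with value 1 at \<open>(M0, M0)\<close>. Near that pair its entries are within distance
  less than 1 of those of the identity, and integers that close are equal. This makes the quotient
  map locally injective.\<close>

lemma Sp_Z_discrete:
  assumes "M0 \<in> Sp_C"
  obtains N where "open N" "M0 \<in> N"
    "\<And>M S. M \<in> N \<Longrightarrow> M \<in> Sp_C \<Longrightarrow> S \<in> Sp_Z \<Longrightarrow> S ** M \<in> N \<Longrightarrow> S = mat 1"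
proof -
  define V where "V = (\<Inter>a. \<Inter>b. (\<lambda>Z :: complex^('a + 'a)^('a + 'a). Z $ a $ b) -` ball (mat 1 $ a $ b) 1)"
  have "open V"
    unfolding V_def
    by (intro open_INT finite ballI open_vimage open_ball continuous_intros)
  define f where "f = (\<lambda>p :: (complex^('a + 'a)^('a + 'a)) \<times> (complex^('a + 'a)^('a + 'a)). snd p ** sinv (fst p))"
  have "continuous_on UNIV f" unfolding f_def by (intro continuous_intros)
  then have "open (f -` V)" using \<open>open V\<close> by (simp add: open_vimage)
  moreover have "(M0, M0) \<in> f -` V"
    using assms by (simp add: f_def V_def sinv_right)
  ultimately obtain A B where AB: "open A" "open B" "M0 \<in> A" "M0 \<in> B" "A \<times> B \<subseteq> f -` V"
    by (metis open_prod_elim mem_Sigma_iff)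
  show ?thesis
  proof (rule that[of "A \<inter> B"])
    fix M S assume M: "M \<in> A \<inter> B" "M \<in> Sp_C" and S: "S \<in> Sp_Z" "S ** M \<in> A \<inter> B"
    have "f (M, S ** M) = S" using M by (simp add: f_def sinv_right flip: matrix_mul_assoc)
    then have "S \<in> V" using AB M S by auto
    have "S $ a $ b = mat 1 $ a $ b" for a b
    proof -
      have "S $ a $ b \<in> \<int>" using S by (simp add: Sp_Z_def)
      then obtain n where n: "S $ a $ b = of_int n" by (auto elim: Ints_cases)
      define m :: int where "m = (if a = b then 1 else 0)"
      have "norm ((mat 1 :: complex^('a + 'a)^('a + 'a)) $ a $ b - S $ a $ b) < 1"
        using \<open>S \<in> V\<close> unfolding V_def by (auto simp: dist_norm)
      moreover have "(mat 1 :: complex^('a + 'a)^('a + 'a)) $ a $ b = of_int m"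
        by (simp add: mat_def m_def)
      ultimately have "norm (of_int m - of_int n :: complex) < 1" by (simp only: n)
      then have "\<bar>m - n\<bar> < 1"
        by (simp only: norm_of_int flip: of_int_diff)
      then show ?thesis by (simp add: n m_def mat_def split: if_splits)
    qed
    then show "S = mat 1" by (simp add: vec_eq_iff)
  qed (use AB in auto)
qed

section \<open>Positivity\<close>

text \<open>With \<open>y = D x\<close> and \<open>tau = B D^-1\<close> this is the imaginary part
  of the Hermitian expression of \<open>tau\<close> at \<open>y\<close>; written with
  \<open>B\<close> and \<open>D\<close> it makes sense before \<open>D\<close> is known to be
  invertible.\<close>

definition hpos_form :: "complex^('g::finite + 'g)^('g + 'g) \<Rightarrow> complex^'g \<Rightarrow> real" where
  "hpos_form M x = Im (\<Sum>i\<in>UNIV. cnj ((block_22 M *v x) $ i) * (block_12 M *v x) $ i)"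

definition hpos :: "complex^('g::finite + 'g)^('g + 'g) \<Rightarrow> bool" where
  "hpos M \<longleftrightarrow> (\<forall>x. x \<noteq> 0 \<longrightarrow> 0 < hpos_form M x)"

lemma continuous_on_hpos_form:
  "continuous_on UNIV (\<lambda>p :: (complex^('g::finite + 'g)^('g + 'g)) \<times> (complex^'g). hpos_form (fst p) (snd p))"
  unfolding hpos_form_def matrix_vector_mult_def blocks_def
  by (simp, intro continuous_intros)

lemma matrix_vector_mult_of_real:
  fixes A :: "complex^'n^'m"
  shows "A *v (r *\<^sub>R x) = r *\<^sub>R (A *v x)"
  by (simp add: vec_eq_iff matrix_vector_mult_def scaleR_sum_right)

lemma hpos_form_scale: "hpos_form M (r *\<^sub>R x) = r^2 * hpos_form M x"
  unfolding hpos_form_def matrix_vector_mult_of_real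
  by (simp add: power2_eq_square sum_distrib_left algebra_simps)

lemma hpos_iff_sphere: "hpos M \<longleftrightarrow> (\<forall>x\<in>sphere 0 1. 0 < hpos_form M x)"
proof
  assume *: "\<forall>x\<in>sphere 0 1. 0 < hpos_form M x"
  show "hpos M"
    unfolding hpos_def
  proof (intro allI impI)
    fix x :: "complex^'a" assume "x \<noteq> 0"
    then have "0 < hpos_form M ((1 / norm x) *\<^sub>R x)" using * by simp
    then show "0 < hpos_form M x" using \<open>x \<noteq> 0\<close> by (simp only: hpos_form_scale zero_less_mult_iff) auto
  qed
next
  assume "hpos M" then show "\<forall>x\<in>sphere 0 1. 0 < hpos_form M x"
    unfolding hpos_def by (metis dist_0_norm mem_sphere norm_zero zero_neq_one)
qed

text \<open>Positivity on the compact unit sphere persists in a neighbourhood of \<open>M\<close> by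
  the tube lemma; homogeneity of degree 2 extends it to all nonzero \<open>x\<close>.\<close>

lemma open_hpos: "open {M. hpos M}"
proof (subst open_subopen, intro ballI)
  fix M :: "complex^('a + 'a)^('a + 'a)" assume M: "M \<in> {M. hpos M}"
  let ?W = "(\<lambda>p :: (complex^('a + 'a)^('a + 'a)) \<times> (complex^'a). hpos_form (fst p) (snd p)) -` {0<..}"
  have "open ?W"
    by (intro open_vimage continuous_on_hpos_form) auto
  moreover have "{M} \<times> sphere 0 1 \<subseteq> ?W" using M by (auto simp: hpos_iff_sphere)
  ultimately obtain T where "M \<in> T" "open T" "T \<times> sphere 0 1 \<subseteq> ?W"
    using Elementary_Topology.tube_lemma[OF compact_sphere, of ?W M 0 1] by auto
  then show "\<exists>T. open T \<and> M \<in> T \<and> T \<subseteq> {M. hpos M}"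
    by (intro exI[of _ T]) (auto simp: hpos_iff_sphere)
qed

definition cnj_vec :: "complex^'n \<Rightarrow> complex^'n" where
  "cnj_vec v = (\<chi> i. cnj (v $ i))"

lemma cnj_vec_nth [simp]: "cnj_vec v $ i = cnj (v $ i)"
  by (simp add: cnj_vec_def)

text \<open>The combination with coefficients \<open>x\<close> of the right half of the columns of
  \<open>M\<close>, which in a period matrix are the period vectors of the omega divided by
  \<open>2 pi i\<close>.\<close>

definition right_columns :: "complex^('g::finite + 'g)^('g + 'g) \<Rightarrow> complex^'g \<Rightarrow> complex^('g + 'g)" where
  "right_columns M x = M *v (\<chi> a. case a of Inl i \<Rightarrow> 0 | Inr i \<Rightarrow> x $ i)"

lemma right_columns_nth:
  "right_columns M x $ Inl i = (block_12 M *v x) $ i" "right_columns M x $ Inr i = (block_22 M *v x) $ i"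
  by (simp_all add: right_columns_def matrix_vector_mult_def sum_UNIV_sum)

text \<open>The right-hand side is invariant under real symplectic matrices, hence positivity is, too.\<close>

lemma hpos_form_sform:
  "of_real (hpos_form M x) = sform (right_columns M x) (cnj_vec (right_columns M x)) / (2 * \<i>)"
proof -
  let ?z = "\<Sum>i\<in>UNIV. cnj ((block_22 M *v x) $ i) * (block_12 M *v x) $ i"
  have "sform (right_columns M x) (cnj_vec (right_columns M x)) = ?z - cnj ?z"
    by (simp add: sform_def right_columns_nth sum_subtractf mult.commute)
  also have "\<dots> = 2 * \<i> * of_real (Im ?z)"
    by (simp add: complex_eq_iff del: cnj_sum)
  finally show ?thesis by (simp add: hpos_form_def)
qed

lemma sform_eq_J: "sform F G = (\<Sum>a\<in>UNIV. F $ a * (J_matrix *v G) $ a)"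
  by (simp add: sform_def matrix_vector_mult_def sum_UNIV_sum sum_negf sum_subtractf
      if_distrib[of "\<lambda>x. x * _"] if_distrib[of uminus] cong: if_cong)

lemma sform_mult:
  assumes "S \<in> Sp_C" shows "sform (S *v F) (S *v G) = sform F G"
proof -
  have "transpose S ** J_matrix ** S = J_matrix"
    using transpose_in_Sp_C[OF assms] by (simp add: Sp_C_def transpose_transpose)
  then have JG: "J_matrix *v G = transpose S *v (J_matrix *v (S *v G))"
    by (simp add: matrix_vector_mul_assoc matrix_mul_assoc)
  have tS: "(transpose S *v v) $ a = (\<Sum>b\<in>UNIV. S $ b $ a * v $ b)" for v a
    by (simp add: matrix_vector_mult_def transpose_def)
  have "sform F G = (\<Sum>a\<in>UNIV. F $ a * (transpose S *v (J_matrix *v (S *v G))) $ a)"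
    unfolding sform_eq_J[of F G] by (subst JG) simp
  also have "\<dots> = (\<Sum>a\<in>UNIV. F $ a * (\<Sum>b\<in>UNIV. S $ b $ a * (J_matrix *v (S *v G)) $ b))"
    by (simp only: sform_eq_J tS)
  also have "\<dots> = (\<Sum>b\<in>UNIV. (\<Sum>a\<in>UNIV. S $ b $ a * F $ a) * (J_matrix *v (S *v G)) $ b)"
    unfolding sum_distrib_left sum_distrib_right by (subst sum.swap) (simp add: mult_ac)
  also have "\<dots> = sform (S *v F) (S *v G)"
    unfolding sform_eq_J[of "S *v F"] by (simp add: matrix_vector_mult_def[of S F])
  finally show ?thesis by simp
qed

text \<open>Integral entries are real, so \<open>S\<close> commutes with complex conjugation; this
  lets the invariance of the bilinear \<open>sform\<close> carry over to the Hermitian form.\<close>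

lemma hpos_mult_Sp_Z:
  assumes S: "S \<in> Sp_Z" and "hpos M" shows "hpos (S ** M)"
proof -
  have rc: "right_columns (S ** M) x = S *v right_columns M x" for x
    by (simp add: right_columns_def matrix_vector_mul_assoc)
  have "cnj (S $ i $ j) = S $ i $ j" for i j
  proof -
    have "S $ i $ j \<in> \<int>" using S by (simp add: Sp_Z_def)
    then show ?thesis by (auto elim: Ints_cases)
  qed
  then have "cnj_vec (S *v v) = S *v cnj_vec v" for v
    by (simp add: vec_eq_iff matrix_vector_mult_def)
  then have "of_real (hpos_form (S ** M) x) = (of_real (hpos_form M x) :: complex)" for x
    by (simp add: hpos_form_sform rc sform_mult Sp_Z_subset[OF S])
  then show ?thesis using assms by (simp add: hpos_def)
qed

text \<open>\<open>siegel_space\<close> tests \<open>Im tau\<close> on real vectors only. For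
  \<open>y = a + i b\<close> the terms with \<open>Re tau\<close> cancel by symmetry, and the
  expression becomes the sum of the values of \<open>Im tau\<close> at \<open>a\<close> and at
  \<open>b\<close>.\<close>

lemma siegel_space_hermitian:
  fixes \<tau> :: "complex^'g::finite^'g"
  assumes "\<tau> \<in> siegel_space" "y \<noteq> 0"
  shows "0 < Im (\<Sum>i\<in>UNIV. cnj (y $ i) * (\<tau> *v y) $ i)"
proof -
  let ?Y = "Im_matrix \<tau>"
  define a where "a = (\<chi> i. Re (y $ i))"
  define b where "b = (\<chi> i. Im (y $ i))"
  have sym: "\<tau> $ i $ j = \<tau> $ j $ i" for i j
    using assms(1) by (metis (mono_tags, lifting) mem_Collect_eq siegel_space_def transpose_def vec_lambda_beta)
  have pos: "0 < x \<bullet> (?Y *v x)" if "x \<noteq> 0" for x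
    using assms(1) that by (auto simp: siegel_space_def)
  have sw: "(\<Sum>i\<in>UNIV. \<Sum>j\<in>UNIV. a $ i * (Re (\<tau> $ i $ j) * b $ j)) = (\<Sum>i\<in>UNIV. \<Sum>j\<in>UNIV. b $ i * (Re (\<tau> $ i $ j) * a $ j))"
  proof -
    have "a $ j * (Re (\<tau> $ j $ i) * b $ i) = b $ i * (Re (\<tau> $ i $ j) * a $ j)" for i j
      by (simp add: sym[of j i])
    then show ?thesis by (subst sum.swap, intro sum.cong refl)
  qed
  have "Im (\<Sum>i\<in>UNIV. cnj (y $ i) * (\<tau> *v y) $ i) =
     (\<Sum>i\<in>UNIV. \<Sum>j\<in>UNIV. a $ i * (Re (\<tau> $ i $ j) * b $ j) + a $ i * (Im (\<tau> $ i $ j) * a $ j)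
       - b $ i * (Re (\<tau> $ i $ j) * a $ j) + b $ i * (Im (\<tau> $ i $ j) * b $ j))"
    by (simp add: matrix_vector_mult_def sum_distrib_left a_def b_def algebra_simps sum.distrib sum_subtractf)
  also have "\<dots> = a \<bullet> (?Y *v a) + b \<bullet> (?Y *v b)"
    unfolding sum.distrib sum_subtractf
    by (simp add: sw inner_vec_def matrix_vector_mult_def Im_matrix_def sum_distrib_left)
  finally have eq: "Im (\<Sum>i\<in>UNIV. cnj (y $ i) * (\<tau> *v y) $ i) = a \<bullet> (?Y *v a) + b \<bullet> (?Y *v b)" .
  have "a \<noteq> 0 \<or> b \<noteq> 0"
    using assms(2) by (auto simp: vec_eq_iff a_def b_def complex_eq_iff)
  moreover have "0 \<le> x \<bullet> (?Y *v x)" for x using pos[of x] by (cases "x = 0") auto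
  ultimately show ?thesis unfolding eq using pos by (smt (verit))
qed

section \<open>Block relations and the Siegel space\<close>

lemma matrix_inv:
  fixes D :: "complex^'n^'n"
  assumes "invertible D"
  shows "D ** matrix_inv D = mat 1" "matrix_inv D ** D = mat 1"
  using assms unfolding invertible_def matrix_inv_def by (metis (mono_tags, lifting) someI_ex)+

lemma Sp_C_block_relations:
  assumes "M \<in> Sp_C"
  shows "transpose (block_12 M) ** block_22 M = transpose (block_22 M) ** block_12 M"
    and "block_21 M ** transpose (block_22 M) = block_22 M ** transpose (block_21 M)"
    and "transpose (block_11 M) ** block_22 M - transpose (block_21 M) ** block_12 M = mat 1"
proof -
  have T: "block_matrix (transpose (block_11 M)) (transpose (block_21 M)) (transpose (block_12 M)) (transpose (block_22 M)) \<in> Sp_C"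
    using transpose_in_Sp_C[OF assms] by (metis block_matrix_blocks transpose_block_matrix)
  have M: "block_matrix (block_11 M) (block_12 M) (block_21 M) (block_22 M) \<in> Sp_C"
    using assms by (simp add: block_matrix_blocks)
  show "transpose (block_12 M) ** block_22 M = transpose (block_22 M) ** block_12 M"
    "transpose (block_11 M) ** block_22 M - transpose (block_21 M) ** block_12 M = mat 1"
    using T unfolding block_matrix_in_Sp_C_iff by (auto simp: transpose_transpose)
  show "block_21 M ** transpose (block_22 M) = block_22 M ** transpose (block_21 M)"
    using M unfolding block_matrix_in_Sp_C_iff by auto
qed

lemma transpose_matrix_inv:
  fixes D :: "complex^'n^'n"
  assumes "invertible D"
  shows "transpose D ** transpose (matrix_inv D) = mat 1" "transpose (matrix_inv D) ** transpose D = mat 1"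
  by (simp_all add: matrix_inv[OF assms] flip: matrix_transpose_mul)

text \<open>Each symmetry follows from a block relation, \<open>B^T D = D^T B\<close> or
  \<open>C D^T = D C^T\<close>, by cancelling \<open>D\<close> and its transpose on the two
  sides.\<close>

lemma Sp_C_symmetric:
  assumes M: "M \<in> Sp_C" and D: "invertible (block_22 M)"
  shows "transpose (block_12 M ** matrix_inv (block_22 M)) = block_12 M ** matrix_inv (block_22 M)"
    and "transpose (matrix_inv (block_22 M) ** block_21 M) = matrix_inv (block_22 M) ** block_21 M"
proof -
  let ?B = "block_12 M" and ?C = "block_21 M" and ?D = "block_22 M"
  have "transpose (?B ** matrix_inv ?D) = transpose (matrix_inv ?D) ** (transpose ?B ** ?D) ** matrix_inv ?D"
    by (simp add: matrix_transpose_mul matrix_inv[OF D] flip: matrix_mul_assoc)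
  also have "\<dots> = (transpose (matrix_inv ?D) ** transpose ?D) ** ?B ** matrix_inv ?D"
    by (simp add: Sp_C_block_relations[OF M] matrix_mul_assoc)
  finally show "transpose (?B ** matrix_inv ?D) = ?B ** matrix_inv ?D"
    by (simp add: transpose_matrix_inv[OF D])
  have "matrix_inv ?D ** ?C = matrix_inv ?D ** (?C ** transpose ?D) ** transpose (matrix_inv ?D)"
    by (simp add: transpose_matrix_inv[OF D] flip: matrix_mul_assoc)
  also have "\<dots> = (matrix_inv ?D ** ?D) ** transpose ?C ** transpose (matrix_inv ?D)"
    by (simp add: Sp_C_block_relations[OF M] matrix_mul_assoc)
  finally show "transpose (matrix_inv ?D ** ?C) = matrix_inv ?D ** ?C"
    by (simp add: matrix_inv[OF D] matrix_transpose_mul)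
qed

lemma hpos_imp_invertible:
  assumes "hpos M" shows "invertible (block_22 M)"
proof -
  have "x = 0" if "block_22 M *v x = 0" for x
  proof (rule ccontr)
    assume "x \<noteq> 0"
    then have "0 < hpos_form M x" using assms by (simp add: hpos_def)
    then show False by (simp add: hpos_form_def that)
  qed
  then show ?thesis by (simp add: invertible_left_inverse matrix_left_invertible_ker)
qed

definition tau_of :: "complex^('g::finite + 'g)^('g + 'g) \<Rightarrow> complex^'g^'g" where
  "tau_of M = block_12 M ** matrix_inv (block_22 M)"

lemma tau_of_mult: "invertible (block_22 M) \<Longrightarrow> tau_of M ** block_22 M = block_12 M"
  by (simp add: tau_of_def matrix_inv flip: matrix_mul_assoc)

text \<open>The substitution \<open>y = D x\<close> carries \<open>hpos_form\<close> to the
  Hermitian expression of \<open>tau_of M\<close>. In the converse direction invertibility of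
  \<open>D\<close> comes from positivity and symmetry of \<open>tau_of M\<close> from
  \<open>M\<close> being symplectic, so that only real \<open>y\<close> remain to be tested.\<close>

lemma siegel_space_iff_hpos:
  assumes M: "M \<in> Sp_C"
  shows "invertible (block_22 M) \<and> tau_of M \<in> siegel_space \<longleftrightarrow> hpos M"
proof
  assume *: "invertible (block_22 M) \<and> tau_of M \<in> siegel_space"
  show "hpos M"
    unfolding hpos_def
  proof (intro allI impI)
    fix x :: "complex^'a" assume x: "x \<noteq> 0"
    have "x = matrix_inv (block_22 M) *v (block_22 M *v x)"
      using * by (simp add: matrix_vector_mul_assoc matrix_inv)
    then have "block_22 M *v x \<noteq> 0" using x by (metis matrix_vector_mult_0_right)
    moreover have "block_12 M *v x = tau_of M *v (block_22 M *v x)"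
      using * by (simp add: matrix_vector_mul_assoc tau_of_mult)
    ultimately show "0 < hpos_form M x"
      unfolding hpos_form_def using siegel_space_hermitian * by metis
  qed
next
  assume hp: "hpos M"
  then have D: "invertible (block_22 M)" by (rule hpos_imp_invertible)
  have "0 < x \<bullet> (Im_matrix (tau_of M) *v x)" if x: "x \<noteq> 0" for x :: "real^'a"
  proof -
    define y :: "complex^'a" where "y = (\<chi> i. of_real (x $ i))"
    have y: "y \<noteq> 0" using x by (auto simp: y_def vec_eq_iff)
    define z where "z = matrix_inv (block_22 M) *v y"
    have Dz: "block_22 M *v z = y" using D by (simp add: z_def matrix_vector_mul_assoc matrix_inv)
    have Bz: "block_12 M *v z = tau_of M *v y" by (simp add: z_def tau_of_def matrix_vector_mul_assoc)
    have "z \<noteq> 0" using y Dz by auto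
    then have "0 < hpos_form M z" using hp by (simp add: hpos_def)
    also have "hpos_form M z = x \<bullet> (Im_matrix (tau_of M) *v x)"
      unfolding hpos_form_def Dz Bz
      by (simp add: inner_vec_def matrix_vector_mult_def y_def Im_matrix_def)
    finally show ?thesis .
  qed
  then show "invertible (block_22 M) \<and> tau_of M \<in> siegel_space"
    using D Sp_C_symmetric(1)[OF M D] by (simp add: siegel_space_def tau_of_def)
qed

text \<open>\<open>period_domain\<close> speaks of some representative of the orbit; invariance of
  \<open>hpos\<close> under \<open>Sp_Z\<close> makes membership a condition on every
  representative.\<close>

lemma Sp_Z_class_in_period_domain_iff:
  assumes M: "M \<in> Sp_C"
  shows "Sp_Z_class M \<in> period_domain \<longleftrightarrow> hpos M"
proof
  assume "hpos M"
  then have "invertible (block_22 M)" "block_12 M ** matrix_inv (block_22 M) \<in> siegel_space"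
    using siegel_space_iff_hpos[OF M] by (auto simp: tau_of_def)
  then show "Sp_Z_class M \<in> period_domain"
    unfolding period_domain_def using M block_matrix_blocks[of M] by (metis (mono_tags, lifting) mem_Collect_eq)
next
  assume "Sp_Z_class M \<in> period_domain"
  then obtain A B C D where N: "Sp_Z_class (block_matrix A B C D) = Sp_Z_class M"
    "block_matrix A B C D \<in> Sp_C" "invertible D" "B ** matrix_inv D \<in> siegel_space"
    by (auto simp: period_domain_def)
  then have "hpos (block_matrix A B C D)"
    using siegel_space_iff_hpos[OF N(2)] by (simp add: tau_of_def)
  then show "hpos M" using N(1) hpos_mult_Sp_Z unfolding Sp_Z_class_eq_iff by metis
qed

section \<open>A holomorphic retraction onto the symplectic group\<close>

text \<open>
  On the open cell where the lower right block \<open>D\<close> is invertible, a symplectic matrix is determined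
  by \<open>D\<close> and the symmetric matrices \<open>B D\<^sup>-\<^sup>1\<close> and \<open>D\<^sup>-\<^sup>1 C\<close>; symmetrizing the latter
  for an arbitrary matrix gives a holomorphic retraction onto the symplectic group.
\<close>

definition sym_part :: "complex^'g^'g \<Rightarrow> complex^'g^'g" where
  "sym_part A = (\<chi> i j. (A $ i $ j + A $ j $ i) / 2)"

lemma transpose_sym_part: "transpose (sym_part A) = sym_part A"
  by (simp add: vec_eq_iff sym_part_def transpose_def add.commute)

lemma sym_part_eq: "transpose A = A \<Longrightarrow> sym_part A = A"
  by (simp add: vec_eq_iff sym_part_def transpose_def)

definition Sp_retraction :: "complex^('g::finite + 'g)^('g + 'g) \<Rightarrow> complex^('g + 'g)^('g + 'g)" where
  "Sp_retraction X =
     (let D = block_22 X; T = sym_part (tau_of X); S = sym_part (matrix_inv D ** block_21 X)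
      in block_matrix (transpose (matrix_inv D) + T ** D ** S) (T ** D) (D ** S) D)"

text \<open>\<open>Sp_retraction X\<close> is an upper unipotent times a block diagonal times a
  lower unipotent matrix. The unipotent factors are symplectic because \<open>T\<close> and
  \<open>S\<close> are symmetric.\<close>

lemma Sp_retraction_in_Sp_C:
  assumes D: "invertible (block_22 X)" shows "Sp_retraction X \<in> Sp_C"
proof -
  define D where "D = block_22 X"
  define T where "T = sym_part (tau_of X)"
  define S where "S = sym_part (matrix_inv D ** block_21 X)"
  have "Sp_retraction X = block_matrix (mat 1) T 0 (mat 1) **
      (block_matrix (transpose (matrix_inv D)) 0 0 D ** block_matrix (mat 1) 0 S (mat 1))"
    by (simp add: Sp_retraction_def Let_def D_def T_def S_def block_matrix_mult block_matrix_eq_iff matrix_mul_assoc)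
  moreover have "block_matrix (mat 1) T 0 (mat 1) \<in> Sp_C"
    by (simp add: block_matrix_in_Sp_C_iff T_def transpose_sym_part)
  moreover have "block_matrix (mat 1) 0 S (mat 1) \<in> Sp_C"
    by (simp add: block_matrix_in_Sp_C_iff S_def transpose_sym_part)
  moreover have "block_matrix (transpose (matrix_inv D)) 0 0 D \<in> Sp_C"
    using D by (simp add: block_matrix_in_Sp_C_iff D_def transpose_matrix_inv matrix_inv transpose_transpose)
  ultimately show ?thesis using mult_in_Sp_C by metis
qed

text \<open>On symplectic matrices symmetrizing changes nothing. Only the upper left block needs an
  argument: the transpose of \<open>A^T D - C^T B = 1\<close> together with the symmetry of
  \<open>B D^-1\<close> gives \<open>A = D^-T + B D^-1 C\<close>.\<close>

lemma Sp_retraction_eq: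
  assumes M: "M \<in> Sp_C" and D: "invertible (block_22 M)" shows "Sp_retraction M = M"
proof -
  let ?A = "block_11 M" and ?B = "block_12 M" and ?C = "block_21 M" and ?D = "block_22 M"
  have "transpose ?A ** ?D = mat 1 + transpose ?C ** ?B"
    using Sp_C_block_relations(3)[OF M] by (simp add: algebra_simps)
  then have "transpose (transpose ?A ** ?D) = mat 1 + transpose ?B ** ?C"
    by (simp add: matrix_transpose_mul transpose_transpose)
  then have "transpose ?D ** ?A = mat 1 + transpose ?B ** ?C"
    by (simp add: matrix_transpose_mul transpose_transpose)
  then have "transpose (matrix_inv ?D) ** (transpose ?D ** ?A) = transpose (matrix_inv ?D) ** (mat 1 + transpose ?B ** ?C)"
    by simp
  then have "?A = transpose (matrix_inv ?D) + transpose (?B ** matrix_inv ?D) ** ?C"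
    by (simp add: matrix_mul_assoc transpose_matrix_inv[OF D] matrix_add_ldistrib matrix_transpose_mul)
  then have A: "?A = transpose (matrix_inv ?D) + tau_of M ** ?C"
    using Sp_C_symmetric(1)[OF M D] by (simp add: tau_of_def)
  have T: "sym_part (tau_of M) = tau_of M"
    by (rule sym_part_eq) (use Sp_C_symmetric(1)[OF M D] in \<open>simp add: tau_of_def\<close>)
  have S: "sym_part (matrix_inv ?D ** ?C) = matrix_inv ?D ** ?C"
    by (rule sym_part_eq) (rule Sp_C_symmetric(2)[OF M D])
  have DS: "?D ** (matrix_inv ?D ** ?C) = ?C"
    by (simp add: matrix_mul_assoc matrix_inv[OF D])
  have "Sp_retraction M = block_matrix ?A ?B ?C ?D"
    unfolding Sp_retraction_def Let_def T S
    by (simp add: tau_of_mult[OF D] block_matrix_eq_iff DS A flip: matrix_mul_assoc)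
      (simp add: matrix_mul_assoc tau_of_mult[OF D], simp add: tau_of_def matrix_mul_assoc)
  then show ?thesis by (simp add: block_matrix_blocks)
qed

lemma block_22_Sp_retraction [simp]: "block_22 (Sp_retraction X) = block_22 X"
  by (simp add: Sp_retraction_def Let_def)

lemma matrix_holomorphic_on_matrix_mult:
  fixes A :: "complex^'n^'m \<Rightarrow> complex^'q^'p" and B :: "complex^'n^'m \<Rightarrow> complex^'r^'q"
  assumes "\<And>i j. matrix_holomorphic_on (\<lambda>X. A X $ i $ j) U" "\<And>i j. matrix_holomorphic_on (\<lambda>X. B X $ i $ j) U"
  shows "matrix_holomorphic_on (\<lambda>X. (A X ** B X) $ i $ j) U"
  unfolding matrix_matrix_mult_def by (simp, intro matrix_holomorphic_intros assms)

lemma matrix_holomorphic_on_det: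
  fixes A :: "complex^'n^'m \<Rightarrow> complex^'p^'p"
  assumes "\<And>i j. matrix_holomorphic_on (\<lambda>X. A X $ i $ j) U"
  shows "matrix_holomorphic_on (\<lambda>X. det (A X)) U"
  unfolding det_def by (intro matrix_holomorphic_intros assms)

text \<open>Cramer's rule for the \<open>l\<close>-th column of the inverse; it exhibits the inverse
  as a quotient of polynomials in the entries, hence as holomorphic.\<close>

lemma matrix_inv_nth:
  fixes D :: "complex^'n^'n"
  assumes "det D \<noteq> 0"
  shows "matrix_inv D $ k $ l = det (\<chi> i j. if j = k then (if i = l then 1 else 0) else D $ i $ j) / det D"
proof -
  have D: "invertible D" using assms by (simp add: invertible_det_nz)
  let ?x = "matrix_inv D *v axis l 1"
  have "D *v ?x = axis l 1" by (simp add: matrix_vector_mul_assoc matrix_inv[OF D])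
  then have x: "?x = (\<chi> k. det (\<chi> i j. if j = k then axis l 1 $ i else D $ i $ j) / det D)"
    using cramer[OF assms] by blast
  have e: "?x $ k = matrix_inv D $ k $ l"
    by (simp add: matrix_vector_mult_def axis_def if_distrib cong: if_cong)
  show ?thesis unfolding e[symmetric] x by (simp add: axis_def cong: if_cong)
qed

lemma matrix_holomorphic_on_matrix_inv:
  fixes A :: "complex^'n^'m \<Rightarrow> complex^'p^'p"
  assumes "\<And>i j. matrix_holomorphic_on (\<lambda>X. A X $ i $ j) U" "\<And>X. X \<in> U \<Longrightarrow> det (A X) \<noteq> 0" "open U"
  shows "matrix_holomorphic_on (\<lambda>X. matrix_inv (A X) $ k $ l) U"
proof (rule matrix_holomorphic_on_cong[OF assms(3)])
  have "matrix_holomorphic_on (\<lambda>X. (\<chi> i j. if j = k then (if i = l then 1 else 0) else A X $ i $ j) $ i $ j) U" for i j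
    by (cases "j = k"; cases "i = l") (simp_all add: assms matrix_holomorphic_on_const)
  then show "matrix_holomorphic_on (\<lambda>X. det (\<chi> i j. if j = k then (if i = l then 1 else 0) else A X $ i $ j) / det (A X)) U"
    by (intro matrix_holomorphic_on_divide matrix_holomorphic_on_det assms)
qed (simp add: matrix_inv_nth assms)

text \<open>An open set of arbitrary matrices, the base of a test family; its symplectic members are
  exactly the positive ones.\<close>

definition Sp_cell :: "(complex^('g::finite + 'g)^('g + 'g)) set" where
  "Sp_cell = {X. det (block_22 X) \<noteq> 0 \<and> hpos (Sp_retraction X)}"

lemma matrix_holomorphic_on_tau_of:
  assumes "open U" "\<And>X. X \<in> U \<Longrightarrow> det (block_22 X) \<noteq> 0"
  shows "matrix_holomorphic_on (\<lambda>X. tau_of X $ i $ j) U"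
  unfolding tau_of_def
  by (intro matrix_holomorphic_on_matrix_mult matrix_holomorphic_on_matrix_inv assms)
    (auto intro: matrix_holomorphic_on_entry)

lemma matrix_holomorphic_on_Sp_retraction:
  assumes U: "open U" "\<And>X. X \<in> U \<Longrightarrow> det (block_22 X) \<noteq> 0"
  shows "matrix_holomorphic_on (\<lambda>X. Sp_retraction X $ a $ b) U"
proof -
  define T :: "complex^('a + 'a)^('a + 'a) \<Rightarrow> complex^'a^'a" where "T X = sym_part (tau_of X)" for X
  define S :: "complex^('a + 'a)^('a + 'a) \<Rightarrow> complex^'a^'a" where
    "S X = sym_part (matrix_inv (block_22 X) ** block_21 X)" for X
  define A :: "complex^('a + 'a)^('a + 'a) \<Rightarrow> complex^'a^'a" where
    "A X = transpose (matrix_inv (block_22 X)) + T X ** block_22 X ** S X" for X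
  have b: "matrix_holomorphic_on (\<lambda>X. block_22 X $ i $ j) U" "matrix_holomorphic_on (\<lambda>X. block_21 X $ i $ j) U" for i j
    by (auto intro: matrix_holomorphic_on_entry)
  have inv: "matrix_holomorphic_on (\<lambda>X. matrix_inv (block_22 X) $ i $ j) U" for i j
    by (intro matrix_holomorphic_on_matrix_inv b U)
  have T: "matrix_holomorphic_on (\<lambda>X. T X $ i $ j) U" for i j
    unfolding T_def sym_part_def
    by (simp, intro matrix_holomorphic_intros matrix_holomorphic_on_tau_of U) auto
  have S: "matrix_holomorphic_on (\<lambda>X. S X $ i $ j) U" for i j
    unfolding S_def sym_part_def
    by (simp, intro matrix_holomorphic_intros matrix_holomorphic_on_matrix_mult inv b) auto
  have A: "matrix_holomorphic_on (\<lambda>X. A X $ i $ j) U" for i j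
  proof -
    have "matrix_holomorphic_on (\<lambda>X. matrix_inv (block_22 X) $ j $ i + (T X ** block_22 X ** S X) $ i $ j) U"
      by (intro matrix_holomorphic_on_add matrix_holomorphic_on_matrix_mult inv b T S)
    then show ?thesis by (simp add: A_def transpose_def)
  qed
  have r: "Sp_retraction X = block_matrix (A X) (T X ** block_22 X) (block_22 X ** S X) (block_22 X)" for X
    by (simp add: Sp_retraction_def Let_def A_def S_def T_def)
  show ?thesis
    unfolding r
    by (cases a; cases b) (auto intro!: matrix_holomorphic_on_matrix_mult A b T S simp del: blocks_nth)
qed

lemma open_Sp_cell: "open (Sp_cell :: (complex^('g::finite + 'g)^('g + 'g)) set)"
proof -
  let ?U = "{X :: complex^('g + 'g)^('g + 'g). det (block_22 X) \<noteq> 0}"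
  interpret M: hol_space "matrix_submanifold (UNIV :: (complex^('g + 'g)^('g + 'g)) set)"
    by (rule hol_space_matrix_submanifold)
  have "matrix_holomorphic_on (\<lambda>X :: complex^('g + 'g)^('g + 'g). det (block_22 X)) UNIV"
    by (intro matrix_holomorphic_on_det) (auto intro: matrix_holomorphic_on_entry)
  then have "open ((\<lambda>X :: complex^('g + 'g)^('g + 'g). det (block_22 X)) -` (- {0}))"
    by (intro open_vimage matrix_holomorphic_on_imp_continuous_on) auto
  then have U: "open ?U" by (simp add: vimage_def)
  have "openin (Top (matrix_submanifold UNIV)) {X \<in> ?U. Sp_retraction X \<in> {M. hpos M}}"
    by (rule M.Hol_matrix_open)
      (use U in \<open>auto intro!: matrix_holomorphic_on_imp_Hol[OF _ U] matrix_holomorphic_on_Sp_retraction open_hpos\<close>)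
  moreover have "{X \<in> ?U. Sp_retraction X \<in> {M. hpos M}} = Sp_cell"
    by (auto simp: Sp_cell_def)
  ultimately show ?thesis by simp
qed

lemma Sp_cell_retraction:
  assumes "X \<in> Sp_cell" shows "Sp_retraction X \<in> Sp_C" "hpos (Sp_retraction X)"
  using assms by (auto simp: Sp_cell_def invertible_det_nz intro: Sp_retraction_in_Sp_C)

lemma Sp_C_hpos_in_cell: "M \<in> Sp_C \<Longrightarrow> hpos M \<Longrightarrow> M \<in> Sp_cell"
  using Sp_retraction_eq[of M] hpos_imp_invertible[of M] by (simp add: Sp_cell_def invertible_det_nz)

lemma matrix_holomorphic_on_cell_retraction: "matrix_holomorphic_on (\<lambda>X. Sp_retraction X $ a $ b) Sp_cell"
  by (rule matrix_holomorphic_on_Sp_retraction[OF open_Sp_cell]) (simp add: Sp_cell_def)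

section \<open>Lattices and symplectic bases\<close>

lemma complex_linear_functional_iff:
  "Vector_Spaces.linear (*s) (*) (a :: complex^'g \<Rightarrow> complex) \<longleftrightarrow>
    (\<forall>x y. a (x + y) = a x + a y) \<and> (\<forall>c x. a (c *s x) = c * a x)"
  unfolding Vector_Spaces.linear_def module_hom_def module_hom_axioms_def vector_space_def module_def
  by (auto simp: vec_eq_iff algebra_simps)

lemma complex_linear_map_iff:
  "Vector_Spaces.linear (*s) (*s) (f :: complex^'g \<Rightarrow> complex^'h) \<longleftrightarrow>
    (\<forall>x y. f (x + y) = f x + f y) \<and> (\<forall>c x. f (c *s x) = c *s f x)"
  unfolding Vector_Spaces.linear_def module_hom_def module_hom_axioms_def vector_space_def module_def
  by (auto simp: vec_eq_iff algebra_simps)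

lemma scaleR_vec_complex: "r *\<^sub>R (v :: complex^'g) = complex_of_real r *s v"
  by (simp add: vec_eq_iff scaleR_conv_of_real[symmetric])

definition skew_form :: "(complex^'g::finite \<Rightarrow> complex^'g \<Rightarrow> real) \<Rightarrow> bool" where
  "skew_form E \<longleftrightarrow> bilinear E \<and> (\<forall>v w. E v w = - E w v)"

lemma skew_form_swap: "skew_form E \<Longrightarrow> E v w = - E w v"
  unfolding skew_form_def by blast

lemma skew_form_bilinear: "skew_form E \<Longrightarrow> bilinear E"
  unfolding skew_form_def by blast

lemma skew_form_add:
  "skew_form E \<Longrightarrow> E (u + v) w = E u w + E v w" "skew_form E \<Longrightarrow> E w (u + v) = E w u + E w v"
  by (simp_all add: bilinear_ladd[OF skew_form_bilinear] bilinear_radd[OF skew_form_bilinear])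

lemma skew_form_scale:
  "skew_form E \<Longrightarrow> E (r *\<^sub>R v) w = r * E v w" "skew_form E \<Longrightarrow> E w (r *\<^sub>R v) = r * E w v"
  by (simp_all add: bilinear_lmul[OF skew_form_bilinear] bilinear_rmul[OF skew_form_bilinear])

lemma skew_form_diff:
  "skew_form E \<Longrightarrow> E (u - v) w = E u w - E v w" "skew_form E \<Longrightarrow> E w (u - v) = E w u - E w v"
  by (simp_all add: bilinear_lsub[OF skew_form_bilinear] bilinear_rsub[OF skew_form_bilinear])

lemma skew_form_sum:
  assumes "skew_form E"
  shows "E (\<Sum>i\<in>I. f i) w = (\<Sum>i\<in>I. E (f i) w)" "E w (\<Sum>i\<in>I. f i) = (\<Sum>i\<in>I. E w (f i))"
proof -
  have lin: "linear (E w)" "linear (\<lambda>x. E x w)"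
    using skew_form_bilinear[OF assms] by (auto simp: bilinear_def)
  show "E (\<Sum>i\<in>I. f i) w = (\<Sum>i\<in>I. E (f i) w)" by (rule linear_sum[OF lin(2)])
  show "E w (\<Sum>i\<in>I. f i) = (\<Sum>i\<in>I. E w (f i))" by (rule linear_sum[OF lin(1)])
qed

lemma skew_form_0: "skew_form E \<Longrightarrow> E 0 w = 0" "skew_form E \<Longrightarrow> E w 0 = 0"
  using skew_form_scale(1)[of E 0 0 w] skew_form_scale(2)[of E w 0 0] by simp_all

lemma polarization_hermitian:
  assumes "principal_polarization L E"
  obtains H where "pos_def_hermitian H" "\<And>v w. E v w = Im (H v w)"
proof -
  have "\<exists>H. pos_def_hermitian H \<and> (\<forall>v w. E v w = Im (H v w))"
    using assms unfolding principal_polarization_def by (rule conjunct1)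
  then obtain H where H: "pos_def_hermitian H" "\<forall>v w. E v w = Im (H v w)"
    by (elim exE conjE)
  show ?thesis by (rule that[OF H(1)]) (rule H(2)[rule_format])
qed

lemma pos_def_hermitian_linear:
  assumes "pos_def_hermitian H"
  shows "H v (x + y) = H v x + H v y" "H v (c *s x) = c * H v x"
    "H (x + y) v = H x v + H y v" "H (c *s x) v = cnj c * H x v"
proof -
  have lin: "H v (x + y) = H v x + H v y" "H v (c *s x) = c * H v x" for v x y c
    using assms unfolding pos_def_hermitian_def complex_linear_functional_iff by blast+
  have herm: "H w v = cnj (H v w)" for v w using assms unfolding pos_def_hermitian_def by blast
  show "H v (x + y) = H v x + H v y" "H v (c *s x) = c * H v x" by (rule lin)+
  show "H (x + y) v = H x v + H y v" "H (c *s x) v = cnj c * H x v"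
    by (simp_all only: herm[of "x + y" v] herm[of x v] herm[of y v] herm[of "c *s x" v] lin
        complex_cnj_add complex_cnj_mult)
qed

lemma Im_hermitian_skew_form:
  assumes H: "pos_def_hermitian H" and E: "\<And>v w. E v w = Im (H v w)"
  shows "skew_form E"
  unfolding skew_form_def bilinear_def
proof (intro conjI allI linearI)
  fix v w
  have "H v w = cnj (H w v)" using H unfolding pos_def_hermitian_def by blast
  then show "E v w = - E w v" by (simp add: E)
qed (simp_all add: E scaleR_vec_complex pos_def_hermitian_linear[OF H])

lemma polarization_skew_form: "principal_polarization L E \<Longrightarrow> skew_form E"
  using polarization_hermitian Im_hermitian_skew_form by metis

text \<open>No lattice occurs here, so that expansions with real coefficients can be separated from
  questions of integrality.\<close>

definition symplectic_relations ::
  "(complex^'g::finite \<Rightarrow> complex^'g \<Rightarrow> real) \<Rightarrow> ('g \<Rightarrow> complex^'g) \<Rightarrow> ('g \<Rightarrow> complex^'g) \<Rightarrow> bool" where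
  "symplectic_relations E \<gamma> \<delta> \<longleftrightarrow> skew_form E \<and>
     (\<forall>i j. E (\<gamma> i) (\<gamma> j) = 0 \<and> E (\<delta> i) (\<delta> j) = 0 \<and> E (\<gamma> i) (\<delta> j) = (if i = j then 1 else 0))"

lemma symplectic_relations_eqs:
  assumes "symplectic_relations E \<gamma> \<delta>"
  shows "E (\<gamma> i) (\<gamma> j) = 0" "E (\<delta> i) (\<delta> j) = 0" "E (\<gamma> i) (\<delta> j) = (if i = j then 1 else 0)"
    "E (\<delta> i) (\<gamma> j) = - (if i = j then 1 else 0)"
  using assms skew_form_swap[of E "\<delta> i" "\<gamma> j"] by (auto simp: symplectic_relations_def)

lemma symplectic_combination:
  assumes S: "symplectic_relations E \<gamma> \<delta>"
  shows "E (\<Sum>i\<in>UNIV. a i *\<^sub>R \<gamma> i + b i *\<^sub>R \<delta> i) (\<gamma> j) = - b j"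
    "E (\<Sum>i\<in>UNIV. a i *\<^sub>R \<gamma> i + b i *\<^sub>R \<delta> i) (\<delta> j) = a j"
proof -
  have E: "skew_form E" using S by (simp add: symplectic_relations_def)
  show "E (\<Sum>i\<in>UNIV. a i *\<^sub>R \<gamma> i + b i *\<^sub>R \<delta> i) (\<gamma> j) = - b j"
    "E (\<Sum>i\<in>UNIV. a i *\<^sub>R \<gamma> i + b i *\<^sub>R \<delta> i) (\<delta> j) = a j"
    by (simp_all add: skew_form_sum[OF E] skew_form_add[OF E] skew_form_scale[OF E] symplectic_relations_eqs[OF S]
        if_distrib[of "\<lambda>x. _ * x"] if_distrib[of uminus] cong: if_cong)
qed

text \<open>Pairing with the system recovers the coefficients of a combination, so the
  \<open>2g\<close> vectors are independent over the reals and by dimension form a real basis. The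
  coefficients of \<open>v\<close> are then read off by pairing.\<close>

lemma symplectic_expand:
  fixes \<gamma> :: "'g::finite \<Rightarrow> complex^'g"
  assumes S: "symplectic_relations E \<gamma> \<delta>"
  shows "v = (\<Sum>i\<in>UNIV. E v (\<delta> i) *\<^sub>R \<gamma> i + (- E v (\<gamma> i)) *\<^sub>R \<delta> i)"
proof -
  define f where "f c = (\<Sum>i\<in>UNIV. (c $ Inl i) *\<^sub>R \<gamma> i + (c $ Inr i) *\<^sub>R \<delta> i)" for c :: "real^('g + 'g)"
  have f: "linear f"
    by (rule linearI) (simp_all add: f_def algebra_simps sum.distrib scaleR_sum_right)
  have E: "skew_form E" using S by (simp add: symplectic_relations_def)
  have "inj f"
    unfolding linear_injective_0[OF f]
  proof (intro allI impI)
    fix c assume "f c = 0"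
    then have "E (f c) (\<gamma> j) = 0" "E (f c) (\<delta> j) = 0" for j by (simp_all add: skew_form_0[OF E])
    then have "c $ Inr j = 0" "c $ Inl j = 0" for j
      using symplectic_combination[OF S, of "\<lambda>i. c $ Inl i" "\<lambda>i. c $ Inr i" j] by (simp_all add: f_def)
    then show "c = 0" by (simp add: vec_eq_iff all_sum)
  qed
  then have "dim (range f) = dim (UNIV :: (real^('g + 'g)) set)"
    using dim_image_eq[OF f, of UNIV] by simp
  also have "\<dots> = DIM(complex^'g)"
    by (simp add: card_UNIV_sum)
  finally have "span (range f) = UNIV" using dim_eq_full by blast
  moreover have "span (range f) = range f"
    by (simp add: span_eq_iff linear_subspace_image[OF f])
  ultimately obtain c where c: "v = f c" by (metis UNIV_I imageE)
  then have "E v (\<delta> i) = c $ Inl i" "E v (\<gamma> i) = - c $ Inr i" for i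
    using symplectic_combination[OF S, of "\<lambda>i. c $ Inl i" "\<lambda>i. c $ Inr i" i] by (simp_all add: f_def)
  with c show ?thesis by (simp add: f_def)
qed

lemma symplectic_form_expand:
  assumes S: "symplectic_relations E \<gamma> \<delta>"
  shows "E u v = (\<Sum>i\<in>UNIV. E u (\<gamma> i) * E v (\<delta> i) - E u (\<delta> i) * E v (\<gamma> i))"
proof -
  have E: "skew_form E" using S by (simp add: symplectic_relations_def)
  have "E u v = E u (\<Sum>i\<in>UNIV. E v (\<delta> i) *\<^sub>R \<gamma> i + (- E v (\<gamma> i)) *\<^sub>R \<delta> i)"
    using symplectic_expand[OF S, of v] by simp
  also have "\<dots> = (\<Sum>i\<in>UNIV. E u (\<gamma> i) * E v (\<delta> i) - E u (\<delta> i) * E v (\<gamma> i))"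
    by (simp only: skew_form_sum[OF E] skew_form_add[OF E] skew_form_scale[OF E]) (simp add: algebra_simps)
  finally show ?thesis .
qed

lemma symplectic_independent:
  assumes S: "symplectic_relations E \<gamma> \<delta>" and 0: "(\<Sum>a\<in>UNIV. c a *\<^sub>R case_sum \<gamma> \<delta> a) = 0"
  shows "\<forall>a. c a = 0"
proof -
  have E: "skew_form E" using S by (simp add: symplectic_relations_def)
  have z: "(\<Sum>i\<in>UNIV. c (Inl i) *\<^sub>R \<gamma> i + c (Inr i) *\<^sub>R \<delta> i) = 0"
    using 0 by (simp add: sum_UNIV_sum sum.distrib)
  have "c (Inr j) = 0" "c (Inl j) = 0" for j
    using symplectic_combination[OF S, of "\<lambda>i. c (Inl i)" "\<lambda>i. c (Inr i)" j] by (simp_all add: z skew_form_0[OF E])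
  then show ?thesis by (simp add: all_sum)
qed

definition int_subgroup :: "(complex^'g) set \<Rightarrow> bool" where
  "int_subgroup L \<longleftrightarrow> 0 \<in> L \<and> (\<forall>x\<in>L. \<forall>y\<in>L. x - y \<in> L)"

lemma int_subgroup_closed:
  assumes "int_subgroup L"
  shows "0 \<in> L" "x \<in> L \<Longrightarrow> y \<in> L \<Longrightarrow> x - y \<in> L" "x \<in> L \<Longrightarrow> - x \<in> L" "x \<in> L \<Longrightarrow> y \<in> L \<Longrightarrow> x + y \<in> L"
proof -
  show 0: "0 \<in> L" and d: "x \<in> L \<Longrightarrow> y \<in> L \<Longrightarrow> x - y \<in> L" for x y using assms by (auto simp: int_subgroup_def)
  show m: "x \<in> L \<Longrightarrow> - x \<in> L" for x using d[OF 0, of x] by simp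
  show "x \<in> L \<Longrightarrow> y \<in> L \<Longrightarrow> x + y \<in> L" using d[OF _ m, of x y] by simp
qed

lemma int_subgroup_of_int:
  assumes "int_subgroup L" "x \<in> L" shows "of_int n *\<^sub>R x \<in> L"
proof -
  have nat: "real m *\<^sub>R x \<in> L" for m
    by (induction m) (use assms int_subgroup_closed in \<open>auto simp: algebra_simps\<close>)
  show ?thesis
  proof (cases n rule: int_cases2)
    case (nonneg m)
    then show ?thesis using nat[of m] by simp
  next
    case (nonpos m)
    then show ?thesis using int_subgroup_closed(3)[OF assms(1) nat[of m]] by simp
  qed
qed

lemma int_subgroup_sum:
  assumes "int_subgroup L" "\<And>i. i \<in> I \<Longrightarrow> f i \<in> L" shows "(\<Sum>i\<in>I. f i) \<in> L"
  using assms(2) by (induction I rule: infinite_finite_induct) (auto intro: int_subgroup_closed[OF assms(1)])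

lemma int_combinations_subgroup: "int_subgroup {\<Sum>i\<in>UNIV. of_int (n i) *\<^sub>R b i | n. True}"
  unfolding int_subgroup_def
proof (intro conjI ballI)
  show "0 \<in> {\<Sum>i\<in>UNIV. of_int (n i) *\<^sub>R b i | n. True}" by (auto intro!: exI[of _ "\<lambda>_. 0"])
  fix x y assume "x \<in> {\<Sum>i\<in>UNIV. of_int (n i) *\<^sub>R b i | n. True}" "y \<in> {\<Sum>i\<in>UNIV. of_int (n i) *\<^sub>R b i | n. True}"
  then obtain n m where "x = (\<Sum>i\<in>UNIV. of_int (n i) *\<^sub>R b i)" "y = (\<Sum>i\<in>UNIV. of_int (m i) *\<^sub>R b i)" by blast
  then have "x - y = (\<Sum>i\<in>UNIV. of_int (n i - m i) *\<^sub>R b i)" by (simp add: algebra_simps sum_subtractf)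
  then show "x - y \<in> {\<Sum>i\<in>UNIV. of_int (n i) *\<^sub>R b i | n. True}"
    by (auto intro!: exI[of _ "\<lambda>i. n i - m i"])
qed

lemma is_lattice_subgroup: "is_lattice L \<Longrightarrow> int_subgroup L"
proof -
  assume "is_lattice L"
  then obtain b :: "'a + 'a \<Rightarrow> complex^'a" where "L = {\<Sum>i\<in>UNIV. of_int (n i) *\<^sub>R b i | n. True}"
    unfolding is_lattice_def by blast
  then show ?thesis using int_combinations_subgroup[of b] by simp
qed

lemma symplectic_int_expand:
  assumes S: "symplectic_relations E \<gamma> \<delta>" and int: "\<And>x y. x \<in> L \<Longrightarrow> y \<in> L \<Longrightarrow> E x y \<in> \<int>"
    and L: "range \<gamma> \<subseteq> L" "range \<delta> \<subseteq> L" and x: "x \<in> L"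
  obtains n where "x = (\<Sum>a\<in>UNIV. of_int (n a) *\<^sub>R case_sum \<gamma> \<delta> a)"
    "\<And>i. E x (\<delta> i) = of_int (n (Inl i))" "\<And>i. E x (\<gamma> i) = - of_int (n (Inr i))"
proof -
  define n where "n a = (case a of Inl i \<Rightarrow> \<lfloor>E x (\<delta> i)\<rfloor> | Inr i \<Rightarrow> - \<lfloor>E x (\<gamma> i)\<rfloor>)" for a
  have n: "E x (\<delta> i) = of_int (n (Inl i))" "E x (\<gamma> i) = - of_int (n (Inr i))" for i
  proof -
    have "\<gamma> i \<in> L" "\<delta> i \<in> L" using L by blast+
    then show "E x (\<delta> i) = of_int (n (Inl i))" "E x (\<gamma> i) = - of_int (n (Inr i))"
      using int[OF x, of "\<delta> i"] int[OF x, of "\<gamma> i"] by (auto simp: n_def)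
  qed
  have "x = (\<Sum>i\<in>UNIV. E x (\<delta> i) *\<^sub>R \<gamma> i + (- E x (\<gamma> i)) *\<^sub>R \<delta> i)"
    by (rule symplectic_expand[OF S])
  also have "\<dots> = (\<Sum>a\<in>UNIV. of_int (n a) *\<^sub>R case_sum \<gamma> \<delta> a)"
    by (simp add: sum_UNIV_sum n sum.distrib)
  finally have e: "x = (\<Sum>a\<in>UNIV. of_int (n a) *\<^sub>R case_sum \<gamma> \<delta> a)" .
  show ?thesis by (rule that[of n], rule e, rule n(1), rule n(2))
qed

text \<open>The coefficients of a lattice vector are, up to sign, its pairings with the system,
  hence integers. So \<open>2g\<close> lattice vectors with the symplectic relations generate all of
  \<open>L\<close> and not just a subgroup of finite index.\<close>

lemma symplectic_lattice_basis:
  assumes S: "symplectic_relations E \<gamma> \<delta>" and int: "\<And>x y. x \<in> L \<Longrightarrow> y \<in> L \<Longrightarrow> E x y \<in> \<int>"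
    and L: "range \<gamma> \<subseteq> L" "range \<delta> \<subseteq> L"
  shows "lattice_basis L (case_sum \<gamma> \<delta>)"
  unfolding lattice_basis_def
proof (intro conjI ballI)
  show "range (case_sum \<gamma> \<delta>) \<subseteq> L" using L[THEN subsetD, OF rangeI] by (auto split: sum.splits)
  fix x assume x: "x \<in> L"
  obtain n where n: "x = (\<Sum>a\<in>UNIV. of_int (n a) *\<^sub>R case_sum \<gamma> \<delta> a)"
    by (rule symplectic_int_expand[OF S int L x]) (erule that | assumption)+
  show "\<exists>!n. x = (\<Sum>a\<in>UNIV. of_int (n a) *\<^sub>R case_sum \<gamma> \<delta> a)"
  proof (rule ex1I[of _ n])
    fix m assume "x = (\<Sum>a\<in>UNIV. of_int (m a) *\<^sub>R case_sum \<gamma> \<delta> a)"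
    then have "(\<Sum>a\<in>UNIV. (of_int (m a) - of_int (n a)) *\<^sub>R case_sum \<gamma> \<delta> a) = 0"
      using n by (simp add: scaleR_diff_left sum_subtractf)
    from symplectic_independent[OF S this] show "m = n" by auto
  qed (rule n)
qed

lemma polarization_int: "principal_polarization L E \<Longrightarrow> x \<in> L \<Longrightarrow> y \<in> L \<Longrightarrow> E x y \<in> \<int>"
  by (simp add: principal_polarization_def)

lemma integral_symplectic_basis_iff:
  assumes "principal_polarization L E"
  shows "integral_symplectic_basis L E \<gamma> \<delta> \<longleftrightarrow> symplectic_relations E \<gamma> \<delta> \<and> range \<gamma> \<subseteq> L \<and> range \<delta> \<subseteq> L"
proof
  assume "integral_symplectic_basis L E \<gamma> \<delta>"
  then have "range (case_sum \<gamma> \<delta>) \<subseteq> L" "symplectic_relations E \<gamma> \<delta>"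
    using polarization_skew_form[OF assms]
    by (auto simp: integral_symplectic_basis_def lattice_basis_def symplectic_relations_def)
  then show "symplectic_relations E \<gamma> \<delta> \<and> range \<gamma> \<subseteq> L \<and> range \<delta> \<subseteq> L"
    by (metis image_subset_iff rangeI subsetI sum.case(1) sum.case(2) image_iff)
next
  assume "symplectic_relations E \<gamma> \<delta> \<and> range \<gamma> \<subseteq> L \<and> range \<delta> \<subseteq> L"
  then show "integral_symplectic_basis L E \<gamma> \<delta>"
    using symplectic_lattice_basis[of E \<gamma> \<delta> L] polarization_int[OF assms]
    by (auto simp: integral_symplectic_basis_def symplectic_relations_def)
qed

section \<open>Existence of integral symplectic bases\<close>

text \<open>
  Extension step: an element of the orthogonal complement pairs with it in multiples of a minimal
  \<open>d\<close>, so by unimodularity its functional divided by \<open>d\<close> is represented by a lattice vector,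
  which forms a hyperbolic pair with a vector realizing \<open>d\<close>.
\<close>

lemma extend_symplectic_system:
  fixes \<gamma> \<delta> :: "'g::finite \<Rightarrow> complex^'g"
  assumes lat: "is_lattice L" and pp: "principal_polarization L E"
    and mem: "\<And>i. i \<in> A \<Longrightarrow> \<gamma> i \<in> L \<and> \<delta> i \<in> L"
    and rel: "\<And>i j. i \<in> A \<Longrightarrow> j \<in> A \<Longrightarrow> E (\<gamma> i) (\<gamma> j) = 0 \<and> E (\<delta> i) (\<delta> j) = 0 \<and>
      E (\<gamma> i) (\<delta> j) = (if i = j then 1 else 0)"
    and A: "A \<noteq> UNIV"
  obtains x y where "x \<in> L" "y \<in> L" "E x y = 1"
    "\<And>i. i \<in> A \<Longrightarrow> E x (\<gamma> i) = 0 \<and> E x (\<delta> i) = 0 \<and> E y (\<gamma> i) = 0 \<and> E y (\<delta> i) = 0"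
proof -
  have E: "skew_form E" by (rule polarization_skew_form[OF pp])
  have sg: "int_subgroup L" by (rule is_lattice_subgroup[OF lat])
  have int: "E x y \<in> \<int>" if "x \<in> L" "y \<in> L" for x y using polarization_int[OF pp that] .
  define P where "P = {x \<in> L. \<forall>i\<in>A. E x (\<gamma> i) = 0 \<and> E x (\<delta> i) = 0}"
  \<comment> \<open>The projection onto the span of the pairs already found, along their orthogonal
    complement. It preserves the lattice because the pairings are integers, so
    \<open>z - pr z\<close> lies in the lattice part \<open>P\<close> of the complement.\<close>
  define pr where "pr z = (\<Sum>i\<in>A. E z (\<delta> i) *\<^sub>R \<gamma> i - E z (\<gamma> i) *\<^sub>R \<delta> i)" for z
  have prL: "pr z \<in> L" if "z \<in> L" for z
  proof -
    have "r *\<^sub>R x \<in> L" if "r \<in> \<int>" "x \<in> L" for r x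
      using that int_subgroup_of_int[OF sg] by (auto elim!: Ints_cases)
    then show ?thesis
      unfolding pr_def using that mem int by (intro int_subgroup_sum[OF sg] int_subgroup_closed(2)[OF sg]) auto
  qed
  have pr_E: "E (pr z) (\<gamma> j) = E z (\<gamma> j)" "E (pr z) (\<delta> j) = E z (\<delta> j)" if "j \<in> A" for z j
  proof -
    have *: "E (pr z) w = (\<Sum>i\<in>A. E z (\<delta> i) * E (\<gamma> i) w - E z (\<gamma> i) * E (\<delta> i) w)" for w
      by (simp add: pr_def skew_form_sum[OF E] skew_form_diff[OF E] skew_form_scale[OF E])
    have "E (pr z) (\<gamma> j) = (\<Sum>i\<in>A. if j = i then E z (\<gamma> i) else 0)"
      unfolding * using rel that skew_form_swap[OF E] by (intro sum.cong refl) (smt (verit) mult_minus_right mult_cancel_left2 mult_zero_right)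
    then show "E (pr z) (\<gamma> j) = E z (\<gamma> j)" using that by (simp add: sum.delta)
    have "E (pr z) (\<delta> j) = (\<Sum>i\<in>A. if j = i then E z (\<delta> i) else 0)"
      unfolding * using rel that by (intro sum.cong refl) auto
    then show "E (pr z) (\<delta> j) = E z (\<delta> j)" using that by (simp add: sum.delta)
  qed
  have P: "z - pr z \<in> P" if "z \<in> L" for z
    using that prL pr_E int_subgroup_closed(2)[OF sg] by (auto simp: P_def skew_form_diff[OF E])
  \<comment> \<open>Otherwise \<open>L\<close> would lie in the span of at most
    \<open>2 * card A\<close> vectors, against its rank.\<close>
  have "\<exists>x\<in>P. x \<noteq> 0"
  proof (rule ccontr)
    assume "\<not> (\<exists>x\<in>P. x \<noteq> 0)"
    then have z: "z = pr z" if "z \<in> L" for z using P[OF that] by force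
    have "pr z \<in> span (\<gamma> ` A \<union> \<delta> ` A)" for z
      unfolding pr_def by (intro span_sum span_diff span_scale) (auto intro: span_base)
    then have sub: "L \<subseteq> span (\<gamma> ` A \<union> \<delta> ` A)" using z by (metis subsetI)
    obtain b :: "'g + 'g \<Rightarrow> complex^'g" where b: "inj b" "independent (range b)"
      "L = {\<Sum>i\<in>UNIV. of_int (n i) *\<^sub>R b i | n. True}"
      using lat unfolding is_lattice_def by blast
    have "b i \<in> L" for i
    proof -
      have "b i = (\<Sum>j\<in>UNIV. of_int (if j = i then 1 else 0) *\<^sub>R b j)"
        by (simp add: if_distrib[of of_int] if_distrib[of "\<lambda>x. x *\<^sub>R _"] cong: if_cong)
      then show ?thesis unfolding b(3) by (intro CollectI exI[of _ "\<lambda>j. if j = i then 1 else 0"]) simp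
    qed
    then have "range b \<subseteq> span (\<gamma> ` A \<union> \<delta> ` A)" using sub by auto
    then have "card (range b) \<le> card (\<gamma> ` A \<union> \<delta> ` A)"
      using independent_span_bound[OF _ b(2)] by auto
    also have "\<dots> \<le> card A + card A"
      by (meson add_mono card_Un_le card_image_le finite order_trans)
    also have "\<dots> < CARD('g) + CARD('g)"
      using psubset_card_mono[of UNIV A] A by fastforce
    finally show False by (simp add: card_image[OF b(1)] card_UNIV_sum)
  qed
  then obtain x where x: "x \<in> P" "x \<noteq> 0" by blast
  have xL: "x \<in> L" using x by (simp add: P_def)
  have x_pr: "E x (pr z) = 0" for z
    using x by (simp add: pr_def P_def skew_form_sum[OF E] skew_form_diff[OF E] skew_form_scale[OF E])
  have x_red: "E x z = E x (z - pr z)" for z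
    by (simp add: skew_form_diff[OF E] x_pr)
  have ex1: "\<exists>!\<gamma>. \<gamma> \<in> L \<and> (\<forall>x\<in>L. E \<gamma> x = of_int (f x))" if "\<forall>x\<in>L. \<forall>y\<in>L. f (x + y) = f x + f y" for f :: "complex^'g \<Rightarrow> int"
    using pp that unfolding principal_polarization_def by blast
  \<comment> \<open>Uniqueness in unimodularity: if \<open>x\<close> paired to zero with all of
    \<open>P\<close>, then \<open>x\<close> and \<open>0\<close> would both represent the zero
    functional.\<close>
  have "\<exists>y\<in>P. E x y \<noteq> 0"
  proof (rule ccontr)
    assume "\<not> (\<exists>y\<in>P. E x y \<noteq> 0)"
    then have x0: "\<forall>z\<in>L. E x z = of_int 0" using P x_red by (metis of_int_0)
    have z0: "\<forall>z\<in>L. E 0 z = of_int 0" by (simp add: skew_form_0[OF E])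
    have "\<exists>!y. y \<in> L \<and> (\<forall>z\<in>L. E y z = of_int 0)"
      by (rule ex1) simp
    then have "x = 0"
      using xL x0 int_subgroup_closed(1)[OF sg] z0 by (metis (no_types, lifting))
    then show False using x(2) by simp
  qed
  then obtain y where y: "y \<in> P" "E x y \<noteq> 0" by blast
  have PL: "z \<in> L" if "z \<in> P" for z using that by (simp add: P_def)
  have P_comb: "u - of_int n *\<^sub>R v \<in> P" if "u \<in> P" "v \<in> P" for u v n
    using that int_subgroup_closed(2)[OF sg] int_subgroup_of_int[OF sg]
    by (auto simp: P_def skew_form_diff[OF E] skew_form_scale[OF E])
  define Q where "Q n \<longleftrightarrow> 0 < n \<and> (\<exists>z\<in>P. E x z = of_nat n)" for n :: nat
  have "\<exists>n. Q n"
  proof -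
    obtain m where m: "E x y = of_int m" using int[OF xL PL[OF y(1)]] by (auto elim: Ints_cases)
    show ?thesis
    proof (cases "m > 0")
      case True
      then show ?thesis using y m by (intro exI[of _ "nat m"]) (auto simp: Q_def)
    next
      case False
      have "- y \<in> P" using y(1) int_subgroup_closed(3)[OF sg] skew_form_scale(1)[OF E, of "-1"] by (auto simp: P_def)
      moreover have "E x (- y) = of_nat (nat (- m))" using False m skew_form_scale(2)[OF E, of x "-1" y] by auto
      ultimately show ?thesis using False y m by (intro exI[of _ "nat (- m)"]) (auto simp: Q_def)
    qed
  qed
  define d where "d = (LEAST n. Q n)"
  have "Q d" unfolding d_def using \<open>\<exists>n. Q n\<close> LeastI_ex by metis
  then obtain y0 where d: "0 < d" and y0: "y0 \<in> P" "E x y0 = of_nat d" by (auto simp: Q_def)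
  \<comment> \<open>Euclidean division by \<open>d\<close>: the remainder of a value taken on
    \<open>P\<close> is again a value taken on \<open>P\<close>, so minimality of \<open>d\<close>
    makes it zero.\<close>
  have div: "\<exists>k. E x z = of_nat d * of_int k" if "z \<in> L" for z
  proof -
    have zP: "z - pr z \<in> P" by (rule P[OF that])
    obtain m where m: "E x (z - pr z) = of_int m" using int[OF xL PL[OF zP]] by (auto elim: Ints_cases)
    define u where "u = (z - pr z) - of_int (m div int d) *\<^sub>R y0"
    have "u \<in> P" unfolding u_def by (rule P_comb[OF zP y0(1)])
    have "E x u = of_int m - of_int (m div int d) * of_nat d"
      by (simp add: u_def skew_form_diff(2)[OF E, of x "z - pr z"] skew_form_scale[OF E] m y0)
    also have "\<dots> = of_int (m mod int d)"
      by (simp only: minus_div_mult_eq_mod[symmetric] of_int_diff of_int_mult of_int_of_nat_eq)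
    finally have Eu: "E x u = of_nat (nat (m mod int d))" using d by simp
    have "\<not> Q (nat (m mod int d))"
      using d by (intro not_less_Least[of _ Q, folded d_def]) (simp add: nat_less_iff)
    then have "m mod int d = 0" using Eu \<open>u \<in> P\<close> d
      by (metis Q_def not_gr_zero nat_eq_iff2 pos_mod_sign of_nat_0_less_iff nat_0_iff order_antisym)
    then have "m = int d * (m div int d)" by (metis mult_div_mod_eq add.right_neutral)
    then have "E x z = of_nat d * of_int (m div int d)"
      using m x_red[of z] by (metis of_int_mult of_int_of_nat_eq)
    then show ?thesis by blast
  qed
  \<comment> \<open>The functional of \<open>x\<close> divided by \<open>d\<close>. Its representing
    vector \<open>x'\<close> pairs to 1 with \<open>y0\<close> and stays orthogonal to the old pairs
    because \<open>x\<close> does.\<close>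
  define f where "f z = (SOME k. E x z = of_nat d * of_int k)" for z
  have f: "E x z = of_nat d * of_int (f z)" if "z \<in> L" for z
    unfolding f_def using div[OF that] by (rule someI_ex)
  have "\<forall>u\<in>L. \<forall>v\<in>L. f (u + v) = f u + f v"
  proof (intro ballI)
    fix u v assume "u \<in> L" "v \<in> L"
    then have "of_nat d * of_int (f (u + v)) = (of_nat d * of_int (f u + f v) :: real)"
      using f[of u] f[of v] f[of "u + v"] int_subgroup_closed(4)[OF sg]
      by (simp add: skew_form_add[OF E] algebra_simps)
    then show "f (u + v) = f u + f v" using d by simp
  qed
  from ex1[OF this] obtain x' where x': "x' \<in> L" "\<forall>z\<in>L. E x' z = of_int (f z)" by blast
  show ?thesis
  proof (rule that[of x' y0])
    show "x' \<in> L" "y0 \<in> L" using x' y0 PL by auto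
    show "E x' y0 = 1" using x'(2) f[OF PL[OF y0(1)]] y0 d PL by auto
    fix i assume i: "i \<in> A"
    have "of_nat d * of_int (f (\<gamma> i)) = (0 :: real)" "of_nat d * of_int (f (\<delta> i)) = (0 :: real)"
      using f[of "\<gamma> i"] f[of "\<delta> i"] mem[OF i] x(1) i by (simp_all add: P_def)
    then have "E x' (\<gamma> i) = 0" "E x' (\<delta> i) = 0" using x'(2) mem[OF i] d by auto
    then show "E x' (\<gamma> i) = 0 \<and> E x' (\<delta> i) = 0 \<and> E y0 (\<gamma> i) = 0 \<and> E y0 (\<delta> i) = 0"
      using y0 i by (simp add: P_def)
  qed
qed

text \<open>Induction on the set of indices already equipped with a hyperbolic pair; each new pair
  comes from the orthogonal complement of the previous ones.\<close>

lemma exists_integral_symplectic_basis: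
  fixes L :: "(complex^'g::finite) set"
  assumes lat: "is_lattice L" and pp: "principal_polarization L E"
  obtains \<gamma> \<delta> where "integral_symplectic_basis L E \<gamma> \<delta>"
proof -
  have E: "skew_form E" by (rule polarization_skew_form[OF pp])
  have E0: "E v v = 0" for v using skew_form_swap[OF E, of v v] by linarith
  have "\<exists>\<gamma> \<delta> :: 'g \<Rightarrow> complex^'g. (\<forall>i\<in>A. \<gamma> i \<in> L \<and> \<delta> i \<in> L) \<and> (\<forall>i\<in>A. \<forall>j\<in>A. E (\<gamma> i) (\<gamma> j) = 0 \<and> E (\<delta> i) (\<delta> j) = 0 \<and>
      E (\<gamma> i) (\<delta> j) = (if i = j then 1 else 0))" if "finite A" for A :: "'g set"
    using that
  proof (induction A rule: finite_induct)
    case (insert a A)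
    then obtain \<gamma> \<delta> :: "'g \<Rightarrow> complex^'g" where IH: "\<forall>i\<in>A. \<gamma> i \<in> L \<and> \<delta> i \<in> L"
      "\<forall>i\<in>A. \<forall>j\<in>A. E (\<gamma> i) (\<gamma> j) = 0 \<and> E (\<delta> i) (\<delta> j) = 0 \<and> E (\<gamma> i) (\<delta> j) = (if i = j then 1 else 0)" by blast
    obtain x y where xy: "x \<in> L" "y \<in> L" "E x y = 1"
      "\<And>i. i \<in> A \<Longrightarrow> E x (\<gamma> i) = 0 \<and> E x (\<delta> i) = 0 \<and> E y (\<gamma> i) = 0 \<and> E y (\<delta> i) = 0"
      by (rule extend_symplectic_system[OF lat pp, of A \<gamma> \<delta>]) (use IH insert.hyps in auto)
    have xy': "E (\<gamma> i) x = 0 \<and> E (\<delta> i) x = 0 \<and> E (\<gamma> i) y = 0 \<and> E (\<delta> i) y = 0" if "i \<in> A" for i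
      using xy(4)[OF that] skew_form_swap[OF E, of "\<gamma> i" x] skew_form_swap[OF E, of "\<delta> i" x]
        skew_form_swap[OF E, of "\<gamma> i" y] skew_form_swap[OF E, of "\<delta> i" y] by auto
    show ?case
      by (rule exI[of _ "\<gamma>(a := x)"], rule exI[of _ "\<delta>(a := y)"])
        (use IH xy xy' insert.hyps in \<open>auto simp: E0\<close>)
  qed simp
  from this[of UNIV] obtain \<gamma> \<delta> :: "'g \<Rightarrow> complex^'g" where "\<forall>i. \<gamma> i \<in> L \<and> \<delta> i \<in> L" "symplectic_relations E \<gamma> \<delta>"
    using E by (auto simp: symplectic_relations_def)
  then show ?thesis using that integral_symplectic_basis_iff[OF pp] by (metis image_subset_iff)
qed

section \<open>Period matrices\<close>

lemma additive_int_combination: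
  fixes f :: "complex^'g \<Rightarrow> 'r::ring_1"
  assumes sg: "int_subgroup L" and f: "\<And>x y. x \<in> L \<Longrightarrow> y \<in> L \<Longrightarrow> f (x + y) = f x + f y"
    and b: "\<And>a. a \<in> I \<Longrightarrow> b a \<in> L"
  shows "f (\<Sum>a\<in>I. of_int (n a) *\<^sub>R b a) = (\<Sum>a\<in>I. of_int (n a) * f (b a))"
proof -
  have 0: "f 0 = 0" using f[of 0 0] int_subgroup_closed(1)[OF sg] by simp
  have neg: "f (- x) = - f x" if "x \<in> L" for x
    using f[OF that int_subgroup_closed(3)[OF sg that]] 0 by (simp add: eq_neg_iff_add_eq_0 add.commute)
  have nat: "f (of_int (int k) *\<^sub>R x) = of_int (int k) * f x" if x: "x \<in> L" for k x
  proof (induction k)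
    case (Suc k)
    have "of_int (int (Suc k)) *\<^sub>R x = x + of_int (int k) *\<^sub>R x" by (simp add: algebra_simps)
    then show ?case
      using f[OF x int_subgroup_of_int[OF sg x, of "int k"]] Suc.IH by (simp add: algebra_simps)
  qed (simp add: 0)
  have int: "f (of_int k *\<^sub>R x) = of_int k * f x" if x: "x \<in> L" for k x
  proof (cases k rule: int_cases2)
    case (nonpos m)
    then show ?thesis using neg[OF int_subgroup_of_int[OF sg x, of "int m"]] nat[OF x, of m] by simp
  qed (use nat[OF x] in simp)
  show ?thesis
    using b
  proof (induction I rule: infinite_finite_induct)
    case (insert i I)
    have "(\<Sum>a\<in>I. of_int (n a) *\<^sub>R b a) \<in> L"
      using insert.prems by (intro int_subgroup_sum[OF sg] int_subgroup_of_int[OF sg]) auto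
    then show ?case
      using f[OF int_subgroup_of_int[OF sg, of "b i" "n i"]] insert int by simp
  qed (simp_all add: 0)
qed

lemma H1dR_additive: "f \<in> H1dR L \<Longrightarrow> x \<in> L \<Longrightarrow> y \<in> L \<Longrightarrow> f (x + y) = f x + f y"
  by (simp add: H1dR_def)

lemma H1dR_int_combination:
  assumes "int_subgroup L" "f \<in> H1dR L" "\<And>a. a \<in> I \<Longrightarrow> b a \<in> L"
  shows "f (\<Sum>a\<in>I. of_int (n a) *\<^sub>R b a) = (\<Sum>a\<in>I. of_int (n a) * f (b a))"
  by (rule additive_int_combination[OF assms(1)]) (use H1dR_additive assms in auto)

lemma H1dR_eqI:
  assumes sg: "int_subgroup L" and f: "f \<in> H1dR L" and g: "g \<in> H1dR L"
    and b: "lattice_basis L b" and eq: "\<And>a. f (b a) = g (b a)"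
  shows "f = g"
proof
  fix x
  show "f x = g x"
  proof (cases "x \<in> L")
    case True
    then obtain n where n: "x = (\<Sum>a\<in>UNIV. of_int (n a) *\<^sub>R b a)"
      using b unfolding lattice_basis_def by blast
    have bL: "b a \<in> L" for a using b unfolding lattice_basis_def by blast
    show ?thesis
      unfolding n H1dR_int_combination[OF sg f bL] H1dR_int_combination[OF sg g bL] eq ..
  qed (use f g in \<open>simp add: H1dR_def\<close>)
qed

lemma H1dR_zero: "(\<lambda>_. 0) \<in> H1dR L"
  by (simp add: H1dR_def)

lemma H1dR_axpy: "f \<in> H1dR L \<Longrightarrow> g \<in> H1dR L \<Longrightarrow> (\<lambda>x. a * f x + g x) \<in> H1dR L"
  by (simp add: H1dR_def algebra_simps)

lemma H1dR_sum: "finite I \<Longrightarrow> (\<And>i. i \<in> I \<Longrightarrow> F i \<in> H1dR L) \<Longrightarrow> (\<lambda>x. \<Sum>i\<in>I. c i * F i x) \<in> H1dR L"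
  by (induction I rule: finite_induct) (simp_all add: H1dR_zero H1dR_axpy)

lemma restrict0_H1dR:
  assumes "int_subgroup L" "\<And>x y. a (x + y) = a x + a y"
  shows "restrict0 L a \<in> H1dR L"
  using assms(2) int_subgroup_closed(4)[OF assms(1)] by (auto simp: H1dR_def restrict0_def)

lemma is_pairing_sum:
  assumes P: "is_pairing L E P" and "finite I" "\<And>i. i \<in> I \<Longrightarrow> F i \<in> H1dR L" and h: "h \<in> H1dR L"
  shows "P (\<lambda>x. \<Sum>i\<in>I. c i * F i x) h = (\<Sum>i\<in>I. c i * P (F i) h)"
    and "P h (\<lambda>x. \<Sum>i\<in>I. c i * F i x) = (\<Sum>i\<in>I. c i * P h (F i))"
proof -
  have lin: "P (\<lambda>x. a * f x + g x) h = a * P f h + P g h" "P h (\<lambda>x. a * f x + g x) = a * P h f + P h g"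
    if "f \<in> H1dR L" "g \<in> H1dR L" for f g a
    using P that h unfolding is_pairing_def by blast+
  have 0: "P (\<lambda>x. 0) h = 0" "P h (\<lambda>x. 0) = 0"
    using lin[OF H1dR_zero H1dR_zero, of "-1"] by simp_all
  show "P (\<lambda>x. \<Sum>i\<in>I. c i * F i x) h = (\<Sum>i\<in>I. c i * P (F i) h)"
    using assms(2,3)
  proof (induction I rule: finite_induct)
    case (insert i I)
    then show ?case using lin(1)[of "F i" "\<lambda>x. \<Sum>i\<in>I. c i * F i x" "c i"] H1dR_sum[of I F L c] by simp
  qed (simp add: 0)
  show "P h (\<lambda>x. \<Sum>i\<in>I. c i * F i x) = (\<Sum>i\<in>I. c i * P h (F i))"
    using assms(2,3)
  proof (induction I rule: finite_induct)
    case (insert i I)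
    then show ?case using lin(2)[of "F i" "\<lambda>x. \<Sum>i\<in>I. c i * F i x" "c i"] H1dR_sum[of I F L c] by simp
  qed (simp add: 0)
qed

text \<open>Rows of period matrices are indexed by \<open>\<delta>\<close> first.\<close>

definition periods :: "('g::finite \<Rightarrow> complex^'g) \<Rightarrow> ('g \<Rightarrow> complex^'g) \<Rightarrow> (complex^'g \<Rightarrow> complex) \<Rightarrow> complex^('g + 'g)" where
  "periods \<gamma> \<delta> f = (\<chi> a. f (case_sum \<delta> \<gamma> a))"

text \<open>The expression in periods satisfies \<open>is_pairing\<close> by the expansion of
  \<open>E\<close> in the symplectic basis. Every other such form agrees with it, because the
  functionals of the basis vectors span \<open>H1dR L\<close> over the complex numbers. The minus
  sign comes from listing \<open>\<delta>\<close> before \<open>\<gamma>\<close> in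
  \<open>periods\<close>.\<close>

lemma pairing_formula:
  assumes sg: "int_subgroup L" and pp: "principal_polarization L E" and sb: "integral_symplectic_basis L E \<gamma> \<delta>"
    and f: "f \<in> H1dR L" and g: "g \<in> H1dR L"
  shows "pairing L E f g = - sform (periods \<gamma> \<delta> f) (periods \<gamma> \<delta> g) / two_pi_i"
proof -
  have S: "symplectic_relations E \<gamma> \<delta>" and L: "range \<gamma> \<subseteq> L" "range \<delta> \<subseteq> L"
    using sb integral_symplectic_basis_iff[OF pp] by auto
  have mem: "\<gamma> i \<in> L" "\<delta> i \<in> L" for i using L by auto
  have E: "skew_form E" by (rule polarization_skew_form[OF pp])
  define P0 where "P0 f g = - sform (periods \<gamma> \<delta> f) (periods \<gamma> \<delta> g) / two_pi_i" for f g
  have P0: "is_pairing L E P0"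
    unfolding is_pairing_def
  proof (intro conjI ballI allI)
    fix x y assume "x \<in> L" "y \<in> L"
    have "P0 (restrict0 L (\<lambda>z. of_real (E x z))) (restrict0 L (\<lambda>z. of_real (E y z)))
      = of_real (\<Sum>i\<in>UNIV. E x (\<gamma> i) * E y (\<delta> i) - E x (\<delta> i) * E y (\<gamma> i)) / two_pi_i"
      by (simp add: P0_def sform_def periods_def restrict0_def mem sum_negf[symmetric])
    then show "P0 (restrict0 L (\<lambda>z. of_real (E x z))) (restrict0 L (\<lambda>z. of_real (E y z))) = of_real (E x y) / two_pi_i"
      using symplectic_form_expand[OF S, of x y] by simp
  qed (simp_all add: P0_def sform_def periods_def algebra_simps sum.distrib sum_subtractf sum_distrib_left
      add_divide_distrib diff_divide_distrib)
  define \<epsilon> where "\<epsilon> v = restrict0 L (\<lambda>z. of_real (E v z) :: complex)" for v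
  have \<epsilon>: "\<epsilon> v \<in> H1dR L" for v
    unfolding \<epsilon>_def by (rule restrict0_H1dR[OF sg]) (simp add: skew_form_add[OF E])
  \<comment> \<open>Coefficients of \<open>f\<close> in the functionals of the basis: that of
    \<open>\<gamma> i\<close> is \<open>f (\<delta> i)\<close> and that of \<open>\<delta> i\<close>
    is \<open>- f (\<gamma> i)\<close>.\<close>
  define c :: "(complex^'a \<Rightarrow> complex) \<Rightarrow> 'a + 'a \<Rightarrow> complex" where
    "c f a = (case a of Inl i \<Rightarrow> f (\<delta> i) | Inr i \<Rightarrow> - f (\<gamma> i))" for f a
  define F where "F a = \<epsilon> (case_sum \<gamma> \<delta> a)" for a
  have F: "F a \<in> H1dR L" for a by (simp add: F_def \<epsilon>)
  have expand: "f = (\<lambda>x. \<Sum>a\<in>UNIV. c f a * F a x)" if f: "f \<in> H1dR L" for f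
  proof (rule H1dR_eqI[OF sg f H1dR_sum[OF _ F], where b = "case_sum \<gamma> \<delta>"])
    show "lattice_basis L (case_sum \<gamma> \<delta>)" using sb by (simp add: integral_symplectic_basis_def)
    fix a
    show "f (case_sum \<gamma> \<delta> a) = (\<Sum>b\<in>UNIV. c f b * F b (case_sum \<gamma> \<delta> a))"
      by (cases a) (simp_all add: sum_UNIV_sum c_def F_def \<epsilon>_def restrict0_def mem symplectic_relations_eqs[OF S]
          if_distrib[of "\<lambda>x. _ * x"] if_distrib[of of_real] if_distrib[of uminus] cong: if_cong)
  qed simp
  have eq: "P f g = P0 f g" if P: "is_pairing L E P" for P
  proof -
    have Q: "Q f g = (\<Sum>a\<in>UNIV. c f a * (\<Sum>b\<in>UNIV. c g b * Q (F a) (F b)))" if Q: "is_pairing L E Q" for Q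
    proof -
      have "Q f g = Q (\<lambda>x. \<Sum>a\<in>UNIV. c f a * F a x) g" using expand[OF f] by simp
      also have "\<dots> = (\<Sum>a\<in>UNIV. c f a * Q (F a) g)" by (rule is_pairing_sum(1)[OF Q _ F g]) simp
      also have "\<dots> = (\<Sum>a\<in>UNIV. c f a * Q (F a) (\<lambda>x. \<Sum>a\<in>UNIV. c g a * F a x))" using expand[OF g] by simp
      finally show ?thesis by (simp add: is_pairing_sum(2)[OF Q _ F F])
    qed
    have memL: "case_sum \<gamma> \<delta> a \<in> L" for a using mem by (cases a) auto
    have QF: "Q (F a) (F b) = of_real (E (case_sum \<gamma> \<delta> a) (case_sum \<gamma> \<delta> b)) / two_pi_i" if "is_pairing L E Q" for Q a b
      using that memL[of a] memL[of b] unfolding is_pairing_def F_def \<epsilon>_def by blast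
    have "P (F a) (F b) = P0 (F a) (F b)" for a b by (simp add: QF[OF P] QF[OF P0])
    then show ?thesis using Q[OF P] Q[OF P0] by simp
  qed
  show ?thesis
    unfolding pairing_def
  proof (rule the_equality)
    show "\<forall>P. is_pairing L E P \<longrightarrow> P f g = - sform (periods \<gamma> \<delta> f) (periods \<gamma> \<delta> g) / two_pi_i"
      using eq by (simp add: P0_def)
    fix z assume "\<forall>P. is_pairing L E P \<longrightarrow> P f g = z"
    then show "z = - sform (periods \<gamma> \<delta> f) (periods \<gamma> \<delta> g) / two_pi_i"
      using P0 P0_def by metis
  qed
qed

lemma period_matrix_nth [simp]:
  "period_matrix t \<gamma> \<delta> $ a $ Inl j = et t j (case_sum \<delta> \<gamma> a)"
  "period_matrix t \<gamma> \<delta> $ a $ Inr j = om t j (case_sum \<delta> \<gamma> a) / two_pi_i"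
  by (cases a; simp add: period_matrix_def Let_def)+

lemma sform_swap: "sform F G = - sform G F"
  by (simp add: sform_def mult.commute flip: sum_negf)

lemma sform_scale: "sform (\<chi> a. F $ a / c) G = sform F G / c" "sform F (\<chi> a. G $ a / c) = sform F G / c"
  by (simp_all add: sform_def diff_divide_distrib sum_divide_distrib)

lemma two_pi_i_nonzero [simp]: "two_pi_i \<noteq> 0"
  by simp

text \<open>The columns of the period matrix are the period vectors of \<open>et\<close> and,
  divided by \<open>2 pi i\<close>, of \<open>om\<close>. The pairing carries the same factor and a
  sign, so that the relations of a symplectic-Hodge basis become the column form of
  \<open>Sp_C\<close>.\<close>

lemma period_matrix_in_Sp_C_iff:
  assumes sg: "int_subgroup (lat t)" and pp: "principal_polarization (lat t) (pol t)"
    and sb: "integral_symplectic_basis (lat t) (pol t) \<gamma> \<delta>"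
    and om: "\<And>i. om t i \<in> H1dR (lat t)" and et: "\<And>i. et t i \<in> H1dR (lat t)"
  shows "period_matrix t \<gamma> \<delta> \<in> Sp_C \<longleftrightarrow>
    (\<forall>i j. pairing (lat t) (pol t) (om t i) (om t j) = 0 \<and> pairing (lat t) (pol t) (et t i) (et t j) = 0 \<and>
       pairing (lat t) (pol t) (om t i) (et t j) = (if i = j then 1 else 0))"
proof -
  let ?p = "periods \<gamma> \<delta>" and ?c = two_pi_i
  have c0: "?c \<noteq> 0" by (rule two_pi_i_nonzero)
  have col: "column (Inl j) (period_matrix t \<gamma> \<delta>) = ?p (et t j)"
    "column (Inr j) (period_matrix t \<gamma> \<delta>) = (\<chi> a. ?p (om t j) $ a / ?c)" for j
    by (simp_all add: vec_eq_iff column_def periods_def)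
  have "period_matrix t \<gamma> \<delta> \<in> Sp_C \<longleftrightarrow>
    (\<forall>i j. sform (?p (et t i)) (?p (et t j)) = 0 \<and> sform (?p (om t i)) (?p (om t j)) = 0 \<and>
      sform (?p (et t i)) (?p (om t j)) / ?c = (if i = j then 1 else 0) \<and>
      sform (?p (om t i)) (?p (et t j)) / ?c = - (if i = j then 1 else 0))"
    unfolding Sp_C_iff_columns all_sum col sform_scale J_nth using c0 by auto
  also have "\<dots> \<longleftrightarrow> (\<forall>i j. sform (?p (et t i)) (?p (et t j)) = 0 \<and> sform (?p (om t i)) (?p (om t j)) = 0 \<and>
      sform (?p (om t i)) (?p (et t j)) / ?c = - (if i = j then 1 else 0))"
  proof -
    have sw: "sform (?p (et t i)) (?p (om t j)) / ?c = - (sform (?p (om t j)) (?p (et t i)) / ?c)" for i j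
      by (subst sform_swap) simp
    show ?thesis unfolding sw by (auto simp del: mult_eq_0_iff divide_eq_0_iff)
  qed
  also have "\<dots> \<longleftrightarrow> (\<forall>i j. pairing (lat t) (pol t) (om t i) (om t j) = 0 \<and> pairing (lat t) (pol t) (et t i) (et t j) = 0 \<and>
       pairing (lat t) (pol t) (om t i) (et t j) = (if i = j then 1 else 0))"
    unfolding pairing_formula[OF sg pp sb om om] pairing_formula[OF sg pp sb et et] pairing_formula[OF sg pp sb om et]
    using c0 by (auto simp: minus_equation_iff eq_commute[of _ "- _"])
  finally show ?thesis .
qed

lemma is_tripleD:
  assumes "is_triple t"
  shows "is_lattice (lat t)" "int_subgroup (lat t)" "principal_polarization (lat t) (pol t)"
    "om t i \<in> H1dR (lat t)" "et t i \<in> H1dR (lat t)" "om t i \<in> hodge_F1 (lat t)"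
proof -
  have h: "symplectic_hodge_basis (lat t) (pol t) (om t) (et t)" using assms unfolding is_triple_def by blast
  show "is_lattice (lat t)" "principal_polarization (lat t) (pol t)" using assms unfolding is_triple_def by blast+
  then show "int_subgroup (lat t)" by (intro is_lattice_subgroup)
  have "range (om t) \<subseteq> H1dR (lat t)" "range (et t) \<subseteq> H1dR (lat t)" "\<forall>i. om t i \<in> hodge_F1 (lat t)"
    using h by (simp_all add: symplectic_hodge_basis_def)
  then show "om t i \<in> H1dR (lat t)" "et t i \<in> H1dR (lat t)" "om t i \<in> hodge_F1 (lat t)" by auto
qed

lemma ex1_unique: "\<exists>!x. P x \<Longrightarrow> P a \<Longrightarrow> P b \<Longrightarrow> a = b"
  by blast

lemma is_triple_unique:
  assumes t: "is_triple t" and f: "f \<in> H1dR (lat t)"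
    and "f = (\<lambda>x. \<Sum>i\<in>UNIV. fst u i * om t i x + snd u i * et t i x)"
    and "f = (\<lambda>x. \<Sum>i\<in>UNIV. fst v i * om t i x + snd v i * et t i x)"
  shows "u = v"
proof -
  have "\<exists>!ac. f = (\<lambda>x. \<Sum>i\<in>UNIV. fst ac i * om t i x + snd ac i * et t i x)"
    using t f by (simp only: is_triple_def symplectic_hodge_basis_def)
  from ex1_unique[OF this assms(3,4)] show ?thesis .
qed

lemma period_matrix_in_Sp_C:
  assumes t: "is_triple t" and sb: "integral_symplectic_basis (lat t) (pol t) \<gamma> \<delta>"
  shows "period_matrix t \<gamma> \<delta> \<in> Sp_C"
  using period_matrix_in_Sp_C_iff[OF is_tripleD(2,3)[OF t] sb is_tripleD(4,5)[OF t]] t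
  by (simp add: is_triple_def symplectic_hodge_basis_def)

section \<open>Representation of functionals and Riemann's positivity\<close>

lemma pos_def_hermitian_pos: "pos_def_hermitian H \<Longrightarrow> v \<noteq> 0 \<Longrightarrow> 0 < Re (H v v)"
  unfolding pos_def_hermitian_def by blast

text \<open>Positive definiteness makes the Gram matrix \<open>h\<close> of the standard basis
  invertible, so the linear system for the representing vector has a solution. The solution is
  conjugated because \<open>H\<close> is antilinear in its first argument.\<close>

lemma hermitian_representation:
  fixes a :: "complex^'g::finite \<Rightarrow> complex"
  assumes H: "pos_def_hermitian H" and a: "Vector_Spaces.linear (*s) (*) a"
  obtains w where "\<And>v. a v = H w v"
proof -
  define h :: "complex^'g^'g" where "h = (\<chi> i j. H (axis i 1) (axis j 1))"
  have a0: "a 0 = 0"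
    using a by (metis complex_linear_functional_iff mult_zero_left vector_smult_lzero)
  have sumH: "H v (\<Sum>i\<in>I. f i) = (\<Sum>i\<in>I. H v (f i))" "H (\<Sum>i\<in>I. f i) v = (\<Sum>i\<in>I. H (f i) v)"
    "a (\<Sum>i\<in>I. f i) = (\<Sum>i\<in>I. a (f i))" if "finite I" for v I and f :: "'g \<Rightarrow> complex^'g"
    using that pos_def_hermitian_linear(2,4)[OF H, where c = 0] a a0
    by (induction I rule: finite_induct) (auto simp: pos_def_hermitian_linear[OF H] complex_linear_functional_iff)
  have ax: "v = (\<Sum>i\<in>UNIV. v $ i *s axis i 1)" for v :: "complex^'g"
    by (simp add: basis_expansion)
  have Hh: "H w v = (\<Sum>j\<in>UNIV. (\<Sum>i\<in>UNIV. cnj (w $ i) * h $ i $ j) * v $ j)" for v w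
  proof -
    have "H w v = H (\<Sum>i\<in>UNIV. w $ i *s axis i 1) (\<Sum>j\<in>UNIV. v $ j *s axis j 1)"
      by (simp only: ax[symmetric])
    also have "\<dots> = (\<Sum>j\<in>UNIV. \<Sum>i\<in>UNIV. v $ j * (cnj (w $ i) * h $ i $ j))"
      by (simp add: sumH pos_def_hermitian_linear[OF H] h_def sum_distrib_left)
    finally show ?thesis by (simp add: sum_distrib_left sum_distrib_right mult.commute)
  qed
  have "x = 0" if "transpose h *v x = 0" for x
  proof (rule ccontr)
    assume "x \<noteq> 0"
    define w where "w = cnj_vec x"
    have "(\<Sum>i\<in>UNIV. cnj (w $ i) * h $ i $ j) = 0" for j
      using arg_cong[OF that, of "\<lambda>v. v $ j"]
      by (simp add: w_def matrix_vector_mult_def transpose_def mult.commute)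
    then have "H w w = 0" by (simp add: Hh)
    moreover have "w \<noteq> 0" using \<open>x \<noteq> 0\<close> by (auto simp: w_def vec_eq_iff)
    ultimately show False using pos_def_hermitian_pos[OF H, of w] by simp
  qed
  then have "invertible (transpose h)"
    by (simp add: invertible_left_inverse matrix_left_invertible_ker)
  define x where "x = matrix_inv (transpose h) *v (\<chi> j. a (axis j 1))"
  have x: "transpose h *v x = (\<chi> j. a (axis j 1))"
    by (simp add: x_def matrix_vector_mul_assoc matrix_inv \<open>invertible (transpose h)\<close>)
  show ?thesis
  proof (rule that[of "cnj_vec x"])
    fix v
    have "H (cnj_vec x) v = (\<Sum>j\<in>UNIV. (transpose h *v x) $ j * v $ j)"
      by (simp add: Hh matrix_vector_mult_def transpose_def mult.commute)
    also have "\<dots> = (\<Sum>j\<in>UNIV. v $ j * a (axis j 1))" by (subst x) (simp add: mult.commute)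
    also have "\<dots> = a (\<Sum>j\<in>UNIV. v $ j *s axis j 1)"
      using a by (simp add: sumH complex_linear_functional_iff)
    finally show "a v = H (cnj_vec x) v" by (simp only: ax[symmetric])
  qed
qed

text \<open>
  Riemann's positivity: a nonzero functional is \<open>H(w, \<cdot>)\<close>, whose real and imaginary parts are
  \<open>- E(\<i>w, \<cdot>)\<close> and \<open>E(w, \<cdot>)\<close>, so that the form becomes \<open>E(w, \<i>w)\<close>.
\<close>

lemma riemann_positivity:
  assumes pp: "principal_polarization L E" and S: "symplectic_relations E \<gamma> \<delta>"
    and a: "Vector_Spaces.linear (*s) (*) a" and nz: "a v0 \<noteq> 0"
  shows "0 < Im (\<Sum>i\<in>UNIV. cnj (a (\<gamma> i)) * a (\<delta> i))"
proof -
  obtain H where H: "pos_def_hermitian H" "\<And>v w. E v w = Im (H v w)"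
    by (rule polarization_hermitian[OF pp]) (rule that)
  obtain w where w: "\<And>v. a v = H w v"
    by (rule hermitian_representation[OF H(1) a]) (rule that)
  have w0: "w \<noteq> 0"
  proof
    assume "w = 0"
    then have "a v0 = 0" using pos_def_hermitian_linear(4)[OF H(1), of 0 0 v0] by (simp add: w)
    then show False using nz by simp
  qed
  have re: "Re (a v) = - E (\<i> *s w) v" and im: "Im (a v) = E w v" for v
    by (simp_all add: w H(2) pos_def_hermitian_linear[OF H(1)])
  have "Im (\<Sum>i\<in>UNIV. cnj (a (\<gamma> i)) * a (\<delta> i)) = (\<Sum>i\<in>UNIV. E w (\<gamma> i) * E (\<i> *s w) (\<delta> i) - E w (\<delta> i) * E (\<i> *s w) (\<gamma> i))"
    by (simp add: re im algebra_simps)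
  also have "\<dots> = E w (\<i> *s w)"
    by (rule symplectic_form_expand[OF S, symmetric])
  also have "\<dots> = Re (H w w)"
    by (simp add: H(2) pos_def_hermitian_linear[OF H(1)])
  also have "\<dots> > 0" by (rule pos_def_hermitian_pos[OF H(1) w0])
  finally show ?thesis .
qed

text \<open>Riemann's positivity for the form with coefficients \<open>x\<close> in the omega. The
  constant \<open>4 * pi^2\<close> is the squared modulus of \<open>2 pi i\<close>, by which the
  right columns are normalized.\<close>

lemma period_matrix_hpos:
  assumes t: "is_triple t" and sb: "integral_symplectic_basis (lat t) (pol t) \<gamma> \<delta>"
  shows "hpos (period_matrix t \<gamma> \<delta>)"
  unfolding hpos_def
proof (intro allI impI)
  fix x :: "complex^'a" assume x: "x \<noteq> 0"
  have pp: "principal_polarization (lat t) (pol t)" by (rule is_tripleD[OF t])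
  have S: "symplectic_relations (pol t) \<gamma> \<delta>" and mem: "\<And>i. \<gamma> i \<in> lat t" "\<And>i. \<delta> i \<in> lat t"
    using sb integral_symplectic_basis_iff[OF pp] by auto
  have "\<forall>j. \<exists>a. om t j = restrict0 (lat t) a \<and> Vector_Spaces.linear (*s) (*) a"
    using is_tripleD(6)[OF t] by (auto simp: hodge_F1_def)
  then obtain a where a: "\<And>j. om t j = restrict0 (lat t) (a j)" "\<And>j. Vector_Spaces.linear (*s) (*) (a j)"
    by metis
  define A where "A v = (\<Sum>j\<in>UNIV. x $ j * a j v)" for v
  have A: "Vector_Spaces.linear (*s) (*) A"
    using a(2) by (simp add: complex_linear_functional_iff A_def algebra_simps sum.distrib sum_distrib_left)
  \<comment> \<open>If \<open>A\<close> vanished, \<open>x\<close> would give a second expansion of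
    the zero class in the basis besides the trivial one.\<close>
  have "\<exists>v. A v \<noteq> 0"
  proof (rule ccontr)
    assume "\<not> (\<exists>v. A v \<noteq> 0)"
    then have A0: "(\<Sum>j\<in>UNIV. x $ j * a j v) = 0" for v by (simp add: A_def)
    have "(\<Sum>j\<in>UNIV. x $ j * om t j v + 0 * et t j v) = 0" for v
      using A0[of v] by (cases "v \<in> lat t") (simp_all add: a(1) restrict0_def)
    define u v :: "('a \<Rightarrow> complex) \<times> ('a \<Rightarrow> complex)" where "u = (($) x, \<lambda>_. 0)" and "v = (\<lambda>_. 0, \<lambda>_. 0)"
    have "u = v"
      by (rule is_triple_unique[OF t H1dR_zero])
        (use \<open>\<And>v. (\<Sum>j\<in>UNIV. x $ j * om t j v + 0 * et t j v) = 0\<close> in \<open>simp_all add: u_def v_def fun_eq_iff\<close>)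
    then have "($) x = (\<lambda>_. 0)" by (simp add: u_def v_def)
    then have "x $ j = 0" for j by metis
    then show False using x by (simp add: vec_eq_iff)
  qed
  then obtain v0 where "A v0 \<noteq> 0" by blast
  from riemann_positivity[OF pp S A this]
  have "0 < Im (\<Sum>i\<in>UNIV. cnj (A (\<gamma> i)) * A (\<delta> i))" .
  also have "(\<Sum>i\<in>UNIV. cnj (A (\<gamma> i)) * A (\<delta> i)) =
     of_real (4 * pi^2) * (\<Sum>i\<in>UNIV. cnj ((block_22 (period_matrix t \<gamma> \<delta>) *v x) $ i) * (block_12 (period_matrix t \<gamma> \<delta>) *v x) $ i)"
  proof -
    have "A (\<gamma> i) = two_pi_i * (block_22 (period_matrix t \<gamma> \<delta>) *v x) $ i"
      "A (\<delta> i) = two_pi_i * (block_12 (period_matrix t \<gamma> \<delta>) *v x) $ i" for i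
      by (simp_all add: A_def matrix_vector_mult_def a(1) restrict0_def mem sum_distrib_left mult.commute)
    then show ?thesis
      by (simp add: sum_distrib_left power2_eq_square mult_ac)
  qed
  finally have "0 < Im (of_real (4 * pi^2) * (\<Sum>i\<in>UNIV. cnj ((block_22 (period_matrix t \<gamma> \<delta>) *v x) $ i) * (block_12 (period_matrix t \<gamma> \<delta>) *v x) $ i))" .
  moreover have "Im (of_real c * z) = c * Im z" for c z by simp
  ultimately have "0 < 4 * pi^2 * hpos_form (period_matrix t \<gamma> \<delta>) x"
    unfolding hpos_form_def by metis
  then show "0 < hpos_form (period_matrix t \<gamma> \<delta>) x"
    by (simp add: zero_less_mult_iff)
qed

lemma lattice_basis_mem: "lattice_basis L b \<Longrightarrow> b a \<in> L"
  unfolding lattice_basis_def by blast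

text \<open>Integral coordinates of the new basis give an integral \<open>S\<close>. That
  \<open>S\<close> is symplectic is not computed from the coordinates: it is a quotient of two
  symplectic matrices.\<close>

lemma period_matrix_change_basis:
  assumes t: "is_triple t" and sb: "integral_symplectic_basis (lat t) (pol t) \<gamma> \<delta>"
    and sb': "integral_symplectic_basis (lat t) (pol t) \<gamma>' \<delta>'"
  obtains S where "S \<in> Sp_Z" "period_matrix t \<gamma>' \<delta>' = S ** period_matrix t \<gamma> \<delta>"
proof -
  have sg: "int_subgroup (lat t)" by (rule is_tripleD[OF t])
  have lb: "lattice_basis (lat t) (case_sum \<gamma> \<delta>)" and lb': "lattice_basis (lat t) (case_sum \<gamma>' \<delta>')"
    using sb sb' by (auto simp: integral_symplectic_basis_def)
  have mem: "\<gamma> i \<in> lat t" "\<delta> i \<in> lat t" "\<gamma>' i \<in> lat t" "\<delta>' i \<in> lat t" for i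
    using lattice_basis_mem[OF lb, of "Inl i"] lattice_basis_mem[OF lb, of "Inr i"]
      lattice_basis_mem[OF lb', of "Inl i"] lattice_basis_mem[OF lb', of "Inr i"] by auto
  have "\<exists>n. x = (\<Sum>b\<in>UNIV. of_int (n b) *\<^sub>R case_sum \<delta> \<gamma> b)" if x: "x \<in> lat t" for x
  proof -
    obtain m where m: "x = (\<Sum>b\<in>UNIV. of_int (m b) *\<^sub>R case_sum \<gamma> \<delta> b)"
      using lb x unfolding lattice_basis_def by blast
    show ?thesis
      by (rule exI[of _ "case_sum (m \<circ> Inr) (m \<circ> Inl)"]) (simp add: m sum_UNIV_sum add.commute)
  qed
  moreover have mem': "case_sum \<delta>' \<gamma>' a \<in> lat t" "case_sum \<delta> \<gamma> a \<in> lat t" for a using mem by (cases a; simp)+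
  ultimately have "\<forall>a. \<exists>n. case_sum \<delta>' \<gamma>' a = (\<Sum>b\<in>UNIV. of_int (n b) *\<^sub>R case_sum \<delta> \<gamma> b)" by blast
  then obtain n where n: "\<And>a. case_sum \<delta>' \<gamma>' a = (\<Sum>b\<in>UNIV. of_int (n a b) *\<^sub>R case_sum \<delta> \<gamma> b)" by metis
  define S :: "complex^('a + 'a)^('a + 'a)" where "S = (\<chi> a b. of_int (n a b))"
  have ev: "f (case_sum \<delta>' \<gamma>' a) = (\<Sum>b\<in>UNIV. of_int (n a b) * f (case_sum \<delta> \<gamma> b))" if "f \<in> H1dR (lat t)" for f a
    unfolding n by (rule H1dR_int_combination[OF sg that mem'(2)])
  have "period_matrix t \<gamma>' \<delta>' $ a $ c = (S ** period_matrix t \<gamma> \<delta>) $ a $ c" for a c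
    by (cases c) (simp_all add: matrix_matrix_mult_def S_def ev[OF is_tripleD(5)[OF t]] ev[OF is_tripleD(4)[OF t]] sum_divide_distrib)
  then have eq: "period_matrix t \<gamma>' \<delta>' = S ** period_matrix t \<gamma> \<delta>" by (simp add: vec_eq_iff)
  let ?P = "period_matrix t \<gamma> \<delta>" and ?P' = "period_matrix t \<gamma>' \<delta>'"
  have P: "?P \<in> Sp_C" "?P' \<in> Sp_C" using period_matrix_in_Sp_C[OF t] sb sb' by auto
  have "S = ?P' ** sinv ?P" by (simp add: eq sinv_right[OF P(1)] flip: matrix_mul_assoc)
  then have "S \<in> Sp_C" using P mult_in_Sp_C sinv_in_Sp_C by metis
  then have "S \<in> Sp_Z" by (simp add: Sp_Z_def S_def)
  then show ?thesis using eq by (rule that)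
qed

section \<open>The Siegel model of a principally polarized torus\<close>

definition re_vec :: "complex^'g \<Rightarrow> real^'g" where "re_vec v = (\<chi> i. Re (v $ i))"
definition im_vec :: "complex^'g \<Rightarrow> real^'g" where "im_vec v = (\<chi> i. Im (v $ i))"

lemma real_matrix_inv:
  fixes Y :: "real^'g^'g"
  assumes "invertible Y"
  shows "Y ** matrix_inv Y = mat 1" "matrix_inv Y ** Y = mat 1"
  using assms unfolding invertible_def matrix_inv_def by (metis (mono_tags, lifting) someI_ex)+

lemma siegel_space_sym: "\<tau> \<in> siegel_space \<Longrightarrow> \<tau> $ i $ j = \<tau> $ j $ i"
  by (metis (mono_tags, lifting) mem_Collect_eq siegel_space_def transpose_def vec_lambda_beta)

lemma siegel_space_pos: "\<tau> \<in> siegel_space \<Longrightarrow> x \<noteq> 0 \<Longrightarrow> 0 < x \<bullet> (Im_matrix \<tau> *v x)"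
  unfolding siegel_space_def by blast

lemma siegel_Im_matrix_inv:
  fixes \<tau> :: "complex^'g::finite^'g"
  assumes "\<tau> \<in> siegel_space"
  defines "Y \<equiv> Im_matrix \<tau>"
  shows "Y ** matrix_inv Y = mat 1" "matrix_inv Y ** Y = mat 1" "transpose (matrix_inv Y) = matrix_inv Y"
    "x \<noteq> 0 \<Longrightarrow> 0 < x \<bullet> (matrix_inv Y *v x)"
proof -
  have "x = 0" if "Y *v x = 0" for x
  proof (rule ccontr)
    assume "x \<noteq> 0"
    then have "0 < x \<bullet> (Y *v x)" using siegel_space_pos[OF assms(1)] by (simp add: Y_def)
    then show False by (simp add: that)
  qed
  then have "invertible Y" by (simp add: invertible_left_inverse matrix_left_invertible_ker)
  then show inv: "Y ** matrix_inv Y = mat 1" "matrix_inv Y ** Y = mat 1" by (rule real_matrix_inv)+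
  have Ysym: "transpose Y = Y"
    using siegel_space_sym[OF assms(1)] by (simp add: vec_eq_iff transpose_def Y_def Im_matrix_def)
  have "transpose (matrix_inv Y) = transpose (matrix_inv Y) ** (Y ** matrix_inv Y)" by (simp add: inv)
  also have "\<dots> = transpose (Y ** matrix_inv Y) ** matrix_inv Y"
    by (simp add: matrix_transpose_mul Ysym matrix_mul_assoc)
  finally show "transpose (matrix_inv Y) = matrix_inv Y" by (simp add: inv)
  assume "x \<noteq> 0"
  define u where "u = matrix_inv Y *v x"
  have Yu: "Y *v u = x" by (simp add: u_def matrix_vector_mul_assoc inv)
  then have "u \<noteq> 0" using \<open>x \<noteq> 0\<close> by auto
  then have "0 < u \<bullet> (Y *v u)" using siegel_space_pos[OF assms(1)] by (simp add: Y_def)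
  then show "0 < x \<bullet> (matrix_inv Y *v x)" unfolding Yu by (simp add: u_def inner_commute)
qed

definition siegel_hermitian :: "complex^'g^'g \<Rightarrow> complex^'g \<Rightarrow> complex^'g \<Rightarrow> complex" where
  "siegel_hermitian \<tau> v w =
     (\<Sum>i\<in>UNIV. \<Sum>j\<in>UNIV. cnj (v $ i) * of_real (matrix_inv (Im_matrix \<tau>) $ i $ j) * w $ j)"

lemma siegel_form_hermitian: "siegel_form \<tau> v w = Im (siegel_hermitian \<tau> v w)"
  by (simp add: siegel_form_def siegel_hermitian_def)

lemma siegel_hermitian_Re:
  "Re (siegel_hermitian \<tau> v w) = re_vec v \<bullet> (matrix_inv (Im_matrix \<tau>) *v re_vec w) + im_vec v \<bullet> (matrix_inv (Im_matrix \<tau>) *v im_vec w)"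
  by (simp add: siegel_hermitian_def inner_vec_def matrix_vector_mult_def re_vec_def im_vec_def sum_distrib_left
      sum.distrib[symmetric] algebra_simps)

lemma siegel_form_eq:
  "siegel_form \<tau> v w = re_vec v \<bullet> (matrix_inv (Im_matrix \<tau>) *v im_vec w) - im_vec v \<bullet> (matrix_inv (Im_matrix \<tau>) *v re_vec w)"
  by (simp add: siegel_form_def inner_vec_def matrix_vector_mult_def re_vec_def im_vec_def sum_distrib_left
      sum_subtractf[symmetric] algebra_simps)

text \<open>The inverse of \<open>Im \<tau>\<close> is real, symmetric and positive definite, so the
  value of the form at \<open>v\<close> is the sum of its values at the real and at the imaginary
  part of \<open>v\<close>.\<close>

lemma siegel_hermitian_pos_def:
  fixes \<tau> :: "complex^'g::finite^'g"
  assumes "\<tau> \<in> siegel_space"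
  shows "pos_def_hermitian (siegel_hermitian \<tau>)"
  unfolding pos_def_hermitian_def
proof (intro conjI allI impI)
  fix v w :: "complex^'g"
  show "Vector_Spaces.linear (*s) (*) (siegel_hermitian \<tau> v)"
    unfolding complex_linear_functional_iff siegel_hermitian_def
    by (simp add: algebra_simps sum.distrib sum_distrib_left)
  have "matrix_inv (Im_matrix \<tau>) $ j $ i = matrix_inv (Im_matrix \<tau>) $ i $ j" for i j
    using siegel_Im_matrix_inv(3)[OF assms] by (metis (mono_tags) transpose_def vec_lambda_beta)
  then show "siegel_hermitian \<tau> w v = cnj (siegel_hermitian \<tau> v w)"
    unfolding siegel_hermitian_def by (subst sum.swap) (simp add: mult_ac)
  assume "v \<noteq> 0"
  then have "re_vec v \<noteq> 0 \<or> im_vec v \<noteq> 0" by (auto simp: vec_eq_iff re_vec_def im_vec_def complex_eq_iff)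
  moreover have "0 \<le> x \<bullet> (matrix_inv (Im_matrix \<tau>) *v x)" for x
    using siegel_Im_matrix_inv(4)[OF assms, of x] by (cases "x = 0") auto
  ultimately show "0 < Re (siegel_hermitian \<tau> v v)"
    unfolding siegel_hermitian_Re using siegel_Im_matrix_inv(4)[OF assms] by (smt (verit))
qed

lemma real_matrix_vector_axis: "(A :: real^'n^'m) *v axis i 1 = column i A"
  by (simp add: vec_eq_iff matrix_vector_mult_def axis_def column_def if_distrib cong: if_cong)

text \<open>The imaginary part of column \<open>i\<close> of \<open>\<tau>\<close> is column
  \<open>i\<close> of \<open>Y = Im \<tau>\<close>, which \<open>Y^-1\<close> takes to a standard
  vector. For two columns of \<open>\<tau>\<close> the difference of two opposite entries of
  \<open>Re \<tau>\<close> remains, and it vanishes by symmetry.\<close>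

lemma siegel_form_relations:
  fixes \<tau> :: "complex^'g::finite^'g"
  assumes "\<tau> \<in> siegel_space"
  shows "symplectic_relations (siegel_form \<tau>) (\<lambda>i. axis i 1) (\<lambda>i. column i \<tau>)"
  unfolding symplectic_relations_def
proof (intro conjI allI)
  let ?Y = "Im_matrix \<tau>"
  show "skew_form (siegel_form \<tau>)"
    by (rule Im_hermitian_skew_form[OF siegel_hermitian_pos_def[OF assms] siegel_form_hermitian])
  fix i j :: 'g
  have ax: "re_vec (axis i 1) = axis i 1" "im_vec (axis i 1) = 0" for i :: 'g
    by (simp_all add: vec_eq_iff re_vec_def im_vec_def axis_def)
  have col: "im_vec (column i \<tau>) = ?Y *v axis i 1" for i
    by (simp add: vec_eq_iff im_vec_def column_def Im_matrix_def real_matrix_vector_axis)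
  have inv: "matrix_inv ?Y *v im_vec (column i \<tau>) = axis i 1" for i
    by (simp add: col matrix_vector_mul_assoc siegel_Im_matrix_inv[OF assms])
  show "siegel_form \<tau> (axis i 1) (axis j 1) = 0" by (simp add: siegel_form_eq ax)
  show "siegel_form \<tau> (axis i 1) (column j \<tau>) = (if i = j then 1 else 0)"
    by (simp add: siegel_form_eq ax inv inner_axis_axis)
  have "im_vec (column i \<tau>) \<bullet> (matrix_inv ?Y *v re_vec (column j \<tau>)) = (matrix_inv ?Y *v im_vec (column i \<tau>)) \<bullet> re_vec (column j \<tau>)"
    by (metis dot_lmul_matrix siegel_Im_matrix_inv(3)[OF assms] transpose_matrix_vector)
  then have "siegel_form \<tau> (column i \<tau>) (column j \<tau>) = Re (\<tau> $ j $ i) - Re (\<tau> $ i $ j)"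
    unfolding siegel_form_eq inv by (simp add: inner_axis inner_axis' re_vec_def column_def)
  then show "siegel_form \<tau> (column i \<tau>) (column j \<tau>) = 0"
    using siegel_space_sym[OF assms, of i j] by simp
qed

lemma siegel_lattice_eq:
  "siegel_lattice \<tau> = {\<Sum>a\<in>UNIV. of_int (n a) *\<^sub>R case_sum (\<lambda>i. axis i 1) (\<lambda>i. column i \<tau>) a | n. True}"
proof -
  have comb: "(\<Sum>a\<in>UNIV. of_int (n a) *\<^sub>R case_sum (\<lambda>i. axis i 1) (\<lambda>i. column i \<tau>) a)
      = (\<chi> i. of_int (n (Inl i))) + \<tau> *v (\<chi> i. of_int (n (Inr i)))" for n
    unfolding scaleR_vec_complex
    by (simp add: vec_eq_iff sum_UNIV_sum matrix_vector_mult_def axis_def column_def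
        if_distrib mult.commute cong: if_cong)
  show ?thesis
  proof (intro equalityI subsetI)
    fix z assume "z \<in> siegel_lattice \<tau>"
    then obtain m n where z: "z = m + \<tau> *v n" and i: "\<forall>i. m $ i \<in> \<int>" "\<forall>i. n $ i \<in> \<int>"
      unfolding siegel_lattice_def by blast
    have "\<forall>i. \<exists>k. m $ i = of_int k" "\<forall>i. \<exists>k. n $ i = of_int k" using i by (metis Ints_cases)+
    then obtain m' n' where "\<And>i. m $ i = of_int (m' i)" "\<And>i. n $ i = of_int (n' i)" by metis
    then have "m = (\<chi> i. of_int (m' i))" "n = (\<chi> i. of_int (n' i))" by (simp_all add: vec_eq_iff)
    then have "z = (\<Sum>a\<in>UNIV. of_int (case_sum m' n' a) *\<^sub>R case_sum (\<lambda>i. axis i 1) (\<lambda>i. column i \<tau>) a)"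
      unfolding comb z by simp
    then show "z \<in> {\<Sum>a\<in>UNIV. of_int (n a) *\<^sub>R case_sum (\<lambda>i. axis i 1) (\<lambda>i. column i \<tau>) a | n. True}" by blast
  next
    fix z assume "z \<in> {\<Sum>a\<in>UNIV. of_int (n a) *\<^sub>R case_sum (\<lambda>i. axis i 1) (\<lambda>i. column i \<tau>) a | n. True}"
    then obtain n where "z = (\<chi> i. of_int (n (Inl i))) + \<tau> *v (\<chi> i. of_int (n (Inr i)))"
      using comb by blast
    then show "z \<in> siegel_lattice \<tau>"
      unfolding siegel_lattice_def by (intro CollectI exI conjI) auto
  qed
qed

lemma combination_single:
  fixes b :: "'i::finite \<Rightarrow> 'b::real_vector"
  shows "(\<Sum>a\<in>UNIV. of_int (if a = i then 1 else 0) *\<^sub>R b a) = b i"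
  by (simp add: if_distrib[of of_int] if_distrib[of "\<lambda>x. x *\<^sub>R _"] cong: if_cong)

lemma combinations_contain: "b i \<in> {\<Sum>a\<in>UNIV. of_int (n a) *\<^sub>R b a | n. True}"
  for b :: "'i::finite \<Rightarrow> 'b::real_vector"
  using combination_single[of i b, symmetric] by (intro CollectI exI[of _ "\<lambda>a. if a = i then 1 else 0"]) simp

text \<open>Independence over the reals, obtained by pairing, gives both injectivity of the family
  and independence of its range.\<close>

lemma symplectic_is_lattice:
  fixes \<gamma> :: "'g::finite \<Rightarrow> complex^'g"
  assumes S: "symplectic_relations E \<gamma> \<delta>"
  shows "is_lattice {\<Sum>a\<in>UNIV. of_int (n a) *\<^sub>R case_sum \<gamma> \<delta> a | n. True}"
  unfolding is_lattice_def
proof (intro exI[of _ "case_sum \<gamma> \<delta>"] conjI refl)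
  let ?b = "case_sum \<gamma> \<delta>"
  show inj: "inj ?b"
  proof (rule injI, rule ccontr)
    fix a c assume ac: "?b a = ?b c" "a \<noteq> c"
    have "(\<Sum>x\<in>UNIV. (of_int (if x = a then 1 else 0) - of_int (if x = c then 1 else 0)) *\<^sub>R ?b x) = 0"
      unfolding scaleR_diff_left sum_subtractf combination_single using ac by simp
    from symplectic_independent[OF S this] have "(of_int (if a = a then 1 else 0) - of_int (if a = c then 1 else 0) :: real) = 0" by blast
    then show False using ac by simp
  qed
  show "independent (range ?b)"
  proof
    assume "dependent (range ?b)"
    then obtain u where u: "\<exists>v\<in>range ?b. u v \<noteq> 0" "(\<Sum>v\<in>range ?b. u v *\<^sub>R v) = 0"
      by (auto simp: dependent_finite)
    have "(\<Sum>a\<in>UNIV. u (?b a) *\<^sub>R ?b a) = 0"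
      using u(2) by (simp add: sum.reindex[OF inj] o_def)
    from symplectic_independent[OF S this] show False using u(1) by blast
  qed
qed

text \<open>In a symplectic system unimodularity is explicit: the functional \<open>f\<close> is
  represented by the combination with coefficient \<open>f (\<delta> i)\<close> at
  \<open>\<gamma> i\<close> and \<open>- f (\<gamma> i)\<close> at \<open>\<delta> i\<close>, and
  \<open>symplectic_expand\<close> shows that nothing else represents it.\<close>

lemma symplectic_principal_polarization:
  fixes \<gamma> :: "'g::finite \<Rightarrow> complex^'g"
  assumes S: "symplectic_relations E \<gamma> \<delta>" and H: "pos_def_hermitian H" "\<And>v w. E v w = Im (H v w)"
  shows "principal_polarization {\<Sum>a\<in>UNIV. of_int (n a) *\<^sub>R case_sum \<gamma> \<delta> a | n. True} E"
proof -
  let ?b = "case_sum \<gamma> \<delta>" and ?L = "{\<Sum>a\<in>UNIV. of_int (n a) *\<^sub>R case_sum \<gamma> \<delta> a | n. True}"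
  have E: "skew_form E" using S by (simp add: symplectic_relations_def)
  have sg: "int_subgroup ?L" by (rule int_combinations_subgroup)
  have bL: "?b a \<in> ?L" for a by (rule combinations_contain)
  have int: "E x (\<gamma> i) \<in> \<int>" "E x (\<delta> i) \<in> \<int>" if xL: "x \<in> ?L" for x i
  proof -
    obtain n where "x = (\<Sum>a\<in>UNIV. of_int (n a) *\<^sub>R ?b a)" using xL by blast
    then have x: "x = (\<Sum>i\<in>UNIV. of_int (n (Inl i)) *\<^sub>R \<gamma> i + of_int (n (Inr i)) *\<^sub>R \<delta> i)"
      by (simp add: sum_UNIV_sum sum.distrib)
    show "E x (\<gamma> i) \<in> \<int>" "E x (\<delta> i) \<in> \<int>"
      unfolding x symplectic_combination[OF S] by auto
  qed
  have "E x y \<in> \<int>" if "x \<in> ?L" "y \<in> ?L" for x y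
    using int[OF that(1)] int[OF that(2)] symplectic_form_expand[OF S, of x y]
    by (simp only:) (intro Ints_sum Ints_diff Ints_mult)
  moreover have "\<exists>!y. y \<in> ?L \<and> (\<forall>x\<in>?L. E y x = of_int (f x))" if f: "\<forall>x\<in>?L. \<forall>y\<in>?L. f (x + y) = f x + f y" for f :: "complex^'g \<Rightarrow> int"
  proof (rule ex1I, intro conjI ballI)
    define y where "y = (\<Sum>i\<in>UNIV. of_int (f (\<delta> i)) *\<^sub>R \<gamma> i + of_int (- f (\<gamma> i)) *\<^sub>R \<delta> i)"
    have "y = (\<Sum>a\<in>UNIV. of_int (case_sum (\<lambda>i. f (\<delta> i)) (\<lambda>i. - f (\<gamma> i)) a) *\<^sub>R ?b a)"
      by (simp add: y_def sum_UNIV_sum sum_subtractf sum_negf)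
    then show "y \<in> ?L" by blast
    have yb: "E y (?b a) = of_int (f (?b a))" for a
      unfolding y_def by (cases a) (simp_all only: symplectic_combination[OF S] sum.case of_int_minus minus_minus)
    fix x assume "x \<in> ?L"
    then obtain n where n: "x = (\<Sum>a\<in>UNIV. of_int (n a) *\<^sub>R ?b a)" by blast
    have "f x = (\<Sum>a\<in>UNIV. n a * f (?b a))"
      using additive_int_combination[OF sg, of f UNIV ?b n] f bL by (simp add: n)
    then show "E y x = of_int (f x)"
      by (simp add: n skew_form_sum[OF E] skew_form_scale[OF E] yb)
  next
    fix z assume z: "z \<in> ?L \<and> (\<forall>x\<in>?L. E z x = of_int (f x))"
    have "E z (\<gamma> i) = of_int (f (\<gamma> i))" "E z (\<delta> i) = of_int (f (\<delta> i))" for i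
      using z bL[of "Inl i"] bL[of "Inr i"] by auto
    then show "z = (\<Sum>i\<in>UNIV. of_int (f (\<delta> i)) *\<^sub>R \<gamma> i + of_int (- f (\<gamma> i)) *\<^sub>R \<delta> i)"
      using symplectic_expand[OF S, of z] by simp
  qed
  ultimately show ?thesis
    unfolding principal_polarization_def using H by blast
qed

text \<open>For a positive symplectic \<open>M\<close>, the Siegel torus of \<open>tau_of M\<close>
  with the forms whose periods are prescribed by \<open>M\<close>. In \<open>et\<close>,
  \<open>E (axis i 1) z\<close> and \<open>- E (column i \<tau>) z\<close> are the real coordinates
  of \<open>z\<close> along column \<open>i\<close> of \<open>\<tau>\<close> and along the standard
  vector.\<close>

definition matrix_triple :: "complex^('g::finite + 'g)^('g + 'g) \<Rightarrow> 'g triple" where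
  "matrix_triple M = (let \<tau> = tau_of M; L = siegel_lattice \<tau>; E = siegel_form \<tau> in
   \<lparr>lat = L, pol = E,
    om = (\<lambda>j. restrict0 L (\<lambda>z. two_pi_i * (\<Sum>i\<in>UNIV. z $ i * M $ Inr i $ Inr j))),
    et = (\<lambda>j. restrict0 L (\<lambda>z. \<Sum>i\<in>UNIV. of_real (E (axis i 1) z) * M $ Inl i $ Inl j
                                    - of_real (E (column i \<tau>) z) * M $ Inr i $ Inl j))\<rparr>)"

lemma matrix_triple_sel:
  "lat (matrix_triple M) = siegel_lattice (tau_of M)" "pol (matrix_triple M) = siegel_form (tau_of M)"
  "om (matrix_triple M) j = restrict0 (siegel_lattice (tau_of M)) (\<lambda>z. two_pi_i * (\<Sum>i\<in>UNIV. z $ i * M $ Inr i $ Inr j))"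
  "et (matrix_triple M) j = restrict0 (siegel_lattice (tau_of M)) (\<lambda>z. \<Sum>i\<in>UNIV. of_real (siegel_form (tau_of M) (axis i 1) z) * M $ Inl i $ Inl j
       - of_real (siegel_form (tau_of M) (column i (tau_of M)) z) * M $ Inr i $ Inl j)"
  by (simp_all add: matrix_triple_def Let_def)

lemma hpos_tau_of: "M \<in> Sp_C \<Longrightarrow> hpos M \<Longrightarrow> invertible (block_22 M)"
  "M \<in> Sp_C \<Longrightarrow> hpos M \<Longrightarrow> tau_of M \<in> siegel_space"
  using siegel_space_iff_hpos by blast+

lemma siegel_lattice_polarization:
  fixes \<tau> :: "complex^'g::finite^'g"
  assumes \<tau>: "\<tau> \<in> siegel_space"
  shows "is_lattice (siegel_lattice \<tau>)" "principal_polarization (siegel_lattice \<tau>) (siegel_form \<tau>)"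
    "integral_symplectic_basis (siegel_lattice \<tau>) (siegel_form \<tau>) (\<lambda>i. axis i 1) (\<lambda>i. column i \<tau>)"
proof -
  have S: "symplectic_relations (siegel_form \<tau>) (\<lambda>i. axis i 1) (\<lambda>i. column i \<tau>)" by (rule siegel_form_relations[OF \<tau>])
  show "is_lattice (siegel_lattice \<tau>)" unfolding siegel_lattice_eq by (rule symplectic_is_lattice[OF S])
  show pp: "principal_polarization (siegel_lattice \<tau>) (siegel_form \<tau>)"
    unfolding siegel_lattice_eq
    by (rule symplectic_principal_polarization[OF S siegel_hermitian_pos_def[OF \<tau>] siegel_form_hermitian])
  have "case_sum (\<lambda>i. axis i 1) (\<lambda>i. column i \<tau>) a \<in> siegel_lattice \<tau>" for a
    unfolding siegel_lattice_eq by (rule combinations_contain)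
  from this[of "Inl _"] this[of "Inr _"]
  have "range (\<lambda>i. axis i 1) \<subseteq> siegel_lattice \<tau>" "range (\<lambda>i. column i \<tau>) \<subseteq> siegel_lattice \<tau>" by auto
  then show "integral_symplectic_basis (siegel_lattice \<tau>) (siegel_form \<tau>) (\<lambda>i. axis i 1) (\<lambda>i. column i \<tau>)"
    using S integral_symplectic_basis_iff[OF pp] by blast
qed

text \<open>A symplectic matrix is invertible, so every class in \<open>H1dR\<close> has exactly one
  expansion in the forms: its coefficients solve a linear system with the period matrix. Thus the
  basis condition and the pairing relations both follow from membership in
  \<open>Sp_C\<close>.\<close>

lemma symplectic_hodge_basis_from_period_matrix:
  assumes lat: "is_lattice (lat t)" and pp: "principal_polarization (lat t) (pol t)"
    and sb: "integral_symplectic_basis (lat t) (pol t) \<gamma> \<delta>"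
    and om: "\<And>i. om t i \<in> hodge_F1 (lat t)" and et: "\<And>i. et t i \<in> H1dR (lat t)"
    and M: "period_matrix t \<gamma> \<delta> \<in> Sp_C"
  shows "is_triple t"
proof -
  let ?M = "period_matrix t \<gamma> \<delta>" and ?L = "lat t"
  have sg: "int_subgroup ?L" by (rule is_lattice_subgroup[OF lat])
  have om': "om t i \<in> H1dR ?L" for i
    using om[of i] restrict0_H1dR[OF sg] by (auto simp: hodge_F1_def complex_linear_functional_iff)
  have lb: "lattice_basis ?L (case_sum \<gamma> \<delta>)" using sb by (simp add: integral_symplectic_basis_def)
  have comb: "(\<lambda>x. \<Sum>i\<in>UNIV. fst ac i * om t i x + snd ac i * et t i x) \<in> H1dR ?L" for ac
    using om' et by (auto simp: H1dR_def algebra_simps sum.distrib)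
  \<comment> \<open>The unknowns of that system; the omega coefficients carry the factor
    \<open>2 pi i\<close> because the right columns are divided by it.\<close>
  define vec :: "('a \<Rightarrow> complex) \<times> ('a \<Rightarrow> complex) \<Rightarrow> complex^('a + 'a)" where
    "vec ac = (\<chi> a. case a of Inl i \<Rightarrow> snd ac i | Inr i \<Rightarrow> two_pi_i * fst ac i)" for ac
  have ev: "(\<Sum>i\<in>UNIV. fst ac i * om t i x + snd ac i * et t i x) = (?M *v vec ac) $ a"
    if "x = case_sum \<delta> \<gamma> a" for ac a x
    by (simp add: matrix_vector_mult_def sum_UNIV_sum vec_def that sum.distrib mult.commute)
  have inj: "ac = ac'" if "vec ac = vec ac'" for ac ac'
  proof -
    have "snd ac i = snd ac' i" "fst ac i = fst ac' i" for i
      using arg_cong[OF that, of "\<lambda>v. v $ Inl i"] arg_cong[OF that, of "\<lambda>v. v $ Inr i"] by (simp_all add: vec_def)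
    then show ?thesis by (simp add: prod_eq_iff fun_eq_iff)
  qed
  have ex1: "\<exists>!ac. f = (\<lambda>x. \<Sum>i\<in>UNIV. fst ac i * om t i x + snd ac i * et t i x)" if f: "f \<in> H1dR ?L" for f
  proof -
    have iff: "f = (\<lambda>x. \<Sum>i\<in>UNIV. fst ac i * om t i x + snd ac i * et t i x) \<longleftrightarrow> periods \<gamma> \<delta> f = ?M *v vec ac" for ac
    proof
      assume fe: "f = (\<lambda>x. \<Sum>i\<in>UNIV. fst ac i * om t i x + snd ac i * et t i x)"
      then have "f (case_sum \<delta> \<gamma> a) = (?M *v vec ac) $ a" for a using ev[OF refl, of ac a] by metis
      then show "periods \<gamma> \<delta> f = ?M *v vec ac" by (simp add: vec_eq_iff periods_def)
    next
      assume p: "periods \<gamma> \<delta> f = ?M *v vec ac"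
      show "f = (\<lambda>x. \<Sum>i\<in>UNIV. fst ac i * om t i x + snd ac i * et t i x)"
      proof (rule H1dR_eqI[OF sg f comb lb])
        fix a
        obtain a' where a': "case_sum \<gamma> \<delta> a = case_sum \<delta> \<gamma> a'"
          by (cases a) (metis sum.case(1) sum.case(2))+
        have fa: "f (case_sum \<gamma> \<delta> a) = (?M *v vec ac) $ a'" using p unfolding a' by (metis periods_def vec_lambda_beta)
        show "f (case_sum \<gamma> \<delta> a) = (\<Sum>i\<in>UNIV. fst ac i * om t i (case_sum \<gamma> \<delta> a) + snd ac i * et t i (case_sum \<gamma> \<delta> a))"
          by (simp only: fa ev[OF a'])
      qed
    qed
    define v where "v = sinv ?M *v periods \<gamma> \<delta> f"
    have v: "?M *v w = periods \<gamma> \<delta> f \<longleftrightarrow> w = v" for w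
      using sinv_left[OF M] sinv_right[OF M] by (metis matrix_vector_mul_assoc matrix_vector_mul_lid v_def)
    define ac where "ac = ((\<lambda>i. v $ Inr i / two_pi_i), (\<lambda>i. v $ Inl i))"
    have "vec ac = v" by (simp add: vec_eq_iff all_sum vec_def ac_def)
    show ?thesis
      unfolding iff
    proof (rule ex1I[of _ ac])
      show "periods \<gamma> \<delta> f = ?M *v vec ac" using v \<open>vec ac = v\<close> by metis
      fix ac' assume "periods \<gamma> \<delta> f = ?M *v vec ac'"
      then show "ac' = ac" using v \<open>vec ac = v\<close> inj by metis
    qed
  qed
  have pr: "\<forall>i j. pairing ?L (pol t) (om t i) (om t j) = 0 \<and> pairing ?L (pol t) (et t i) (et t j) = 0 \<and>
       pairing ?L (pol t) (om t i) (et t j) = (if i = j then 1 else 0)"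
    using period_matrix_in_Sp_C_iff[OF sg pp sb om' et] M by blast
  show ?thesis
    unfolding is_triple_def symplectic_hodge_basis_def
    using lat pp om' et om ex1 pr by (intro conjI) blast+
qed

text \<open>Over the standard vectors the entries are right by construction. Over the columns of
  \<open>\<tau>\<close> the omega periods come from \<open>\<tau> D = B\<close>, where symmetry of
  \<open>\<tau>\<close> allows its columns to be read as rows.\<close>

lemma period_matrix_matrix_triple:
  assumes M: "M \<in> Sp_C" "hpos M"
  shows "period_matrix (matrix_triple M) (\<lambda>i. axis i 1) (\<lambda>i. column i (tau_of M)) = M"
proof -
  let ?\<tau> = "tau_of M" and ?M = "matrix_triple M"
  have \<tau>: "?\<tau> \<in> siegel_space" and D: "invertible (block_22 M)" using hpos_tau_of[OF M] by auto
  have S: "symplectic_relations (siegel_form ?\<tau>) (\<lambda>i. axis i 1) (\<lambda>i. column i ?\<tau>)" by (rule siegel_form_relations[OF \<tau>])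
  have "case_sum (\<lambda>i. axis i 1) (\<lambda>i. column i ?\<tau>) a \<in> siegel_lattice ?\<tau>" for a
    unfolding siegel_lattice_eq by (rule combinations_contain)
  from this[of "Inl _"] this[of "Inr _"]
  have mem: "axis i 1 \<in> siegel_lattice ?\<tau>" "column i ?\<tau> \<in> siegel_lattice ?\<tau>" for i by auto
  have B: "(\<Sum>k\<in>UNIV. ?\<tau> $ k $ i * M $ Inr k $ Inr j) = M $ Inl i $ Inr j" for i j
  proof -
    have "(?\<tau> ** block_22 M) $ i $ j = block_12 M $ i $ j" by (simp add: tau_of_mult[OF D])
    then show ?thesis using siegel_space_sym[OF \<tau>] by (simp add: matrix_matrix_mult_def)
  qed
  note rel = symplectic_relations_eqs[OF S]
  have "period_matrix ?M (\<lambda>i. axis i 1) (\<lambda>i. column i ?\<tau>) $ a $ b = M $ a $ b" for a b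
  proof (cases a)
    case (Inl i)
    show ?thesis
      by (cases b) (simp_all add: Inl matrix_triple_sel restrict0_def mem rel B column_def[of i, simplified vec_eq_iff, rule_format] if_distrib[of of_real] if_distrib[of "\<lambda>x. x * _"] cong: if_cong)
  next
    case (Inr i)
    show ?thesis
      by (cases b) (simp_all add: Inr matrix_triple_sel restrict0_def mem rel axis_def[of i, simplified vec_eq_iff, rule_format] if_distrib[of of_real] if_distrib[of uminus] if_distrib[of "\<lambda>x. x * _"] cong: if_cong)
  qed
  then show ?thesis by (simp add: vec_eq_iff)
qed

lemma is_triple_matrix_triple:
  assumes M: "M \<in> Sp_C" "hpos M"
  shows "is_triple (matrix_triple M)"
proof -
  have \<tau>: "tau_of M \<in> siegel_space" using hpos_tau_of[OF M] by auto
  note lp = siegel_lattice_polarization[OF \<tau>]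
  have E: "skew_form (siegel_form (tau_of M))" by (rule polarization_skew_form[OF lp(2)])
  show ?thesis
  proof (rule symplectic_hodge_basis_from_period_matrix)
    show "integral_symplectic_basis (lat (matrix_triple M)) (pol (matrix_triple M)) (\<lambda>i. axis i 1) (\<lambda>i. column i (tau_of M))"
      using lp by (simp add: matrix_triple_sel)
    show "om (matrix_triple M) j \<in> hodge_F1 (lat (matrix_triple M))" for j
      unfolding hodge_F1_def matrix_triple_sel complex_linear_functional_iff
      by (intro CollectI exI[of _ "\<lambda>z. two_pi_i * (\<Sum>i\<in>UNIV. z $ i * M $ Inr i $ Inr j)"] conjI refl)
        (simp_all add: algebra_simps sum.distrib sum_distrib_left)
    show "et (matrix_triple M) j \<in> H1dR (lat (matrix_triple M))" for j
      unfolding matrix_triple_sel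
      by (rule restrict0_H1dR[OF is_lattice_subgroup[OF lp(1)]])
        (simp add: skew_form_add[OF E] algebra_simps sum.distrib sum_subtractf)
  qed (use lp period_matrix_matrix_triple[OF M] M in \<open>simp_all add: matrix_triple_sel\<close>)
qed

section \<open>Isomorphisms of triples\<close>

declare transpose_matrix_vector [simp del]

definition is_triple_iso :: "'g::finite triple \<Rightarrow> 'g triple \<Rightarrow> (complex^'g \<Rightarrow> complex^'g) \<Rightarrow> bool" where
  "is_triple_iso t t' f \<longleftrightarrow> Vector_Spaces.linear (*s) (*s) f \<and> bij f \<and> f ` lat t = lat t' \<and>
        (\<forall>v w. pol t' (f v) (f w) = pol t v w) \<and>
        (\<forall>i. \<forall>x\<in>lat t. om t' i (f x) = om t i x \<and> et t' i (f x) = et t i x)"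

lemma triple_iso_iff: "(t, t') \<in> triple_iso \<longleftrightarrow> is_triple t \<and> is_triple t' \<and> (\<exists>f. is_triple_iso t t' f)"
  by (simp add: triple_iso_def is_triple_iso_def)

lemma is_triple_iso_id: "is_triple_iso t t id"
  by (simp add: is_triple_iso_def complex_linear_map_iff)

lemma is_triple_iso_comp:
  assumes f: "is_triple_iso t t' f" and g: "is_triple_iso t' t'' g"
  shows "is_triple_iso t t'' (g \<circ> f)"
proof -
  have "(g \<circ> f) ` lat t = g ` (f ` lat t)" by (rule image_comp[symmetric])
  also have "\<dots> = lat t''" using f g by (simp add: is_triple_iso_def)
  finally have im: "(g \<circ> f) ` lat t = lat t''" .
  have fx: "f x \<in> lat t'" if "x \<in> lat t" for x using f that unfolding is_triple_iso_def by blast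
  have forms: "om t'' i (g (f x)) = om t i x \<and> et t'' i (g (f x)) = et t i x" if "x \<in> lat t" for i x
    using f g fx[OF that] that unfolding is_triple_iso_def by metis
  have "bij (g \<circ> f)" by (rule bij_comp) (use f g in \<open>simp_all add: is_triple_iso_def\<close>)
  then show ?thesis
    using f g im forms by (simp add: is_triple_iso_def complex_linear_map_iff)
qed

lemma is_triple_iso_inv:
  assumes f: "is_triple_iso t t' f" shows "is_triple_iso t' t (inv f)"
proof -
  have lin: "f (x + y) = f x + f y" "f (c *s x) = c *s f x" for x y c
    using f by (auto simp: is_triple_iso_def complex_linear_map_iff)
  have bij: "bij f" using f by (simp add: is_triple_iso_def)
  have fi: "f (inv f y) = y" "inv f (f x) = x" for x y
    using bij by (auto simp: bij_is_surj surj_f_inv_f bij_is_inj inv_f_f)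
  have "inv f (x + y) = inv f x + inv f y" for x y by (metis fi lin(1))
  moreover have "inv f (c *s x) = c *s inv f x" for c x by (metis fi lin(2))
  moreover have im: "inv f ` lat t' = lat t"
  proof -
    have "lat t' = f ` lat t" using f by (simp add: is_triple_iso_def)
    then show ?thesis by (simp add: image_image fi)
  qed
  moreover have "pol t (inv f v) (inv f w) = pol t' v w" for v w using f by (metis fi(1) is_triple_iso_def)
  moreover have "om t i (inv f x) = om t' i x \<and> et t i (inv f x) = et t' i x" if "x \<in> lat t'" for i x
  proof -
    have "inv f x \<in> lat t" using im that by blast
    then have "om t' i (f (inv f x)) = om t i (inv f x) \<and> et t' i (f (inv f x)) = et t i (inv f x)"
      using f unfolding is_triple_iso_def by blast
    then show ?thesis by (simp add: fi)
  qed
  ultimately show ?thesis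
    using bij_imp_bij_inv[OF bij] by (simp add: is_triple_iso_def complex_linear_map_iff)
qed

lemma equiv_triple_iso: "equiv {t. is_triple t} triple_iso"
proof (rule equivI)
  show "triple_iso \<subseteq> {t. is_triple t} \<times> {t. is_triple t}" by (auto simp: triple_iso_iff)
  show "refl_on {t. is_triple t} triple_iso"
    using is_triple_iso_id by (auto simp: refl_on_def triple_iso_iff)
  show "sym triple_iso" using is_triple_iso_inv by (auto simp: sym_def triple_iso_iff)
  show "trans triple_iso" using is_triple_iso_comp by (force simp: trans_def triple_iso_iff)
qed

lemma triple_class_eq_iff:
  "is_triple t \<Longrightarrow> is_triple t' \<Longrightarrow> triple_class t = triple_class t' \<longleftrightarrow> (t, t') \<in> triple_iso"
  unfolding triple_class_def using equiv_class_eq_iff[OF equiv_triple_iso, of t t'] by simp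

lemma mem_triple_class_iff: "is_triple t \<Longrightarrow> t' \<in> triple_class t \<longleftrightarrow> (t, t') \<in> triple_iso"
  by (simp add: triple_class_def)

lemma triple_class_in_B_set: "is_triple t \<Longrightarrow> triple_class t \<in> B_set"
  by (simp add: triple_class_def B_set_def quotientI)

lemma B_setE:
  assumes "p \<in> B_set" obtains t where "is_triple t" "p = triple_class t"
  using assms by (auto simp: B_set_def triple_class_def elim!: quotientE)

lemma mem_B_set:
  assumes "p \<in> B_set" "t \<in> p" shows "is_triple t" "triple_class t = p"
proof -
  obtain s where s: "is_triple s" "p = triple_class s" by (rule B_setE[OF assms(1)])
  then have "(s, t) \<in> triple_iso" using assms mem_triple_class_iff by blast
  then show t: "is_triple t" by (simp add: triple_iso_iff)
  show "triple_class t = p"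
    using triple_class_eq_iff[OF s(1) t] \<open>(s, t) \<in> triple_iso\<close> s(2) by simp
qed

lemma period_matrix_iso:
  assumes t: "is_triple t" "is_triple t'" and f: "is_triple_iso t t' f"
    and sb: "integral_symplectic_basis (lat t) (pol t) \<gamma> \<delta>"
  shows "integral_symplectic_basis (lat t') (pol t') (f \<circ> \<gamma>) (f \<circ> \<delta>)"
    "period_matrix t' (f \<circ> \<gamma>) (f \<circ> \<delta>) = period_matrix t \<gamma> \<delta>"
proof -
  note pp = is_tripleD(3)[OF t(1)] and pp' = is_tripleD(3)[OF t(2)]
  have S: "symplectic_relations (pol t) \<gamma> \<delta>" and mem: "\<And>i. \<gamma> i \<in> lat t" "\<And>i. \<delta> i \<in> lat t"
    using sb integral_symplectic_basis_iff[OF pp] by auto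
  have pol: "pol t' (f v) (f w) = pol t v w" for v w using f unfolding is_triple_iso_def by blast
  have im: "f x \<in> lat t'" if "x \<in> lat t" for x using f that unfolding is_triple_iso_def by blast
  have "symplectic_relations (pol t') (f \<circ> \<gamma>) (f \<circ> \<delta>)"
    unfolding symplectic_relations_def
    by (intro conjI allI) (simp_all add: polarization_skew_form[OF pp'] pol symplectic_relations_eqs[OF S])
  then show "integral_symplectic_basis (lat t') (pol t') (f \<circ> \<gamma>) (f \<circ> \<delta>)"
    unfolding integral_symplectic_basis_iff[OF pp'] using im mem by auto
  have "om t' j (f x) = om t j x" "et t' j (f x) = et t j x" if "x \<in> lat t" for j x
    using f that unfolding is_triple_iso_def by blast+
  then have "om t' j (case_sum (f \<circ> \<delta>) (f \<circ> \<gamma>) a) = om t j (case_sum \<delta> \<gamma> a)"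
    "et t' j (case_sum (f \<circ> \<delta>) (f \<circ> \<gamma>) a) = et t j (case_sum \<delta> \<gamma> a)" for j a
    using mem by (cases a; simp)+
  then show "period_matrix t' (f \<circ> \<gamma>) (f \<circ> \<delta>) = period_matrix t \<gamma> \<delta>"
    by (simp add: vec_eq_iff all_sum[of "\<lambda>b. period_matrix t' _ _ $ _ $ b = _ $ b"])
qed

text \<open>The normal form of a triple. The isomorphism applies \<open>D^-T\<close> to the values
  of the omega divided by \<open>2 pi i\<close>; it carries \<open>\<gamma> i\<close> to a standard
  vector and \<open>\<delta> i\<close> to column \<open>i\<close> of \<open>tau_of M\<close>. All
  remaining data are determined by their values on this basis.\<close>

lemma triple_iso_matrix_triple:
  fixes t :: "'g::finite triple"
  assumes t: "is_triple t" and sb: "integral_symplectic_basis (lat t) (pol t) \<gamma> \<delta>"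
  shows "(t, matrix_triple (period_matrix t \<gamma> \<delta>)) \<in> triple_iso"
proof -
  define M where "M = period_matrix t \<gamma> \<delta>"
  have M: "M \<in> Sp_C" "hpos M" using period_matrix_in_Sp_C[OF t sb] period_matrix_hpos[OF t sb] by (auto simp: M_def)
  let ?\<tau> = "tau_of M" and ?t = "matrix_triple M"
  let ?\<gamma> = "\<lambda>i :: 'g. axis i 1 :: complex^'g" and ?\<delta> = "\<lambda>i. column i ?\<tau>"
  have D: "invertible (block_22 M)" and \<tau>: "?\<tau> \<in> siegel_space" using hpos_tau_of[OF M] by auto
  have t': "is_triple ?t" by (rule is_triple_matrix_triple[OF M])
  have sb': "integral_symplectic_basis (lat ?t) (pol ?t) ?\<gamma> ?\<delta>"
    using siegel_lattice_polarization[OF \<tau>] by (simp add: matrix_triple_sel)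
  have S: "symplectic_relations (pol t) \<gamma> \<delta>" and mem: "\<And>i. \<gamma> i \<in> lat t" "\<And>i. \<delta> i \<in> lat t"
    using sb integral_symplectic_basis_iff[OF is_tripleD(3)[OF t]] by auto
  have S': "symplectic_relations (pol ?t) ?\<gamma> ?\<delta>" using sb' integral_symplectic_basis_iff[OF is_tripleD(3)[OF t']] by auto
  have "\<forall>j. \<exists>a. om t j = restrict0 (lat t) a \<and> Vector_Spaces.linear (*s) (*) a"
    using is_tripleD(6)[OF t] by (auto simp: hodge_F1_def)
  then obtain a where a: "\<And>j. om t j = restrict0 (lat t) (a j)" "\<And>j. Vector_Spaces.linear (*s) (*) (a j)"
    by metis
  have al: "a j (x + y) = a j x + a j y" "a j (c *s x) = c * a j x" for j x y c
    using a(2)[of j] by (simp_all add: complex_linear_functional_iff)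
  define f where "f z = transpose (matrix_inv (block_22 M)) *v (\<chi> j. a j z / two_pi_i)" for z
  have f_lin: "Vector_Spaces.linear (*s) (*s) f"
    unfolding complex_linear_map_iff f_def
    by (simp add: vec_eq_iff matrix_vector_mult_def al algebra_simps sum.distrib sum_distrib_left add_divide_distrib)
  have f_add: "f (x + y) = f x + f y" and f_scale: "f (c *s x) = c *s f x" for x y c
    using f_lin by (simp_all add: complex_linear_map_iff)
  have f_scaleR: "f (r *\<^sub>R x) = r *\<^sub>R f x" for r x by (simp add: scaleR_vec_complex f_scale)
  have f_linear: "linear f" by (rule linearI) (simp_all add: f_add f_scaleR)
  have f_a: "two_pi_i * (\<Sum>i\<in>UNIV. f z $ i * M $ Inr i $ Inr j) = a j z" for z j
  proof -
    have "transpose (block_22 M) *v f z = (\<chi> j. a j z / two_pi_i)"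
      by (simp add: f_def matrix_vector_mul_assoc transpose_matrix_inv[OF D] del: transpose_matrix_vector)
    from arg_cong[OF this, of "\<lambda>v. v $ j"]
    have "(\<Sum>i\<in>UNIV. f z $ i * M $ Inr i $ Inr j) = a j z / two_pi_i"
      by (simp add: matrix_vector_mult_def transpose_def mult.commute)
    then show ?thesis by simp
  qed
  have M\<gamma>: "M $ Inr i $ Inr j = a j (\<gamma> i) / two_pi_i" and M\<delta>: "M $ Inl i $ Inr j = a j (\<delta> i) / two_pi_i" for i j
    by (simp_all add: M_def a(1) restrict0_def mem)
  have f\<gamma>: "f (\<gamma> i) = axis i 1" for i
  proof -
    have "f (\<gamma> i) = transpose (matrix_inv (block_22 M)) *v (transpose (block_22 M) *v axis i 1)"
      unfolding f_def M\<gamma>[symmetric]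
      by (rule arg_cong[where f = "\<lambda>v. _ *v v"])
        (simp add: vec_eq_iff matrix_vector_mult_def transpose_def axis_def if_distrib cong: if_cong)
    then show ?thesis by (simp add: matrix_vector_mul_assoc transpose_matrix_inv[OF D])
  qed
  have f\<delta>: "f (\<delta> i) = column i ?\<tau>" for i
  proof -
    have "f (\<delta> i) = transpose (matrix_inv (block_22 M)) *v (transpose (block_12 M) *v axis i 1)"
      unfolding f_def M\<delta>[symmetric]
      by (rule arg_cong[where f = "\<lambda>v. _ *v v"])
        (simp add: vec_eq_iff matrix_vector_mult_def transpose_def axis_def if_distrib cong: if_cong)
    also have "\<dots> = transpose ?\<tau> *v axis i 1"
      by (simp add: matrix_vector_mul_assoc tau_of_def matrix_transpose_mul)
    finally show ?thesis
      using siegel_space_sym[OF \<tau>]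
      by (simp add: vec_eq_iff matrix_vector_mult_def transpose_def axis_def column_def if_distrib cong: if_cong)
  qed
  \<comment> \<open>The symplectic expansion of \<open>v\<close> determines \<open>f v\<close>;
    hence \<open>f\<close> preserves the form on all vectors and not only on the lattice, and
    nondegeneracy makes it injective.\<close>
  have f_expand: "f v = (\<Sum>i\<in>UNIV. pol t v (\<delta> i) *\<^sub>R axis i 1 + (- pol t v (\<gamma> i)) *\<^sub>R column i ?\<tau>)" for v
  proof -
    have "f v = f (\<Sum>i\<in>UNIV. pol t v (\<delta> i) *\<^sub>R \<gamma> i + (- pol t v (\<gamma> i)) *\<^sub>R \<delta> i)"
      by (rule arg_cong[OF symplectic_expand[OF S]])
    then show ?thesis by (simp only: linear_sum[OF f_linear] f_add f_scaleR f\<gamma> f\<delta>)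
  qed
  have pol\<gamma>: "pol ?t (f v) (axis i 1) = pol t v (\<gamma> i)" and pol\<delta>: "pol ?t (f v) (column i ?\<tau>) = pol t v (\<delta> i)" for v i
    unfolding f_expand symplectic_combination[OF S'] by simp_all
  have pol: "pol ?t (f v) (f w) = pol t v w" for v w
    by (simp only: symplectic_form_expand[OF S', of "f v" "f w"] symplectic_form_expand[OF S, of v w] pol\<gamma> pol\<delta>)
  have "inj f"
    unfolding linear_injective_0[OF f_linear]
  proof (intro allI impI)
    fix v assume "f v = 0"
    then have "pol t v w = 0" for w using pol[of v w] skew_form_0[OF polarization_skew_form[OF is_tripleD(3)[OF t']]] by simp
    then show "v = 0" using symplectic_expand[OF S, of v] by simp
  qed
  then have bij: "bij f" using linear_injective_imp_surjective[OF f_linear] by (simp add: bij_def)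
  have lat: "f ` lat t = lat ?t"
  proof -
    have fc: "f (\<Sum>a\<in>UNIV. of_int (n a) *\<^sub>R case_sum \<gamma> \<delta> a) = (\<Sum>a\<in>UNIV. of_int (n a) *\<^sub>R case_sum ?\<gamma> ?\<delta> a)" for n
      by (simp add: linear_sum[OF f_linear] f_scaleR sum_UNIV_sum f\<gamma> f\<delta> f_add)
    have memL: "case_sum \<gamma> \<delta> a \<in> lat t" for a using mem by (cases a) auto
    have "lat t = {\<Sum>a\<in>UNIV. of_int (n a) *\<^sub>R case_sum \<gamma> \<delta> a | n. True}"
    proof (intro equalityI subsetI)
      fix x assume "x \<in> lat t"
      then show "x \<in> {\<Sum>a\<in>UNIV. of_int (n a) *\<^sub>R case_sum \<gamma> \<delta> a | n. True}"
        using sb unfolding integral_symplectic_basis_def lattice_basis_def by blast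
    next
      fix x assume "x \<in> {\<Sum>a\<in>UNIV. of_int (n a) *\<^sub>R case_sum \<gamma> \<delta> a | n. True}"
      then obtain n where x: "x = (\<Sum>a\<in>UNIV. of_int (n a) *\<^sub>R case_sum \<gamma> \<delta> a)" by blast
      show "x \<in> lat t"
        unfolding x by (intro int_subgroup_sum[OF is_tripleD(2)[OF t]] int_subgroup_of_int[OF is_tripleD(2)[OF t]] memL)
    qed
    then have "f ` lat t = {f (\<Sum>a\<in>UNIV. of_int (n a) *\<^sub>R case_sum \<gamma> \<delta> a) | n. True}"
      by (simp only: setcompr_eq_image image_image)
    then show ?thesis
      unfolding fc by (simp only: matrix_triple_sel siegel_lattice_eq)
  qed
  have om: "om ?t j (f x) = om t j x" if "x \<in> lat t" for j x
  proof -
    have "f x \<in> siegel_lattice ?\<tau>" using lat that by (auto simp: matrix_triple_sel)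
    then show ?thesis using that by (simp only: matrix_triple_sel a(1) restrict0_def f_a if_True)
  qed
  have et: "et ?t j (f x) = et t j x" if x: "x \<in> lat t" for j x
  proof -
    obtain n where n: "x = (\<Sum>a\<in>UNIV. of_int (n a) *\<^sub>R case_sum \<gamma> \<delta> a)"
      "\<And>i. pol t x (\<delta> i) = of_int (n (Inl i))" "\<And>i. pol t x (\<gamma> i) = - of_int (n (Inr i))"
      by (rule symplectic_int_expand[OF S polarization_int[OF is_tripleD(3)[OF t]] _ _ x])
        (use mem in \<open>auto intro: that\<close>)
    have memL: "case_sum \<gamma> \<delta> a \<in> lat t" for a using mem by (cases a) auto
    have "et t j x = (\<Sum>a\<in>UNIV. of_int (n a) * et t j (case_sum \<gamma> \<delta> a))"
      unfolding n(1) by (rule H1dR_int_combination[OF is_tripleD(2,5)[OF t] memL])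
    also have "\<dots> = (\<Sum>i\<in>UNIV. of_int (n (Inl i)) * M $ Inr i $ Inl j + of_int (n (Inr i)) * M $ Inl i $ Inl j)"
      by (simp add: sum_UNIV_sum M_def sum.distrib)
    finally have e: "et t j x = \<dots>" .
    have sw: "siegel_form ?\<tau> (axis i 1) (f x) = of_int (n (Inr i))" "siegel_form ?\<tau> (column i ?\<tau>) (f x) = - of_int (n (Inl i))" for i
      using pol\<gamma>[of x i] pol\<delta>[of x i] n(2,3)[of i] skew_form_swap[of "siegel_form ?\<tau>" "axis i 1" "f x"]
        skew_form_swap[of "siegel_form ?\<tau>" "column i ?\<tau>" "f x"] S'
      by (simp_all add: matrix_triple_sel symplectic_relations_def)
    have "f x \<in> siegel_lattice ?\<tau>" using lat that by (auto simp: matrix_triple_sel)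
    then show ?thesis
      unfolding e by (simp add: matrix_triple_sel restrict0_def sw add.commute)
  qed
  have "is_triple_iso t ?t f"
    unfolding is_triple_iso_def using f_lin bij lat pol om et by blast
  then show ?thesis
    using t t' by (auto simp: triple_iso_iff M_def)
qed

section \<open>Classes of triples and orbits of period matrices\<close>

text \<open>The description in \<open>period_map\<close> is unambiguous: an isomorphism keeps the
  period matrix, and another symplectic basis multiplies it by an element of
  \<open>Sp_Z\<close>.\<close>

lemma period_map_triple_class:
  assumes t: "is_triple t" and sb: "integral_symplectic_basis (lat t) (pol t) \<gamma> \<delta>"
  shows "period_map (triple_class t) = Sp_Z_class (period_matrix t \<gamma> \<delta>)"
  unfolding period_map_def
proof (rule the_equality)
  have "t \<in> triple_class t" using t is_triple_iso_id by (auto simp: mem_triple_class_iff triple_iso_iff)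
  then show "\<exists>t'\<in>triple_class t. \<exists>\<gamma>' \<delta>'. integral_symplectic_basis (lat t') (pol t') \<gamma>' \<delta>' \<and>
      Sp_Z_class (period_matrix t \<gamma> \<delta>) = Sp_Z_class (period_matrix t' \<gamma>' \<delta>')"
    using sb by blast
  fix q assume "\<exists>t'\<in>triple_class t. \<exists>\<gamma>' \<delta>'. integral_symplectic_basis (lat t') (pol t') \<gamma>' \<delta>' \<and>
      q = Sp_Z_class (period_matrix t' \<gamma>' \<delta>')"
  then obtain t' \<gamma>' \<delta>' where t': "t' \<in> triple_class t" "integral_symplectic_basis (lat t') (pol t') \<gamma>' \<delta>'"
    and q: "q = Sp_Z_class (period_matrix t' \<gamma>' \<delta>')" by blast
  then obtain f where tt: "is_triple t'" and f: "is_triple_iso t t' f"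
    using t by (auto simp: mem_triple_class_iff triple_iso_iff)
  note pf = period_matrix_iso[OF t tt f sb]
  obtain S where "S \<in> Sp_Z" "period_matrix t' \<gamma>' \<delta>' = S ** period_matrix t' (f \<circ> \<gamma>) (f \<circ> \<delta>)"
    by (rule period_matrix_change_basis[OF tt pf(1) t'(2)])
  then show "q = Sp_Z_class (period_matrix t \<gamma> \<delta>)"
    by (simp add: q pf(2) Sp_Z_class_mult)
qed

text \<open>Restricted to positive symplectic matrices this is the quotient map onto the moduli
  space; its fibres there are the orbits of \<open>Sp_Z\<close>.\<close>

definition matrix_class :: "complex^('g::finite + 'g)^('g + 'g) \<Rightarrow> 'g triple set" where
  "matrix_class M = triple_class (matrix_triple M)"

lemma matrix_class_in_B_set: "M \<in> Sp_C \<Longrightarrow> hpos M \<Longrightarrow> matrix_class M \<in> B_set"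
  unfolding matrix_class_def by (intro triple_class_in_B_set is_triple_matrix_triple)

lemma triple_class_eq_matrix_class:
  assumes t: "is_triple t" and sb: "integral_symplectic_basis (lat t) (pol t) \<gamma> \<delta>"
  shows "triple_class t = matrix_class (period_matrix t \<gamma> \<delta>)"
  unfolding matrix_class_def
  using triple_iso_matrix_triple[OF t sb]
    triple_class_eq_iff[OF t is_triple_matrix_triple[OF period_matrix_in_Sp_C[OF t sb] period_matrix_hpos[OF t sb]]]
  by simp

lemma period_map_matrix_class:
  assumes M: "M \<in> Sp_C" "hpos M" shows "period_map (matrix_class M) = Sp_Z_class M"
proof -
  have "integral_symplectic_basis (lat (matrix_triple M)) (pol (matrix_triple M)) (\<lambda>i. axis i 1) (\<lambda>i. column i (tau_of M))"
    using siegel_lattice_polarization[OF hpos_tau_of(2)[OF M]] by (simp add: matrix_triple_sel)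
  from period_map_triple_class[OF is_triple_matrix_triple[OF M] this]
  show ?thesis by (simp add: matrix_class_def period_matrix_matrix_triple[OF M])
qed

lemma B_set_matrix_class:
  assumes "p \<in> B_set"
  obtains M where "M \<in> Sp_C" "hpos M" "p = matrix_class M"
proof -
  obtain t where t: "is_triple t" "p = triple_class t" by (rule B_setE[OF assms])
  obtain \<gamma> \<delta> where sb: "integral_symplectic_basis (lat t) (pol t) \<gamma> \<delta>"
    by (rule exists_integral_symplectic_basis[OF is_tripleD(1,3)[OF t(1)]])
  show ?thesis
    by (rule that[OF period_matrix_in_Sp_C[OF t(1) sb] period_matrix_hpos[OF t(1) sb]])
      (simp add: t(2) triple_class_eq_matrix_class[OF t(1) sb])
qed

text \<open>The converse of the change of basis: every \<open>S\<close> in \<open>Sp_Z\<close>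
  occurs. In the order \<open>\<delta>\<close>, \<open>\<gamma>\<close> the Gram matrix of the
  polarization is \<open>- J_matrix\<close>, so the rows of \<open>S\<close> define a system with
  the same relations, and such a system is automatically a lattice basis.\<close>

lemma integral_symplectic_basis_transform:
  fixes t :: "'g::finite triple"
  assumes t: "is_triple t" and sb: "integral_symplectic_basis (lat t) (pol t) \<gamma> \<delta>" and S: "S \<in> Sp_Z"
  obtains \<gamma>' \<delta>' where "integral_symplectic_basis (lat t) (pol t) \<gamma>' \<delta>'"
    "period_matrix t \<gamma>' \<delta>' = S ** period_matrix t \<gamma> \<delta>"
proof -
  have "\<forall>a b. \<exists>k. S $ a $ b = of_int k" using S unfolding Sp_Z_def by (metis (mono_tags, lifting) Ints_cases mem_Collect_eq)
  then obtain n where n: "\<And>a b. S $ a $ b = of_int (n a b)" by metis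
  note sg = is_tripleD(2)[OF t] and pp = is_tripleD(3)[OF t]
  have E: "skew_form (pol t)" by (rule polarization_skew_form[OF pp])
  have R: "symplectic_relations (pol t) \<gamma> \<delta>" and mem: "\<And>i. \<gamma> i \<in> lat t" "\<And>i. \<delta> i \<in> lat t"
    using sb integral_symplectic_basis_iff[OF pp] by auto
  have memL: "case_sum \<delta> \<gamma> a \<in> lat t" for a using mem by (cases a) auto
  define \<beta> where "\<beta> a = (\<Sum>b\<in>UNIV. of_int (n a b) *\<^sub>R case_sum \<delta> \<gamma> b)" for a
  have \<beta>L: "\<beta> a \<in> lat t" for a
    unfolding \<beta>_def by (intro int_subgroup_sum[OF sg] int_subgroup_of_int[OF sg] memL)
  have J: "of_real (pol t (case_sum \<delta> \<gamma> c) (case_sum \<delta> \<gamma> d)) = - J_matrix $ c $ d" for c d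
    by (cases c; cases d) (simp_all add: symplectic_relations_eqs[OF R])
  have "of_real (pol t (\<beta> a) (\<beta> b)) = - J_matrix $ a $ b" for a b
  proof -
    have "of_real (pol t (\<beta> a) (\<beta> b)) = (\<Sum>c\<in>UNIV. \<Sum>d\<in>UNIV. S $ a $ c * (S $ b $ d * of_real (pol t (case_sum \<delta> \<gamma> c) (case_sum \<delta> \<gamma> d))))"
      by (simp add: \<beta>_def skew_form_sum[OF E] skew_form_scale[OF E] n sum_distrib_left)
        (subst sum.swap, simp add: mult.left_commute)
    also have "\<dots> = - (\<Sum>d\<in>UNIV. (\<Sum>c\<in>UNIV. S $ a $ c * J_matrix $ c $ d) * S $ b $ d)"
      unfolding J sum_distrib_right by (subst sum.swap) (simp add: sum_negf mult_ac)
    also have "(\<Sum>d\<in>UNIV. (\<Sum>c\<in>UNIV. S $ a $ c * J_matrix $ c $ d) * S $ b $ d) = (S ** J_matrix ** transpose S) $ a $ b"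
      by (simp add: matrix_matrix_mult_def transpose_def)
    also have "\<dots> = J_matrix $ a $ b"
      using Sp_Z_subset[OF S] by (simp add: Sp_C_def)
    finally show ?thesis .
  qed
  then have \<beta>J: "complex_of_real (pol t (\<beta> a) (\<beta> b)) = - J_matrix $ a $ b" for a b .
  have "symplectic_relations (pol t) (\<beta> \<circ> Inr) (\<beta> \<circ> Inl)"
    unfolding symplectic_relations_def
  proof (intro conjI allI E)
    fix i j
    show "pol t ((\<beta> \<circ> Inr) i) ((\<beta> \<circ> Inr) j) = 0" "pol t ((\<beta> \<circ> Inl) i) ((\<beta> \<circ> Inl) j) = 0"
      using \<beta>J[of "Inr i" "Inr j"] \<beta>J[of "Inl i" "Inl j"] by simp_all
    show "pol t ((\<beta> \<circ> Inr) i) ((\<beta> \<circ> Inl) j) = (if i = j then 1 else 0)"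
      using \<beta>J[of "Inr i" "Inl j"] by (simp split: if_splits)
  qed
  then have sb': "integral_symplectic_basis (lat t) (pol t) (\<beta> \<circ> Inr) (\<beta> \<circ> Inl)"
    unfolding integral_symplectic_basis_iff[OF pp] using \<beta>L by auto
  have cs: "case_sum (\<beta> \<circ> Inl) (\<beta> \<circ> Inr) a = \<beta> a" for a by (cases a) simp_all
  have ev: "f (\<beta> a) = (\<Sum>b\<in>UNIV. of_int (n a b) * f (case_sum \<delta> \<gamma> b))" if "f \<in> H1dR (lat t)" for f a
    unfolding \<beta>_def by (rule H1dR_int_combination[OF sg that memL])
  have "period_matrix t (\<beta> \<circ> Inr) (\<beta> \<circ> Inl) $ a $ c = (S ** period_matrix t \<gamma> \<delta>) $ a $ c" for a c
    by (cases c) (simp_all add: cs matrix_matrix_mult_def n ev[OF is_tripleD(5)[OF t]] ev[OF is_tripleD(4)[OF t]] sum_divide_distrib)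
  then have "period_matrix t (\<beta> \<circ> Inr) (\<beta> \<circ> Inl) = S ** period_matrix t \<gamma> \<delta>" by (simp add: vec_eq_iff)
  with sb' show ?thesis by (rule that)
qed

text \<open>\<open>S ** M\<close> is a period matrix of the same triple in another basis.\<close>

lemma matrix_class_mult:
  assumes M: "M \<in> Sp_C" "hpos M" and S: "S \<in> Sp_Z"
  shows "matrix_class (S ** M) = matrix_class M"
proof -
  let ?t = "matrix_triple M"
  have t: "is_triple ?t" by (rule is_triple_matrix_triple[OF M])
  have "integral_symplectic_basis (lat ?t) (pol ?t) (\<lambda>i. axis i 1) (\<lambda>i. column i (tau_of M))"
    using siegel_lattice_polarization[OF hpos_tau_of(2)[OF M]] by (simp add: matrix_triple_sel)
  from integral_symplectic_basis_transform[OF t this S] obtain \<gamma>' \<delta>'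
    where "integral_symplectic_basis (lat ?t) (pol ?t) \<gamma>' \<delta>'" "period_matrix ?t \<gamma>' \<delta>' = S ** M"
    unfolding period_matrix_matrix_triple[OF M] by metis
  then show ?thesis using triple_class_eq_matrix_class[OF t] by (simp add: matrix_class_def)
qed

lemma matrix_class_eq_iff:
  assumes M: "M \<in> Sp_C" "hpos M" and N: "N \<in> Sp_C" "hpos N"
  shows "matrix_class M = matrix_class N \<longleftrightarrow> Sp_Z_class M = Sp_Z_class N"
proof
  assume "Sp_Z_class M = Sp_Z_class N"
  then obtain S where "S \<in> Sp_Z" "N = S ** M" unfolding Sp_Z_class_eq_iff by blast
  then show "matrix_class M = matrix_class N" using matrix_class_mult[OF M] by simp
qed (metis period_map_matrix_class M N)

section \<open>The complex structure on the moduli space\<close>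

lemma openin_B_space_iff_test:
  "openin (Top B_space) W \<longleftrightarrow> W \<subseteq> B_set \<and> (\<forall>U F. test_family U F \<longrightarrow> open {u \<in> U. triple_class (F u) \<in> W})"
proof -
  let ?P = "\<lambda>W :: 'a triple set set. W \<subseteq> B_set \<and> (\<forall>U F. test_family U F \<longrightarrow> open {u \<in> U. triple_class (F u) \<in> W})"
  have "istopology ?P"
    unfolding istopology_def
  proof (intro conjI allI impI)
    fix S T :: "'a triple set set" and U and F :: "complex^('a + 'a)^('a + 'a) \<Rightarrow> 'a triple"
    assume S: "?P S" and T: "?P T"
    then show "S \<inter> T \<subseteq> B_set" by blast
    assume "test_family U F"
    then have "open ({u \<in> U. triple_class (F u) \<in> S} \<inter> {u \<in> U. triple_class (F u) \<in> T})"
      using S T by (intro open_Int) blast+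
    then show "open {u \<in> U. triple_class (F u) \<in> S \<inter> T}" by (rule back_subst[of "open"]) auto
  next
    fix K :: "'a triple set set set" and U and F :: "complex^('a + 'a)^('a + 'a) \<Rightarrow> 'a triple"
    assume K: "\<forall>S\<in>K. ?P S"
    show "\<Union>K \<subseteq> B_set" using K by auto
    assume "test_family U F"
    then have "open (\<Union>S\<in>K. {u \<in> U. triple_class (F u) \<in> S})"
      using K by (intro open_UN) blast
    then show "open {u \<in> U. triple_class (F u) \<in> \<Union>K}" by (rule back_subst[of "open"]) auto
  qed
  then show ?thesis by (simp add: B_space_def topology_inverse')
qed

lemma test_familyD:
  assumes "test_family U F"
  shows "open U" "u \<in> U \<Longrightarrow> is_triple (F u)" "holomorphic_family (matrix_submanifold U) F"
  using assms by (auto simp: test_family_def holomorphic_family_def)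

lemma topspace_B_space: "topspace (Top (B_space :: 'a::finite triple set cspace)) = B_set"
proof -
  have "openin (Top (B_space :: 'a triple set cspace)) B_set"
    unfolding openin_B_space_iff_test
  proof (intro conjI allI impI subset_refl)
    fix U :: "(complex^('a + 'a)^('a + 'a)) set" and F :: "complex^('a + 'a)^('a + 'a) \<Rightarrow> 'a triple"
    assume tf: "test_family U F"
    have "triple_class (F u) \<in> B_set" if "u \<in> U" for u
      by (rule triple_class_in_B_set[OF test_familyD(2)[OF tf that]])
    then have "{u \<in> U. triple_class (F u) \<in> B_set} = U" "open U"
      using test_familyD(1)[OF tf] by auto
    then show "open {u \<in> U. triple_class (F u) \<in> B_set}" by simp
  qed
  then have "B_set \<subseteq> topspace (Top (B_space :: 'a triple set cspace))" by (rule openin_subset)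
  moreover have "topspace (Top (B_space :: 'a triple set cspace)) \<subseteq> B_set"
    using openin_topspace[of "Top (B_space :: 'a triple set cspace)"] unfolding openin_B_space_iff_test by (rule conjunct1)
  ultimately show ?thesis by (rule subset_antisym[rotated])
qed

lemma mem_Hol_B_space:
  "h \<in> Hol B_space W \<longleftrightarrow> (\<forall>U F. test_family U F \<longrightarrow>
     (\<lambda>u. h (triple_class (F u))) \<in> Hol (matrix_submanifold U) {u \<in> U. triple_class (F u) \<in> W})"
  by (simp add: B_space_def)

text \<open>Each property is checked after pull-back to the base of every test family, where it
  holds for submanifolds of matrices.\<close>

lemma hol_space_B_space: "hol_space (B_space :: 'g::finite triple set cspace)"
proof
  fix h h' f g :: "'g triple set \<Rightarrow> complex" and W W' :: "'g triple set set" and a :: complex and V :: "complex set"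
  have hs: "hol_space (matrix_submanifold U)" for U :: "(complex^('g + 'g)^('g + 'g)) set" by (rule hol_space_matrix_submanifold)
  note rules = hol_space.Hol_subset[OF hs] hol_space.Hol_const[OF hs] hol_space.Hol_add[OF hs] hol_space.Hol_mult[OF hs]
  show "(\<lambda>_. a) \<in> Hol B_space W" by (simp add: mem_Hol_B_space rules)
  show "(\<lambda>x. f x + g x) \<in> Hol B_space W" if "f \<in> Hol B_space W" "g \<in> Hol B_space W"
    using that by (simp add: mem_Hol_B_space rules)
  show "(\<lambda>x. f x * g x) \<in> Hol B_space W" if "f \<in> Hol B_space W" "g \<in> Hol B_space W"
    using that by (simp add: mem_Hol_B_space rules)
  assume h: "h \<in> Hol B_space W"
  show "h' \<in> Hol B_space W" if "\<And>x. x \<in> W \<Longrightarrow> h x = h' x"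
    unfolding mem_Hol_B_space
  proof (intro allI impI)
    fix U and F :: "complex^('g + 'g)^('g + 'g) \<Rightarrow> 'g triple" assume "test_family U F"
    then have "(\<lambda>u. h (triple_class (F u))) \<in> Hol (matrix_submanifold U) {u \<in> U. triple_class (F u) \<in> W}"
      using h by (simp add: mem_Hol_B_space)
    then show "(\<lambda>u. h' (triple_class (F u))) \<in> Hol (matrix_submanifold U) {u \<in> U. triple_class (F u) \<in> W}"
      by (rule hol_space.Hol_cong[OF hs]) (simp add: that)
  qed
  show "h \<in> Hol B_space W'" if W': "W' \<subseteq> W"
    unfolding mem_Hol_B_space
  proof (intro allI impI)
    fix U and F :: "complex^('g + 'g)^('g + 'g) \<Rightarrow> 'g triple" assume "test_family U F"
    then have "(\<lambda>u. h (triple_class (F u))) \<in> Hol (matrix_submanifold U) {u \<in> U. triple_class (F u) \<in> W}"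
      using h by (simp add: mem_Hol_B_space)
    then show "(\<lambda>u. h (triple_class (F u))) \<in> Hol (matrix_submanifold U) {u \<in> U. triple_class (F u) \<in> W'}"
      by (rule rules(1)) (use W' in blast)
  qed
  assume W: "openin (Top B_space) W" and V: "open V"
  show "openin (Top B_space) {x \<in> W. h x \<in> V}"
    unfolding openin_B_space_iff_test
  proof (intro conjI allI impI)
    show "{x \<in> W. h x \<in> V} \<subseteq> B_set" using W openin_B_space_iff_test by blast
    fix U :: "(complex^('g + 'g)^('g + 'g)) set" and F :: "complex^('g + 'g)^('g + 'g) \<Rightarrow> 'g triple"
    assume tf: "test_family U F"
    then have U: "open U" by (rule test_familyD)
    have "open {u \<in> U. triple_class (F u) \<in> W}" using W tf openin_B_space_iff_test by blast
    then have "openin (Top (matrix_submanifold U)) {u \<in> U. triple_class (F u) \<in> W}"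
      by (auto intro: open_subset)
    moreover have "(\<lambda>u. h (triple_class (F u))) \<in> Hol (matrix_submanifold U) {u \<in> U. triple_class (F u) \<in> W}"
      using h tf by (simp add: mem_Hol_B_space)
    ultimately have "openin (Top (matrix_submanifold U)) {u \<in> {u \<in> U. triple_class (F u) \<in> W}. h (triple_class (F u)) \<in> V}"
      by (rule hol_space.Hol_open[OF hs _ _ V])
    then have "open {u \<in> {u \<in> U. triple_class (F u) \<in> W}. h (triple_class (F u)) \<in> V}"
      using U by (simp add: openin_open_eq)
    then show "open {u \<in> U. triple_class (F u) \<in> {x \<in> W. h x \<in> V}}" by (rule back_subst[of "open"]) auto
  qed
qed

lemma matrix_triple_frame:
  assumes M: "M \<in> Sp_C" "hpos M"
  shows "lattice_basis (lat (matrix_triple M)) (case_sum (\<lambda>i. axis i 1) (\<lambda>i. column i (tau_of M)))"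
    "integral_symplectic_basis (lat (matrix_triple M)) (pol (matrix_triple M)) (\<lambda>i. axis i 1) (\<lambda>i. column i (tau_of M))"
    "om (matrix_triple M) j (axis i 1) = two_pi_i * M $ Inr i $ Inr j"
    "om (matrix_triple M) j (column i (tau_of M)) = two_pi_i * M $ Inl i $ Inr j"
    "et (matrix_triple M) j (axis i 1) = M $ Inr i $ Inl j"
    "et (matrix_triple M) j (column i (tau_of M)) = M $ Inl i $ Inl j"
proof -
  show sb: "integral_symplectic_basis (lat (matrix_triple M)) (pol (matrix_triple M)) (\<lambda>i. axis i 1) (\<lambda>i. column i (tau_of M))"
    using siegel_lattice_polarization[OF hpos_tau_of(2)[OF M]] by (simp add: matrix_triple_sel)
  then show "lattice_basis (lat (matrix_triple M)) (case_sum (\<lambda>i. axis i 1) (\<lambda>i. column i (tau_of M)))"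
    by (simp add: integral_symplectic_basis_def)
  have p: "period_matrix (matrix_triple M) (\<lambda>i. axis i 1) (\<lambda>i. column i (tau_of M)) $ a $ b = M $ a $ b" for a b
    by (simp add: period_matrix_matrix_triple[OF M])
  show "om (matrix_triple M) j (axis i 1) = two_pi_i * M $ Inr i $ Inr j" using p[of "Inr i" "Inr j"] by (simp add: field_simps)
  show "om (matrix_triple M) j (column i (tau_of M)) = two_pi_i * M $ Inl i $ Inr j" using p[of "Inl i" "Inr j"] by (simp add: field_simps)
  show "et (matrix_triple M) j (axis i 1) = M $ Inr i $ Inl j" using p[of "Inr i" "Inl j"] by simp
  show "et (matrix_triple M) j (column i (tau_of M)) = M $ Inl i $ Inl j" using p[of "Inl i" "Inl j"] by simp
qed

text \<open>This family detects the whole structure of \<open>B_space\<close>. Composing with the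
  retraction makes its base an open set of matrices; the standard vectors and the columns of
  \<open>tau_of\<close> form a holomorphic frame with constant pairings.\<close>

lemma test_family_retraction: "test_family Sp_cell (\<lambda>X. matrix_triple (Sp_retraction X))"
  unfolding test_family_def holomorphic_family_def
proof (intro conjI ballI)
  show "open (Sp_cell :: (complex^('a + 'a)^('a + 'a)) set)" by (rule open_Sp_cell)
  fix x :: "complex^('a + 'a)^('a + 'a)" assume "x \<in> points (matrix_submanifold Sp_cell)"
  then have x: "x \<in> Sp_cell" by simp
  show "is_triple (matrix_triple (Sp_retraction x))"
    by (rule is_triple_matrix_triple[OF Sp_cell_retraction[OF x]])
  let ?r = "Sp_retraction :: complex^('a + 'a)^('a + 'a) \<Rightarrow> complex^('a + 'a)^('a + 'a)"
  define b :: "'a + 'a \<Rightarrow> complex^('a + 'a)^('a + 'a) \<Rightarrow> complex^'a" where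
    "b a X = case_sum (\<lambda>i. axis i 1) (\<lambda>i. column i (tau_of (?r X))) a" for a X
  have Hol: "h \<in> Hol (matrix_submanifold Sp_cell) Sp_cell" if "matrix_holomorphic_on h Sp_cell" for h :: "complex^('a + 'a)^('a + 'a) \<Rightarrow> complex"
    by (rule matrix_holomorphic_on_imp_Hol[OF that open_Sp_cell]) simp
  have Hol': "h' \<in> Hol (matrix_submanifold Sp_cell) Sp_cell"
    if "matrix_holomorphic_on h Sp_cell" "\<And>X. X \<in> Sp_cell \<Longrightarrow> h X = h' X" for h h' :: "complex^('a + 'a)^('a + 'a) \<Rightarrow> complex"
    by (rule Hol[OF matrix_holomorphic_on_cong[OF open_Sp_cell that(2,1)]])
  have r: "matrix_holomorphic_on (\<lambda>X. ?r X $ a $ c) Sp_cell" for a c by (rule matrix_holomorphic_on_cell_retraction)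
  \<comment> \<open>\<open>tau_of\<close> is holomorphic where the lower right block is invertible,
    and the retraction maps the cell into itself.\<close>
  have tau: "matrix_holomorphic_on (\<lambda>X. tau_of (?r X) $ i $ j) Sp_cell" for i j
  proof -
    have 1: "matrix_holomorphic_on (\<lambda>X :: complex^('a + 'a)^('a + 'a). tau_of X $ i $ j) (Sp_cell \<inter> {X. det (block_22 X) \<noteq> 0})"
      using matrix_holomorphic_on_tau_of[OF open_Sp_cell, of i j]
      by (rule matrix_holomorphic_on_subset) (auto simp: Sp_cell_def)
    have 2: "?r ` Sp_cell \<subseteq> Sp_cell \<inter> {X. det (block_22 X) \<noteq> 0}"
      using Sp_cell_retraction Sp_C_hpos_in_cell by (force simp: Sp_cell_def)
    show ?thesis by (rule matrix_holomorphic_on_compose[OF 1 r 2])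
  qed
  show "\<exists>N b. openin (Top (matrix_submanifold Sp_cell)) N \<and> x \<in> N \<and>
        (\<forall>u\<in>N. lattice_basis (lat (matrix_triple (?r u))) (\<lambda>i. b i u)) \<and>
        (\<forall>i j. (\<lambda>u. b i u $ j) \<in> Hol (matrix_submanifold Sp_cell) N) \<and>
        (\<forall>u\<in>N. \<forall>i j. pol (matrix_triple (?r u)) (b i u) (b j u) = pol (matrix_triple (?r x)) (b i x) (b j x)) \<and>
        (\<forall>i j. (\<lambda>u. om (matrix_triple (?r u)) j (b i u)) \<in> Hol (matrix_submanifold Sp_cell) N \<and>
          (\<lambda>u. et (matrix_triple (?r u)) j (b i u)) \<in> Hol (matrix_submanifold Sp_cell) N)"
  proof (intro exI[of _ Sp_cell] exI[of _ b] conjI allI ballI)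
    show "openin (Top (matrix_submanifold Sp_cell)) Sp_cell" by simp
    show "x \<in> Sp_cell" by (rule x)
    show "lattice_basis (lat (matrix_triple (?r u))) (\<lambda>i. b i u)" if "u \<in> Sp_cell" for u
      unfolding b_def using matrix_triple_frame(1)[OF Sp_cell_retraction[OF that]] by simp
    show "(\<lambda>u. b i u $ j) \<in> Hol (matrix_submanifold Sp_cell) Sp_cell" for i j
      by (cases i) (auto simp: b_def column_def intro!: Hol matrix_holomorphic_on_const tau)
    have sb: "symplectic_relations (pol (matrix_triple (?r u))) (\<lambda>i. axis i 1) (\<lambda>i. column i (tau_of (?r u)))" if "u \<in> Sp_cell" for u
      using siegel_form_relations[OF hpos_tau_of(2)[OF Sp_cell_retraction[OF that]]] by (simp add: matrix_triple_sel)
    show "pol (matrix_triple (?r u)) (b i u) (b j u) = pol (matrix_triple (?r x)) (b i x) (b j x)" if "u \<in> Sp_cell" for u i j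
      by (cases i; cases j) (simp_all add: b_def symplectic_relations_eqs[OF sb[OF that]] symplectic_relations_eqs[OF sb[OF x]])
    note fr = matrix_triple_frame[OF Sp_cell_retraction]
    show "(\<lambda>u. om (matrix_triple (?r u)) j (b i u)) \<in> Hol (matrix_submanifold Sp_cell) Sp_cell" for i j
    proof (cases i)
      case (Inl k)
      show ?thesis
        by (rule Hol'[of "\<lambda>u. two_pi_i * ?r u $ Inr k $ Inr j"]) (intro matrix_holomorphic_intros r, simp add: b_def Inl fr)
    next
      case (Inr k)
      show ?thesis
        by (rule Hol'[of "\<lambda>u. two_pi_i * ?r u $ Inl k $ Inr j"]) (intro matrix_holomorphic_intros r, simp add: b_def Inr fr)
    qed
    show "(\<lambda>u. et (matrix_triple (?r u)) j (b i u)) \<in> Hol (matrix_submanifold Sp_cell) Sp_cell" for i j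
    proof (cases i)
      case (Inl k)
      show ?thesis
        by (rule Hol'[of "\<lambda>u. ?r u $ Inr k $ Inl j"]) (intro r, simp add: b_def Inl fr)
    next
      case (Inr k)
      show ?thesis
        by (rule Hol'[of "\<lambda>u. ?r u $ Inl k $ Inl j"]) (intro r, simp add: b_def Inr fr)
    qed
  qed
qed

section \<open>Period frames and the structure of the moduli space\<close>

text \<open>A local lift of the classifying map of \<open>F\<close> to the symplectic group: the
  period matrix in an integral symplectic basis that varies holomorphically.\<close>

definition period_frame ::
  "'a cspace \<Rightarrow> ('a \<Rightarrow> 'g::finite triple) \<Rightarrow> 'a set \<Rightarrow> ('g \<Rightarrow> 'a \<Rightarrow> complex^'g) \<Rightarrow> ('g \<Rightarrow> 'a \<Rightarrow> complex^'g) \<Rightarrow> bool" where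
  "period_frame X F N \<gamma> \<delta> \<longleftrightarrow> openin (Top X) N \<and> (\<forall>u\<in>N. is_triple (F u)) \<and>
     (\<forall>u\<in>N. integral_symplectic_basis (lat (F u)) (pol (F u)) (\<lambda>i. \<gamma> i u) (\<lambda>i. \<delta> i u)) \<and>
     (\<forall>i j. (\<lambda>u. \<gamma> i u $ j) \<in> Hol X N) \<and> (\<forall>i j. (\<lambda>u. \<delta> i u $ j) \<in> Hol X N) \<and>
     (\<forall>a c. (\<lambda>u. period_matrix (F u) (\<lambda>i. \<gamma> i u) (\<lambda>i. \<delta> i u) $ a $ c) \<in> Hol X N)"

lemma period_frameD:
  assumes "period_frame X F N \<gamma> \<delta>"
  shows "openin (Top X) N" "u \<in> N \<Longrightarrow> is_triple (F u)"
    "u \<in> N \<Longrightarrow> integral_symplectic_basis (lat (F u)) (pol (F u)) (\<lambda>i. \<gamma> i u) (\<lambda>i. \<delta> i u)"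
    "(\<lambda>u. \<gamma> i u $ j) \<in> Hol X N" "(\<lambda>u. \<delta> i u $ j) \<in> Hol X N"
    "(\<lambda>u. period_matrix (F u) (\<lambda>i. \<gamma> i u) (\<lambda>i. \<delta> i u) $ a $ c) \<in> Hol X N"
  using assms by (simp_all add: period_frame_def)

lemma period_frame_matrix:
  assumes "period_frame X F N \<gamma> \<delta>" "u \<in> N"
  shows "period_matrix (F u) (\<lambda>i. \<gamma> i u) (\<lambda>i. \<delta> i u) \<in> Sp_C"
    "hpos (period_matrix (F u) (\<lambda>i. \<gamma> i u) (\<lambda>i. \<delta> i u))"
    "triple_class (F u) = matrix_class (period_matrix (F u) (\<lambda>i. \<gamma> i u) (\<lambda>i. \<delta> i u))"
  using period_frameD(2,3)[OF assms] period_matrix_in_Sp_C period_matrix_hpos triple_class_eq_matrix_class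
  by blast+

text \<open>A symplectic basis at \<open>x\<close> is continued with fixed integral coordinates in
  the given frame. Since the polarization is constant on the frame, the symplectic relations persist
  over all of \<open>N\<close>.\<close>

lemma holomorphic_family_period_frame:
  fixes F :: "'a \<Rightarrow> 'g::finite triple"
  assumes X: "hol_space X" and F: "holomorphic_family X F" and x: "x \<in> points X"
  obtains N \<gamma> \<delta> where "x \<in> N" "period_frame X F N \<gamma> \<delta>"
proof -
  interpret hol_space X by (rule X)
  have ex: "\<exists>N b. openin (Top X) N \<and> x \<in> N \<and>
        (\<forall>u\<in>N. lattice_basis (lat (F u)) (\<lambda>i. b i u)) \<and>
        (\<forall>i j. (\<lambda>u. b i u $ j) \<in> Hol X N) \<and>
        (\<forall>u\<in>N. \<forall>i j. pol (F u) (b i u) (b j u) = pol (F x) (b i x) (b j x)) \<and>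
        (\<forall>i j. (\<lambda>u. om (F u) j (b i u)) \<in> Hol X N \<and> (\<lambda>u. et (F u) j (b i u)) \<in> Hol X N)"
    using F x unfolding holomorphic_family_def by (elim conjE) (erule bspec)
  then obtain N b where N: "openin (Top X) N" "x \<in> N"
    and lb: "\<forall>u\<in>N. lattice_basis (lat (F u)) (\<lambda>i. b i u)"
    and b: "\<forall>i j. (\<lambda>u. b i u $ j) \<in> Hol X N"
    and pol: "\<forall>u\<in>N. \<forall>i j. pol (F u) (b i u) (b j u) = pol (F x) (b i x) (b j x)"
    and forms: "\<forall>i j. (\<lambda>u. om (F u) j (b i u)) \<in> Hol X N \<and> (\<lambda>u. et (F u) j (b i u)) \<in> Hol X N"
    by (elim exE conjE)
  have NX: "u \<in> points X" if "u \<in> N" for u using openin_subset[OF N(1)] that by blast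
  have t: "is_triple (F u)" if "u \<in> N" for u
    using F NX[OF that] unfolding holomorphic_family_def by blast
  obtain \<gamma>0 \<delta>0 where sb: "integral_symplectic_basis (lat (F x)) (pol (F x)) \<gamma>0 \<delta>0"
    by (rule exists_integral_symplectic_basis[OF is_tripleD(1,3)[OF t[OF N(2)]]])
  have S: "symplectic_relations (pol (F x)) \<gamma>0 \<delta>0" and mem: "\<And>i. \<gamma>0 i \<in> lat (F x)" "\<And>i. \<delta>0 i \<in> lat (F x)"
    using sb integral_symplectic_basis_iff[OF is_tripleD(3)[OF t[OF N(2)]]] by auto
  have lbx: "lattice_basis (lat (F x)) (\<lambda>i. b i x)" using lb N by blast
  have "\<forall>a. \<exists>n. case_sum \<gamma>0 \<delta>0 a = (\<Sum>i\<in>UNIV. of_int (n i) *\<^sub>R b i x)"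
  proof
    fix a
    have "case_sum \<gamma>0 \<delta>0 a \<in> lat (F x)" using mem by (cases a) auto
    then show "\<exists>n. case_sum \<gamma>0 \<delta>0 a = (\<Sum>i\<in>UNIV. of_int (n i) *\<^sub>R b i x)"
      using lbx unfolding lattice_basis_def by blast
  qed
  then obtain n where n: "\<forall>a. case_sum \<gamma>0 \<delta>0 a = (\<Sum>i\<in>UNIV. of_int (n a i) *\<^sub>R b i x)" by metis
  define l where "l a u = (\<Sum>i\<in>UNIV. of_int (n a i) *\<^sub>R b i u)" for a u
  have lx: "l (Inl i) x = \<gamma>0 i" "l (Inr i) x = \<delta>0 i" for i
    using n[rule_format, of "Inl i"] n[rule_format, of "Inr i"] by (simp_all add: l_def)
  have bL: "b i u \<in> lat (F u)" if "u \<in> N" for i u using lb that lattice_basis_mem by blast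
  have lL: "l a u \<in> lat (F u)" if "u \<in> N" for a u
    unfolding l_def
    by (intro int_subgroup_sum[OF is_tripleD(2)[OF t[OF that]]] int_subgroup_of_int[OF is_tripleD(2)[OF t[OF that]]] bL that)
  have lpol: "pol (F u) (l a u) (l c u) = pol (F x) (l a x) (l c x)" if u: "u \<in> N" for a c u
  proof -
    have E: "skew_form (pol (F u))" if "u \<in> N" for u by (rule polarization_skew_form[OF is_tripleD(3)[OF t[OF that]]])
    have pu: "pol (F u) (b i u) (b j u) = pol (F x) (b i x) (b j x)" for i j using pol u by blast
    show ?thesis
      unfolding l_def skew_form_sum[OF E[OF u]] skew_form_scale[OF E[OF u]] skew_form_sum[OF E[OF N(2)]] skew_form_scale[OF E[OF N(2)]] pu ..
  qed
  have sbu: "integral_symplectic_basis (lat (F u)) (pol (F u)) (\<lambda>i. l (Inl i) u) (\<lambda>i. l (Inr i) u)" if u: "u \<in> N" for u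
  proof -
    have "symplectic_relations (pol (F u)) (\<lambda>i. l (Inl i) u) (\<lambda>i. l (Inr i) u)"
      unfolding symplectic_relations_def lpol[OF u] lx
      using S polarization_skew_form[OF is_tripleD(3)[OF t[OF u]]] unfolding symplectic_relations_def by blast
    then show ?thesis
      unfolding integral_symplectic_basis_iff[OF is_tripleD(3)[OF t[OF u]]] using lL[OF u] by auto
  qed
  have l_Hol: "(\<lambda>u. l a u $ j) \<in> Hol X N" for a j
    unfolding l_def sum_component vector_scaleR_component
    by (rule Hol_sum, rule Hol_scaleR) (use b in blast)
  have ev: "(\<lambda>u. f u (l a u)) \<in> Hol X N" if f: "\<And>u. u \<in> N \<Longrightarrow> f u \<in> H1dR (lat (F u))" and fb: "\<And>i. (\<lambda>u. f u (b i u)) \<in> Hol X N" for f :: "'a \<Rightarrow> complex^'g \<Rightarrow> complex" and a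
  proof (rule Hol_cong)
    show "(\<lambda>u. \<Sum>i\<in>UNIV. of_int (n a i) * f u (b i u)) \<in> Hol X N"
      by (rule Hol_sum, rule Hol_mult, rule Hol_const, rule fb)
    fix u assume u: "u \<in> N"
    show "(\<Sum>i\<in>UNIV. of_int (n a i) * f u (b i u)) = f u (l a u)"
      unfolding l_def by (rule H1dR_int_combination[OF is_tripleD(2)[OF t[OF u]] f[OF u] bL[OF u], symmetric])
  qed
  have om_Hol: "(\<lambda>u. om (F u) j (l a u)) \<in> Hol X N" and et_Hol: "(\<lambda>u. et (F u) j (l a u)) \<in> Hol X N" for j a
    by (rule ev; use is_tripleD(4,5)[OF t] forms in blast)+
  have P: "(\<lambda>u. period_matrix (F u) (\<lambda>i. l (Inl i) u) (\<lambda>i. l (Inr i) u) $ a $ c) \<in> Hol X N" for a c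
  proof -
    have cs: "case_sum (\<lambda>i. l (Inr i) u) (\<lambda>i. l (Inl i) u) a = l (case_sum Inr Inl a) u" for u by (cases a) simp_all
    show ?thesis
      using Hol_mult[OF om_Hol Hol_const[of "1 / two_pi_i"]] et_Hol
      by (cases c) (simp_all add: cs)
  qed
  have "period_frame X F N (\<lambda>i. l (Inl i)) (\<lambda>i. l (Inr i))"
    unfolding period_frame_def using N(1) t sbu l_Hol P by simp
  with N(2) show ?thesis by (rule that)
qed

definition lifted :: "'g::finite triple set set \<Rightarrow> (complex^('g + 'g)^('g + 'g)) set" where
  "lifted W = {M \<in> Sp_C. hpos M \<and> matrix_class M \<in> W}"

text \<open>On positive symplectic matrices the retraction is the identity, so the family over the
  cell restricts to \<open>matrix_class\<close>.\<close>

lemma cell_lifted: "Sp_C \<inter> {X \<in> Sp_cell. triple_class (matrix_triple (Sp_retraction X)) \<in> W} = lifted W"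
proof -
  have "M \<in> Sp_cell \<Longrightarrow> M \<in> Sp_C \<Longrightarrow> Sp_retraction M = M \<and> hpos M" for M :: "complex^('a + 'a)^('a + 'a)"
    using Sp_retraction_eq[of M] Sp_cell_retraction[of M] by (auto simp: Sp_cell_def invertible_det_nz)
  then show ?thesis
    using Sp_C_hpos_in_cell by (auto simp: lifted_def matrix_class_def)
qed

text \<open>One direction uses only the family over the cell. Conversely, every test family factors
  locally through \<open>matrix_class\<close> by its period matrix in a frame, whose entries are
  holomorphic and hence continuous.\<close>

lemma openin_B_space_iff:
  "openin (Top B_space) W \<longleftrightarrow> W \<subseteq> B_set \<and> openin (top_of_set Sp_C) (lifted W)"
proof
  assume W: "openin (Top B_space) W"
  then have "open {X \<in> Sp_cell. triple_class (matrix_triple (Sp_retraction X)) \<in> W}"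
    using test_family_retraction openin_B_space_iff_test by blast
  then have "openin (top_of_set Sp_C) (lifted W)"
    unfolding cell_lifted[symmetric] by (rule openin_open_Int)
  then show "W \<subseteq> B_set \<and> openin (top_of_set Sp_C) (lifted W)"
    using W openin_B_space_iff_test by blast
next
  assume W: "W \<subseteq> B_set \<and> openin (top_of_set Sp_C) (lifted W)"
  then obtain T where T: "open T" "lifted W = Sp_C \<inter> T" by (auto simp: openin_open)
  show "openin (Top B_space) W"
    unfolding openin_B_space_iff_test
  proof (intro conjI allI impI)
    show "W \<subseteq> B_set" using W by blast
    fix U :: "(complex^('a + 'a)^('a + 'a)) set" and F :: "complex^('a + 'a)^('a + 'a) \<Rightarrow> 'a triple"
    assume tf: "test_family U F"
    note U = test_familyD[OF tf]
    interpret hol_space "matrix_submanifold U" by (rule hol_space_matrix_submanifold)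
    show "open {u \<in> U. triple_class (F u) \<in> W}"
    proof (subst open_subopen, intro ballI)
      fix x assume x: "x \<in> {u \<in> U. triple_class (F u) \<in> W}"
      then have "x \<in> points (matrix_submanifold U)" by simp
      then obtain N \<gamma> \<delta> where N: "x \<in> N" and pf: "period_frame (matrix_submanifold U) F N \<gamma> \<delta>"
        by (rule holomorphic_family_period_frame[OF hol_space_axioms U(3)])
      note pfD = period_frameD[OF pf] and pm = period_frame_matrix[OF pf]
      let ?P = "\<lambda>u. period_matrix (F u) (\<lambda>i. \<gamma> i u) (\<lambda>i. \<delta> i u)"
      have iff: "?P u \<in> T \<longleftrightarrow> triple_class (F u) \<in> W" if u: "u \<in> N" for u
      proof -
        have "?P u \<in> T \<longleftrightarrow> ?P u \<in> lifted W" using T pm(1)[OF u] by simp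
        also have "\<dots> \<longleftrightarrow> triple_class (F u) \<in> W"
          using pm[OF u] by (simp add: lifted_def)
        finally show ?thesis .
      qed
      have "openin (Top (matrix_submanifold U)) {u \<in> N. ?P u \<in> T}"
        by (rule Hol_matrix_open[OF pfD(1) pfD(6) T(1)])
      then have "open {u \<in> N. ?P u \<in> T}" using U(1) by (simp add: openin_open_eq)
      moreover have "N \<subseteq> U" using openin_subset[OF pfD(1)] by simp
      ultimately show "\<exists>T. open T \<and> x \<in> T \<and> T \<subseteq> {u \<in> U. triple_class (F u) \<in> W}"
        using x N iff by (intro exI[of _ "{u \<in> N. ?P u \<in> T}"]) auto
    qed
  qed
qed

text \<open>An ambient extension of the function pulled back to the cell also extends its lift to
  \<open>Sp_C\<close>. In the other direction, along any test family the function is locally the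
  lift composed with a holomorphic period matrix.\<close>

lemma Hol_B_space_iff:
  "h \<in> Hol B_space W \<longleftrightarrow> h \<circ> matrix_class \<in> Hol Sp_manifold (lifted W)"
proof
  assume "h \<in> Hol B_space W"
  then have h: "(\<lambda>X. h (triple_class (matrix_triple (Sp_retraction X)))) \<in> Hol (matrix_submanifold Sp_cell) {X \<in> Sp_cell. triple_class (matrix_triple (Sp_retraction X)) \<in> W}"
    using test_family_retraction unfolding mem_Hol_B_space by blast
  show "h \<circ> matrix_class \<in> Hol Sp_manifold (lifted W)"
  proof (rule Hol_matrix_submanifoldI)
    fix A assume A: "A \<in> lifted W"
    then have "A \<in> {X \<in> Sp_cell. triple_class (matrix_triple (Sp_retraction X)) \<in> W}" using cell_lifted by blast
    from Hol_matrix_submanifoldD[OF h this] obtain N H where N: "open N" "A \<in> N" "matrix_holomorphic_on H N"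
      "\<And>X. X \<in> N \<Longrightarrow> X \<in> {X \<in> Sp_cell. triple_class (matrix_triple (Sp_retraction X)) \<in> W} \<Longrightarrow> H X = h (triple_class (matrix_triple (Sp_retraction X)))"
      by blast
    have "H X = (h \<circ> matrix_class) X" if X: "X \<in> N \<inter> lifted W" for X
    proof -
      have "X \<in> {X \<in> Sp_cell. triple_class (matrix_triple (Sp_retraction X)) \<in> W}" "X \<in> Sp_C" using X cell_lifted[of W] by auto
      moreover from this have "Sp_retraction X = X" using Sp_retraction_eq[of X] by (auto simp: Sp_cell_def invertible_det_nz)
      ultimately show ?thesis using N(4)[of X] X by (simp add: matrix_class_def)
    qed
    then show "\<exists>N H. open N \<and> A \<in> N \<and> matrix_holomorphic_on H N \<and> (\<forall>X\<in>N \<inter> lifted W. H X = (h \<circ> matrix_class) X)"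
      using N(1-3) by (intro exI[of _ N] exI[of _ H]) simp
  qed
next
  assume h: "h \<circ> matrix_class \<in> Hol Sp_manifold (lifted W)"
  show "h \<in> Hol B_space W"
    unfolding mem_Hol_B_space
  proof (intro allI impI)
    fix U :: "(complex^('a + 'a)^('a + 'a)) set" and F :: "complex^('a + 'a)^('a + 'a) \<Rightarrow> 'a triple"
    assume tf: "test_family U F"
    note U = test_familyD[OF tf]
    interpret hol_space "matrix_submanifold U" by (rule hol_space_matrix_submanifold)
    show "(\<lambda>u. h (triple_class (F u))) \<in> Hol (matrix_submanifold U) {u \<in> U. triple_class (F u) \<in> W}"
    proof (rule Hol_matrix_submanifoldI)
      fix x assume x: "x \<in> {u \<in> U. triple_class (F u) \<in> W}"
      then have "x \<in> points (matrix_submanifold U)" by simp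
      then obtain N \<gamma> \<delta> where N: "x \<in> N" and pf: "period_frame (matrix_submanifold U) F N \<gamma> \<delta>"
        by (rule holomorphic_family_period_frame[OF hol_space_axioms U(3)])
      note pfD = period_frameD[OF pf] and pm = period_frame_matrix[OF pf]
      let ?P = "\<lambda>u. period_matrix (F u) (\<lambda>i. \<gamma> i u) (\<lambda>i. \<delta> i u)"
      let ?W = "{u \<in> N. triple_class (F u) \<in> W}"
      have oN: "open N" using pfD(1) U(1) by (simp add: openin_open_eq)
      have "(\<lambda>u. (h \<circ> matrix_class) (?P u)) \<in> Hol (matrix_submanifold U) ?W"
      proof (rule Hol_matrix_submanifold_compose[OF _ h])
        show "(\<lambda>u. ?P u $ a $ c) \<in> Hol (matrix_submanifold U) ?W" for a c
          by (rule Hol_subset[OF pfD(6)]) blast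
        show "?P ` ?W \<subseteq> lifted W" using pm by (auto simp: lifted_def)
      qed
      from Hol_matrix_submanifoldD[OF this, of x] obtain N' H where N': "open N'" "x \<in> N'" "matrix_holomorphic_on H N'"
        "\<And>X. X \<in> N' \<Longrightarrow> X \<in> ?W \<Longrightarrow> H X = (h \<circ> matrix_class) (?P X)" using x N by blast
      show "\<exists>N H. open N \<and> x \<in> N \<and> matrix_holomorphic_on H N \<and>
          (\<forall>X\<in>N \<inter> {u \<in> U. triple_class (F u) \<in> W}. H X = h (triple_class (F X)))"
      proof (intro exI conjI ballI)
        show "open (N \<inter> N')" "x \<in> N \<inter> N'" "matrix_holomorphic_on H (N \<inter> N')"
          using oN N N' by (auto intro: matrix_holomorphic_on_subset)
        fix X assume "X \<in> N \<inter> N' \<inter> {u \<in> U. triple_class (F u) \<in> W}"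
        then show "H X = h (triple_class (F X))" using N'(4)[of X] pm(3)[of X] by simp
      qed
    qed
  qed
qed

section \<open>Left invariant vector fields\<close>

lemma openin_Sp_quotient_iff:
  "openin (Top Sp_quotient) W \<longleftrightarrow> W \<subseteq> Sp_Z_class ` Sp_C \<and> openin (top_of_set Sp_C) {M \<in> Sp_C. Sp_Z_class M \<in> W}"
proof -
  let ?P = "\<lambda>W :: (complex^('a + 'a)^('a + 'a)) set set. W \<subseteq> Sp_Z_class ` Sp_C \<and> openin (top_of_set Sp_C) {M \<in> Sp_C. Sp_Z_class M \<in> W}"
  have "istopology ?P"
    unfolding istopology_def
  proof (intro conjI allI impI)
    fix S T :: "(complex^('a + 'a)^('a + 'a)) set set"
    assume S: "?P S" and T: "?P T"
    then show "S \<inter> T \<subseteq> Sp_Z_class ` Sp_C" by blast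
    have "openin (top_of_set Sp_C) ({M \<in> Sp_C. Sp_Z_class M \<in> S} \<inter> {M \<in> Sp_C. Sp_Z_class M \<in> T})"
      using S T by (intro openin_Int) auto
    then show "openin (top_of_set Sp_C) {M \<in> Sp_C. Sp_Z_class M \<in> S \<inter> T}"
      by (rule back_subst[of "openin (top_of_set Sp_C)"]) auto
  next
    fix K :: "(complex^('a + 'a)^('a + 'a)) set set set"
    assume K: "\<forall>S\<in>K. ?P S"
    show "\<Union>K \<subseteq> Sp_Z_class ` Sp_C" using K by auto
    have "openin (top_of_set Sp_C) (\<Union>S\<in>K. {M \<in> Sp_C. Sp_Z_class M \<in> S})"
      using K by (intro openin_Union) auto
    then show "openin (top_of_set Sp_C) {M \<in> Sp_C. Sp_Z_class M \<in> \<Union>K}"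
      by (rule back_subst[of "openin (top_of_set Sp_C)"]) auto
  qed
  then show ?thesis by (simp add: Sp_quotient_def topology_inverse')
qed

lemma topspace_Sp_quotient: "topspace (Top (Sp_quotient :: (complex^('g::finite + 'g)^('g + 'g)) set cspace)) = Sp_Z_class ` Sp_C"
proof -
  have "openin (Top (Sp_quotient :: (complex^('g + 'g)^('g + 'g)) set cspace)) (Sp_Z_class ` Sp_C)"
  proof -
    have "{M \<in> Sp_C :: (complex^('g + 'g)^('g + 'g)) set. Sp_Z_class M \<in> Sp_Z_class ` Sp_C} = Sp_C" by auto
    then show ?thesis by (simp add: openin_Sp_quotient_iff)
  qed
  then have "Sp_Z_class ` Sp_C \<subseteq> topspace (Top (Sp_quotient :: (complex^('g + 'g)^('g + 'g)) set cspace))"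
    by (rule openin_subset)
  moreover have "topspace (Top (Sp_quotient :: (complex^('g + 'g)^('g + 'g)) set cspace)) \<subseteq> Sp_Z_class ` Sp_C"
    using openin_topspace[of "Top (Sp_quotient :: (complex^('g + 'g)^('g + 'g)) set cspace)"]
    unfolding openin_Sp_quotient_iff by (rule conjunct1)
  ultimately show ?thesis by (rule subset_antisym[rotated])
qed

lemma mem_Hol_Sp_quotient:
  "h \<in> Hol Sp_quotient W \<longleftrightarrow> h \<circ> Sp_Z_class \<in> Hol Sp_manifold {M \<in> Sp_C. Sp_Z_class M \<in> W}"
  by (simp add: Sp_quotient_def)

lemma period_domain_subset: "period_domain \<subseteq> Sp_Z_class ` Sp_C"
  by (auto simp: period_domain_def)

lemma period_domain_preimage: "{M \<in> Sp_C. Sp_Z_class M \<in> period_domain} = Sp_C \<inter> {M. hpos M}"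
  using Sp_Z_class_in_period_domain_iff by blast

lemma openin_period_domain: "openin (Top Sp_quotient) period_domain"
  unfolding openin_Sp_quotient_iff period_domain_preimage
  by (intro conjI period_domain_subset openin_open_Int open_hpos)

lemma openin_open_subspace_period_domain:
  "openin (Top (open_subspace Sp_quotient period_domain)) W \<longleftrightarrow> openin (Top Sp_quotient) W \<and> W \<subseteq> period_domain"
  by (simp add: open_subspace_def openin_open_subtopology[OF openin_period_domain])

lemma points_open_subspace_period_domain: "points (open_subspace Sp_quotient period_domain) = period_domain"
  using period_domain_subset by (auto simp: open_subspace_def topspace_Sp_quotient)

lemma Sp_Z_class_repr:
  assumes "q \<in> period_domain"
  obtains M where "M \<in> Sp_C" "hpos M" "q = Sp_Z_class M"
proof -
  obtain M where M: "M \<in> Sp_C" "q = Sp_Z_class M" using assms period_domain_subset by blast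
  then have "hpos M" using assms Sp_Z_class_in_period_domain_iff by blast
  with M show ?thesis using that by blast
qed

lemma period_map_in_period_domain: "p \<in> B_set \<Longrightarrow> period_map p \<in> period_domain"
  by (metis B_set_matrix_class period_map_matrix_class Sp_Z_class_in_period_domain_iff)

text \<open>Since \<open>period_map\<close> after \<open>matrix_class\<close> is
  \<open>Sp_Z_class\<close> on positive matrices, openness and holomorphy on both sides are tested
  on the same subset of \<open>Sp_C\<close>.\<close>

lemma lifted_period_map:
  "V \<subseteq> period_domain \<Longrightarrow> lifted {p \<in> B_set. period_map p \<in> V} = {M \<in> Sp_C. Sp_Z_class M \<in> V}"
  using Sp_Z_class_in_period_domain_iff by (auto simp: lifted_def period_map_matrix_class matrix_class_in_B_set)

lemma Hol_Sp_cong: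
  "h \<in> Hol Sp_manifold W \<Longrightarrow> (\<And>M. M \<in> W \<Longrightarrow> h M = h' M) \<Longrightarrow> h' \<in> Hol Sp_manifold W"
  by (rule hol_space.Hol_cong[OF hol_space_matrix_submanifold])

lemma holomorphic_map_period_map:
  "holomorphic_map (B_space :: 'g::finite triple set cspace) (open_subspace Sp_quotient period_domain) period_map"
  unfolding holomorphic_map_def continuous_map_def topspace_B_space points_open_subspace_period_domain
    openin_open_subspace_period_domain
proof (intro conjI allI impI)
  show "period_map \<in> (B_set :: 'g triple set set) \<rightarrow> period_domain" using period_map_in_period_domain by blast
  fix V :: "(complex^('g + 'g)^('g + 'g)) set set"
  {
    assume V: "openin (Top Sp_quotient) V \<and> V \<subseteq> period_domain"
    then show "openin (Top (B_space :: 'g triple set cspace)) {p \<in> B_set. period_map p \<in> V}"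
      unfolding openin_B_space_iff using V lifted_period_map[of V] by (auto simp: openin_Sp_quotient_iff)
  next
    fix h assume *: "(openin (Top Sp_quotient) V \<and> V \<subseteq> period_domain) \<and> h \<in> Hol (open_subspace Sp_quotient period_domain) V"
    then have h: "h \<circ> Sp_Z_class \<in> Hol Sp_manifold {M \<in> Sp_C. Sp_Z_class M \<in> V}"
      by (simp add: open_subspace_def mem_Hol_Sp_quotient)
    show "h \<circ> period_map \<in> Hol B_space {p \<in> B_set. period_map p \<in> V}"
      unfolding Hol_B_space_iff
    proof (rule Hol_Sp_cong)
      show "h \<circ> Sp_Z_class \<in> Hol Sp_manifold (lifted {p \<in> B_set. period_map p \<in> V})"
        using h * by (simp only: lifted_period_map)
    qed (simp add: lifted_def period_map_matrix_class)
  }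
qed

text \<open>Both spaces carry the structure induced from positive symplectic matrices, by
  \<open>matrix_class\<close> and by \<open>Sp_Z_class\<close>, and these maps have the same fibres.
  The inverse picks any positive representative; the choice is immaterial because
  \<open>matrix_class\<close> is constant on orbits.\<close>

lemma biholomorphic_map_period_map:
  "biholomorphic_map (B_space :: 'g::finite triple set cspace) (open_subspace Sp_quotient period_domain) period_map"
proof -
  define g :: "(complex^('g + 'g)^('g + 'g)) set \<Rightarrow> 'g triple set" where
    "g q = matrix_class (SOME M. M \<in> Sp_C \<and> hpos M \<and> q = Sp_Z_class M)" for q
  have g: "g (Sp_Z_class M) = matrix_class M" if M: "M \<in> Sp_C" "hpos M" for M
  proof -
    let ?N = "SOME N. N \<in> Sp_C \<and> hpos N \<and> Sp_Z_class M = Sp_Z_class N"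
    have "\<exists>N. N \<in> Sp_C \<and> hpos N \<and> Sp_Z_class M = Sp_Z_class N" using M by blast
    then have N: "?N \<in> Sp_C \<and> hpos ?N \<and> Sp_Z_class M = Sp_Z_class ?N" by (rule someI_ex)
    then show ?thesis unfolding g_def using matrix_class_eq_iff[of ?N M] M by simp
  qed
  have pre: "{M \<in> Sp_C. Sp_Z_class M \<in> {q \<in> period_domain. g q \<in> W}} = lifted W" for W
    using Sp_Z_class_in_period_domain_iff g by (auto simp: lifted_def)
  have "holomorphic_map (open_subspace Sp_quotient period_domain) B_space g"
    unfolding holomorphic_map_def continuous_map_def topspace_B_space points_open_subspace_period_domain
      openin_open_subspace_period_domain
  proof (intro conjI allI impI)
    show "g \<in> period_domain \<rightarrow> B_set"
      using g matrix_class_in_B_set by (auto elim!: Sp_Z_class_repr)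
    fix W :: "'g triple set set"
    {
      assume "openin (Top B_space) W"
      then have o: "openin (top_of_set Sp_C) (lifted W)" by (simp add: openin_B_space_iff)
      show "openin (Top Sp_quotient) {q \<in> period_domain. g q \<in> W}"
        unfolding openin_Sp_quotient_iff pre using o period_domain_subset by blast
      show "{q \<in> period_domain. g q \<in> W} \<subseteq> period_domain" by blast
    next
      fix h assume "openin (Top B_space) W \<and> h \<in> Hol B_space W"
      then have h: "h \<circ> matrix_class \<in> Hol Sp_manifold (lifted W)" by (simp add: Hol_B_space_iff)
      have "h \<circ> g \<circ> Sp_Z_class \<in> Hol Sp_manifold (lifted W)"
        by (rule Hol_Sp_cong[OF h]) (simp add: lifted_def g)
      then show "h \<circ> g \<in> Hol (open_subspace Sp_quotient period_domain) {q \<in> period_domain. g q \<in> W}"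
        by (simp only: open_subspace_def cspace.simps mem_Hol_Sp_quotient pre)
    }
  qed
  moreover have "\<forall>p\<in>points B_space. g (period_map p) = p"
    unfolding topspace_B_space by (metis B_set_matrix_class g period_map_matrix_class)
  moreover have "\<forall>q\<in>points (open_subspace Sp_quotient period_domain). period_map (g q) = q"
    unfolding points_open_subspace_period_domain using g period_map_matrix_class by (metis Sp_Z_class_repr)
  ultimately show ?thesis
    unfolding biholomorphic_map_def using holomorphic_map_period_map by blast
qed

section \<open>Velocities of curves and flow lines\<close>

text \<open>A function on \<open>W\<close> is differentiated along a curve in \<open>W\<close>
  through an ambient extension \<open>H\<close>. Since \<open>H\<close> agrees with \<open>h\<close>
  only on \<open>W\<close>, the curve has to stay there.\<close>

lemma Hol_curve_derivative:
  fixes c :: "complex \<Rightarrow> complex^'n^'m"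
  assumes N: "open N" "c z0 \<in> N" and H: "matrix_holomorphic_on H N" "\<And>X. X \<in> N \<Longrightarrow> X \<in> W \<Longrightarrow> H X = h X"
    and U: "open U" "z0 \<in> U" "\<And>z. z \<in> U \<Longrightarrow> c z \<in> W"
    and c: "\<And>i j. ((\<lambda>z. c z $ i $ j) has_field_derivative C $ i $ j) (at z0)"
  shows "((h \<circ> c) has_field_derivative frechet_derivative H (at (c z0)) C) (at z0)"
proof -
  have "((\<lambda>z. H (c z)) has_field_derivative frechet_derivative H (at (c z0)) C) (at z0)"
    by (rule matrix_holomorphic_curve[OF matrix_holomorphic_frechet_derivative[OF H(1) N(2)] c])
  moreover have "\<forall>\<^sub>F z in nhds z0. H (c z) = (h \<circ> c) z"
  proof -
    have "(c has_derivative (\<lambda>v. \<chi> i j. C $ i $ j * v)) (at z0)"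
      by (rule has_derivative_matrix) (use c in \<open>simp add: has_field_derivative_def\<close>)
    then have "isCont c z0" by (rule has_derivative_continuous)
    then have "\<forall>\<^sub>F z in nhds z0. c z \<in> N"
      using N by (simp add: eventually_at_topological continuous_at_open eventually_nhds)
    moreover have "\<forall>\<^sub>F z in nhds z0. z \<in> U" using U by (simp add: eventually_nhds_in_open)
    ultimately show ?thesis by eventually_elim (use H(2) U(3) in auto)
  qed
  ultimately show ?thesis by (simp add: DERIV_cong_ev[OF refl _ refl] o_def)
qed

lemma holomorphic_nearI: "openin (Top X) W \<Longrightarrow> x \<in> W \<Longrightarrow> h \<in> Hol X W \<Longrightarrow> holomorphic_near X x h"
  unfolding holomorphic_near_def by blast

lemma holomorphic_map_pullback:
  "holomorphic_map X Y f \<Longrightarrow> openin (Top Y) W \<Longrightarrow> h \<in> Hol Y W \<Longrightarrow> h \<circ> f \<in> Hol X {x \<in> points X. f x \<in> W}"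
  unfolding holomorphic_map_def by blast

text \<open>Equality near \<open>c 0\<close> matters twice: for the derivative, and for the case
  distinction in \<open>velocity\<close>, which gives 0 on functions that are not holomorphic near
  the point.\<close>

lemma velocity_germ:
  assumes X: "hol_space X" and W: "openin (Top X) W" "c 0 \<in> W" "\<And>x. x \<in> W \<Longrightarrow> h x = h' x"
    and c: "\<forall>\<^sub>F z in nhds 0. c z \<in> W"
  shows "velocity X c h = velocity X c h'"
proof -
  have "holomorphic_near X (c 0) h' \<longleftrightarrow> holomorphic_near X (c 0) h"
  proof -
    have *: "holomorphic_near X (c 0) g'" if g: "holomorphic_near X (c 0) g" "\<And>x. x \<in> W \<Longrightarrow> g x = g' x" for g g'
    proof -
      obtain V where V: "openin (Top X) V" "c 0 \<in> V" "g \<in> Hol X V" using g(1) unfolding holomorphic_near_def by blast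
      have "g' \<in> Hol X (V \<inter> W)"
        by (rule hol_space.Hol_cong[OF X hol_space.Hol_subset[OF X V(3)]]) (use g(2) in auto)
      then show ?thesis using V W by (intro holomorphic_nearI[of X "V \<inter> W"]) auto
    qed
    show ?thesis using *[of h h'] *[of h' h] W(3) by metis
  qed
  moreover have "deriv (h \<circ> c) 0 = deriv (h' \<circ> c) 0"
    by (rule deriv_cong_ev) (use c W(3) in \<open>auto elim: eventually_mono\<close>)
  ultimately show ?thesis by (simp add: velocity_def)
qed

text \<open>
  The hypothesis on \<open>N\<close> covers square-zero elements of the Lie algebra, for which \<open>mat 1 + t N\<close> is
  the one-parameter subgroup generated by \<open>N\<close>.
\<close>

definition Sp_line :: "complex^('g::finite + 'g)^('g + 'g) \<Rightarrow> bool" where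
  "Sp_line N \<longleftrightarrow> (\<forall>t. mat 1 + mscale t N \<in> Sp_C)"

text \<open>The integral curve through \<open>M\<close>: left invariant fields generate right
  translations.\<close>

definition flow_line :: "complex^('g::finite + 'g)^('g + 'g) \<Rightarrow> complex^('g + 'g)^('g + 'g) \<Rightarrow> complex \<Rightarrow> complex^('g + 'g)^('g + 'g)" where
  "flow_line N M t = M + mscale t (M ** N)"

lemma matrix_mult_mscale: "A ** mscale t B = mscale t (A ** B)"
  by (simp add: vec_eq_iff matrix_matrix_mult_def sum_distrib_left mult_ac)

lemma flow_line_eq: "flow_line N M t = M ** (mat 1 + mscale t N)"
  by (simp add: flow_line_def matrix_add_ldistrib matrix_mult_mscale)

lemma flow_line_in_Sp_C: "Sp_line N \<Longrightarrow> M \<in> Sp_C \<Longrightarrow> flow_line N M t \<in> Sp_C"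
  by (simp add: flow_line_eq Sp_line_def mult_in_Sp_C)

lemma flow_line_0 [simp]: "flow_line N M 0 = M"
  by (simp add: flow_line_def vec_eq_iff)

lemma flow_line_mult: "S ** flow_line N M t = flow_line N (S ** M) t"
  by (simp add: flow_line_eq matrix_mul_assoc)

lemma flow_line_derivative: "((\<lambda>t. flow_line N M t $ i $ j) has_field_derivative (M ** N) $ i $ j) (at z)"
  by (auto simp: flow_line_def intro!: derivative_eq_intros)

lemma continuous_on_flow_line: "continuous_on S (flow_line N M)"
  unfolding flow_line_def by (intro continuous_intros)

lemma open_flow_line_vimage: "open T \<Longrightarrow> open {t. flow_line N M t \<in> T}"
  using open_vimage[OF _ continuous_on_flow_line] by (simp add: vimage_def)

lemma Sp_open_vimage:
  assumes "openin (top_of_set Sp_C) W" "Sp_line N" "M \<in> Sp_C"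
  shows "open {t. flow_line N M t \<in> W}"
proof -
  obtain T where T: "open T" "W = Sp_C \<inter> T" using assms(1) by (auto simp: openin_open)
  then have "{t. flow_line N M t \<in> W} = {t. flow_line N M t \<in> T}"
    using flow_line_in_Sp_C[OF assms(2,3)] by auto
  then show ?thesis using open_flow_line_vimage[OF T(1)] by simp
qed

lemma holomorphic_map_flow_line:
  assumes N: "Sp_line N" and M: "M \<in> Sp_C"
  shows "holomorphic_map (plane_domain UNIV) Sp_manifold (flow_line N M)"
  unfolding holomorphic_map_def
proof (intro conjI allI impI)
  show "continuous_map (Top (plane_domain UNIV)) (Top Sp_manifold) (flow_line N M)"
    using flow_line_in_Sp_C[OF N M] continuous_on_flow_line[of UNIV N M]
    by (auto simp: plane_domain_def continuous_map_in_subtopology)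
  fix W :: "(complex^('a + 'a)^('a + 'a)) set" and h
  assume *: "openin (Top Sp_manifold) W \<and> h \<in> Hol Sp_manifold W"
  have o: "open {t. flow_line N M t \<in> W}" by (rule Sp_open_vimage) (use * N M in auto)
  have "h \<circ> flow_line N M holomorphic_on {t. flow_line N M t \<in> W}"
    unfolding holomorphic_on_def
  proof
    fix z assume z: "z \<in> {t. flow_line N M t \<in> W}"
    obtain N' H where N': "open N'" "flow_line N M z \<in> N'" "matrix_holomorphic_on H N'" "\<And>X. X \<in> N' \<Longrightarrow> X \<in> W \<Longrightarrow> H X = h X"
      by (rule Hol_matrix_submanifoldD[of h Sp_C W "flow_line N M z"]) (use * z that in auto)
    have "((h \<circ> flow_line N M) has_field_derivative frechet_derivative H (at (flow_line N M z)) (M ** N)) (at z)"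
    proof (rule Hol_curve_derivative[where W = W and c = "flow_line N M" and U = "{t. flow_line N M t \<in> W}"])
      show "\<And>i j. ((\<lambda>t. flow_line N M t $ i $ j) has_field_derivative (M ** N) $ i $ j) (at z)"
        by (rule flow_line_derivative)
      show "flow_line N M x \<in> W" if "x \<in> {t. flow_line N M t \<in> W}" for x
        using that by (rule CollectD)
    qed (use N' o z in simp_all)
    then show "h \<circ> flow_line N M field_differentiable at z within {t. flow_line N M t \<in> W}"
      using field_differentiable_at_within field_differentiable_def by blast
  qed
  then show "h \<circ> flow_line N M \<in> Hol (plane_domain UNIV) {x \<in> points (plane_domain UNIV). flow_line N M x \<in> W}"
    by (simp add: plane_domain_def)
qed

text \<open>The explicit form of the left invariant field; restriction to \<open>Sp_C\<close>
  matches the extensionality required by \<open>holomorphic_vector_field\<close>.\<close>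

definition Sp_field :: "complex^('g::finite + 'g)^('g + 'g) \<Rightarrow> complex^('g + 'g)^('g + 'g) \<Rightarrow> (complex^('g + 'g)^('g + 'g)) tvec" where
  "Sp_field N = (\<lambda>M\<in>Sp_C. velocity Sp_manifold (flow_line N M))"

lemma Sp_field_eq_derivative:
  assumes N: "Sp_line N" and M: "M \<in> Sp_C" and W: "openin (top_of_set Sp_C) W" "M \<in> W" and h: "h \<in> Hol Sp_manifold W"
    and H: "open N'" "M \<in> N'" "matrix_holomorphic_on H N'" "\<And>X. X \<in> N' \<Longrightarrow> X \<in> W \<Longrightarrow> H X = h X"
  shows "Sp_field N M h = frechet_derivative H (at M) (M ** N)"
proof -
  have o: "open {t. flow_line N M t \<in> W}" by (rule Sp_open_vimage[OF W(1) N M])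
  have "((h \<circ> flow_line N M) has_field_derivative frechet_derivative H (at (flow_line N M 0)) (M ** N)) (at 0)"
    by (rule Hol_curve_derivative[where W = W, OF H(1) _ H(3,4) o _ _ flow_line_derivative]) (use H(2) W(2) in auto)
  moreover have "holomorphic_near Sp_manifold M h" using W h by (intro holomorphic_nearI) auto
  ultimately show ?thesis using M by (simp add: Sp_field_def velocity_def DERIV_imp_deriv)
qed

lemma Sp_field_tangent:
  assumes "Sp_line N" "M \<in> Sp_C" shows "Sp_field N M \<in> tangent_space Sp_manifold M"
  unfolding tangent_space_def
  by (intro CollectI exI[of _ "flow_line N M"] conjI exI[of _ UNIV])
    (use assms holomorphic_map_flow_line in \<open>simp_all add: Sp_field_def\<close>)

text \<open>One ambient extension \<open>H\<close> serves all nearby points \<open>X\<close>, where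
  the field acts as the derivative of \<open>H\<close> in direction \<open>X ** N\<close>; this
  expression is holomorphic in \<open>X\<close>.\<close>

lemma Sp_field_Hol:
  assumes N: "Sp_line N" and W: "openin (top_of_set Sp_C) W" and h: "h \<in> Hol Sp_manifold W"
  shows "(\<lambda>M. Sp_field N M h) \<in> Hol Sp_manifold W"
proof (rule Hol_matrix_submanifoldI)
  fix A assume A: "A \<in> W"
  obtain N' H where H: "open N'" "A \<in> N'" "matrix_holomorphic_on H N'" "\<And>X. X \<in> N' \<Longrightarrow> X \<in> W \<Longrightarrow> H X = h X"
    by (rule Hol_matrix_submanifoldD[OF h A]) (use that in auto)
  show "\<exists>N' G. open N' \<and> A \<in> N' \<and> matrix_holomorphic_on G N' \<and> (\<forall>X\<in>N' \<inter> W. G X = Sp_field N X h)"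
  proof (intro exI conjI ballI)
    show "matrix_holomorphic_on (\<lambda>X. frechet_derivative H (at X) (X ** N)) N'"
      by (intro matrix_holomorphic_on_derivative_along H matrix_holomorphic_on_matrix_mult matrix_holomorphic_intros)
    fix X assume X: "X \<in> N' \<inter> W"
    then have "X \<in> Sp_C" using openin_imp_subset[OF W] by blast
    then show "frechet_derivative H (at X) (X ** N) = Sp_field N X h"
      using Sp_field_eq_derivative[OF N _ W _ h H(1) _ H(3,4)] X by auto
  qed (use H in auto)
qed

lemma Sp_translation_Hol:
  assumes S: "S \<in> Sp_C" and W: "openin (top_of_set Sp_C) W" and h: "h \<in> Hol Sp_manifold W"
  shows "openin (top_of_set Sp_C) {M \<in> Sp_C. S ** M \<in> W}"
    and "h \<circ> (**) S \<in> Hol Sp_manifold {M \<in> Sp_C. S ** M \<in> W}"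
proof -
  have "continuous_on Sp_C ((**) S)" by (intro continuous_intros)
  then have "openin (top_of_set Sp_C) (Sp_C \<inter> (**) S -` W)"
    by (rule continuous_openin_preimage[OF _ _ W]) (use S mult_in_Sp_C in auto)
  then show "openin (top_of_set Sp_C) {M \<in> Sp_C. S ** M \<in> W}"
    by (rule back_subst[of "openin (top_of_set Sp_C)"]) auto
  have "matrix_holomorphic_on (\<lambda>M. (S ** M) $ a $ b) UNIV" for a b
    by (intro matrix_holomorphic_on_matrix_mult matrix_holomorphic_intros)
  then have "(\<lambda>M. h (S ** M)) \<in> Hol Sp_manifold {M \<in> Sp_C. S ** M \<in> W}"
    by (intro Hol_matrix_submanifold_compose[OF _ h] matrix_holomorphic_on_imp_Hol[of _ UNIV]) auto
  then show "h \<circ> (**) S \<in> Hol Sp_manifold {M \<in> Sp_C. S ** M \<in> W}" by (simp add: o_def)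
qed

text \<open>Left translation takes flow lines to flow lines. The default values must match as well:
  if \<open>h\<close> is holomorphic near \<open>S ** M\<close>, then its translate is holomorphic
  near \<open>M\<close>.\<close>

lemma Sp_field_left_invariant:
  assumes N: "Sp_line N" and S: "S \<in> Sp_C" and M: "M \<in> Sp_C"
  shows "Sp_field N (S ** M) = pushforward Sp_manifold ((**) S) M (Sp_field N M)"
proof
  fix h :: "complex^('a + 'a)^('a + 'a) \<Rightarrow> complex"
  have SM: "S ** M \<in> Sp_C" by (rule mult_in_Sp_C[OF S M])
  have c: "(h \<circ> (**) S) \<circ> flow_line N M = h \<circ> flow_line N (S ** M)"
    by (simp add: fun_eq_iff flow_line_mult)
  have "holomorphic_near Sp_manifold M (h \<circ> (**) S)" if near: "holomorphic_near Sp_manifold (S ** M) h"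
  proof -
    obtain W where W: "openin (top_of_set Sp_C) W" "S ** M \<in> W" "h \<in> Hol Sp_manifold W"
      using near by (auto simp: holomorphic_near_def)
    show ?thesis
      by (rule holomorphic_nearI[OF _ _ Sp_translation_Hol(2)[OF S W(1,3)]])
        (use Sp_translation_Hol(1)[OF S W(1,3)] W(2) M in auto)
  qed
  then show "Sp_field N (S ** M) h = pushforward Sp_manifold ((**) S) M (Sp_field N M) h"
    using SM M by (simp add: pushforward_def Sp_field_def velocity_def c)
qed

lemma Sp_entry_Hol: "(\<lambda>M. M $ i $ j) \<in> Hol Sp_manifold W"
  by (rule matrix_holomorphic_on_imp_Hol[of _ UNIV]) (auto intro: matrix_holomorphic_on_entry)

lemma Sp_tangent_curve:
  assumes "\<xi> \<in> tangent_space Sp_manifold M"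
  obtains c U where "\<xi> = velocity Sp_manifold c" "c 0 = M" "open U" "0 \<in> U" "c ` U \<subseteq> Sp_C"
    "\<And>i j. (\<lambda>z. c z $ i $ j) holomorphic_on U"
proof -
  obtain c U where c: "\<xi> = velocity Sp_manifold c" "c 0 = M" "open U" "0 \<in> U"
    "holomorphic_map (plane_domain U) Sp_manifold c"
    using assms unfolding tangent_space_def by blast
  have sub: "c ` U \<subseteq> Sp_C"
    using c(5) by (auto simp: holomorphic_map_def continuous_map_def plane_domain_def)
  have "(\<lambda>M. M $ i $ j) \<circ> c \<in> Hol (plane_domain U) {x \<in> points (plane_domain U). c x \<in> Sp_C}" for i j
    by (rule holomorphic_map_pullback[OF c(5) _ Sp_entry_Hol]) simp
  moreover have "{x \<in> points (plane_domain U). c x \<in> Sp_C} = U" using sub by (auto simp: plane_domain_def)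
  ultimately have "(\<lambda>z. c z $ i $ j) holomorphic_on U" for i j
    by (simp add: plane_domain_def o_def)
  then show ?thesis using that[OF c(1-4) sub] by blast
qed

text \<open>A tangent vector at the identity is determined by its effect on the matrix entries, by
  the chain rule for ambient extensions. Left invariance carries the equality to all of
  \<open>Sp_C\<close>, extensionality to all other matrices.\<close>

lemma left_invariant_field_eq:
  assumes N: "Sp_line N" shows "left_invariant_field N = Sp_field N"
  unfolding left_invariant_field_def
proof (rule the_equality)
  have one: "(mat 1 :: complex^('a + 'a)^('a + 'a)) \<in> Sp_C" by (rule one_in_Sp_C)
  have near: "holomorphic_near Sp_manifold (mat 1) (\<lambda>M :: complex^('a + 'a)^('a + 'a). M $ i $ j)" for i j
    by (rule holomorphic_nearI[of _ Sp_C]) (use one Sp_entry_Hol in auto)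
  have entry: "Sp_field N (mat 1) (\<lambda>M. M $ i $ j) = N $ i $ j" for i j
  proof -
    have "deriv ((\<lambda>M. M $ i $ j) \<circ> flow_line N (mat 1)) 0 = (mat 1 ** N) $ i $ j"
      by (rule DERIV_imp_deriv) (use flow_line_derivative[of N "mat 1" i j 0] in \<open>simp add: o_def\<close>)
    then show ?thesis using near one by (simp add: Sp_field_def velocity_def)
  qed
  show "holomorphic_vector_field Sp_manifold (Sp_field N) \<and>
     (\<forall>S\<in>Sp_C. \<forall>M\<in>Sp_C. Sp_field N (S ** M) = pushforward Sp_manifold ((**) S) M (Sp_field N M)) \<and>
     (\<forall>i j. Sp_field N (mat 1) (\<lambda>M. M $ i $ j) = N $ i $ j)"
    unfolding holomorphic_vector_field_def
    using Sp_field_tangent[OF N] Sp_field_Hol[OF N] Sp_field_left_invariant[OF N] entry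
    by (auto simp: Sp_field_def)
  fix V :: "complex^('a + 'a)^('a + 'a) \<Rightarrow> (complex^('a + 'a)^('a + 'a)) tvec"
  assume V: "holomorphic_vector_field Sp_manifold V \<and>
     (\<forall>S\<in>Sp_C. \<forall>M\<in>Sp_C. V (S ** M) = pushforward Sp_manifold ((**) S) M (V M)) \<and>
     (\<forall>i j. V (mat 1) (\<lambda>M. M $ i $ j) = N $ i $ j)"
  have "V (mat 1) \<in> tangent_space Sp_manifold (mat 1)"
    using V one unfolding holomorphic_vector_field_def by auto
  then obtain c U where c: "V (mat 1) = velocity Sp_manifold c" "c 0 = mat 1" "open U" "0 \<in> U" "c ` U \<subseteq> Sp_C"
    and hol: "\<And>i j. (\<lambda>z. c z $ i $ j) holomorphic_on U"
    by (rule Sp_tangent_curve) blast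
  have dc: "((\<lambda>z. c z $ i $ j) has_field_derivative (mat 1 ** N) $ i $ j) (at 0)" for i j
  proof -
    have "V (mat 1) (\<lambda>M. M $ i $ j) = deriv (\<lambda>z. c z $ i $ j) 0"
      using near by (simp add: c(1,2) velocity_def o_def)
    moreover have "V (mat 1) (\<lambda>M. M $ i $ j) = N $ i $ j" using V by blast
    ultimately show ?thesis using holomorphic_derivI[OF hol c(3,4)] by simp
  qed
  have V1: "V (mat 1) = Sp_field N (mat 1)"
  proof
    fix h
    show "V (mat 1) h = Sp_field N (mat 1) h"
    proof (cases "holomorphic_near Sp_manifold (mat 1) h")
      case True
      then obtain W where W: "openin (top_of_set Sp_C) W" "mat 1 \<in> W" "h \<in> Hol Sp_manifold W"
        by (auto simp: holomorphic_near_def)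
      obtain N' H where H: "open N'" "mat 1 \<in> N'" "matrix_holomorphic_on H N'" "\<And>X. X \<in> N' \<Longrightarrow> X \<in> W \<Longrightarrow> H X = h X"
        by (rule Hol_matrix_submanifoldD[OF W(3,2)]) (use that in auto)
      obtain T where T: "open T" "W = Sp_C \<inter> T" using W(1) by (auto simp: openin_open)
      have contc: "continuous_on U c"
      proof -
        have "isCont c z" if "z \<in> U" for z
        proof -
          have "(c has_derivative (\<lambda>v. \<chi> i j. deriv (\<lambda>z. c z $ i $ j) z * v)) (at z)"
            by (rule has_derivative_matrix) (use holomorphic_derivI[OF hol c(3) that] in \<open>simp add: has_field_derivative_def\<close>)
          then show ?thesis by (rule has_derivative_continuous)
        qed
        then show ?thesis by (simp add: continuous_at_imp_continuous_on)
      qed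
      have oU: "open (U \<inter> c -` T)" using continuous_open_preimage[OF contc c(3) T(1)] by simp
      have "((h \<circ> c) has_field_derivative frechet_derivative H (at (c 0)) (mat 1 ** N)) (at 0)"
        by (rule Hol_curve_derivative[where W = W, OF H(1) _ H(3,4) oU _ _ dc]) (use H(2) c W(2) T(2) in auto)
      moreover have "Sp_field N (mat 1) h = frechet_derivative H (at (mat 1)) (mat 1 ** N)"
        by (rule Sp_field_eq_derivative[OF N one W H])
      ultimately show ?thesis using True by (simp add: c(1,2) velocity_def DERIV_imp_deriv)
    next
      case False
      then show ?thesis using one by (simp add: c(1,2) velocity_def Sp_field_def)
    qed
  qed
  show "V = Sp_field N"
  proof
    fix M
    show "V M = Sp_field N M"
    proof (cases "M \<in> Sp_C")
      case True
      have "V (M ** mat 1) = pushforward Sp_manifold ((**) M) (mat 1) (V (mat 1))" using V True one by blast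
      then show ?thesis
        using Sp_field_left_invariant[OF N True one] by (simp add: V1)
    next
      case False
      then show ?thesis
        using V by (simp add: holomorphic_vector_field_def Sp_field_def extensional_def)
    qed
  qed
qed

section \<open>The Gauss-Manin connection and the Ramanujan fields\<close>

lemma Sp_field_germ:
  assumes N: "Sp_line N" and M: "M \<in> Sp_C" and W: "openin (top_of_set Sp_C) W" "M \<in> W" "\<And>X. X \<in> W \<Longrightarrow> h X = h' X"
  shows "Sp_field N M h = Sp_field N M h'"
proof -
  have "open {t. flow_line N M t \<in> W}" by (rule Sp_open_vimage[OF W(1) N M])
  then have "\<forall>\<^sub>F t in nhds 0. flow_line N M t \<in> W"
    using W(2) by (auto simp: eventually_nhds intro!: exI[of _ "{t. flow_line N M t \<in> W}"])
  then have "velocity Sp_manifold (flow_line N M) h = velocity Sp_manifold (flow_line N M) h'"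
    using W by (intro velocity_germ[OF hol_space_matrix_submanifold, of _ W]) auto
  then show ?thesis using M by (simp add: Sp_field_def)
qed

lemma lifted_matrix_class: "M \<in> Sp_C \<Longrightarrow> hpos M \<Longrightarrow> matrix_class M \<in> W \<Longrightarrow> M \<in> lifted W"
  by (simp add: lifted_def)

lemma holomorphic_near_lift:
  assumes M: "M \<in> Sp_C" "hpos M" and h: "holomorphic_near B_space (matrix_class M) h"
  shows "holomorphic_near Sp_manifold M (h \<circ> matrix_class)"
proof -
  obtain W where W: "openin (Top B_space) W" "matrix_class M \<in> W" "h \<in> Hol B_space W"
    using h unfolding holomorphic_near_def by blast
  show ?thesis
    by (rule holomorphic_nearI[of _ "lifted W"])
      (use W M in \<open>simp_all add: openin_B_space_iff Hol_B_space_iff lifted_matrix_class\<close>)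
qed

lemma openin_hpos: "openin (top_of_set Sp_C) (Sp_C \<inter> {M. hpos M})"
  by (rule openin_open_Int[OF open_hpos])

section \<open>Descent of left invariant fields to the moduli space\<close>

text \<open>The field induced by \<open>Sp_field N\<close>, written with an arbitrary positive
  representative of the class.\<close>

definition B_field :: "complex^('g::finite + 'g)^('g + 'g) \<Rightarrow> 'g triple set \<Rightarrow> 'g triple set tvec" where
  "B_field N = (\<lambda>p\<in>B_set. velocity B_space (\<lambda>t. matrix_class (flow_line N (SOME M. M \<in> Sp_C \<and> hpos M \<and> p = matrix_class M) t)))"

text \<open>The chosen representative and \<open>M\<close> differ by some \<open>S\<close> in
  \<open>Sp_Z\<close>. Left invariance moves the derivative from one to the other at the price of
  translating the lifted function by \<open>S\<close>, and on the open set of positive matrices this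
  function is invariant under the translation.\<close>

lemma B_field_matrix_class:
  fixes M :: "complex^('g::finite + 'g)^('g + 'g)"
  assumes N: "Sp_line N" and M: "M \<in> Sp_C" "hpos M"
  shows "B_field N (matrix_class M) h = (if holomorphic_near B_space (matrix_class M) h then Sp_field N M (h \<circ> matrix_class) else 0)"
proof -
  define M0 where "M0 = (SOME M'. M' \<in> Sp_C \<and> hpos M' \<and> matrix_class M = matrix_class M')"
  have "\<exists>M'. M' \<in> Sp_C \<and> hpos M' \<and> matrix_class M = matrix_class M'" using M by blast
  then have "M0 \<in> Sp_C \<and> hpos M0 \<and> matrix_class M = matrix_class M0"
    unfolding M0_def by (rule someI_ex)
  then have M0: "M0 \<in> Sp_C" "hpos M0" "matrix_class M = matrix_class M0" by auto
  have B: "B_field N (matrix_class M) h = velocity B_space (\<lambda>t. matrix_class (flow_line N M0 t)) h"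
    using matrix_class_in_B_set[OF M] by (simp add: B_field_def M0_def)
  show ?thesis
  proof (cases "holomorphic_near B_space (matrix_class M) h")
    case True
    then have near: "holomorphic_near Sp_manifold M0 (h \<circ> matrix_class)" "holomorphic_near Sp_manifold M (h \<circ> matrix_class)"
      using holomorphic_near_lift M M0 by metis+
    have "Sp_Z_class M0 = Sp_Z_class M" using matrix_class_eq_iff[OF M0(1,2) M] M0(3) by simp
    then obtain S where S: "S \<in> Sp_Z" "M = S ** M0" unfolding Sp_Z_class_eq_iff by blast
    have "Sp_field N M (h \<circ> matrix_class) = Sp_field N M0 ((h \<circ> matrix_class) \<circ> (**) S)"
      using Sp_field_left_invariant[OF N Sp_Z_subset[OF S(1)] M0(1)] near(2)
      by (simp add: S(2)[symmetric] pushforward_def)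
    also have "\<dots> = Sp_field N M0 (h \<circ> matrix_class)"
      by (rule Sp_field_germ[OF N M0(1) openin_hpos]) (use M0 in \<open>auto simp: matrix_class_mult S(1)\<close>)
    also have "\<dots> = deriv ((h \<circ> matrix_class) \<circ> flow_line N M0) 0"
      using M0 near(1) by (simp add: Sp_field_def velocity_def)
    finally show ?thesis
      unfolding B using True M0 by (simp add: velocity_def o_def)
  next
    case False
    then show ?thesis unfolding B using M0 by (simp add: velocity_def)
  qed
qed

lemma B_field_tangent:
  fixes p :: "'g::finite triple set"
  assumes N: "Sp_line N" and p: "p \<in> B_set"
  shows "B_field N p \<in> tangent_space B_space p"
proof -
  define M where "M = (SOME M. M \<in> Sp_C \<and> hpos M \<and> p = matrix_class M)"
  have "\<exists>M. M \<in> Sp_C \<and> hpos M \<and> p = matrix_class M" using B_set_matrix_class[OF p] by metis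
  then have "M \<in> Sp_C \<and> hpos M \<and> p = matrix_class M" unfolding M_def by (rule someI_ex)
  then have M: "M \<in> Sp_C" "hpos M" "p = matrix_class M" by auto
  let ?c = "\<lambda>t. matrix_class (flow_line N M t)"
  \<comment> \<open>The flow line may leave the positive matrices, so the curve is restricted to the
    open set of times at which it is positive.\<close>
  define U where "U = {t. flow_line N M t \<in> {M. hpos M}}"
  have U: "open U" "0 \<in> U" using open_flow_line_vimage[OF open_hpos] M by (auto simp: U_def)
  have pre: "{t \<in> U. ?c t \<in> W} = {t. flow_line N M t \<in> lifted W}" for W :: "'g triple set set"
    using flow_line_in_Sp_C[OF N M(1)] by (auto simp: U_def lifted_def)
  have "holomorphic_map (plane_domain U) B_space ?c"
    unfolding holomorphic_map_def continuous_map_def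
  proof (intro conjI allI impI)
    show "?c \<in> points (plane_domain U) \<rightarrow> points B_space"
      unfolding topspace_B_space using matrix_class_in_B_set flow_line_in_Sp_C[OF N M(1)] by (auto simp: plane_domain_def U_def)
    fix W :: "'g triple set set"
    {
      assume W: "openin (Top B_space) W"
      then have "open {t. flow_line N M t \<in> lifted W}"
        using Sp_open_vimage[OF _ N M(1)] by (simp add: openin_B_space_iff)
      then have "open {t \<in> U. ?c t \<in> W}" by (simp only: pre)
      then have "openin (top_of_set U) {t \<in> U. ?c t \<in> W}" by (rule open_subset[rotated]) auto
      then show "openin (Top (plane_domain U)) {t \<in> points (plane_domain U). ?c t \<in> W}"
        by (simp add: plane_domain_def)
    next
      fix h assume "openin (Top B_space) W \<and> h \<in> Hol B_space W"
      then have "openin (Top Sp_manifold) (lifted W)" "h \<circ> matrix_class \<in> Hol Sp_manifold (lifted W)"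
        by (simp_all add: openin_B_space_iff Hol_B_space_iff)
      from holomorphic_map_pullback[OF holomorphic_map_flow_line[OF N M(1)] this]
      have "(h \<circ> matrix_class) \<circ> flow_line N M holomorphic_on {t. flow_line N M t \<in> lifted W}"
        by (simp add: plane_domain_def)
      then show "h \<circ> ?c \<in> Hol (plane_domain U) {t \<in> points (plane_domain U). ?c t \<in> W}"
        by (simp add: plane_domain_def pre o_def)
    }
  qed
  moreover have "B_field N p = velocity B_space ?c" using p by (simp add: B_field_def M_def)
  moreover have "?c 0 = p" using M by simp
  ultimately show ?thesis unfolding tangent_space_def using U by blast
qed

text \<open>Lifted to \<open>Sp_C\<close>, the function becomes the derivative by
  \<open>Sp_field N\<close> of the lift of \<open>h\<close>.\<close>

lemma B_field_Hol:
  assumes N: "Sp_line N" and W: "openin (Top B_space) W" and h: "h \<in> Hol B_space W"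
  shows "(\<lambda>p. B_field N p h) \<in> Hol B_space W"
  unfolding Hol_B_space_iff
proof (rule Hol_Sp_cong)
  show "(\<lambda>M. Sp_field N M (h \<circ> matrix_class)) \<in> Hol Sp_manifold (lifted W)"
    by (rule Sp_field_Hol[OF N]) (use W h in \<open>simp_all add: openin_B_space_iff Hol_B_space_iff\<close>)
  fix M assume "M \<in> lifted W"
  then have "M \<in> Sp_C" "hpos M" "matrix_class M \<in> W" by (auto simp: lifted_def)
  then show "Sp_field N M (h \<circ> matrix_class) = ((\<lambda>p. B_field N p h) \<circ> matrix_class) M"
    using B_field_matrix_class[OF N] holomorphic_nearI[OF W _ h] by simp
qed

lemma holomorphic_vector_field_B_field:
  assumes "Sp_line N" shows "holomorphic_vector_field B_space (B_field N)"
  unfolding holomorphic_vector_field_def topspace_B_space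
  using B_field_tangent[OF assms] B_field_Hol[OF assms] by (auto simp: B_field_def)

lemma tangent_space_curve:
  assumes "\<xi> \<in> tangent_space X x"
  obtains c U where "\<xi> = velocity X c" "c 0 = x" "open U" "0 \<in> U" "holomorphic_map (plane_domain U) X c"
  using assms unfolding tangent_space_def by blast

lemma holomorphic_curve_preimage:
  assumes c: "holomorphic_map (plane_domain U) X c" and U: "open U" and W: "openin (Top X) W"
  shows "open {z \<in> U. c z \<in> W}" "h \<in> Hol X W \<Longrightarrow> h \<circ> c holomorphic_on {z \<in> U. c z \<in> W}"
proof -
  have p: "points (plane_domain U) = U" by (simp add: plane_domain_def)
  have "continuous_map (Top (plane_domain U)) (Top X) c" using c unfolding holomorphic_map_def by blast
  from openin_continuous_map_preimage[OF this W]
  have "openin (top_of_set U) {z \<in> U. c z \<in> W}" by (simp add: plane_domain_def)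
  then show "open {z \<in> U. c z \<in> W}" using U by (simp add: openin_open_eq)
  show "h \<circ> c holomorphic_on {z \<in> U. c z \<in> W}" if "h \<in> Hol X W"
    using holomorphic_map_pullback[OF c W that] by (simp add: plane_domain_def)
qed

lemma tangent_germ:
  assumes X: "hol_space X" and \<xi>: "\<xi> \<in> tangent_space X x" and W: "openin (Top X) W" "x \<in> W" "\<And>u. u \<in> W \<Longrightarrow> h u = h' u"
  shows "\<xi> h = \<xi> h'"
proof -
  obtain c U where c: "\<xi> = velocity X c" "c 0 = x" "open U" "0 \<in> U" "holomorphic_map (plane_domain U) X c"
    by (rule tangent_space_curve[OF \<xi>])
  have "\<forall>\<^sub>F z in nhds 0. c z \<in> W"
    using holomorphic_curve_preimage(1)[OF c(5,3) W(1)] c W(2) unfolding eventually_nhds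
    by (intro exI[of _ "{z \<in> U. c z \<in> W}"]) auto
  then show ?thesis unfolding c(1) using W c(2) by (intro velocity_germ[OF X, of W]) auto
qed

text \<open>Linearity is claimed for functions holomorphic near the point; on all others a tangent
  vector is 0 by convention.\<close>

lemma tangent_sum:
  assumes X: "hol_space X" and \<xi>: "\<xi> \<in> tangent_space X x" and W: "openin (Top X) W" "x \<in> W"
    and g: "\<And>a. a \<in> I \<Longrightarrow> g a \<in> Hol X W"
  shows "\<xi> (\<lambda>u. \<Sum>a\<in>I. k a * g a u) = (\<Sum>a\<in>I. k a * \<xi> (g a))"
proof -
  interpret hol_space X by (rule X)
  obtain c U where c: "\<xi> = velocity X c" "c 0 = x" "open U" "0 \<in> U" "holomorphic_map (plane_domain U) X c"
    by (rule tangent_space_curve[OF \<xi>])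
  note pre = holomorphic_curve_preimage[OF c(5,3) W(1)]
  have d: "((g a \<circ> c) has_field_derivative deriv (g a \<circ> c) 0) (at 0)" if "a \<in> I" for a
    by (rule holomorphic_derivI[OF pre(2)[OF g[OF that]] pre(1)]) (use c W in auto)
  have "((\<lambda>z. \<Sum>a\<in>I. k a * (g a \<circ> c) z) has_field_derivative (\<Sum>a\<in>I. k a * deriv (g a \<circ> c) 0)) (at 0)"
    by (intro DERIV_sum DERIV_cmult d)
  then have "deriv ((\<lambda>u. \<Sum>a\<in>I. k a * g a u) \<circ> c) 0 = (\<Sum>a\<in>I. k a * deriv (g a \<circ> c) 0)"
    by (simp add: o_def DERIV_imp_deriv)
  moreover have "holomorphic_near X x (\<lambda>u. \<Sum>a\<in>I. k a * g a u)"
    by (rule holomorphic_nearI[OF W]) (intro Hol_sum Hol_mult Hol_const g)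
  moreover have "holomorphic_near X x (g a)" if "a \<in> I" for a
    by (rule holomorphic_nearI[OF W g[OF that]])
  ultimately show ?thesis by (simp add: c(1,2) velocity_def)
qed

section \<open>The Gauss-Manin connection in terms of periods\<close>

lemma lattice_basis_expand: "lattice_basis L b \<Longrightarrow> x \<in> L \<Longrightarrow> \<exists>n. x = (\<Sum>i\<in>UNIV. of_int (n i) *\<^sub>R b i)"
  unfolding lattice_basis_def by blast

text \<open>Near \<open>x\<close> the homology section chosen in \<open>gauss_manin\<close> is the
  combination of the frame with constant integral coordinates, so covariant differentiation amounts
  to differentiating periods. Both sides are additive on the lattice, hence comparison on the frame
  suffices.\<close>

lemma gauss_manin_eq_iff:
  fixes F :: "'a \<Rightarrow> 'g::finite triple"
  assumes X: "hol_space X" and pf: "period_frame X F N \<gamma> \<delta>" and x: "x \<in> N" and \<xi>: "\<xi> \<in> tangent_space X x"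
    and f: "\<And>u. u \<in> N \<Longrightarrow> f u \<in> H1dR (lat (F u))"
    and fb: "\<And>a. (\<lambda>u. f u (case_sum (\<lambda>i. \<delta> i u) (\<lambda>i. \<gamma> i u) a)) \<in> Hol X N"
    and G: "G \<in> H1dR (lat (F x))"
  shows "gauss_manin X (\<lambda>q. lat (F q)) x \<xi> f = G \<longleftrightarrow>
    (\<forall>a. \<xi> (\<lambda>u. f u (case_sum (\<lambda>i. \<delta> i u) (\<lambda>i. \<gamma> i u) a)) = G (case_sum (\<lambda>i. \<delta> i x) (\<lambda>i. \<gamma> i x) a))"
proof -
  interpret hol_space X by (rule X)
  note pfD = period_frameD[OF pf]
  define b where "b a u = case_sum (\<lambda>i. \<gamma> i u) (\<lambda>i. \<delta> i u) a" for a u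
  have lb: "lattice_basis (lat (F u)) (\<lambda>a. b a u)" if "u \<in> N" for u
    using pfD(3)[OF that] by (simp add: integral_symplectic_basis_def b_def)
  note t = pfD(2)
  have b_Hol: "(\<lambda>u. b a u $ j) \<in> Hol X N" for a j
    by (cases a) (simp_all add: b_def pfD(4,5))
  have bL: "b a u \<in> lat (F u)" if "u \<in> N" for a u using lattice_basis_mem[OF lb[OF that]] .
  have fb': "(\<lambda>u. f u (b a u)) \<in> Hol X N" for a
    using fb[of "case_sum Inr Inl a"] by (cases a) (simp_all add: b_def)
  have GM: "gauss_manin X (\<lambda>q. lat (F q)) x \<xi> f y = (\<Sum>a\<in>UNIV. of_int (n a) * \<xi> (\<lambda>u. f u (b a u)))"
    if y: "y = (\<Sum>a\<in>UNIV. of_int (n a) *\<^sub>R b a x)" for y n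
  proof -
    have yL: "y \<in> lat (F x)"
      unfolding y by (intro int_subgroup_sum[OF is_tripleD(2)[OF t[OF x]]] int_subgroup_of_int[OF is_tripleD(2)[OF t[OF x]]] bL x)
    \<comment> \<open>The section inside \<open>gauss_manin\<close> is an indefinite choice, of
      which only \<open>homology_section\<close> is known.\<close>
    define \<sigma> where "\<sigma> = (SOME \<sigma>. homology_section X (\<lambda>q. lat (F q)) x y \<sigma>)"
    have "homology_section X (\<lambda>q. lat (F q)) x y (\<lambda>u. \<Sum>a\<in>UNIV. of_int (n a) *\<^sub>R b a u)"
      unfolding homology_section_def
    proof (intro conjI exI[of _ N] ballI allI)
      show "(\<Sum>a\<in>UNIV. of_int (n a) *\<^sub>R b a u) \<in> lat (F u)" if "u \<in> N" for u
        by (intro int_subgroup_sum[OF is_tripleD(2)[OF t[OF that]]] int_subgroup_of_int[OF is_tripleD(2)[OF t[OF that]]] bL that)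
      show "(\<lambda>u. (\<Sum>a\<in>UNIV. of_int (n a) *\<^sub>R b a u) $ j) \<in> Hol X N" for j
        unfolding sum_component vector_scaleR_component by (rule Hol_sum, rule Hol_scaleR, rule b_Hol)
    qed (use y pfD(1) x in auto)
    then have "\<exists>\<sigma>. homology_section X (\<lambda>q. lat (F q)) x y \<sigma>" by blast
    then have \<sigma>: "homology_section X (\<lambda>q. lat (F q)) x y \<sigma>" unfolding \<sigma>_def by (rule someI_ex)
    have S: "symplectic_relations (pol (F x)) (\<lambda>i. \<gamma> i x) (\<lambda>i. \<delta> i x)"
      using pfD(3)[OF x] integral_symplectic_basis_iff[OF is_tripleD(3)[OF t[OF x]]] by blast
    have indep: "\<forall>i. c i = 0" if "(\<Sum>i\<in>UNIV. c i *\<^sub>R b i x) = 0" for c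
      using symplectic_independent[OF S, of c] that by (simp add: b_def)
    obtain N' where N': "openin (Top X) N'" "x \<in> N'" "N' \<subseteq> N"
      and \<sigma>N: "\<forall>u\<in>N'. \<sigma> u = (\<Sum>i\<in>UNIV. of_int (n i) *\<^sub>R b i u)"
    proof -
      have "\<exists>N'. openin (Top X) N' \<and> x \<in> N' \<and> N' \<subseteq> N \<and> (\<forall>u\<in>N'. \<sigma> u = (\<Sum>i\<in>UNIV. of_int (n i) *\<^sub>R b i u))"
        by (rule homology_section_locally_constant[where b = b and n = n, OF pfD(1) x _ b_Hol indep \<sigma> y])
          (use lattice_basis_expand[OF lb] in auto)
      then show ?thesis using that by (elim exE conjE)
    qed
    have "\<xi> (\<lambda>u. f u (\<sigma> u)) = \<xi> (\<lambda>u. \<Sum>a\<in>UNIV. of_int (n a) * f u (b a u))"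
    proof (rule tangent_germ[OF X \<xi> N'(1,2)])
      fix u assume u: "u \<in> N'"
      then have uN: "u \<in> N" using N'(3) by blast
      show "f u (\<sigma> u) = (\<Sum>a\<in>UNIV. of_int (n a) * f u (b a u))"
        unfolding \<sigma>N[rule_format, OF u] by (rule H1dR_int_combination[OF is_tripleD(2)[OF t[OF uN]] f[OF uN] bL[OF uN]])
    qed
    also have "\<dots> = (\<Sum>a\<in>UNIV. of_int (n a) * \<xi> (\<lambda>u. f u (b a u)))"
      by (rule tangent_sum[OF X \<xi> pfD(1) x fb'])
    finally show ?thesis
      using yL by (simp add: gauss_manin_def restrict0_def \<sigma>_def)
  qed
  have Gy: "G (\<Sum>a\<in>UNIV. of_int (n a) *\<^sub>R b a x) = (\<Sum>a\<in>UNIV. of_int (n a) * G (b a x))" for n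
    by (rule H1dR_int_combination[OF is_tripleD(2)[OF t[OF x]] G bL[OF x]])
  have "gauss_manin X (\<lambda>q. lat (F q)) x \<xi> f = G \<longleftrightarrow> (\<forall>a. \<xi> (\<lambda>u. f u (b a u)) = G (b a x))"
  proof
    assume eq: "gauss_manin X (\<lambda>q. lat (F q)) x \<xi> f = G"
    show "\<forall>a. \<xi> (\<lambda>u. f u (b a u)) = G (b a x)"
    proof
      fix a
      have "(\<Sum>c\<in>UNIV. of_int (if c = a then 1 else 0) * \<xi> (\<lambda>u. f u (b c u))) = G (b a x)"
        using GM[OF combination_single[of a "\<lambda>a. b a x", symmetric]] eq by simp
      then show "\<xi> (\<lambda>u. f u (b a u)) = G (b a x)"
        by (simp add: if_distrib[of of_int] if_distrib[of "\<lambda>x. x * _"] cong: if_cong)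
    qed
  next
    assume *: "\<forall>a. \<xi> (\<lambda>u. f u (b a u)) = G (b a x)"
    show "gauss_manin X (\<lambda>q. lat (F q)) x \<xi> f = G"
    proof
      fix y
      show "gauss_manin X (\<lambda>q. lat (F q)) x \<xi> f y = G y"
      proof (cases "y \<in> lat (F x)")
        case True
        then obtain n where n: "y = (\<Sum>a\<in>UNIV. of_int (n a) *\<^sub>R b a x)" using lattice_basis_expand[OF lb[OF x]] by blast
        show ?thesis using GM[OF n] * Gy[of n] by (simp add: n)
      next
        case False
        then show ?thesis using G by (simp add: gauss_manin_def restrict0_def H1dR_def)
      qed
    qed
  qed
  then show ?thesis by (simp add: all_sum b_def conj_commute)
qed

definition ramanujan_matrix :: "'g::finite \<Rightarrow> 'g \<Rightarrow> complex^('g + 'g)^('g + 'g)" where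
  "ramanujan_matrix k l = mscale (1 / two_pi_i) (block_matrix 0 (E_matrix k l) 0 0)"

lemma Sp_line_ramanujan_matrix: "Sp_line (ramanujan_matrix k l)"
  unfolding Sp_line_def
proof
  fix t
  have "mat 1 + mscale t (ramanujan_matrix k l) = block_matrix (mat 1) (mscale (t / two_pi_i) (E_matrix k l)) 0 (mat 1)"
    by (simp add: vec_eq_iff all_sum ramanujan_matrix_def mat_def)
  moreover have "transpose (mscale c (E_matrix k l)) = mscale c (E_matrix k l)" for c
    by (auto simp: vec_eq_iff transpose_def E_matrix_def)
  ultimately show "mat 1 + mscale t (ramanujan_matrix k l) \<in> Sp_C"
    by (simp add: block_matrix_in_Sp_C_iff)
qed

text \<open>This is how the prescription for the omega appears in a period matrix: eta columns
  \<open>l\<close> and \<open>k\<close> move to omega columns \<open>k\<close> and \<open>l\<close>.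
  For \<open>k = l\<close> the single entry of \<open>E_matrix\<close> must be counted once, which
  the nested conditional respects.\<close>

lemma mult_ramanujan_matrix:
  "(P ** ramanujan_matrix k l) $ a $ Inl j = 0"
  "(P ** ramanujan_matrix k l) $ a $ Inr j =
     (if j = k then P $ a $ Inl l else if j = l then P $ a $ Inl k else 0) / two_pi_i"
proof -
  show "(P ** ramanujan_matrix k l) $ a $ Inl j = 0"
    by (simp add: matrix_matrix_mult_def ramanujan_matrix_def sum_UNIV_sum)
  have "(\<Sum>i\<in>UNIV. P $ a $ Inl i * E_matrix k l $ i $ j) = (if j = k then P $ a $ Inl l else if j = l then P $ a $ Inl k else 0)"
  proof -
    have "P $ a $ Inl i * E_matrix k l $ i $ j = (if i = (if j = k then l else k) then (if j = k \<or> j = l then P $ a $ Inl i else 0) else 0)" for i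
      by (auto simp: E_matrix_def)
    then show ?thesis by (simp add: sum.delta)
  qed
  moreover have "(P ** ramanujan_matrix k l) $ a $ Inr j = (\<Sum>i\<in>UNIV. P $ a $ Inl i * E_matrix k l $ i $ j) / two_pi_i"
    by (simp add: matrix_matrix_mult_def ramanujan_matrix_def sum_UNIV_sum sum_divide_distrib)
  ultimately show "(P ** ramanujan_matrix k l) $ a $ Inr j =
     (if j = k then P $ a $ Inl l else if j = l then P $ a $ Inl k else 0) / two_pi_i" by simp
qed

lemma tangent_scale:
  assumes X: "hol_space X" and \<xi>: "\<xi> \<in> tangent_space X x" and W: "openin (Top X) W" "x \<in> W" and g: "g \<in> Hol X W"
  shows "\<xi> (\<lambda>u. k * g u) = k * \<xi> g"
  using tangent_sum[OF X \<xi> W, of "{()}" "\<lambda>_. g" "\<lambda>_. k"] g by simp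

abbreviation frame_period :: "('a \<Rightarrow> 'g::finite triple) \<Rightarrow> ('g \<Rightarrow> 'a \<Rightarrow> complex^'g) \<Rightarrow> ('g \<Rightarrow> 'a \<Rightarrow> complex^'g) \<Rightarrow> 'a \<Rightarrow> complex^('g + 'g)^('g + 'g)" where
  "frame_period F \<gamma> \<delta> u \<equiv> period_matrix (F u) (\<lambda>i. \<gamma> i u) (\<lambda>i. \<delta> i u)"

text \<open>In a frame the periods of \<open>om\<close> are \<open>2 pi i\<close> times entries of
  the right columns and those of \<open>et\<close> are entries of the left columns, and the
  connection differentiates them. The factor \<open>1 / two_pi_i\<close> in
  \<open>ramanujan_matrix\<close> compensates the normalization of the right columns.\<close>

lemma ramanujan_equations_iff:
  assumes X: "hol_space X" and pf: "period_frame X F N \<gamma> \<delta>" and p: "p \<in> N" and \<xi>: "\<xi> \<in> tangent_space X p"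
  shows "(gauss_manin X (\<lambda>q. lat (F q)) p \<xi> (\<lambda>q. om (F q) k) = et (F p) l \<and>
     gauss_manin X (\<lambda>q. lat (F q)) p \<xi> (\<lambda>q. om (F q) l) = et (F p) k \<and>
     (\<forall>m. m \<notin> {k, l} \<longrightarrow> gauss_manin X (\<lambda>q. lat (F q)) p \<xi> (\<lambda>q. om (F q) m) = (\<lambda>_. 0)) \<and>
     (\<forall>m. gauss_manin X (\<lambda>q. lat (F q)) p \<xi> (\<lambda>q. et (F q) m) = (\<lambda>_. 0))) \<longleftrightarrow>
   (\<forall>a c. \<xi> (\<lambda>u. frame_period F \<gamma> \<delta> u $ a $ c) = (frame_period F \<gamma> \<delta> p ** ramanujan_matrix k l) $ a $ c)"
proof -
  interpret hol_space X by (rule X)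
  let ?P = "frame_period F \<gamma> \<delta>" and ?GM = "gauss_manin X (\<lambda>q. lat (F q)) p \<xi>"
  note pfD = period_frameD[OF pf] and t = period_frameD(2)[OF pf]
  have c0: "two_pi_i \<noteq> 0" by (rule two_pi_i_nonzero)
  have om: "om (F u) j (case_sum (\<lambda>i. \<delta> i u) (\<lambda>i. \<gamma> i u) a) = two_pi_i * ?P u $ a $ Inr j"
    and et: "et (F u) j (case_sum (\<lambda>i. \<delta> i u) (\<lambda>i. \<gamma> i u) a) = ?P u $ a $ Inl j" for u j a
    by simp_all
  have om_GM: "?GM (\<lambda>q. om (F q) j) = G \<longleftrightarrow>
      (\<forall>a. two_pi_i * \<xi> (\<lambda>u. ?P u $ a $ Inr j) = G (case_sum (\<lambda>i. \<delta> i p) (\<lambda>i. \<gamma> i p) a))"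
    if G: "G \<in> H1dR (lat (F p))" for G j
  proof -
    have "?GM (\<lambda>q. om (F q) j) = G \<longleftrightarrow> (\<forall>a. \<xi> (\<lambda>u. om (F u) j (case_sum (\<lambda>i. \<delta> i u) (\<lambda>i. \<gamma> i u) a)) = G (case_sum (\<lambda>i. \<delta> i p) (\<lambda>i. \<gamma> i p) a))"
    proof (rule gauss_manin_eq_iff[OF X pf p \<xi> _ _ G])
      show "om (F u) j \<in> H1dR (lat (F u))" if "u \<in> N" for u by (rule is_tripleD(4)[OF t[OF that]])
      show "(\<lambda>u. om (F u) j (case_sum (\<lambda>i. \<delta> i u) (\<lambda>i. \<gamma> i u) a)) \<in> Hol X N" for a
        unfolding om by (rule Hol_mult[OF Hol_const pfD(6)])
    qed
    also have "\<dots> \<longleftrightarrow> (\<forall>a. two_pi_i * \<xi> (\<lambda>u. ?P u $ a $ Inr j) = G (case_sum (\<lambda>i. \<delta> i p) (\<lambda>i. \<gamma> i p) a))"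
      unfolding om tangent_scale[OF X \<xi> pfD(1) p pfD(6)] ..
    finally show ?thesis .
  qed
  have et_GM: "?GM (\<lambda>q. et (F q) j) = (\<lambda>_. 0) \<longleftrightarrow> (\<forall>a. \<xi> (\<lambda>u. ?P u $ a $ Inl j) = 0)" for j
  proof -
    have "?GM (\<lambda>q. et (F q) j) = (\<lambda>_. 0) \<longleftrightarrow> (\<forall>a. \<xi> (\<lambda>u. et (F u) j (case_sum (\<lambda>i. \<delta> i u) (\<lambda>i. \<gamma> i u) a)) = 0)"
    proof (rule gauss_manin_eq_iff[OF X pf p \<xi> _ _ H1dR_zero])
      show "et (F u) j \<in> H1dR (lat (F u))" if "u \<in> N" for u by (rule is_tripleD(5)[OF t[OF that]])
      show "(\<lambda>u. et (F u) j (case_sum (\<lambda>i. \<delta> i u) (\<lambda>i. \<gamma> i u) a)) \<in> Hol X N" for a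
        unfolding et by (rule pfD(6))
    qed
    then show ?thesis unfolding et .
  qed
  have "(?GM (\<lambda>q. om (F q) k) = et (F p) l \<and> ?GM (\<lambda>q. om (F q) l) = et (F p) k \<and>
     (\<forall>m. m \<notin> {k, l} \<longrightarrow> ?GM (\<lambda>q. om (F q) m) = (\<lambda>_. 0)) \<and> (\<forall>m. ?GM (\<lambda>q. et (F q) m) = (\<lambda>_. 0))) \<longleftrightarrow>
    ((\<forall>a. two_pi_i * \<xi> (\<lambda>u. ?P u $ a $ Inr k) = ?P p $ a $ Inl l) \<and>
     (\<forall>a. two_pi_i * \<xi> (\<lambda>u. ?P u $ a $ Inr l) = ?P p $ a $ Inl k) \<and>
     (\<forall>m. m \<notin> {k, l} \<longrightarrow> (\<forall>a. two_pi_i * \<xi> (\<lambda>u. ?P u $ a $ Inr m) = 0)) \<and>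
     (\<forall>m a. \<xi> (\<lambda>u. ?P u $ a $ Inl m) = 0))"
    unfolding om_GM[OF is_tripleD(5)[OF t[OF p]]] om_GM[OF H1dR_zero] et_GM et ..
  also have "\<dots> \<longleftrightarrow> (\<forall>a c. \<xi> (\<lambda>u. ?P u $ a $ c) = (?P p ** ramanujan_matrix k l) $ a $ c)"
  proof -
    have e: "two_pi_i * z = w \<longleftrightarrow> z = w / two_pi_i" for z w using c0 by (auto simp: field_simps)
    have r: "(\<forall>c. \<xi> (\<lambda>u. ?P u $ a $ c) = (?P p ** ramanujan_matrix k l) $ a $ c) \<longleftrightarrow>
       (\<forall>m. \<xi> (\<lambda>u. ?P u $ a $ Inl m) = 0) \<and> (\<forall>m. \<xi> (\<lambda>u. ?P u $ a $ Inr m) = (if m = k then ?P p $ a $ Inl l else if m = l then ?P p $ a $ Inl k else 0) / two_pi_i)" for a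
      by (simp only: all_sum[of "\<lambda>c. \<xi> (\<lambda>u. ?P u $ a $ c) = _ $ a $ c"] mult_ramanujan_matrix)
    have m: "(\<forall>m. z m = (if m = k then w l else if m = l then w k else 0) / two_pi_i) \<longleftrightarrow>
       z k = w l / two_pi_i \<and> z l = w k / two_pi_i \<and> (\<forall>m. m \<notin> {k, l} \<longrightarrow> z m = 0 / two_pi_i)" for z w :: "'b \<Rightarrow> complex"
      by (auto simp del: div_0)
    show ?thesis
      unfolding e r m[of "\<lambda>m. \<xi> (\<lambda>u. ?P u $ _ $ Inr m)" "\<lambda>m. ?P p $ _ $ Inl m"] by blast
  qed
  finally show ?thesis .
qed

lemma universal_familyD:
  assumes F: "universal_family F" and pf: "period_frame B_space F N \<gamma> \<delta>" and u: "u \<in> N"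
  shows "u \<in> B_set" "u = matrix_class (frame_period F \<gamma> \<delta> u)"
proof -
  show uB: "u \<in> B_set" using openin_subset[OF period_frameD(1)[OF pf]] u by (auto simp: topspace_B_space)
  then have "F u \<in> u" using F by (auto simp: universal_family_def topspace_B_space)
  from mem_B_set(2)[OF uB this] show "u = matrix_class (frame_period F \<gamma> \<delta> u)"
    using period_frame_matrix(3)[OF pf u] by simp
qed

text \<open>\<open>X\<close> and the frame period of its class lie in one orbit of
  \<open>Sp_Z\<close>. Near the frame period of \<open>p\<close> both lie in a neighbourhood in
  which an orbit has at most one symplectic point, so they coincide. Thus the frame is a local
  inverse of \<open>matrix_class\<close>.\<close>

lemma frame_period_local_identity:
  fixes F :: "'g::finite triple set \<Rightarrow> 'g triple"
  assumes F: "universal_family F" and pf: "period_frame B_space F N \<gamma> \<delta>" and p: "p \<in> N"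
  obtains W where "openin (top_of_set Sp_C) W" "frame_period F \<gamma> \<delta> p \<in> W"
    "\<forall>X\<in>W. frame_period F \<gamma> \<delta> (matrix_class X) = X"
proof -
  let ?P = "frame_period F \<gamma> \<delta>"
  note pfD = period_frameD[OF pf] and pm = period_frame_matrix[OF pf]
  obtain D where D: "open D" "?P p \<in> D" "\<And>M S. M \<in> D \<Longrightarrow> M \<in> Sp_C \<Longrightarrow> S \<in> Sp_Z \<Longrightarrow> S ** M \<in> D \<Longrightarrow> S = mat 1"
    by (rule Sp_Z_discrete[OF pm(1)[OF p]]) (use that in auto)
  have N: "openin (top_of_set Sp_C) (lifted N)" using pfD(1) by (simp add: openin_B_space_iff)
  have mem: "?P p \<in> lifted N" using pm(1,2)[OF p] universal_familyD(2)[OF F pf p] p by (simp add: lifted_def)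
  have Hol: "(\<lambda>X. ?P (matrix_class X) $ a $ c) \<in> Hol Sp_manifold (lifted N)" for a c
    using pfD(6)[of a c] unfolding Hol_B_space_iff by (simp add: o_def)
  have "openin (Top Sp_manifold) {X \<in> lifted N. ?P (matrix_class X) \<in> D}"
    using N by (intro hol_space.Hol_matrix_open[OF hol_space_matrix_submanifold _ Hol D(1)]) simp
  then have o: "openin (top_of_set Sp_C) ({X \<in> lifted N. ?P (matrix_class X) \<in> D} \<inter> D)"
    using D(1) by (auto intro: openin_Int_open)
  show ?thesis
  proof (rule that[OF o])
    show "?P p \<in> {X \<in> lifted N. ?P (matrix_class X) \<in> D} \<inter> D"
      using mem D(2) universal_familyD(2)[OF F pf p] by simp
    show "\<forall>X\<in>{X \<in> lifted N. ?P (matrix_class X) \<in> D} \<inter> D. ?P (matrix_class X) = X"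
    proof
      fix X assume "X \<in> {X \<in> lifted N. ?P (matrix_class X) \<in> D} \<inter> D"
      then have X: "X \<in> Sp_C" "hpos X" "matrix_class X \<in> N" "?P (matrix_class X) \<in> D" "X \<in> D" by (auto simp: lifted_def)
      have "matrix_class X = matrix_class (?P (matrix_class X))" by (rule universal_familyD(2)[OF F pf X(3)])
      then have "Sp_Z_class X = Sp_Z_class (?P (matrix_class X))"
        using matrix_class_eq_iff[OF X(1,2) pm(1,2)[OF X(3)]] by simp
      then obtain S where S: "S \<in> Sp_Z" "?P (matrix_class X) = S ** X" unfolding Sp_Z_class_eq_iff by blast
      have "S = mat 1" by (rule D(3)[OF X(5,1) S(1)]) (use X(4) S(2) in simp)
      then show "?P (matrix_class X) = X" using S(2) by simp
    qed
  qed
qed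

lemma Sp_field_entry:
  assumes N: "Sp_line N" and M: "M \<in> Sp_C"
  shows "Sp_field N M (\<lambda>X. X $ a $ c) = (M ** N) $ a $ c"
proof -
  have "holomorphic_near Sp_manifold M (\<lambda>X. X $ a $ c)"
    by (rule holomorphic_nearI[of _ Sp_C]) (use M Sp_entry_Hol in auto)
  moreover have "deriv ((\<lambda>X. X $ a $ c) \<circ> flow_line N M) 0 = (M ** N) $ a $ c"
    by (rule DERIV_imp_deriv) (use flow_line_derivative[of N M a c 0] in \<open>simp add: o_def\<close>)
  ultimately show ?thesis using M by (simp add: Sp_field_def velocity_def)
qed

text \<open>Near the frame period of \<open>p\<close> the functions lift to plain matrix entries,
  whose derivatives along the flow line are the entries of the product with
  \<open>A\<close>.\<close>

lemma B_field_frame_period: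
  assumes A: "Sp_line A" and F: "universal_family F" and pf: "period_frame B_space F N \<gamma> \<delta>" and p: "p \<in> N"
  shows "B_field A p (\<lambda>u. frame_period F \<gamma> \<delta> u $ a $ c) = (frame_period F \<gamma> \<delta> p ** A) $ a $ c"
proof -
  let ?P = "frame_period F \<gamma> \<delta>"
  note pm = period_frame_matrix[OF pf p] and pe = universal_familyD(2)[OF F pf p]
  obtain W where W: "openin (top_of_set Sp_C) W" "?P p \<in> W" "\<forall>X\<in>W. ?P (matrix_class X) = X"
    by (rule frame_period_local_identity[OF F pf p])
  have "holomorphic_near B_space (matrix_class (?P p)) (\<lambda>u. ?P u $ a $ c)"
    using period_frameD(1,6)[OF pf] p pe by (intro holomorphic_nearI[of _ N]) auto
  then have "B_field A (matrix_class (?P p)) (\<lambda>u. ?P u $ a $ c) = Sp_field A (?P p) ((\<lambda>u. ?P u $ a $ c) \<circ> matrix_class)"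
    by (simp only: B_field_matrix_class[OF A pm(1,2)] if_True)
  also have "\<dots> = Sp_field A (?P p) (\<lambda>X. X $ a $ c)"
    by (rule Sp_field_germ[OF A pm(1) W(1,2)]) (use W(3) in simp)
  finally show ?thesis using Sp_field_entry[OF A pm(1)] pe by simp
qed

text \<open>The frame period serves as local coordinates. The curve representing
  \<open>\<xi>\<close> lifts through it to \<open>Sp_C\<close> with the same initial velocity as the
  flow line of \<open>A\<close>, and the derivative of any \<open>h\<close> is that of an ambient
  extension of its lift in this direction.\<close>

lemma tangent_eq_B_field:
  fixes F :: "'g::finite triple set \<Rightarrow> 'g triple"
  assumes A: "Sp_line A" and F: "universal_family F" and pf: "period_frame B_space F N \<gamma> \<delta>" and p: "p \<in> N"
    and \<xi>: "\<xi> \<in> tangent_space B_space p"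
    and eq: "\<And>a c. \<xi> (\<lambda>u. frame_period F \<gamma> \<delta> u $ a $ c) = (frame_period F \<gamma> \<delta> p ** A) $ a $ c"
  shows "\<xi> = B_field A p"
proof
  fix h
  let ?P = "frame_period F \<gamma> \<delta>"
  note pfD = period_frameD[OF pf] and pm = period_frame_matrix[OF pf p] and pe = universal_familyD(2)[OF F pf p]
  interpret hol_space "B_space :: 'g triple set cspace" by (rule hol_space_B_space)
  obtain c U where c: "\<xi> = velocity B_space c" "c 0 = p" "open U" "0 \<in> U" "holomorphic_map (plane_domain U) B_space c"
    by (rule tangent_space_curve[OF \<xi>])
  have Bp: "B_field A p h = (if holomorphic_near B_space p h then Sp_field A (?P p) (h \<circ> matrix_class) else 0)"
    using B_field_matrix_class[OF A pm(1,2), of h] unfolding pe[symmetric] .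
  show "\<xi> h = B_field A p h"
  proof (cases "holomorphic_near B_space p h")
    case True
    then obtain W where W: "openin (Top B_space) W" "p \<in> W" "h \<in> Hol B_space W" unfolding holomorphic_near_def by blast
    then have lW: "openin (top_of_set Sp_C) (lifted W)" "h \<circ> matrix_class \<in> Hol Sp_manifold (lifted W)"
      by (simp_all add: openin_B_space_iff Hol_B_space_iff)
    have Pp: "?P p \<in> lifted W" using pm(1,2) pe W(2) by (simp add: lifted_def)
    obtain N' H where H: "open N'" "?P p \<in> N'" "matrix_holomorphic_on H N'" "\<And>X. X \<in> N' \<Longrightarrow> X \<in> lifted W \<Longrightarrow> H X = (h \<circ> matrix_class) X"
      by (rule Hol_matrix_submanifoldD[OF lW(2) Pp]) (use that in auto)
    have NW: "openin (Top B_space) (N \<inter> W)" using pfD(1) W(1) by blast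
    define U' where "U' = {z \<in> U. c z \<in> N \<inter> W}"
    note pre = holomorphic_curve_preimage[OF c(5,3) NW, folded U'_def]
    have U': "open U'" "0 \<in> U'" using pre(1) c(2,4) p W(2) by (auto simp: U'_def)
    have near: "holomorphic_near B_space p (\<lambda>u. ?P u $ a $ b)" for a b
      by (rule holomorphic_nearI[OF pfD(1) p pfD(6)])
    have d: "((\<lambda>z. (?P \<circ> c) z $ a $ b) has_field_derivative (?P p ** A) $ a $ b) (at 0)" for a b
    proof -
      have "(\<lambda>u. ?P u $ a $ b) \<circ> c holomorphic_on U'"
        by (rule pre(2)[OF Hol_subset[OF pfD(6)]]) blast
      from holomorphic_derivI[OF this U'] have "((\<lambda>z. (?P \<circ> c) z $ a $ b) has_field_derivative deriv ((\<lambda>u. ?P u $ a $ b) \<circ> c) 0) (at 0)"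
        by (simp add: o_def)
      moreover have "deriv ((\<lambda>u. ?P u $ a $ b) \<circ> c) 0 = \<xi> (\<lambda>u. ?P u $ a $ b)"
        using near by (simp add: c(1,2) velocity_def)
      ultimately show ?thesis by (simp only: eq)
    qed
    \<comment> \<open>The lifted curve stays in \<open>lifted W\<close> and projects back to
      \<open>c\<close>.\<close>
    have PW: "(?P \<circ> c) z \<in> lifted W" "matrix_class (?P (c z)) = c z" if "z \<in> U'" for z
      using that period_frame_matrix[OF pf, of "c z"] universal_familyD(2)[OF F pf, of "c z"] by (auto simp: U'_def lifted_def)
    have "((h \<circ> matrix_class) \<circ> (?P \<circ> c) has_field_derivative frechet_derivative H (at ((?P \<circ> c) 0)) (?P p ** A)) (at 0)"
      by (rule Hol_curve_derivative[where c = "?P \<circ> c" and W = "lifted W" and U = U' and C = "?P p ** A", OF H(1) _ H(3,4) U' PW(1) d])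
        (use H(2) c(2) in simp_all)
    moreover have "\<forall>\<^sub>F z in nhds 0. ((h \<circ> matrix_class) \<circ> (?P \<circ> c)) z = (h \<circ> c) z"
      using U' PW(2) unfolding eventually_nhds by (intro exI[of _ U']) auto
    ultimately have "((h \<circ> c) has_field_derivative frechet_derivative H (at (?P p)) (?P p ** A)) (at 0)"
      using c(2) by (simp add: DERIV_cong_ev[OF refl _ refl] o_def)
    then have "\<xi> h = frechet_derivative H (at (?P p)) (?P p ** A)"
      using True by (simp add: c(1,2) velocity_def DERIV_imp_deriv)
    also have "\<dots> = Sp_field A (?P p) (h \<circ> matrix_class)"
      by (rule Sp_field_eq_derivative[OF A pm(1) lW(1) Pp lW(2) H, symmetric])
    finally show ?thesis using True Bp by simp
  next
    case False
    then show ?thesis using Bp by (simp add: c(1,2) velocity_def)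
  qed
qed

section \<open>The universal family\<close>

text \<open>
  Every point of the moduli space has exactly one representative in which the forms \<open>\<omega>\<close> are the
  coordinates of \<open>\<complex>\<^sup>g\<close>; these representatives form the universal family.
\<close>

definition coordinate_triple :: "'g::finite triple \<Rightarrow> bool" where
  "coordinate_triple t \<longleftrightarrow> (\<forall>j. om t j = restrict0 (lat t) (\<lambda>z. z $ j))"

text \<open>An isomorphism that respects the coordinate functions is the identity on the lattice,
  which spans over the reals. Off the lattice the forms are 0, so the triples are equal and not only
  isomorphic.\<close>

lemma coordinate_triple_unique:
  fixes t :: "'g::finite triple"
  assumes tt: "(t, t') \<in> triple_iso" and c: "coordinate_triple t" "coordinate_triple t'"
  shows "t = t'"
proof -
  obtain f where t: "is_triple t" "is_triple t'" and f: "is_triple_iso t t' f"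
    using tt by (auto simp: triple_iso_iff)
  have fL: "f x \<in> lat t'" "om t' j (f x) = om t j x" "et t' j (f x) = et t j x" if "x \<in> lat t" for x j
    using f that unfolding is_triple_iso_def by blast+
  have fx: "f x = x" if "x \<in> lat t" for x
  proof -
    have "f x $ j = x $ j" for j
      using fL(1)[OF that] fL(2)[OF that, of j] c that by (simp add: coordinate_triple_def restrict0_def)
    then show ?thesis by (simp add: vec_eq_iff)
  qed
  have "f ` lat t = lat t" using fx by simp
  then have lat: "lat t' = lat t" using f by (simp add: is_triple_iso_def)
  obtain \<gamma> \<delta> where sb: "integral_symplectic_basis (lat t) (pol t) \<gamma> \<delta>"
    by (rule exists_integral_symplectic_basis[OF is_tripleD(1,3)[OF t(1)]])
  have S: "symplectic_relations (pol t) \<gamma> \<delta>" and mem: "\<And>i. \<gamma> i \<in> lat t" "\<And>i. \<delta> i \<in> lat t"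
    using sb integral_symplectic_basis_iff[OF is_tripleD(3)[OF t(1)]] by auto
  have f_add: "f (x + y) = f x + f y" and f_scaleR: "f (r *\<^sub>R x) = r *\<^sub>R f x" for x y r
    using f by (simp_all add: is_triple_iso_def complex_linear_map_iff scaleR_vec_complex)
  have f_linear: "linear f" by (rule linearI) (simp_all add: f_add f_scaleR)
  have fid: "f v = v" for v
  proof -
    let ?e = "\<Sum>i\<in>UNIV. pol t v (\<delta> i) *\<^sub>R \<gamma> i + (- pol t v (\<gamma> i)) *\<^sub>R \<delta> i"
    have "f v = f ?e" by (rule arg_cong[OF symplectic_expand[OF S]])
    also have "\<dots> = ?e" by (simp only: linear_sum[OF f_linear] f_add f_scaleR fx[OF mem(1)] fx[OF mem(2)])
    also have "\<dots> = v" by (rule symplectic_expand[OF S, symmetric])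
    finally show ?thesis .
  qed
  have "pol t' (f v) (f w) = pol t v w" for v w using f unfolding is_triple_iso_def by blast
  then have pol: "pol t' = pol t" by (simp add: fid fun_eq_iff)
  have om: "om t' = om t" using c by (simp add: coordinate_triple_def lat fun_eq_iff)
  have "et t' j x = et t j x" for j x
  proof (cases "x \<in> lat t")
    case True
    then show ?thesis using fL(3)[OF True] by (simp add: fid)
  next
    case False
    then show ?thesis using is_tripleD(5)[OF t(1), of j] is_tripleD(5)[OF t(2), of j] lat by (simp add: H1dR_def)
  qed
  then have "et t' = et t" by (simp add: fun_eq_iff)
  with lat pol om show ?thesis by simp
qed

text \<open>Lattice vectors in the coordinates given by the omega: component \<open>j\<close> is the
  prescribed period of \<open>om j\<close>.\<close>

definition norm_\<gamma> :: "complex^('g::finite + 'g)^('g + 'g) \<Rightarrow> 'g \<Rightarrow> complex^'g" where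
  "norm_\<gamma> M i = (\<chi> j. two_pi_i * M $ Inr i $ Inr j)"
definition norm_\<delta> :: "complex^('g::finite + 'g)^('g + 'g) \<Rightarrow> 'g \<Rightarrow> complex^'g" where
  "norm_\<delta> M i = (\<chi> j. two_pi_i * M $ Inl i $ Inr j)"
text \<open>The linear map from these coordinates to the Siegel model; for positive symplectic
  \<open>M\<close> it takes \<open>norm_\<gamma> M i\<close> to a standard vector and
  \<open>norm_\<delta> M i\<close> to column \<open>i\<close> of \<open>tau_of M\<close>.\<close>

definition norm_chart :: "complex^('g::finite + 'g)^('g + 'g) \<Rightarrow> complex^'g \<Rightarrow> complex^'g" where
  "norm_chart M v = transpose (matrix_inv (block_22 M)) *v (\<chi> j. v $ j / two_pi_i)"
definition norm_form :: "complex^('g::finite + 'g)^('g + 'g) \<Rightarrow> complex^'g \<Rightarrow> complex^'g \<Rightarrow> real" where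
  "norm_form M v w = siegel_form (tau_of M) (norm_chart M v) (norm_chart M w)"
definition norm_lattice :: "complex^('g::finite + 'g)^('g + 'g) \<Rightarrow> (complex^'g) set" where
  "norm_lattice M = {\<Sum>a\<in>UNIV. of_int (n a) *\<^sub>R case_sum (norm_\<gamma> M) (norm_\<delta> M) a | n. True}"
definition norm_triple :: "complex^('g::finite + 'g)^('g + 'g) \<Rightarrow> 'g triple" where
  "norm_triple M = \<lparr>lat = norm_lattice M, pol = norm_form M,
     om = (\<lambda>j. restrict0 (norm_lattice M) (\<lambda>z. z $ j)),
     et = (\<lambda>j. restrict0 (norm_lattice M) (\<lambda>z. \<Sum>i\<in>UNIV. of_real (norm_form M (norm_\<gamma> M i) z) * M $ Inl i $ Inl j
                                    - of_real (norm_form M (norm_\<delta> M i) z) * M $ Inr i $ Inl j))\<rparr>"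

lemma norm_triple_sel:
  "lat (norm_triple M) = norm_lattice M" "pol (norm_triple M) = norm_form M"
  "om (norm_triple M) j = restrict0 (norm_lattice M) (\<lambda>z. z $ j)"
  "et (norm_triple M) j = restrict0 (norm_lattice M) (\<lambda>z. \<Sum>i\<in>UNIV. of_real (norm_form M (norm_\<gamma> M i) z) * M $ Inl i $ Inl j
                                    - of_real (norm_form M (norm_\<delta> M i) z) * M $ Inr i $ Inl j)"
  by (simp_all add: norm_triple_def)

lemma coordinate_norm_triple: "coordinate_triple (norm_triple M)"
  by (simp add: coordinate_triple_def norm_triple_sel)

text \<open>The Siegel structure is pulled back along \<open>norm_chart\<close>, which is injective.
  The periods of \<open>om\<close> are right because they are the components of the basis vectors;
  \<open>et\<close> is written in dual coordinates as in \<open>matrix_triple\<close>.\<close>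

lemma norm_triple:
  fixes M :: "complex^('g::finite + 'g)^('g + 'g)"
  assumes M: "M \<in> Sp_C" "hpos M"
  shows "is_triple (norm_triple M)"
    "integral_symplectic_basis (lat (norm_triple M)) (pol (norm_triple M)) (norm_\<gamma> M) (norm_\<delta> M)"
    "period_matrix (norm_triple M) (norm_\<gamma> M) (norm_\<delta> M) = M"
    "triple_class (norm_triple M) = matrix_class M"
proof -
  have D: "invertible (block_22 M)" and \<tau>: "tau_of M \<in> siegel_space" using hpos_tau_of[OF M] by auto
  let ?f = "norm_chart M" and ?E = "norm_form M" and ?L = "norm_lattice M" and ?t = "norm_triple M"
  have f_add: "?f (x + y) = ?f x + ?f y" and f_scale: "?f (c *s x) = c *s ?f x" for x y c
    by (simp_all add: norm_chart_def vec_eq_iff matrix_vector_mult_def algebra_simps sum.distrib sum_distrib_left add_divide_distrib)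
  have f\<gamma>: "?f (norm_\<gamma> M i) = axis i 1" for i
  proof -
    have "?f (norm_\<gamma> M i) = transpose (matrix_inv (block_22 M)) *v (transpose (block_22 M) *v axis i 1)"
      unfolding norm_chart_def
      by (rule arg_cong[where f = "\<lambda>v. _ *v v"])
        (simp add: norm_\<gamma>_def vec_eq_iff matrix_vector_mult_def transpose_def axis_def if_distrib cong: if_cong)
    then show ?thesis by (simp add: matrix_vector_mul_assoc transpose_matrix_inv[OF D])
  qed
  have f\<delta>: "?f (norm_\<delta> M i) = column i (tau_of M)" for i
  proof -
    have "?f (norm_\<delta> M i) = transpose (matrix_inv (block_22 M)) *v (transpose (block_12 M) *v axis i 1)"
      unfolding norm_chart_def
      by (rule arg_cong[where f = "\<lambda>v. _ *v v"])
        (simp add: norm_\<delta>_def vec_eq_iff matrix_vector_mult_def transpose_def axis_def if_distrib cong: if_cong)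
    also have "\<dots> = transpose (tau_of M) *v axis i 1"
      by (simp add: matrix_vector_mul_assoc tau_of_def matrix_transpose_mul)
    finally show ?thesis
      using siegel_space_sym[OF \<tau>]
      by (simp add: vec_eq_iff matrix_vector_mult_def transpose_def axis_def column_def if_distrib cong: if_cong)
  qed
  have f0: "v = 0" if "?f v = 0" for v
  proof -
    have "transpose (block_22 M) *v ?f v = (\<chi> j. v $ j / two_pi_i)"
      by (simp add: norm_chart_def matrix_vector_mul_assoc transpose_matrix_inv[OF D])
    then show "v = 0" using that by (simp add: vec_eq_iff)
  qed
  define H where "H v w = siegel_hermitian (tau_of M) (?f v) (?f w)" for v w
  note sh = siegel_hermitian_pos_def[OF \<tau>]
  have H: "pos_def_hermitian H"
    unfolding pos_def_hermitian_def
  proof (intro conjI allI impI)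
    fix v w :: "complex^'g"
    show "Vector_Spaces.linear (*s) (*) (H v)"
      by (simp add: complex_linear_functional_iff H_def f_add f_scale pos_def_hermitian_linear[OF sh])
    show "H w v = cnj (H v w)" using sh unfolding pos_def_hermitian_def H_def by blast
    assume "v \<noteq> 0"
    then show "0 < Re (H v v)" unfolding H_def using pos_def_hermitian_pos[OF sh] f0 by blast
  qed
  have HE: "?E v w = Im (H v w)" for v w by (simp add: norm_form_def H_def siegel_form_hermitian)
  have E: "skew_form ?E" by (rule Im_hermitian_skew_form[OF H HE])
  have S: "symplectic_relations ?E (norm_\<gamma> M) (norm_\<delta> M)"
    unfolding symplectic_relations_def norm_form_def f\<gamma> f\<delta>
    using E by (simp add: symplectic_relations_eqs[OF siegel_form_relations[OF \<tau>]] norm_form_def[abs_def])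
  have lat: "is_lattice ?L" unfolding norm_lattice_def by (rule symplectic_is_lattice[OF S])
  have pp: "principal_polarization ?L ?E"
    unfolding norm_lattice_def by (rule symplectic_principal_polarization[OF S H HE])
  have "case_sum (norm_\<gamma> M) (norm_\<delta> M) a \<in> ?L" for a unfolding norm_lattice_def by (rule combinations_contain)
  from this[of "Inl _"] this[of "Inr _"] have mem: "norm_\<gamma> M i \<in> ?L" "norm_\<delta> M i \<in> ?L" for i by auto
  show sb: "integral_symplectic_basis (lat ?t) (pol ?t) (norm_\<gamma> M) (norm_\<delta> M)"
    using S mem integral_symplectic_basis_iff[OF pp] by (auto simp: norm_triple_sel)
  note rel = symplectic_relations_eqs[OF S]
  have comp: "norm_\<gamma> M i $ j = two_pi_i * M $ Inr i $ Inr j" "norm_\<delta> M i $ j = two_pi_i * M $ Inl i $ Inr j" for i j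
    by (simp_all add: norm_\<gamma>_def norm_\<delta>_def)
  have "period_matrix ?t (norm_\<gamma> M) (norm_\<delta> M) $ a $ b = M $ a $ b" for a b
  proof (cases a)
    case (Inl i)
    then show ?thesis
      by (cases b) (simp_all add: norm_triple_sel restrict0_def mem rel comp if_distrib[of of_real] if_distrib[of "\<lambda>x. x * _"] cong: if_cong)
  next
    case (Inr i)
    then show ?thesis
      by (cases b) (simp_all add: norm_triple_sel restrict0_def mem rel comp if_distrib[of of_real] if_distrib[of uminus] if_distrib[of "\<lambda>x. x * _"] cong: if_cong)
  qed
  then show pm: "period_matrix ?t (norm_\<gamma> M) (norm_\<delta> M) = M" by (simp add: vec_eq_iff)
  show t: "is_triple ?t"
  proof (rule symplectic_hodge_basis_from_period_matrix[OF _ _ sb])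
    show "om ?t j \<in> hodge_F1 (lat ?t)" for j
      unfolding hodge_F1_def norm_triple_sel complex_linear_functional_iff
      by (intro CollectI exI[of _ "\<lambda>z. z $ j"] conjI refl) simp_all
    show "et ?t j \<in> H1dR (lat ?t)" for j
      unfolding norm_triple_sel
      by (rule restrict0_H1dR[OF is_lattice_subgroup[OF lat]])
        (simp add: skew_form_add[OF E] algebra_simps sum.distrib sum_subtractf)
  qed (use lat pp pm M in \<open>simp_all add: norm_triple_sel\<close>)
  show "triple_class ?t = matrix_class M"
    using triple_class_eq_matrix_class[OF t sb] pm by simp
qed

definition coordinate_family :: "'g::finite triple set \<Rightarrow> 'g triple" where
  "coordinate_family p = (THE t. t \<in> p \<and> coordinate_triple t)"

lemma coordinate_family_matrix_class:
  assumes M: "M \<in> Sp_C" "hpos M" shows "coordinate_family (matrix_class M) = norm_triple M"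
  unfolding coordinate_family_def
proof (rule the_equality)
  have "(norm_triple M, norm_triple M) \<in> triple_iso"
    using norm_triple(1)[OF M] is_triple_iso_id by (auto simp: triple_iso_iff)
  then show *: "norm_triple M \<in> matrix_class M \<and> coordinate_triple (norm_triple M)"
    using coordinate_norm_triple mem_triple_class_iff[OF norm_triple(1)[OF M]] norm_triple(4)[OF M] by auto
  fix t assume t: "t \<in> matrix_class M \<and> coordinate_triple t"
  then have "(norm_triple M, t) \<in> triple_iso"
    using mem_triple_class_iff[OF norm_triple(1)[OF M]] norm_triple(4)[OF M] by simp
  then show "t = norm_triple M" using coordinate_triple_unique[OF _ coordinate_norm_triple] t by metis
qed

text \<open>The open piece \<open>T\<close> of positive symplectic matrices meets every orbit at
  most once, so \<open>matrix_class\<close> is injective on it and \<open>s\<close> inverts it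
  there. Near a given point of \<open>lifted N\<close>, the lifted section is multiplication by a
  fixed \<open>S\<close> in \<open>Sp_Z\<close>, hence holomorphic.\<close>

lemma matrix_class_local_section:
  fixes M0 :: "complex^('g::finite + 'g)^('g + 'g)"
  assumes M0: "M0 \<in> Sp_C" "hpos M0"
  obtains N s where "openin (Top B_space) N" "matrix_class M0 \<in> N"
    "\<forall>u\<in>N. s u \<in> Sp_C \<and> hpos (s u) \<and> matrix_class (s u) = u"
    "\<forall>a c. (\<lambda>u. s u $ a $ c) \<in> Hol B_space N"
proof -
  obtain D where D: "open D" "M0 \<in> D" "\<And>M S. M \<in> D \<Longrightarrow> M \<in> Sp_C \<Longrightarrow> S \<in> Sp_Z \<Longrightarrow> S ** M \<in> D \<Longrightarrow> S = mat 1"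
    by (rule Sp_Z_discrete[OF M0(1)]) (use that in auto)
  define T where "T = Sp_C \<inter> (D \<inter> {M. hpos M})"
  have T: "openin (top_of_set Sp_C) T" unfolding T_def by (intro openin_open_Int open_Int D(1) open_hpos)
  have TD: "X \<in> Sp_C" "hpos X" "X \<in> D" if "X \<in> T" for X using that by (auto simp: T_def)
  have uniq: "X = X'" if X: "X \<in> T" "X' \<in> T" "matrix_class X = matrix_class X'" for X X'
  proof -
    have "Sp_Z_class X = Sp_Z_class X'" using matrix_class_eq_iff[OF TD(1,2)[OF X(1)] TD(1,2)[OF X(2)]] X(3) by simp
    then obtain S where S: "S \<in> Sp_Z" "X' = S ** X" unfolding Sp_Z_class_eq_iff by blast
    have "S = mat 1" by (rule D(3)[OF TD(3,1)[OF X(1)] S(1)]) (use TD(3)[OF X(2)] S(2) in simp)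
    then show ?thesis using S(2) by simp
  qed
  define N where "N = matrix_class ` T"
  define s where "s u = (THE X. X \<in> T \<and> matrix_class X = u)" for u
  have s: "s (matrix_class X) = X" if "X \<in> T" for X
    unfolding s_def by (rule the_equality) (use that uniq in auto)
  \<comment> \<open>A positive matrix with class in \<open>N\<close> is carried into
    \<open>T\<close> by some element of \<open>Sp_Z\<close>; conversely translates of
    \<open>T\<close> are positive by invariance. This displays the preimage as a union of open
    sets.\<close>
  have lN: "lifted N = (\<Union>S\<in>Sp_Z. {M \<in> Sp_C. S ** M \<in> T})"
  proof (intro equalityI subsetI)
    fix M assume "M \<in> lifted N"
    then obtain X where M: "M \<in> Sp_C" "hpos M" and X: "X \<in> T" "matrix_class M = matrix_class X"
      by (auto simp: lifted_def N_def)
    have "Sp_Z_class M = Sp_Z_class X" using matrix_class_eq_iff[OF M TD(1,2)[OF X(1)]] X(2) by simp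
    then show "M \<in> (\<Union>S\<in>Sp_Z. {M \<in> Sp_C. S ** M \<in> T})" using X(1) M unfolding Sp_Z_class_eq_iff by blast
  next
    fix M assume "M \<in> (\<Union>S\<in>Sp_Z. {M \<in> Sp_C. S ** M \<in> T})"
    then obtain S where S: "S \<in> Sp_Z" "M \<in> Sp_C" "S ** M \<in> T" by blast
    have "M = sinv S ** (S ** M)" by (simp add: matrix_mul_assoc sinv_left Sp_Z_subset[OF S(1)])
    then have "hpos M" using hpos_mult_Sp_Z[OF sinv_in_Sp_Z[OF S(1)] TD(2)[OF S(3)]] by simp
    then show "M \<in> lifted N"
      using S matrix_class_mult[OF S(2) _ S(1)] by (auto simp: lifted_def N_def image_iff intro!: bexI[of _ "S ** M"])
  qed
  have oN: "openin (Top B_space) N"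
    unfolding openin_B_space_iff
  proof
    show "N \<subseteq> B_set" using matrix_class_in_B_set TD by (auto simp: N_def)
    have tr: "openin (top_of_set Sp_C) {M \<in> Sp_C. S ** M \<in> T}" if "S \<in> Sp_Z" for S
      by (rule Sp_translation_Hol(1)[OF Sp_Z_subset[OF that] T, of "\<lambda>_. 0"])
        (rule hol_space.Hol_const[OF hol_space_matrix_submanifold])
    show "openin (top_of_set Sp_C) (lifted N)"
      unfolding lN by (intro openin_Union) (use tr in auto)
  qed
  have "(\<lambda>u. s u $ a $ c) \<in> Hol B_space N" for a c
    unfolding Hol_B_space_iff
  proof (rule Hol_matrix_submanifoldI)
    fix A assume A: "A \<in> lifted N"
    then obtain S where S: "S \<in> Sp_Z" "A \<in> Sp_C" "S ** A \<in> T" unfolding lN by blast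
    have "open ((**) S -` (D \<inter> {M. hpos M}))"
      by (intro open_vimage open_Int D(1) open_hpos continuous_intros)
    moreover have "A \<in> (**) S -` (D \<inter> {M. hpos M})" using S(3) by (simp add: T_def)
    moreover have "matrix_holomorphic_on (\<lambda>X. (S ** X) $ a $ c) ((**) S -` (D \<inter> {M. hpos M}))"
      by (intro matrix_holomorphic_on_matrix_mult matrix_holomorphic_intros)
    moreover have "(S ** X) $ a $ c = ((\<lambda>u. s u $ a $ c) \<circ> matrix_class) X" if X: "X \<in> (**) S -` (D \<inter> {M. hpos M}) \<inter> lifted N" for X
    proof -
      have XS: "X \<in> Sp_C" "hpos X" using X by (auto simp: lifted_def)
      then have "S ** X \<in> T" using X mult_in_Sp_C[OF Sp_Z_subset[OF S(1)]] by (auto simp: T_def)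
      then have "s (matrix_class X) = S ** X" using s matrix_class_mult[OF XS S(1)] by metis
      then show ?thesis by simp
    qed
    ultimately show "\<exists>N' H. open N' \<and> A \<in> N' \<and> matrix_holomorphic_on H N' \<and> (\<forall>X\<in>N' \<inter> lifted N. H X = ((\<lambda>u. s u $ a $ c) \<circ> matrix_class) X)"
      by (intro exI[of _ "(**) S -` (D \<inter> {M. hpos M})"] exI[of _ "\<lambda>X. (S ** X) $ a $ c"] conjI ballI)
  qed
  then have Hol: "\<forall>a c. (\<lambda>u. s u $ a $ c) \<in> Hol B_space N" by blast
  have M0N: "matrix_class M0 \<in> N" using M0 D(2) by (auto simp: N_def T_def)
  have "\<forall>u\<in>N. s u \<in> Sp_C \<and> hpos (s u) \<and> matrix_class (s u) = u" using s TD by (auto simp: N_def)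
  then show ?thesis by (rule that[OF oN M0N _ Hol])
qed

text \<open>Without a universal family the condition defining \<open>ramanujan_field\<close> would
  be vacuous and determine nothing. Locally the family is \<open>norm_triple\<close> of a
  holomorphic section of \<open>matrix_class\<close>.\<close>

lemma universal_coordinate_family: "universal_family (coordinate_family :: 'g::finite triple set \<Rightarrow> 'g triple)"
  unfolding universal_family_def holomorphic_family_def topspace_B_space
proof (intro conjI ballI)
  interpret hol_space "B_space :: 'g triple set cspace" by (rule hol_space_B_space)
  fix p :: "'g triple set" assume p: "p \<in> B_set"
  obtain M0 where M0: "M0 \<in> Sp_C" "hpos M0" "p = matrix_class M0" by (rule B_set_matrix_class[OF p])
  have F0: "coordinate_family p = norm_triple M0" using coordinate_family_matrix_class M0 by simp
  show "is_triple (coordinate_family p)" unfolding F0 by (rule norm_triple(1)[OF M0(1,2)])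
  show "coordinate_family p \<in> p"
  proof -
    have "(norm_triple M0, norm_triple M0) \<in> triple_iso"
      using norm_triple(1)[OF M0(1,2)] is_triple_iso_id by (auto simp: triple_iso_iff)
    then have "norm_triple M0 \<in> p"
      using mem_triple_class_iff[OF norm_triple(1)[OF M0(1,2)]] norm_triple(4)[OF M0(1,2)] M0(3) by simp
    then show ?thesis unfolding F0 .
  qed
  obtain N s where N: "openin (Top B_space) N" "p \<in> N"
    and s: "\<forall>u\<in>N. s u \<in> Sp_C \<and> hpos (s u) \<and> matrix_class (s u) = u"
    and Hol: "\<forall>a c. (\<lambda>u. s u $ a $ c) \<in> Hol B_space N"
    unfolding M0(3) by (rule matrix_class_local_section[OF M0(1,2)])
  define b where "b a u = case_sum (norm_\<gamma> (s u)) (norm_\<delta> (s u)) a" for a u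
  have su: "s u \<in> Sp_C" "hpos (s u)" "coordinate_family u = norm_triple (s u)" if "u \<in> N" for u
  proof -
    show *: "s u \<in> Sp_C" "hpos (s u)" using s that by blast+
    have "matrix_class (s u) = u" using s that by blast
    then show "coordinate_family u = norm_triple (s u)" using coordinate_family_matrix_class[OF *] by simp
  qed
  have pmu: "period_matrix (coordinate_family u) (norm_\<gamma> (s u)) (norm_\<delta> (s u)) $ a $ c = s u $ a $ c" if "u \<in> N" for u a c
    using su[OF that] norm_triple(3) by metis
  have om: "two_pi_i * s u $ (case_sum Inr Inl a) $ Inr j = om (coordinate_family u) j (b a u)" if "u \<in> N" for u a j
    using pmu[OF that, of "case_sum Inr Inl a" "Inr j"] by (cases a) (simp_all add: b_def field_simps)
  have et: "s u $ (case_sum Inr Inl a) $ Inl j = et (coordinate_family u) j (b a u)" if "u \<in> N" for u a j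
    using pmu[OF that, of "case_sum Inr Inl a" "Inl j"] by (cases a) (simp_all add: b_def)
  have rel: "symplectic_relations (pol (coordinate_family u)) (norm_\<gamma> (s u)) (norm_\<delta> (s u))" if "u \<in> N" for u
    using norm_triple(2)[OF su(1,2)[OF that]] integral_symplectic_basis_iff[OF is_tripleD(3)[OF norm_triple(1)[OF su(1,2)[OF that]]]]
    unfolding su(3)[OF that] by blast
  show "\<exists>N b. openin (Top B_space) N \<and> p \<in> N \<and>
        (\<forall>u\<in>N. lattice_basis (lat (coordinate_family u)) (\<lambda>i. b i u)) \<and>
        (\<forall>i j. (\<lambda>u. b i u $ j) \<in> Hol B_space N) \<and>
        (\<forall>u\<in>N. \<forall>i j. pol (coordinate_family u) (b i u) (b j u) = pol (coordinate_family p) (b i p) (b j p)) \<and>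
        (\<forall>i j. (\<lambda>u. om (coordinate_family u) j (b i u)) \<in> Hol B_space N \<and> (\<lambda>u. et (coordinate_family u) j (b i u)) \<in> Hol B_space N)"
  proof (intro exI[of _ N] exI[of _ b] conjI ballI allI N)
    show "lattice_basis (lat (coordinate_family u)) (\<lambda>i. b i u)" if "u \<in> N" for u
      using norm_triple(2)[OF su(1,2)[OF that]] unfolding su(3)[OF that] by (simp add: integral_symplectic_basis_def b_def)
    show "(\<lambda>u. b i u $ j) \<in> Hol B_space N" for i j
      by (cases i) (simp_all add: b_def norm_\<gamma>_def norm_\<delta>_def Hol_mult[OF Hol_const] Hol)
    show "pol (coordinate_family u) (b i u) (b j u) = pol (coordinate_family p) (b i p) (b j p)" if "u \<in> N" for u i j
      by (cases i; cases j) (simp_all add: b_def symplectic_relations_eqs[OF rel[OF that]] symplectic_relations_eqs[OF rel[OF N(2)]])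
    show "(\<lambda>u. om (coordinate_family u) j (b i u)) \<in> Hol B_space N" for i j
      by (rule Hol_cong[OF _ om]) (intro Hol_mult Hol_const Hol[rule_format])
    show "(\<lambda>u. et (coordinate_family u) j (b i u)) \<in> Hol B_space N" for i j
      by (rule Hol_cong[OF _ et]) (intro Hol[rule_format])
  qed
qed

text \<open>\<open>B_field\<close> solves the equations for every universal family. For uniqueness
  one family is enough: the derivatives of its period entries determine the tangent vector at each
  point, and extensionality fixes the rest.\<close>

lemma ramanujan_field_eq: "ramanujan_field k l = B_field (ramanujan_matrix k l)"
  for k l :: "'g::finite"
  unfolding ramanujan_field_def Let_def
proof (rule the_equality)
  let ?A = "ramanujan_matrix k l"
  have A: "Sp_line ?A" by (rule Sp_line_ramanujan_matrix)
  have frame: "\<exists>N \<gamma> \<delta>. p \<in> N \<and> period_frame B_space F N \<gamma> \<delta>"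
    if "universal_family F" "p \<in> points B_space" for F :: "'g triple set \<Rightarrow> 'g triple" and p
    by (rule holomorphic_family_period_frame[OF hol_space_B_space _ that(2), of F])
      (use that(1) in \<open>auto simp: universal_family_def\<close>)
  show "holomorphic_vector_field B_space (B_field ?A) \<and>
    (\<forall>F. universal_family F \<longrightarrow> (\<forall>p\<in>points B_space.
       gauss_manin B_space (\<lambda>q. lat (F q)) p (B_field ?A p) (\<lambda>q. om (F q) k) = et (F p) l \<and>
       gauss_manin B_space (\<lambda>q. lat (F q)) p (B_field ?A p) (\<lambda>q. om (F q) l) = et (F p) k \<and>
       (\<forall>m. m \<notin> {k, l} \<longrightarrow> gauss_manin B_space (\<lambda>q. lat (F q)) p (B_field ?A p) (\<lambda>q. om (F q) m) = (\<lambda>_. 0)) \<and>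
       (\<forall>m. gauss_manin B_space (\<lambda>q. lat (F q)) p (B_field ?A p) (\<lambda>q. et (F q) m) = (\<lambda>_. 0))))"
  proof (intro conjI[OF holomorphic_vector_field_B_field[OF A]] allI impI ballI)
    fix F :: "'g triple set \<Rightarrow> 'g triple" and p :: "'g triple set"
    assume F: "universal_family F" and p: "p \<in> points B_space"
    obtain N \<gamma> \<delta> where N: "p \<in> N" "period_frame B_space F N \<gamma> \<delta>" using frame[OF F p] by blast
    have t: "B_field ?A p \<in> tangent_space B_space p"
      using p by (intro B_field_tangent[OF A]) (simp add: topspace_B_space)
    show "gauss_manin B_space (\<lambda>q. lat (F q)) p (B_field ?A p) (\<lambda>q. om (F q) k) = et (F p) l \<and>
       gauss_manin B_space (\<lambda>q. lat (F q)) p (B_field ?A p) (\<lambda>q. om (F q) l) = et (F p) k \<and>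
       (\<forall>m. m \<notin> {k, l} \<longrightarrow> gauss_manin B_space (\<lambda>q. lat (F q)) p (B_field ?A p) (\<lambda>q. om (F q) m) = (\<lambda>_. 0)) \<and>
       (\<forall>m. gauss_manin B_space (\<lambda>q. lat (F q)) p (B_field ?A p) (\<lambda>q. et (F q) m) = (\<lambda>_. 0))"
      unfolding ramanujan_equations_iff[OF hol_space_B_space N(2,1) t]
      by (intro allI B_field_frame_period[OF A F N(2,1)])
  qed
  fix v :: "'g triple set \<Rightarrow> 'g triple set tvec"
  assume v: "holomorphic_vector_field B_space v \<and>
    (\<forall>F. universal_family F \<longrightarrow> (\<forall>p\<in>points B_space.
       gauss_manin B_space (\<lambda>q. lat (F q)) p (v p) (\<lambda>q. om (F q) k) = et (F p) l \<and>
       gauss_manin B_space (\<lambda>q. lat (F q)) p (v p) (\<lambda>q. om (F q) l) = et (F p) k \<and>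
       (\<forall>m. m \<notin> {k, l} \<longrightarrow> gauss_manin B_space (\<lambda>q. lat (F q)) p (v p) (\<lambda>q. om (F q) m) = (\<lambda>_. 0)) \<and>
       (\<forall>m. gauss_manin B_space (\<lambda>q. lat (F q)) p (v p) (\<lambda>q. et (F q) m) = (\<lambda>_. 0))))"
  show "v = B_field ?A"
  proof
    fix p
    show "v p = B_field ?A p"
    proof (cases "p \<in> points (B_space :: 'g triple set cspace)")
      case True
      let ?F = "coordinate_family :: 'g triple set \<Rightarrow> 'g triple"
      have F: "universal_family ?F" by (rule universal_coordinate_family)
      obtain N \<gamma> \<delta> where N: "p \<in> N" "period_frame B_space ?F N \<gamma> \<delta>" using frame[OF F True] by blast
      have t: "v p \<in> tangent_space B_space p" using v True by (simp add: holomorphic_vector_field_def)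
      have "\<forall>a c. v p (\<lambda>u. frame_period ?F \<gamma> \<delta> u $ a $ c) = (frame_period ?F \<gamma> \<delta> p ** ?A) $ a $ c"
        unfolding ramanujan_equations_iff[OF hol_space_B_space N(2,1) t, symmetric] using v F True by blast
      then show ?thesis by (intro tangent_eq_B_field[OF A F N(2,1) t]) blast
    next
      case False
      then have "p \<notin> B_set" by (simp add: topspace_B_space)
      then show ?thesis using v False by (simp add: holomorphic_vector_field_def extensional_def B_field_def)
    qed
  qed
qed

text \<open>Both sides differentiate \<open>h\<close> composed with \<open>Sp_Z_class\<close> along
  the flow line at \<open>M\<close>, because \<open>period_map\<close> after
  \<open>matrix_class\<close> equals \<open>Sp_Z_class\<close> on positive matrices.
  \<open>M\<close> itself is positive since its class lies in the period domain.\<close>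

lemma pushforward_ramanujan_field:
  fixes p :: "'g::finite triple set"
  assumes p: "p \<in> B_set" and M: "M \<in> Sp_C" "Sp_Z_class M = period_map p"
  shows "pushforward Sp_quotient period_map p (ramanujan_field k l p) =
    pushforward Sp_quotient Sp_Z_class M (left_invariant_field (ramanujan_matrix k l) M)"
proof
  fix h
  let ?A = "ramanujan_matrix k l"
  have A: "Sp_line ?A" by (rule Sp_line_ramanujan_matrix)
  have "Sp_Z_class M \<in> period_domain" using period_map_in_period_domain[OF p] M(2) by simp
  then have hp: "hpos M" using Sp_Z_class_in_period_domain_iff[OF M(1)] by simp
  obtain M' where M': "M' \<in> Sp_C" "hpos M'" "p = matrix_class M'" by (rule B_set_matrix_class[OF p])
  have "Sp_Z_class M = Sp_Z_class M'" using M(2) M'(3) period_map_matrix_class[OF M'(1,2)] by simp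
  then have pM: "p = matrix_class M" using matrix_class_eq_iff[OF M(1) hp M'(1,2)] M'(3) by simp
  show "pushforward Sp_quotient period_map p (ramanujan_field k l p) h =
    pushforward Sp_quotient Sp_Z_class M (left_invariant_field ?A M) h"
  proof (cases "holomorphic_near Sp_quotient (Sp_Z_class M) h")
    case True
    then obtain W where W: "openin (Top Sp_quotient) W" "Sp_Z_class M \<in> W" "h \<in> Hol Sp_quotient W"
      unfolding holomorphic_near_def by blast
    \<comment> \<open>\<open>period_map\<close> is known to be holomorphic into the open subspace,
      so the neighbourhood is cut down to the period domain.\<close>
    let ?V = "W \<inter> period_domain"
    have V: "openin (Top (open_subspace Sp_quotient period_domain)) ?V"
      unfolding openin_open_subspace_period_domain using W(1) openin_period_domain by blast
    have "h \<circ> Sp_Z_class \<in> Hol Sp_manifold {M \<in> Sp_C. Sp_Z_class M \<in> ?V}"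
      by (rule hol_space.Hol_subset[OF hol_space_matrix_submanifold W(3)[unfolded mem_Hol_Sp_quotient]]) auto
    then have hV: "h \<in> Hol (open_subspace Sp_quotient period_domain) ?V"
      by (simp add: open_subspace_def mem_Hol_Sp_quotient)
    have "holomorphic_near B_space p (h \<circ> period_map)"
    proof (rule holomorphic_nearI)
      show "h \<circ> period_map \<in> Hol B_space {x \<in> points B_space. period_map x \<in> ?V}"
        by (rule holomorphic_map_pullback[OF holomorphic_map_period_map V hV])
      show "openin (Top B_space) {x \<in> points B_space. period_map x \<in> ?V}"
        using holomorphic_map_period_map V unfolding holomorphic_map_def by (blast intro: openin_continuous_map_preimage)
      show "p \<in> {x \<in> points B_space. period_map x \<in> ?V}"
        using p W(2) M(2) period_map_in_period_domain[OF p] by (simp add: topspace_B_space)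
    qed
    then have "B_field ?A p (h \<circ> period_map) = Sp_field ?A M (h \<circ> period_map \<circ> matrix_class)"
      using B_field_matrix_class[OF A M(1) hp] by (simp only: pM if_True)
    also have "\<dots> = Sp_field ?A M (h \<circ> Sp_Z_class)"
      by (rule Sp_field_germ[OF A M(1) openin_hpos]) (use M hp in \<open>auto simp: period_map_matrix_class\<close>)
    finally show ?thesis
      using True M(2) by (simp add: pushforward_def ramanujan_field_eq left_invariant_field_eq[OF A])
  qed (simp add: pushforward_def M(2))
qed

section \<open>The map from the Siegel space\<close>

lemma matrix_inv_mat_1: "matrix_inv (mat 1 :: complex^'n^'n) = mat 1"
proof -
  have "invertible (mat 1 :: complex^'n^'n)" by (auto simp: invertible_def)
  from matrix_inv(1)[OF this] show ?thesis by simp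
qed

text \<open>Diagonal directions preserve symmetry, and among symmetric matrices openness is
  inherited from \<open>open_hpos\<close> through the symplectic matrices with blocks
  \<open>1\<close>, \<open>\<tau>\<close>, \<open>0\<close>, \<open>1\<close>.\<close>

lemma open_diagonal_translates:
  fixes \<tau> :: "complex^'g::finite^'g"
  assumes \<tau>: "\<tau> \<in> siegel_space"
  shows "\<forall>\<^sub>F t in nhds 0. \<tau> + mscale t (E_matrix k k) \<in> siegel_space"
proof -
  let ?M = "\<lambda>\<tau> :: complex^'g^'g. block_matrix (mat 1) \<tau> 0 (mat 1)"
  have iff: "hpos (?M \<sigma>) \<longleftrightarrow> \<sigma> \<in> siegel_space" if "transpose \<sigma> = \<sigma>" for \<sigma>
  proof -
    have "?M \<sigma> \<in> Sp_C" using that by (simp add: block_matrix_in_Sp_C_iff)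
    from siegel_space_iff_hpos[OF this] show ?thesis
      by (auto simp: tau_of_def matrix_inv_mat_1 invertible_def)
  qed
  have sym: "transpose \<tau> = \<tau>" using \<tau> by (simp add: siegel_space_def)
  have "transpose (\<tau> + mscale t (E_matrix k k)) = \<tau> + mscale t (E_matrix k k)" for t
    using sym by (auto simp: vec_eq_iff transpose_def E_matrix_def)
  note iff' = iff[OF this]
  have "continuous_on UNIV (\<lambda>t. ?M (\<tau> + mscale t (E_matrix k k)))"
  proof -
    have "continuous_on UNIV (\<lambda>t. ?M (\<tau> + mscale t (E_matrix k k)) $ a $ b)" for a b
      by (cases a; cases b) (auto intro!: continuous_intros)
    then show ?thesis
      using continuous_on_vec_lambda[of UNIV "\<lambda>a t. \<chi> b. ?M (\<tau> + mscale t (E_matrix k k)) $ a $ b"]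
        continuous_on_vec_lambda[of UNIV "\<lambda>b t. ?M (\<tau> + mscale t (E_matrix k k)) $ a $ b" for a]
      by simp
  qed
  then have "open ((\<lambda>t. ?M (\<tau> + mscale t (E_matrix k k))) -` {M. hpos M})" by (rule open_vimage[OF open_hpos])
  moreover have "0 \<in> (\<lambda>t. ?M (\<tau> + mscale t (E_matrix k k))) -` {M. hpos M}"
    using iff'[of 0] \<tau> by (simp add: mscale_def zero_vec_def[symmetric])
  ultimately show ?thesis
    unfolding eventually_nhds using iff' by (intro exI[of _ "(\<lambda>t. ?M (\<tau> + mscale t (E_matrix k k))) -` {M. hpos M}"]) auto
qed

text \<open>For \<open>y = m + \<tau> n\<close> the period of \<open>siegel_omega k\<close> is
  \<open>2 pi i\<close> times coordinate \<open>k\<close> of \<open>m + \<tau> n\<close>.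
  Differentiating along the diagonal entry \<open>k\<close> of \<open>\<tau>\<close> and dividing by
  \<open>2 pi i\<close> leaves coordinate \<open>k\<close> of \<open>n\<close>, which is also the
  pairing of the standard vector with \<open>y\<close>.\<close>

lemma siegel_eta_eq:
  fixes \<tau> :: "complex^'g::finite^'g"
  assumes \<tau>: "\<tau> \<in> siegel_space"
  shows "siegel_eta k \<tau> = restrict0 (siegel_lattice \<tau>) (\<lambda>z. of_real (siegel_form \<tau> (axis k 1) z))"
proof
  fix y
  let ?X = "matrix_submanifold (siegel_space :: (complex^'g^'g) set)"
  interpret hol_space ?X by (rule hol_space_matrix_submanifold)
  show "siegel_eta k \<tau> y = restrict0 (siegel_lattice \<tau>) (\<lambda>z. of_real (siegel_form \<tau> (axis k 1) z)) y"
  proof (cases "y \<in> siegel_lattice \<tau>")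
    case True
    define b where "b a u = case_sum (\<lambda>i. axis i 1) (\<lambda>i. column i u) a" for a :: "'g + 'g" and u :: "complex^'g^'g"
    obtain n where n: "y = (\<Sum>a\<in>UNIV. of_int (n a) *\<^sub>R b a \<tau>)"
      using True unfolding siegel_lattice_eq b_def by blast
    have bHol: "(\<lambda>u. b a u $ j) \<in> Hol ?X siegel_space" for a j
      by (rule matrix_holomorphic_on_imp_Hol[of _ UNIV])
        (cases a; auto simp: b_def column_def intro!: matrix_holomorphic_on_const matrix_holomorphic_on_entry)+
    define \<sigma> where "\<sigma> = (SOME \<sigma>. homology_section ?X siegel_lattice \<tau> y \<sigma>)"
    have "homology_section ?X siegel_lattice \<tau> y (\<lambda>u. \<Sum>a\<in>UNIV. of_int (n a) *\<^sub>R b a u)"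
      unfolding homology_section_def
    proof (intro conjI exI[of _ siegel_space] ballI allI)
      show "(\<Sum>a\<in>UNIV. of_int (n a) *\<^sub>R b a u) \<in> siegel_lattice u" for u
        unfolding siegel_lattice_eq b_def by blast
      show "(\<lambda>u. (\<Sum>a\<in>UNIV. of_int (n a) *\<^sub>R b a u) $ j) \<in> Hol ?X siegel_space" for j
        unfolding sum_component vector_scaleR_component by (rule Hol_sum, rule Hol_scaleR, rule bHol)
    qed (use n \<tau> in auto)
    then have "\<exists>\<sigma>. homology_section ?X siegel_lattice \<tau> y \<sigma>" by blast
    then have \<sigma>: "homology_section ?X siegel_lattice \<tau> y \<sigma>" unfolding \<sigma>_def by (rule someI_ex)
    have indep: "\<forall>i. c i = 0" if "(\<Sum>i\<in>UNIV. c i *\<^sub>R b i \<tau>) = 0" for c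
      using symplectic_independent[OF siegel_form_relations[OF \<tau>], of c] that by (simp add: b_def)
    have "\<exists>N'. openin (Top ?X) N' \<and> \<tau> \<in> N' \<and> N' \<subseteq> siegel_space \<and> (\<forall>u\<in>N'. \<sigma> u = (\<Sum>i\<in>UNIV. of_int (n i) *\<^sub>R b i u))"
      by (rule homology_section_locally_constant[where b = b and n = n and N = siegel_space, OF _ \<tau> _ bHol indep \<sigma> n])
        (auto simp: siegel_lattice_eq b_def)
    then obtain N' where N': "openin (Top ?X) N'" "\<tau> \<in> N'" "N' \<subseteq> siegel_space"
      and \<sigma>N: "\<forall>u\<in>N'. \<sigma> u = (\<Sum>i\<in>UNIV. of_int (n i) *\<^sub>R b i u)" by (elim exE conjE)
    \<comment> \<open>The period as a polynomial in the entries of an arbitrary matrix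
      \<open>u\<close>; on \<open>N'\<close>, where the chosen section has constant coordinates, it
      agrees with the actual period.\<close>
    define g :: "complex^'g^'g \<Rightarrow> complex" where "g u = two_pi_i * (of_int (n (Inl k)) + (\<Sum>j\<in>UNIV. of_int (n (Inr j)) * u $ k $ j))" for u
    have g: "siegel_omega k u (\<sigma> u) = g u" if u: "u \<in> N'" for u
    proof -
      have "\<sigma> u \<in> siegel_lattice u" using \<sigma>N u unfolding siegel_lattice_eq b_def by blast
      moreover have "\<sigma> u $ k = of_int (n (Inl k)) + (\<Sum>j\<in>UNIV. of_int (n (Inr j)) * u $ k $ j)"
      proof -
        have "\<sigma> u $ k = (\<Sum>a\<in>UNIV. of_int (n a) *\<^sub>R b a u) $ k" using \<sigma>N u by simp
        also have "\<dots> = (\<Sum>a\<in>UNIV. of_int (n a) * b a u $ k)"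
          unfolding sum_component vector_scaleR_component by (simp add: scaleR_conv_of_real)
        also have "\<dots> = of_int (n (Inl k)) + (\<Sum>j\<in>UNIV. of_int (n (Inr j)) * u $ k $ j)"
          by (simp add: sum_UNIV_sum b_def axis_def column_def if_distrib cong: if_cong)
        finally show ?thesis .
      qed
      ultimately show ?thesis by (simp add: siegel_omega_def restrict0_def g_def)
    qed
    obtain T where T: "open T" "N' = siegel_space \<inter> T" using N'(1) by (auto simp: openin_open)
    have "continuous_on UNIV (\<lambda>t. \<tau> + mscale t (E_matrix k k))" by (intro continuous_intros)
    then have "open ((\<lambda>t. \<tau> + mscale t (E_matrix k k)) -` T)" by (rule open_vimage[OF T(1)])
    moreover have t0: "\<tau> + mscale 0 (E_matrix k k) = \<tau>" by (simp add: vec_eq_iff)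
    ultimately have "\<forall>\<^sub>F t in nhds 0. \<tau> + mscale t (E_matrix k k) \<in> T"
      using N'(2) T(2) unfolding eventually_nhds by (intro exI[of _ "(\<lambda>t. \<tau> + mscale t (E_matrix k k)) -` T"]) auto
    with open_diagonal_translates[OF \<tau>, of k]
    have ev: "\<forall>\<^sub>F t in nhds 0. \<tau> + mscale t (E_matrix k k) \<in> N'"
      unfolding T(2) by eventually_elim blast
    have "diag_partial k \<tau> (\<lambda>u. siegel_omega k u (\<sigma> u)) = diag_partial k \<tau> g"
      unfolding diag_partial_def
      by (rule velocity_germ[OF hol_space_axioms N'(1)]) (use g ev N'(2) t0 in auto)
    also have "\<dots> = two_pi_i * of_int (n (Inr k))"
    proof -
      have "g \<in> Hol ?X siegel_space"
        unfolding g_def by (rule matrix_holomorphic_on_imp_Hol[of _ UNIV]) (intro matrix_holomorphic_intros, auto)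
      then have "holomorphic_near ?X \<tau> g" using \<tau> by (intro holomorphic_nearI[of _ siegel_space]) auto
      moreover have "((g \<circ> (\<lambda>t. \<tau> + mscale t (E_matrix k k))) has_field_derivative two_pi_i * of_int (n (Inr k))) (at 0)"
      proof -
        have "((\<lambda>t. two_pi_i * (of_int (n (Inl k)) + (\<Sum>j\<in>UNIV. of_int (n (Inr j)) * (\<tau> $ k $ j + t * E_matrix k k $ k $ j))))
           has_field_derivative two_pi_i * (\<Sum>j\<in>UNIV. of_int (n (Inr j)) * E_matrix k k $ k $ j)) (at 0)"
          by (auto intro!: derivative_eq_intros sum.cong simp: mult.commute)
        moreover have "(\<Sum>j\<in>UNIV. of_int (n (Inr j)) * E_matrix k k $ k $ j) = of_int (n (Inr k))"
          by (simp add: E_matrix_def if_distrib cong: if_cong)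
        ultimately show ?thesis by (simp add: g_def o_def)
      qed
      ultimately show ?thesis by (simp add: diag_partial_def velocity_def DERIV_imp_deriv t0)
    qed
    finally have "siegel_eta k \<tau> y = of_int (n (Inr k))"
      using True by (simp add: siegel_eta_def gauss_manin_def restrict0_def \<sigma>_def)
    moreover have "siegel_form \<tau> (axis k 1) y = of_int (n (Inr k))"
    proof -
      note S = siegel_form_relations[OF \<tau>]
      have E: "skew_form (siegel_form \<tau>)" using S by (simp add: symplectic_relations_def)
      show ?thesis
        unfolding n skew_form_sum[OF E] skew_form_scale[OF E]
        by (simp add: sum_UNIV_sum b_def symplectic_relations_eqs[OF S] if_distrib cong: if_cong)
    qed
    ultimately show ?thesis using True by (simp add: restrict0_def)
  next
    case False
    then show ?thesis by (simp add: siegel_eta_def gauss_manin_def restrict0_def)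
  qed
qed

text \<open>The Siegel triple equals \<open>matrix_triple\<close> of this matrix, not merely up to
  isomorphism: with \<open>A = D = 1\<close> and \<open>C = 0\<close> the omega are
  \<open>2 pi i\<close> times the coordinates and the eta are the functionals found in
  \<open>siegel_eta_eq\<close>.\<close>

lemma phi_map_eq:
  fixes \<tau> :: "complex^'g::finite^'g"
  assumes \<tau>: "\<tau> \<in> siegel_space"
  shows "block_matrix (mat 1) \<tau> 0 (mat 1) \<in> Sp_C" "hpos (block_matrix (mat 1) \<tau> 0 (mat 1))"
    "phi_map \<tau> = matrix_class (block_matrix (mat 1) \<tau> 0 (mat 1))"
proof -
  let ?M = "block_matrix (mat 1) \<tau> 0 (mat 1)"
  have sym: "transpose \<tau> = \<tau>" using \<tau> by (simp add: siegel_space_def)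
  then show M: "?M \<in> Sp_C" by (simp add: block_matrix_in_Sp_C_iff)
  have tau: "tau_of ?M = \<tau>" by (simp add: tau_of_def matrix_inv_mat_1)
  have "invertible (mat 1 :: complex^'g^'g)" by (auto simp: invertible_def)
  then show "hpos ?M" using siegel_space_iff_hpos[OF M] \<tau> by (simp add: tau)
  have om: "om (matrix_triple ?M) k = siegel_omega k \<tau>" for k
    unfolding matrix_triple_sel tau siegel_omega_def
    by (simp add: mat_def if_distrib cong: if_cong)
  have et: "et (matrix_triple ?M) k = siegel_eta k \<tau>" for k
  proof -
    have "x * mat 1 $ i $ k = (if i = k then x else 0)" for x :: complex and i by (simp add: mat_def)
    then show ?thesis unfolding matrix_triple_sel tau siegel_eta_eq[OF \<tau>] by simp
  qed
  have "\<lparr>lat = siegel_lattice \<tau>, pol = siegel_form \<tau>, om = (\<lambda>k. siegel_omega k \<tau>), et = (\<lambda>k. siegel_eta k \<tau>)\<rparr> = matrix_triple ?M"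
    by (rule triple.equality) (simp_all add: matrix_triple_sel(1,2) tau fun_eq_iff om[unfolded fun_eq_iff] et[unfolded fun_eq_iff])
  then show "phi_map \<tau> = matrix_class ?M" by (simp add: phi_map_def matrix_class_def)
qed

theorem theorem1p11:
  shows
    "(\<forall>(t :: 'g::{finite,linorder} triple) \<gamma> \<delta>.
        is_triple t \<and> integral_symplectic_basis (lat t) (pol t) \<gamma> \<delta> \<longrightarrow>
          period_matrix t \<gamma> \<delta> \<in> Sp_C \<and>
          period_map (triple_class t) = Sp_Z_class (period_matrix t \<gamma> \<delta>)) \<and>
     openin (Top Sp_quotient) (period_domain :: (complex^('g + 'g)^('g + 'g)) set set) \<and>
     biholomorphic_map (B_space :: 'g triple set cspace)
       (open_subspace Sp_quotient period_domain) period_map \<and>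
     (\<forall>(k::'g) l. k \<le> l \<longrightarrow>
        (\<forall>p \<in> points B_space. \<forall>M \<in> Sp_C. Sp_Z_class M = period_map p \<longrightarrow>
           pushforward Sp_quotient period_map p (ramanujan_field k l p) =
           pushforward Sp_quotient Sp_Z_class M
             (left_invariant_field
                (mscale (1 / two_pi_i) (block_matrix 0 (E_matrix k l) 0 0)) M))) \<and>
     (\<forall>\<tau> \<in> siegel_space.
        (phi_map \<tau> :: 'g triple set) \<in> points B_space \<and>
        period_map (phi_map \<tau>) = Sp_Z_class (block_matrix (mat 1) \<tau> 0 (mat 1)))"
proof (intro conjI allI impI ballI)
  fix t :: "'g triple" and \<gamma> \<delta>
  assume t: "is_triple t \<and> integral_symplectic_basis (lat t) (pol t) \<gamma> \<delta>"
  then show "period_matrix t \<gamma> \<delta> \<in> Sp_C" using period_matrix_in_Sp_C by blast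
  show "period_map (triple_class t) = Sp_Z_class (period_matrix t \<gamma> \<delta>)"
    using t period_map_triple_class by blast
next
  show "openin (Top Sp_quotient) (period_domain :: (complex^('g + 'g)^('g + 'g)) set set)"
    by (rule openin_period_domain)
  show "biholomorphic_map (B_space :: 'g triple set cspace) (open_subspace Sp_quotient period_domain) period_map"
    by (rule biholomorphic_map_period_map)
next
  fix k l :: 'g and p :: "'g triple set" and M
  assume "p \<in> points B_space" "M \<in> Sp_C" "Sp_Z_class M = period_map p"
  then show "pushforward Sp_quotient period_map p (ramanujan_field k l p) =
      pushforward Sp_quotient Sp_Z_class M
        (left_invariant_field (mscale (1 / two_pi_i) (block_matrix 0 (E_matrix k l) 0 0)) M)"
    using pushforward_ramanujan_field[of p M k l] by (simp add: topspace_B_space ramanujan_matrix_def)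
next
  fix \<tau> :: "((complex, 'g) vec, 'g) vec" assume "\<tau> \<in> siegel_space"
  note phi = phi_map_eq[OF this]
  show "(phi_map \<tau> :: 'g triple set) \<in> points B_space"
    unfolding topspace_B_space phi(3) by (rule matrix_class_in_B_set[OF phi(1,2)])
  show "period_map (phi_map \<tau>) = Sp_Z_class (block_matrix (mat 1) \<tau> 0 (mat 1))"
    unfolding phi(3) by (rule period_map_matrix_class[OF phi(1,2)])
qed

end
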